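(* Let $F>0$, $\nu>0$, and let $\bar U=(\bar\tau,\bar u)$ be the profile of a nonconstant periodic traveling wave, with speed $c\in\mathbb{R}$, of the St. Venant system $\partial_t \tau-\partial_x u=0$, $\partial_t u+\partial_x\big(\frac{\tau^{-2}}{2F^2}\big)=1-\tau u^2+\nu\,\partial_x(\tau^{-2}\partial_x u)$. Set $f(\tau)=(2F^2)^{-1}\tau^{-2}$, $g(\tau)=\nu\tau^{-2}$, $h(\tau,u)=1-\tau u^2$, and let $L$ be the linearized operator about $\bar U$ defined in the context. For any positive integer $s$ there exist positive constants $\theta$, $C$ and $\varepsilon$ such that if, for some $T>0$, $V=(\tau,u)$ and $\psi$ solve on $\mathbb{R}\times[0,T]$ the system $$\begin{aligned}(1-\psi_x)V_t-LV=\;&-\psi_t(\bar U+V)_x+\begin{pmatrix}0\\ -\psi_x\,h(\bar U+V)\end{pmatrix}+\partial_x\begin{pmatrix}0\\ \frac{\psi_x}{1-\psi_x}\,g(\bar\tau+\tau)(\bar u+u)_x\end{pmatrix}\\ &+\partial_x\begin{pmatrix}0\\ (g(\bar\tau+\tau)-g(\bar\tau))u_x+(g(\bar\tau+\tau)-g(\bar\tau)-g'(\bar\tau)\tau)\bar u_x\end{pmatrix}\\ &-\partial_x\begin{pmatrix}0\\ {f(\bar\tau+\tau)-f(\bar\tau)-f'(\bar\tau)\tau}\end{pmatrix}+\begin{pmatrix}0\\ {h(\bar U+V)-h(\bar U)-dh(\bar U)(V)}\end{pmatrix}\end{aligned}$$ and $$\sup_{t\in[0,T]}\|(V,\psi_t,\psi_x)(t)\|_{H^s(\mathbb{R})}\le\varepsilon,$$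 then, for all $0\le t\le T$, $$\|V(t)\|^2_{H^s(\mathbb{R})}\le Ce^{-\theta t}\|V(0)\|^2_{H^s(\mathbb{R})}+C\int_0^te^{-\theta(t-t')}\Big(\|V(t')\|^2_{L^2(\mathbb{R})}+\|(\psi_t,\psi_x)(t')\|^2_{H^s(\mathbb{R})}\Big)\,dt'.$$
   Context: Profile. $\bar U=(\bar\tau,\bar u):\mathbb{R}\to(0,\infty)\times\mathbb{R}$ is smooth, nonconstant, periodic, and satisfies $-c\bar\tau_x-\bar u_x=0$ and $-c\bar u_x+((2F^2)^{-1}\bar\tau^{-2})_x=1-\bar\tau\bar u^2+\nu(\bar\tau^{-2}\bar u_x)_x$. Linearized operator. $L$ is the generator of the linearization about $\bar U$ of the system written in the co-moving coordinate $x-ct$: for $U=(\tau,u)$, $$L U=\Big(c\tau_x+u_x,\;\; c u_x+(\alpha\tau)_x+\nu(\bar\tau^{-2}u_x)_x-\bar u^2\tau-2\bar u\bar\tau u\Big),\qquad \alpha:=\bar\tau^{-3}(F^{-2}-2\nu\bar u_x).$$ Meaning of the system in the claim. It is the system satisfied by $V(x,t)=\tilde U(x-\psi(x,t),t)-\bar U(x)$, where $\psi=\psi(x,t)$ is a real-valued phase shift and $\tilde U=(\tilde\tau,\tilde u)$ solves the co-moving St. Venant system $\tilde\tau_t-c\tilde\tau_x-\tilde u_x=0$, $\tilde u_t-c\tilde u_x+(f(\tilde\tau))_x=h(\tilde\tau,\tilde u)+(g(\tilde\tau)\tilde u_x)_x$. Here $dh(\bar U)(V)=-\bar u^2\tau-2\bar\tau\bar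 u\,u$ is the differential of $h$ at $\bar U$ applied to $V=(\tau,u)$. In the estimates $\psi_t,\psi_x$ denote the partial derivatives of $\psi$. *)

theory Defs
  imports "HOL-Analysis.Analysis"
begin

section \<open>Sobolev spaces on the real line\<close>

definition smooth :: "(real \<Rightarrow> real) \<Rightarrow> bool" where
  "smooth f \<longleftrightarrow> (\<forall>k. (deriv ^^ k) f differentiable_on UNIV)"

definition test_function :: "(real \<Rightarrow> real) \<Rightarrow> bool" where
  "test_function \<phi> \<longleftrightarrow> smooth \<phi> \<and> (\<exists>R. \<forall>x. R < \<bar>x\<bar> \<longrightarrow> \<phi> x = 0)"

definition in_L2 :: "(real \<Rightarrow> 'a::euclidean_space) \<Rightarrow> bool" where
  "in_L2 f \<longleftrightarrow> f \<in> borel_measurable lborel \<and> integrable lborel (\<lambda>x. (norm (f x))\<^sup>2)"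

definition L2_norm :: "(real \<Rightarrow> 'a::euclidean_space) \<Rightarrow> real" where
  "L2_norm f = sqrt (LINT x|lborel. (norm (f x))\<^sup>2)"

definition has_weak_deriv ::
    "nat \<Rightarrow> (real \<Rightarrow> 'a::euclidean_space) \<Rightarrow> (real \<Rightarrow> 'a) \<Rightarrow> bool" where
  "has_weak_deriv k f g \<longleftrightarrow>
     (\<forall>\<phi>. test_function \<phi> \<longrightarrow>
        (LINT x|lborel. (deriv ^^ k) \<phi> x *\<^sub>R f x) = (- 1) ^ k *\<^sub>R (LINT x|lborel. \<phi> x *\<^sub>R g x))"

definition in_Hs :: "nat \<Rightarrow> (real \<Rightarrow> 'a::euclidean_space) \<Rightarrow> bool" where
  "in_Hs s f \<longleftrightarrow> in_L2 f \<and> (\<forall>k\<le>s. \<exists>g. in_L2 g \<and> has_weak_deriv k f g)"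

text \<open>The weak derivative is unique only up to null sets; the norm below does not depend on
  the representative. Outside of \<open>in_Hs s\<close> its value is meaningless, so membership has to be
  required separately.\<close>

definition weak_deriv :: "nat \<Rightarrow> (real \<Rightarrow> 'a::euclidean_space) \<Rightarrow> real \<Rightarrow> 'a" where
  "weak_deriv k f = (SOME g. in_L2 g \<and> has_weak_deriv k f g)"

definition Hs_norm :: "nat \<Rightarrow> (real \<Rightarrow> 'a::euclidean_space) \<Rightarrow> real" where
  "Hs_norm s f = sqrt (\<Sum>k\<le>s. (L2_norm (weak_deriv k f))\<^sup>2)"

section \<open>Functions of space and time\<close>

text \<open>Functions on \<open>\<real> \<times> [0,T]\<close> are written \<open>w x t\<close>; values for \<open>t\<close> outside of \<open>[0,T]\<close> play no
  role, and the time derivative is one-sided at the end points.\<close>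

definition Dx :: "(real \<Rightarrow> real \<Rightarrow> 'a::real_normed_vector) \<Rightarrow> real \<Rightarrow> real \<Rightarrow> 'a" where
  "Dx w x t = vector_derivative (\<lambda>y. w y t) (at x)"

definition Dt :: "real \<Rightarrow> (real \<Rightarrow> real \<Rightarrow> 'a::real_normed_vector) \<Rightarrow> real \<Rightarrow> real \<Rightarrow> 'a" where
  "Dt T w x t = vector_derivative (\<lambda>r. w x r) (at t within {0..T})"

definition has_Dx :: "real \<Rightarrow> (real \<Rightarrow> real \<Rightarrow> 'a::real_normed_vector) \<Rightarrow> bool" where
  "has_Dx T w \<longleftrightarrow>
     (\<forall>x. \<forall>t\<in>{0..T}. (\<lambda>y. w y t) differentiable (at x)) \<and>
     continuous_on (UNIV \<times> {0..T}) (\<lambda>(x, t). Dx w x t)"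

definition has_Dt :: "real \<Rightarrow> (real \<Rightarrow> real \<Rightarrow> 'a::real_normed_vector) \<Rightarrow> bool" where
  "has_Dt T w \<longleftrightarrow>
     (\<forall>x. \<forall>t\<in>{0..T}. (\<lambda>r. w x r) differentiable (at t within {0..T})) \<and>
     continuous_on (UNIV \<times> {0..T}) (\<lambda>(x, t). Dt T w x t)"

section \<open>The St. Venant system\<close>

definition sv_f :: "real \<Rightarrow> real \<Rightarrow> real" where
  "sv_f F \<tau> = inverse (2 * F\<^sup>2) * inverse (\<tau>\<^sup>2)"

definition sv_g :: "real \<Rightarrow> real \<Rightarrow> real" where
  "sv_g \<nu> \<tau> = \<nu> * inverse (\<tau>\<^sup>2)"

definition sv_h :: "real \<times> real \<Rightarrow> real" where
  "sv_h = (\<lambda>(\<tau>, u). 1 - \<tau> * u\<^sup>2)"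

definition sv_dh :: "real \<times> real \<Rightarrow> real \<times> real \<Rightarrow> real" where
  "sv_dh = (\<lambda>(\<tau>b, ub) (\<tau>, u). - (ub\<^sup>2 * \<tau>) - 2 * \<tau>b * ub * u)"

text \<open>Profiles of nonconstant periodic traveling waves \<open>U (x - c t)\<close>, \<open>U = (\<tau>, u)\<close>.\<close>

definition sv_profile :: "real \<Rightarrow> real \<Rightarrow> real \<Rightarrow> (real \<Rightarrow> real \<times> real) \<Rightarrow> bool" where
  "sv_profile F \<nu> c U \<longleftrightarrow>
     (let \<tau> = (\<lambda>x. fst (U x)); u = (\<lambda>x. snd (U x)) in
      smooth \<tau> \<and> smooth u \<and> (\<forall>x. \<tau> x > 0) \<and>
      \<not> (\<exists>a. \<forall>x. U x = a) \<and> (\<exists>P>0. \<forall>x. U (x + P) = U x) \<and>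
      (\<forall>x. - c * deriv \<tau> x - deriv u x = 0) \<and>
      (\<forall>x. - c * deriv u x + deriv (\<lambda>y. inverse (2 * F\<^sup>2) * inverse ((\<tau> y)\<^sup>2)) x =
         1 - \<tau> x * (u x)\<^sup>2 + \<nu> * deriv (\<lambda>y. inverse ((\<tau> y)\<^sup>2) * deriv u y) x))"

definition sv_alpha :: "real \<Rightarrow> real \<Rightarrow> (real \<Rightarrow> real \<times> real) \<Rightarrow> real \<Rightarrow> real" where
  "sv_alpha F \<nu> U x =
     inverse ((fst (U x)) ^ 3) * (inverse (F\<^sup>2) - 2 * \<nu> * deriv (\<lambda>y. snd (U y)) x)"

definition sv_L :: "real \<Rightarrow> real \<Rightarrow> real \<Rightarrow> (real \<Rightarrow> real \<times> real) \<Rightarrow>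
    (real \<Rightarrow> real \<times> real) \<Rightarrow> real \<Rightarrow> real \<times> real" where
  "sv_L F \<nu> c U V x =
     (let \<tau>b = (\<lambda>y. fst (U y)); ub = (\<lambda>y. snd (U y));
          \<tau> = (\<lambda>y. fst (V y)); u = (\<lambda>y. snd (V y)) in
      (c * deriv \<tau> x + deriv u x,
       c * deriv u x + deriv (\<lambda>y. sv_alpha F \<nu> U y * \<tau> y) x
         + \<nu> * deriv (\<lambda>y. inverse ((\<tau>b y)\<^sup>2) * deriv u y) x
         - (ub x)\<^sup>2 * \<tau> x - 2 * ub x * \<tau>b x * u x))"

definition sv_perturbation_eq :: "real \<Rightarrow> real \<Rightarrow> real \<Rightarrow> (real \<Rightarrow> real \<times> real) \<Rightarrow> real \<Rightarrow>
    (real \<Rightarrow> real \<Rightarrow> real \<times> real) \<Rightarrow> (real \<Rightarrow> real \<Rightarrow> real) \<Rightarrow> real \<Rightarrow> real \<Rightarrow> bool" where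
  "sv_perturbation_eq F \<nu> c U T V \<psi> x t \<longleftrightarrow>
     (let f = sv_f F; g = sv_g \<nu>; h = sv_h;
          \<psi>t = Dt T \<psi>; \<psi>x = Dx \<psi>;
          \<tau>b = (\<lambda>y. fst (U y)); ub = (\<lambda>y. snd (U y));
          \<tau> = (\<lambda>y. fst (V y t)); u = (\<lambda>y. snd (V y t)) in
      (1 - \<psi>x x t) *\<^sub>R Dt T V x t - sv_L F \<nu> c U (\<lambda>y. V y t) x =
        - (\<psi>t x t *\<^sub>R Dx (\<lambda>y r. U y + V y r) x t)
        + (0, - \<psi>x x t * h (U x + V x t))
        + (0, deriv (\<lambda>y. \<psi>x y t / (1 - \<psi>x y t) * g (\<tau>b y + \<tau> y)
                           * deriv (\<lambda>z. ub z + u z) y) x)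
        + (0, deriv (\<lambda>y. (g (\<tau>b y + \<tau> y) - g (\<tau>b y)) * deriv u y
                         + (g (\<tau>b y + \<tau> y) - g (\<tau>b y) - deriv g (\<tau>b y) * \<tau> y) * deriv ub y) x)
        - (0, deriv (\<lambda>y. f (\<tau>b y + \<tau> y) - f (\<tau>b y) - deriv f (\<tau>b y) * \<tau> y) x)
        + (0, h (U x + V x t) - h (U x) - sv_dh (U x) (V x t)))"

text \<open>Classical solutions on \<open>\<real> \<times> [0,T]\<close>: exactly the partial derivatives occurring in the
  system are required to exist and to be continuous.\<close>

definition sv_perturbation_solution :: "real \<Rightarrow> real \<Rightarrow> real \<Rightarrow> (real \<Rightarrow> real \<times> real) \<Rightarrow> real \<Rightarrow>
    (real \<Rightarrow> real \<Rightarrow> real \<times> real) \<Rightarrow> (real \<Rightarrow> real \<Rightarrow> real) \<Rightarrow> bool" where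
  "sv_perturbation_solution F \<nu> c U T V \<psi> \<longleftrightarrow>
     has_Dt T V \<and> has_Dx T V \<and> has_Dx T (Dx (\<lambda>x t. snd (V x t))) \<and>
     has_Dt T \<psi> \<and> has_Dx T \<psi> \<and> has_Dx T (Dx \<psi>) \<and>
     (\<forall>x. \<forall>t\<in>{0..T}. sv_perturbation_eq F \<nu> c U T V \<psi> x t)"

end

theory Submission imports Defs
begin

text \<open>
  In the Lagrangian coordinate \<open>z = x - \<psi>(x,t) + c t\<close>, with inverse \<open>x = X(z,t)\<close>, the shifted solution
  solves the original system \<open>\<tau>\<^sub>t = u\<^sub>z\<close>, \<open>u\<^sub>t = (\<nu> \<tau>\<^sup>-\<^sup>2 u\<^sub>z - f(\<tau>))\<^sub>z + h\<close>. The viscous terms cancel in the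
  evolution of the effective velocity \<open>w = u + \<nu> (1/\<tau>)\<^sub>z\<close>, which obeys
  \<open>w\<^sub>t = - (F\<^sup>2 \<nu> \<tau>)\<^sup>-\<^sup>1 (w - u) + h\<close> along particle paths: the top derivative of \<open>\<tau>\<close> is damped exponentially,
  while \<open>u\<close> solves a uniformly parabolic equation whose lower-order terms are absorbed at any rate.

  The solution has only the derivatives occurring in the system, so derivatives are replaced by iterated
  difference quotients \<open>dqs hs\<close>; Fatou's lemma recovers the Sobolev norms. The perturbation of \<open>w\<close> contains
  \<open>X\<^sub>z\<close>, which has no time derivative at this regularity; it too is replaced by a difference quotient
  whose step tends to \<open>0\<close>.

  With \<open>E(t) = e\<^sup>-\<^sup>\<theta>\<^sup>t |V(0)|\<^sup>2 + \<integral>\<^sub>0\<^sup>t e\<^sup>-\<^sup>\<theta>\<^sup>(\<^sup>t\<^sup>-\<^sup>r\<^sup>) (\<dots>) dr\<close> the estimates bound the ratio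
  \<open>R = sup |V|\<^sup>2 / E\<close> by \<open>C + R / 2\<close>.
\<close>

text \<open>Two obstacles determine the function spaces. The profile is periodic, hence not in L^2,
  so coefficients are measured in uniformly local norms (\<open>Gk\<close>) and perturbations in
  global ones (\<open>Hk\<close>). For s = 1 the drift coefficient of the velocity equation contains
  the z-derivative of \<tau>, which is only uniformly locally L^2; products with it are controlled
  by interpolation instead of a sup bound. The closing step rests on how the top norm M enters the
  three bounds. In that of \<tau> it has the factor K/\<Lambda>; in that of u the factor K is fixed,
  but the decay rate \<Lambda> is free; in that of w the rate is fixed, but the factor \<eta> is
  free, because the source contains \<tau> and u only up to order s - 1. Integrated against the
  exponential kernel, each becomes a small multiple of R. The bounds use an
  \<open>ennreal\<close>-valued Duhamel expression, monotone without measurability, so that M can be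
  replaced at once by a multiple of R E. Smallness of the data enters through |psi_x| \<le> 1/2, a
  positive lower bound of the full specific volume and norms at most 1.\<close>

section \<open>Primitives\<close>

text \<open>Local absolute continuity: \<open>f\<close> is an indefinite integral of
  \<open>g\<close>. The relation constrains \<open>f\<close> at every point but \<open>g\<close>
  only up to null sets, which matches weak derivatives.\<close>

definition prim :: "(real \<Rightarrow> real) \<Rightarrow> (real \<Rightarrow> real) \<Rightarrow> bool" where
  "prim f g \<longleftrightarrow> g \<in> borel_measurable borel \<and>
     (\<forall>a b. a \<le> b \<longrightarrow> set_integrable lborel {a..b} g \<and> (LINT x:{a..b}|lborel. g x) = f b - f a)"

lemma primI_HK:
  assumes "g \<in> borel_measurable borel"
    and "\<And>a b. a \<le> b \<Longrightarrow> set_integrable lborel {a..b} g"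
    and "\<And>a b. a \<le> b \<Longrightarrow> (g has_integral (f b - f a)) {a..b}"
  shows "prim f g"
  unfolding prim_def
  using assms by (auto simp: set_borel_integral_eq_integral(2) dest!: integral_unique)

lemma prim_integrable: "prim f g \<Longrightarrow> set_integrable lborel {a..b} g"
  unfolding prim_def by (cases "a \<le> b") auto

lemma prim_borel: "prim f g \<Longrightarrow> g \<in> borel_measurable borel"
  unfolding prim_def by auto

lemma prim_eq: "prim f g \<Longrightarrow> a \<le> b \<Longrightarrow> (LINT x:{a..b}|lborel. g x) = f b - f a"
  unfolding prim_def by auto

lemma prim_has_integral: "prim f g \<Longrightarrow> a \<le> b \<Longrightarrow> (g has_integral (f b - f a)) {a..b}"
  using prim_integrable[of f g a b] prim_eq[of f g a b]
  by (metis set_borel_integral_eq_integral has_integral_integral)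

lemma prim_continuous_on:
  assumes "prim f g" shows "continuous_on S f"
proof -
  have "isCont f x" for x
  proof -
    have i: "g integrable_on {x-1..x+1}"
      using prim_has_integral[OF assms, of "x-1" "x+1"] by auto
    have "continuous_on {x-1..x+1} (\<lambda>y. f (x-1) + integral {x-1..y} g)"
      by (intro continuous_intros indefinite_integral_continuous_1 i)
    moreover have "f (x-1) + integral {x-1..y} g = f y" if "y \<in> {x-1..x+1}" for y
      using that prim_has_integral[OF assms, of "x-1" y] by (auto dest: integral_unique)
    ultimately have "continuous_on {x-1..x+1} f"
      using continuous_on_cong by (metis (no_types, lifting))
    then show ?thesis by (rule continuous_on_interior) auto
  qed
  then show ?thesis by (simp add: continuous_at_imp_continuous_on)
qed

lemma prim_borel_left: "prim f g \<Longrightarrow> f \<in> borel_measurable borel"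
  by (intro borel_measurable_continuous_onI prim_continuous_on)

lemma prim_deriv:
  assumes "\<And>x. (f has_real_derivative g x) (at x)" and "continuous_on UNIV g"
  shows "prim f g"
proof -
  have g: "g \<in> borel_measurable borel" using assms(2) by (rule borel_measurable_continuous_onI)
  have c: "isCont g x" for x using assms(2) by (simp add: continuous_on_eq_continuous_at)
  have "has_bochner_integral lborel (\<lambda>x. g x * indicator {a .. b} x) (f b - f a)" if "a \<le> b" for a b
    by (rule has_bochner_integral_FTC_Icc_real[OF that]) (use assms c in auto)
  then show ?thesis using g
    by (auto simp: prim_def set_integrable_def set_lebesgue_integral_def has_bochner_integral_iff mult.commute)
qed

lemma prim_const: "prim (\<lambda>_. c) (\<lambda>_. 0)"
  by (rule prim_deriv) auto

lemma prim_add: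
  assumes "prim f f'" "prim g g'" shows "prim (\<lambda>x. f x + g x) (\<lambda>x. f' x + g' x)"
  using assms unfolding prim_def by (auto simp: set_integral_add)

lemma prim_cmul:
  assumes "prim f f'" shows "prim (\<lambda>x. c * f x) (\<lambda>x. c * f' x)"
  using assms unfolding prim_def by (auto simp: right_diff_distrib)

lemma prim_diff:
  assumes "prim f f'" "prim g g'" shows "prim (\<lambda>x. f x - g x) (\<lambda>x. f' x - g' x)"
  using prim_add[OF assms(1) prim_cmul[OF assms(2), of "-1"]] by simp

lemma prim_shift:
  assumes "prim f g" shows "prim (\<lambda>x. f (x + h)) (\<lambda>x. g (x + h))"
proof -
  have ind: "indicator {a..b} x = (indicator {a+h..b+h} (h + 1 * x) :: real)" for a b x :: real
    by (auto simp: indicator_def)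
  have i: "integrable lborel (\<lambda>x. indicator {a+h..b+h} x * g x)" for a b
    using prim_integrable[OF assms, of "a+h" "b+h"] by (simp add: set_integrable_def)
  have "integrable lborel (\<lambda>x. indicator {a..b} x * g (x+h))" for a b
    using lborel_integrable_real_affine[OF i[of a b], of 1 h] unfolding ind[of a b]
    by (simp add: add.commute)
  moreover have "(LINT x|lborel. indicator {a..b} x * g (x+h)) = f (b+h) - f (a+h)" if "a \<le> b" for a b
  proof -
    have "(LINT x|lborel. indicator {a+h..b+h} x * g x) = (LINT x|lborel. indicator {a..b} x * g (x+h))"
      using lborel_integral_real_affine[of 1 "\<lambda>x. indicator {a+h..b+h} x * g x" h] unfolding ind[of a b]
      by (simp add: add.commute)
    then show ?thesis using prim_eq[OF assms, of "a+h" "b+h"] that by (simp add: set_lebesgue_integral_def)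
  qed
  ultimately show ?thesis using prim_borel[OF assms]
    by (auto simp: prim_def set_integrable_def set_lebesgue_integral_def)
qed

lemma integrable_product:
  fixes p q :: "real \<Rightarrow> real"
  assumes p: "integrable lborel p" and q: "integrable lborel q"
  shows "integrable (lborel \<Otimes>\<^sub>M lborel) (\<lambda>(x, y). p x * q y)"
proof -
  have [measurable]: "p \<in> borel_measurable borel" "q \<in> borel_measurable borel" using p q by auto
  have "integrable lborel (\<lambda>x. LINT y|lborel. norm (p x * q y))"
    using p by (simp add: abs_mult)
  moreover have "integrable lborel (\<lambda>y. p x * q y)" for x using q by simp
  ultimately show ?thesis
    by (intro lborel_pair.Fubini_integrable) (auto simp: split_beta')
qed

lemma bounded_on_Icc:
  fixes f :: "real \<Rightarrow> real"
  assumes "continuous_on {a..b} f"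
  obtains K where "K \<ge> 0" "\<And>x. x \<in> {a..b} \<Longrightarrow> \<bar>f x\<bar> \<le> K"
proof -
  have "bounded (f ` {a..b})"
    by (intro compact_imp_bounded compact_continuous_image assms) auto
  then obtain K where "\<forall>x\<in>{a..b}. \<bar>f x\<bar> \<le> K" unfolding bounded_iff by auto
  then show ?thesis using that[of "\<bar>K\<bar>"] by force
qed

lemma set_integrable_mult_continuous:
  fixes f g :: "real \<Rightarrow> real"
  assumes f: "set_integrable lborel {a..b} f" and g: "continuous_on UNIV g"
  shows "set_integrable lborel {a..b} (\<lambda>x. f x * g x)"
proof -
  obtain K where K: "K \<ge> 0" "\<And>x. x \<in> {a..b} \<Longrightarrow> \<bar>g x\<bar> \<le> K"
    using bounded_on_Icc[OF continuous_on_subset[OF g]] by (metis subset_UNIV)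
  have [measurable]: "g \<in> borel_measurable borel" using g by (rule borel_measurable_continuous_onI)
  have [measurable]: "(\<lambda>x. indicator {a..b} x *\<^sub>R f x) \<in> borel_measurable borel"
    using f unfolding set_integrable_def by auto
  have "integrable lborel (\<lambda>x. (indicator {a..b} x *\<^sub>R f x) * g x)"
  proof (rule Bochner_Integration.integrable_bound)
    show "integrable lborel (\<lambda>x. K * (indicator {a..b} x *\<^sub>R f x))"
      using f unfolding set_integrable_def by simp
    have "norm ((indicator {a..b} x *\<^sub>R f x) * g x) \<le> norm (K * (indicator {a..b} x *\<^sub>R f x))" for x
      using K mult_right_mono[OF K(2), of x "\<bar>f x\<bar>"] by (auto simp: abs_mult indicator_def mult.commute)
    then show "AE x in lborel. norm ((indicator {a..b} x *\<^sub>R f x) * g x) \<le> norm (K * (indicator {a..b} x *\<^sub>R f x))"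
      by simp
  qed measurable
  then show ?thesis unfolding set_integrable_def by (simp add: mult.assoc)
qed

text \<open>Fubini on the triangle a \<le> y \<le> x \<le> b for the integrand f'(x) g'(y):
  integrating over y first gives the integral of f' g up to boundary values, over x first that of f
  g'.\<close>

lemma prim_mult:
  assumes f: "prim f f'" and g: "prim g g'"
  shows "prim (\<lambda>x. f x * g x) (\<lambda>x. f' x * g x + f x * g' x)"
proof -
  note [measurable] = prim_borel[OF f] prim_borel[OF g] prim_borel_left[OF f] prim_borel_left[OF g]
  have i1: "set_integrable lborel {a..b} (\<lambda>x. f' x * g x)" for a b
    by (intro set_integrable_mult_continuous prim_integrable[OF f] prim_continuous_on[OF g])
  have i2: "set_integrable lborel {a..b} (\<lambda>x. f x * g' x)" for a b
    using set_integrable_mult_continuous[OF prim_integrable[OF g] prim_continuous_on[OF f]]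
    by (simp add: mult.commute)
  have "(LINT x:{a..b}|lborel. f' x * g x + f x * g' x) = f b * g b - f a * g a" if ab: "a \<le> b" for a b
  proof -
    let ?I = "indicator {a..b} :: real \<Rightarrow> real"
    define F where "F = (\<lambda>x y. (?I x * f' x) * (?I y * g' y) * (indicator {..x} y :: real))"
    have p: "integrable lborel (\<lambda>x. ?I x * f' x)" "integrable lborel (\<lambda>x. ?I x * g' x)"
      using prim_integrable[OF f, of a b] prim_integrable[OF g, of a b]
      by (auto simp: set_integrable_def)
    have [measurable]: "(\<lambda>z::real\<times>real. indicator {..fst z} (snd z) :: real) \<in> borel_measurable (borel \<Otimes>\<^sub>M borel)"
    proof -
      have "(\<lambda>z::real\<times>real. indicator {..fst z} (snd z) :: real) = (\<lambda>z. if snd z \<le> fst z then 1 else 0)"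
        by (auto simp: indicator_def)
      also have "\<dots> \<in> borel_measurable (borel \<Otimes>\<^sub>M borel)" by measurable
      finally show ?thesis .
    qed
    have "integrable (lborel \<Otimes>\<^sub>M lborel) (case_prod F)"
    proof (rule Bochner_Integration.integrable_bound[OF integrable_product[OF p]])
      show "case_prod F \<in> borel_measurable (lborel \<Otimes>\<^sub>M lborel)"
        unfolding F_def split_beta' by measurable
    qed (auto simp: F_def indicator_def)
    then have sw: "(LINT y|lborel. LINT x|lborel. F x y) = (LINT x|lborel. LINT y|lborel. F x y)"
      by (rule lborel_pair.Fubini_integral)
    have "(LINT y|lborel. F x y) = ?I x * (f' x * g x) - g a * (?I x * f' x)" for x
    proof (cases "x \<in> {a..b}")
      case True
      have "(LINT y|lborel. F x y) = f' x * (LINT y|lborel. indicator {a..x} y * g' y)"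
        using True by (subst integral_mult_right_zero[symmetric], intro Bochner_Integration.integral_cong)
          (auto simp: F_def indicator_def)
      also have "\<dots> = f' x * (g x - g a)"
        using prim_eq[OF g, of a x] True by (simp add: set_lebesgue_integral_def)
      finally show ?thesis using True by (simp add: algebra_simps)
    qed (simp add: F_def)
    then have R: "(LINT x|lborel. LINT y|lborel. F x y) =
        (LINT x:{a..b}|lborel. f' x * g x) - g a * (f b - f a)"
      using i1[of a b] p prim_eq[OF f ab]
      by (simp add: set_integrable_def set_lebesgue_integral_def)
    have "(LINT x|lborel. F x y) = f b * (?I y * g' y) - ?I y * (f y * g' y)" for y
    proof (cases "y \<in> {a..b}")
      case True
      have "(LINT x|lborel. F x y) = g' y * (LINT x|lborel. indicator {y..b} x * f' x)"
        using True by (subst integral_mult_right_zero[symmetric], intro Bochner_Integration.integral_cong)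
          (auto simp: F_def indicator_def)
      also have "\<dots> = g' y * (f b - f y)"
        using prim_eq[OF f, of y b] True by (simp add: set_lebesgue_integral_def)
      finally show ?thesis using True by (simp add: algebra_simps)
    qed (simp add: F_def)
    then have L: "(LINT y|lborel. LINT x|lborel. F x y) =
        f b * (g b - g a) - (LINT x:{a..b}|lborel. f x * g' x)"
      using i2[of a b] p prim_eq[OF g ab]
      by (simp add: set_integrable_def set_lebesgue_integral_def)
    show ?thesis using L R sw i1[of a b] i2[of a b] by (simp add: set_integral_add algebra_simps)
  qed
  then show ?thesis using i1 i2 unfolding prim_def by (auto simp: set_integral_add)
qed

section \<open>Sobolev and uniformly local Sobolev bounds\<close>

abbreviation nsq :: "(real \<Rightarrow> real) \<Rightarrow> ennreal" where
  "nsq f \<equiv> \<integral>\<^sup>+x. ennreal ((f x)\<^sup>2) \<partial>lborel"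

abbreviation nsq_on :: "real set \<Rightarrow> (real \<Rightarrow> real) \<Rightarrow> ennreal" where
  "nsq_on S f \<equiv> \<integral>\<^sup>+x\<in>S. ennreal ((f x)\<^sup>2) \<partial>lborel"

definition L2 :: "(real \<Rightarrow> real) \<Rightarrow> real \<Rightarrow> bool" where
  "L2 f A \<longleftrightarrow> f \<in> borel_measurable borel \<and> 0 \<le> A \<and> nsq f \<le> ennreal A"

text \<open>Uniformly local L^2: the squared norms over all unit intervals have a common bound. The
  space contains L^2 as well as bounded functions such as the profile.\<close>

definition U2 :: "(real \<Rightarrow> real) \<Rightarrow> real \<Rightarrow> bool" where
  "U2 f B \<longleftrightarrow> f \<in> borel_measurable borel \<and> 0 \<le> B \<and>
     (\<forall>x. (nsq_on {x..x+1} f) \<le> ennreal B)"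

text \<open>All bounds are bounds of squared norms.\<close>

primrec Hk :: "nat \<Rightarrow> (real \<Rightarrow> real) \<Rightarrow> real \<Rightarrow> bool" where
  "Hk 0 f A = L2 f A"
| "Hk (Suc k) f A = (L2 f A \<and> (\<exists>g. prim f g \<and> Hk k g A))"

text \<open>All orders below the top are bounded pointwise, so that a function of positive order is
  a bounded multiplier; only the derivative of order k is merely in \<open>U2\<close>.\<close>

primrec Gk :: "nat \<Rightarrow> (real \<Rightarrow> real) \<Rightarrow> real \<Rightarrow> bool" where
  "Gk 0 f B = U2 f B"
| "Gk (Suc k) f B = (0 \<le> B \<and> (\<forall>x. (f x)\<^sup>2 \<le> B) \<and> (\<exists>g. prim f g \<and> Gk k g B))"

lemma Hk_L2: "Hk k f A \<Longrightarrow> L2 f A" by (cases k) auto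

lemma Hk_nonneg: "Hk k f A \<Longrightarrow> 0 \<le> A" by (drule Hk_L2) (simp add: L2_def)

lemma Gk_nonneg: "Gk k f A \<Longrightarrow> 0 \<le> A" by (cases k) (auto simp: U2_def)

lemma Hk_borel: "Hk k f A \<Longrightarrow> f \<in> borel_measurable borel" by (drule Hk_L2) (simp add: L2_def)

lemma Gk_borel: "Gk k f A \<Longrightarrow> f \<in> borel_measurable borel"
  by (cases k) (auto simp: U2_def prim_borel_left)

lemma L2_mono: "L2 f A \<Longrightarrow> A \<le> B \<Longrightarrow> L2 f B"
  unfolding L2_def by (auto intro: order_trans[OF _ ennreal_leI])

lemma U2_mono: "U2 f A \<Longrightarrow> A \<le> B \<Longrightarrow> U2 f B"
  unfolding U2_def by (auto intro: order_trans[OF _ ennreal_leI])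

lemma Hk_mono: "Hk k f A \<Longrightarrow> A \<le> B \<Longrightarrow> Hk k f B"
  by (induction k arbitrary: f) (auto intro: L2_mono)

lemma Gk_mono: "Gk k f A \<Longrightarrow> A \<le> B \<Longrightarrow> Gk k f B"
  by (induction k arbitrary: f) (auto intro: U2_mono order_trans)

lemma Hk_Suc_lower: "Hk (Suc k) f A \<Longrightarrow> Hk k f A"
  by (induction k arbitrary: f) (auto dest: Hk_L2)

lemma Hk_lower: "Hk k f A \<Longrightarrow> j \<le> k \<Longrightarrow> Hk j f A"
proof (induction "k - j" arbitrary: k)
  case (Suc n)
  then obtain k' where "k = Suc k'" by (cases k) auto
  with Suc show ?case by (metis Hk_Suc_lower Suc_diff_le Suc_inject diff_is_0_eq' nat.simps(3) not_less_eq_eq)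
qed auto

lemma U2_bounded:
  assumes "f \<in> borel_measurable borel" "\<And>x. (f x)\<^sup>2 \<le> B" shows "U2 f B"
proof -
  have B: "0 \<le> B" using assms(2)[of 0] zero_le_power2 order_trans by blast
  have "nsq_on {x..x+1} f \<le> ennreal B" for x
  proof -
    have "nsq_on {x..x+1} f \<le>
      (\<integral>\<^sup>+y\<in>{x..x+1}. ennreal B \<partial>lborel)"
      by (intro nn_integral_mono mult_right_mono ennreal_leI assms) auto
    also have "\<dots> = ennreal B" using B by (simp add: nn_integral_cmult_indicator)
    finally show ?thesis .
  qed
  then show ?thesis using assms B by (simp add: U2_def)
qed

lemma Gk_Suc_lower: "Gk (Suc k) f A \<Longrightarrow> Gk k f A"
  by (induction k arbitrary: f) (auto intro!: U2_bounded dest: prim_borel_left)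

lemma Gk_lower: "Gk k f A \<Longrightarrow> j \<le> k \<Longrightarrow> Gk j f A"
proof (induction "k - j" arbitrary: k)
  case (Suc n)
  then obtain k' where "k = Suc k'" by (cases k) auto
  with Suc show ?case by (metis Gk_Suc_lower Suc_diff_le Suc_inject diff_is_0_eq' nat.simps(3) not_less_eq_eq)
qed auto

lemma sq_sum_le: "(a + b)\<^sup>2 \<le> 2 * a\<^sup>2 + 2 * (b::real)\<^sup>2"
  using sum_squares_bound[of a b] by (simp add: power2_sum)

lemma nn_add_sq:
  assumes [measurable]: "f \<in> borel_measurable borel" "g \<in> borel_measurable borel" "h \<in> borel_measurable borel"
  shows "(\<integral>\<^sup>+x. ennreal ((f x + g x)\<^sup>2) * h x \<partial>lborel) \<le>
     2 * (\<integral>\<^sup>+x. ennreal ((f x)\<^sup>2) * h x \<partial>lborel) + 2 * (\<integral>\<^sup>+x. ennreal ((g x)\<^sup>2) * h x \<partial>lborel)"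
proof -
  have "(\<integral>\<^sup>+x. ennreal ((f x + g x)\<^sup>2) * h x \<partial>lborel) \<le>
     (\<integral>\<^sup>+x. 2 * (ennreal ((f x)\<^sup>2) * h x) + 2 * (ennreal ((g x)\<^sup>2) * h x) \<partial>lborel)"
  proof (intro nn_integral_mono)
    fix x
    have "ennreal ((f x + g x)\<^sup>2) \<le> ennreal (2 * (f x)\<^sup>2 + 2 * (g x)\<^sup>2)"
      by (intro ennreal_leI sq_sum_le)
    also have "\<dots> = 2 * ennreal ((f x)\<^sup>2) + 2 * ennreal ((g x)\<^sup>2)"
      by (simp add: ennreal_plus ennreal_mult)
    finally have "ennreal ((f x + g x)\<^sup>2) * h x \<le> (2 * ennreal ((f x)\<^sup>2) + 2 * ennreal ((g x)\<^sup>2)) * h x"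
      by (rule mult_right_mono) simp
    then show "ennreal ((f x + g x)\<^sup>2) * h x \<le> 2 * (ennreal ((f x)\<^sup>2) * h x) + 2 * (ennreal ((g x)\<^sup>2) * h x)"
      by (simp add: distrib_right mult.assoc)
  qed
  also have "\<dots> = 2 * (\<integral>\<^sup>+x. ennreal ((f x)\<^sup>2) * h x \<partial>lborel) + 2 * (\<integral>\<^sup>+x. ennreal ((g x)\<^sup>2) * h x \<partial>lborel)"
    by (simp add: nn_integral_add nn_integral_cmult)
  finally show ?thesis .
qed

lemma two_ennreal: "0 \<le> A \<Longrightarrow> 2 * ennreal A = ennreal (2 * A)"
  by (simp add: ennreal_mult)

lemma L2_add:
  assumes "L2 f A" "L2 g B" shows "L2 (\<lambda>x. f x + g x) (2 * (A + B))"
proof -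
  have "nsq (\<lambda>x. f x + g x) \<le> 2 * ennreal A + 2 * ennreal B"
    using assms unfolding L2_def
    by (intro order_trans[OF nn_add_sq[of f g "\<lambda>_. 1", simplified]] add_mono mult_left_mono) auto
  also have "\<dots> = ennreal (2 * (A + B))"
    using assms by (simp add: L2_def two_ennreal distrib_left)
  finally show ?thesis using assms unfolding L2_def by auto
qed

lemma U2_add:
  assumes "U2 f A" "U2 g B" shows "U2 (\<lambda>x. f x + g x) (2 * (A + B))"
proof -
  have "(nsq_on {x..x+1} (\<lambda>y. f y + g y)) \<le> 2 * ennreal A + 2 * ennreal B" for x
    using assms unfolding U2_def
    by (intro order_trans[OF nn_add_sq[of f g "indicator {x..x+1}"]] add_mono mult_left_mono) auto
  moreover have "2 * ennreal A + 2 * ennreal B = ennreal (2 * (A + B))"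
    using assms by (simp add: U2_def two_ennreal distrib_left)
  ultimately show ?thesis using assms unfolding U2_def by auto
qed

lemma L2_cmul: assumes "L2 f A" shows "L2 (\<lambda>x. c * f x) (c\<^sup>2 * A)"
proof -
  have [measurable]: "f \<in> borel_measurable borel" using assms by (simp add: L2_def)
  have "nsq (\<lambda>x. c * f x) = ennreal (c\<^sup>2) * nsq f"
    by (simp add: power_mult_distrib ennreal_mult nn_integral_cmult)
  then show ?thesis using assms by (auto simp: L2_def ennreal_mult intro: mult_left_mono)
qed

lemma U2_cmul: assumes "U2 f A" shows "U2 (\<lambda>x. c * f x) (c\<^sup>2 * A)"
proof -
  have [measurable]: "f \<in> borel_measurable borel" using assms by (simp add: U2_def)
  have "(nsq_on {x..x+1} (\<lambda>y. c * f y))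
      = ennreal (c\<^sup>2) * nsq_on {x..x+1} f" for x
    by (subst nn_integral_cmult[symmetric]) (auto simp: power_mult_distrib ennreal_mult mult.assoc)
  then show ?thesis using assms by (auto simp: U2_def ennreal_mult intro: mult_left_mono)
qed

lemma Hk_add: "Hk k f A \<Longrightarrow> Hk k g B \<Longrightarrow> Hk k (\<lambda>x. f x + g x) (2 * (A + B))"
proof (induction k arbitrary: f g)
  case (Suc k)
  then obtain f' g' where "prim f f'" "Hk k f' A" "prim g g'" "Hk k g' B" by auto
  then show ?case using Suc prim_add[of f f' g g'] L2_add[of f A g B]
    by (auto intro!: exI[of _ "\<lambda>x. f' x + g' x"])
next
  case 0 then show ?case using L2_add[of f A g B] by simp
qed

lemma Gk_add: "Gk k f A \<Longrightarrow> Gk k g B \<Longrightarrow> Gk k (\<lambda>x. f x + g x) (2 * (A + B))"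
proof (induction k arbitrary: f g)
  case (Suc k)
  then obtain f' g' where p: "prim f f'" "Gk k f' A" "prim g g'" "Gk k g' B" by auto
  have "(f x + g x)\<^sup>2 \<le> 2 * (A + B)" for x
  proof -
    have "(f x)\<^sup>2 \<le> A" "(g x)\<^sup>2 \<le> B" using Suc.prems by auto
    then have "2 * (f x)\<^sup>2 + 2 * (g x)\<^sup>2 \<le> 2 * (A + B)" by simp
    with sq_sum_le show ?thesis by (rule order_trans)
  qed
  then show ?case using Suc.prems Suc.IH[OF p(2,4)] prim_add[OF p(1,3)]
    by (auto intro!: exI[of _ "\<lambda>x. f' x + g' x"])
next
  case 0 then show ?case using U2_add[of f A g B] by simp
qed

lemma Hk_cmul: "Hk k f A \<Longrightarrow> Hk k (\<lambda>x. c * f x) (c\<^sup>2 * A)"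
proof (induction k arbitrary: f)
  case (Suc k)
  then obtain f' where "prim f f'" "Hk k f' A" by auto
  then show ?case using Suc prim_cmul[of f f' c] L2_cmul[of f A c]
    by (auto intro!: exI[of _ "\<lambda>x. c * f' x"])
qed (auto intro: L2_cmul)

lemma Gk_cmul: "Gk k f A \<Longrightarrow> Gk k (\<lambda>x. c * f x) (c\<^sup>2 * A)"
proof (induction k arbitrary: f)
  case (Suc k)
  then obtain f' where "prim f f'" "Gk k f' A" by auto
  then show ?case using Suc prim_cmul[of f f' c]
    by (auto intro!: exI[of _ "\<lambda>x. c * f' x"] simp: power_mult_distrib mult_left_mono)
qed (auto intro: U2_cmul)

lemma Gk_const: "Gk k (\<lambda>_. c) (c\<^sup>2)"
proof (induction k arbitrary: c)
  case 0 then show ?case by (auto intro: U2_bounded)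
next
  case (Suc k)
  have "Gk k (\<lambda>_. 0) (c\<^sup>2)" using Suc[of 0] by (auto intro: Gk_mono)
  then show ?case by (auto intro!: exI[of _ "\<lambda>_. 0"] prim_const)
qed

section \<open>Cauchy-Schwarz and the one-dimensional Sobolev inequality\<close>

lemma cs_interval:
  fixes g :: "real \<Rightarrow> real"
  assumes f: "set_integrable lborel {x..y} g" and xy: "x < y"
    and f2: "set_integrable lborel {x..y} (\<lambda>r. (g r)\<^sup>2)"
  shows "(LINT r:{x..y}|lborel. g r)\<^sup>2 \<le> (y - x) * (LINT r:{x..y}|lborel. (g r)\<^sup>2)"
proof -
  have d: "y - x > 0" using xy by simp
  define m where "m = (LINT r:{x..y}|lborel. g r) / (y - x)"
  have "integrable lborel (indicator {x..y} :: real \<Rightarrow> real)"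
    by (rule integrable_real_indicator) (auto simp: emeasure_lborel_Icc_eq)
  then have cst: "set_integrable lborel {x..y} (\<lambda>r. m\<^sup>2)" by (simp add: set_integrable_def)
  have "(LINT r:{x..y}|lborel. 2 * m * g r) \<le> (LINT r:{x..y}|lborel. (g r)\<^sup>2 + m\<^sup>2)"
  proof (rule set_integral_mono)
    show "2 * m * g r \<le> (g r)\<^sup>2 + m\<^sup>2" for r
      using sum_squares_bound[of m "g r"] by (simp add: algebra_simps)
  qed (use f f2 cst in \<open>auto simp: set_integral_add\<close>)
  also have "\<dots> = (LINT r:{x..y}|lborel. (g r)\<^sup>2) + m\<^sup>2 * (y - x)"
    using set_integral_add(2)[OF f2 cst] xy by (simp add: set_lebesgue_integral_def mult.commute)
  finally have "2 * m * (m * (y - x)) \<le> (LINT r:{x..y}|lborel. (g r)\<^sup>2) + m\<^sup>2 * (y - x)"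
    using d by (simp add: m_def)
  then have "m\<^sup>2 * (y - x) \<le> (LINT r:{x..y}|lborel. (g r)\<^sup>2)" by (simp add: power2_eq_square algebra_simps)
  then have "(y - x) * (m\<^sup>2 * (y - x)) \<le> (y - x) * (LINT r:{x..y}|lborel. (g r)\<^sup>2)"
    using d by (intro mult_left_mono) auto
  moreover have "(y - x) * (m\<^sup>2 * (y - x)) = (LINT r:{x..y}|lborel. g r)\<^sup>2"
    using d by (simp add: m_def power2_eq_square)
  ultimately show ?thesis by simp
qed

lemma cs_prim:
  assumes p: "prim f g" and xy: "x \<le> y"
  shows "ennreal ((f y - f x)\<^sup>2) \<le> ennreal (y - x) * nsq_on {x..y} g"
proof (cases "x = y")
  case False
  have [measurable]: "g \<in> borel_measurable borel" using p by (rule prim_borel)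
  let ?N = "\<integral>\<^sup>+r\<in>{x..y}. ennreal ((g r)\<^sup>2) \<partial>lborel"
  have N: "?N = (\<integral>\<^sup>+r. ennreal (indicator {x..y} r * (g r)\<^sup>2) \<partial>lborel)"
    by (intro nn_integral_cong) (auto simp: indicator_def)
  show ?thesis
  proof (cases "?N = \<infinity>")
    case True
    then show ?thesis using False xy by (simp add: ennreal_mult_top)
  next
    case fin: False
    then have i: "integrable lborel (\<lambda>r. indicator {x..y} r * (g r)\<^sup>2)"
      unfolding N by (intro integrableI_nonneg) (auto simp: top.not_eq_extremum)
    then have "?N = ennreal (LINT r|lborel. indicator {x..y} r * (g r)\<^sup>2)"
      unfolding N by (intro nn_integral_eq_integral) auto
    moreover have "(f y - f x)\<^sup>2 \<le> (y - x) * (LINT r|lborel. indicator {x..y} r * (g r)\<^sup>2)"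
      using cs_interval[OF prim_integrable[OF p], of x y] i prim_eq[OF p xy] False xy
      by (simp add: set_integrable_def set_lebesgue_integral_def)
    ultimately show ?thesis using xy by (simp add: ennreal_mult'[symmetric] ennreal_leI)
  qed
qed simp

text \<open>Averaging \<open>f x = f y - (f y - f x)\<close> over \<open>y\<close> in an interval of length \<open>d\<close>; small \<open>d\<close> makes
  the derivative contribute with a small factor.\<close>

lemma pointwise_sq_le:
  assumes p: "prim f g" and d: "d > 0"
  shows "ennreal ((f x)\<^sup>2) \<le>
    (\<integral>\<^sup>+y\<in>{x..x+d}. ennreal (2 / d * (f y)\<^sup>2 + 2 * d * (g y)\<^sup>2) \<partial>lborel)"
proof -
  have [measurable]: "g \<in> borel_measurable borel" "f \<in> borel_measurable borel"
    using p by (auto intro: prim_borel prim_borel_left)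
  let ?N = "\<integral>\<^sup>+r\<in>{x..x+d}. ennreal ((g r)\<^sup>2) \<partial>lborel"
  have pt: "ennreal ((f x)\<^sup>2) \<le> 2 * ennreal ((f y)\<^sup>2) + 2 * ennreal d * ?N" if y: "y \<in> {x..x+d}" for y
  proof -
    have "(f x)\<^sup>2 \<le> 2 * (f y)\<^sup>2 + 2 * (f y - f x)\<^sup>2"
      using sq_sum_le[of "f y" "f x - f y"] by (simp add: power2_commute)
    then have "ennreal ((f x)\<^sup>2) \<le> ennreal (2 * (f y)\<^sup>2 + 2 * (f y - f x)\<^sup>2)" by (rule ennreal_leI)
    also have "\<dots> = 2 * ennreal ((f y)\<^sup>2) + 2 * ennreal ((f y - f x)\<^sup>2)"
      by (simp add: ennreal_plus ennreal_mult)
    also have "ennreal ((f y - f x)\<^sup>2) \<le> ennreal (y - x) * nsq_on {x..y} g"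
      using cs_prim[OF p] y by simp
    also have "\<dots> \<le> ennreal d * ?N"
      using y by (intro mult_mono nn_integral_mono ennreal_leI mult_left_mono) (auto simp: indicator_def)
    finally show ?thesis by (simp add: mult.assoc mult_left_mono add_left_mono)
  qed
  have "ennreal d * ennreal ((f x)\<^sup>2) = (nsq_on {x..x+d} (\<lambda>y. f x))"
    using d by (simp add: nn_integral_cmult_indicator mult.commute)
  also have "\<dots> \<le> (\<integral>\<^sup>+y. 2 * (ennreal ((f y)\<^sup>2) * indicator {x..x+d} y) + (2 * ennreal d * ?N) * indicator {x..x+d} y \<partial>lborel)"
    using pt by (intro nn_integral_mono) (auto simp: indicator_def)
  also have "\<dots> = 2 * nsq_on {x..x+d} f + (2 * ennreal d * ?N) * ennreal d"
    using d by (simp add: nn_integral_add nn_integral_cmult nn_integral_cmult_indicator)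
  finally have 1: "ennreal d * ennreal ((f x)\<^sup>2) \<le> \<dots>" .
  have "(\<integral>\<^sup>+y\<in>{x..x+d}. ennreal (2 / d * (f y)\<^sup>2 + 2 * d * (g y)\<^sup>2) \<partial>lborel)
     = (\<integral>\<^sup>+y. ennreal (2 / d) * (ennreal ((f y)\<^sup>2) * indicator {x..x+d} y) + ennreal (2 * d) * (ennreal ((g y)\<^sup>2) * indicator {x..x+d} y) \<partial>lborel)"
  proof (intro nn_integral_cong)
    fix y
    have "ennreal (2 / d * (f y)\<^sup>2 + 2 * d * (g y)\<^sup>2) = ennreal (2/d) * ennreal ((f y)\<^sup>2) + ennreal (2*d) * ennreal ((g y)\<^sup>2)"
      using d by (subst ennreal_plus) (auto simp: ennreal_mult[symmetric])
    then show "ennreal (2 / d * (f y)\<^sup>2 + 2 * d * (g y)\<^sup>2) * indicator {x..x+d} y =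
        ennreal (2 / d) * (ennreal ((f y)\<^sup>2) * indicator {x..x+d} y) + ennreal (2 * d) * (ennreal ((g y)\<^sup>2) * indicator {x..x+d} y)"
      by (simp add: distrib_right mult.assoc)
  qed
  also have "\<dots> = ennreal (2 / d) * nsq_on {x..x+d} f + ennreal (2 * d) * ?N"
    by (simp add: nn_integral_add nn_integral_cmult)
  also have "\<dots> = ennreal (1/d) * (2 * nsq_on {x..x+d} f + (2 * ennreal d * ?N) * ennreal d)"
  proof -
    have a: "ennreal (1/d) * 2 = ennreal (2/d)" using d by (simp add: two_ennreal mult.commute)
    have "ennreal (1/d) * ((2 * ennreal d * ?N) * ennreal d) = (ennreal (1/d) * ennreal d) * (2 * ennreal d) * ?N"
      by (simp add: mult_ac)
    also have "\<dots> = ennreal (2*d) * ?N" using d by (simp add: ennreal_mult[symmetric] two_ennreal)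
    finally show ?thesis by (simp add: distrib_left a mult.assoc[symmetric])
  qed
  finally have 2: "(\<integral>\<^sup>+y\<in>{x..x+d}. ennreal (2 / d * (f y)\<^sup>2 + 2 * d * (g y)\<^sup>2) \<partial>lborel) = \<dots>" .
  have "ennreal ((f x)\<^sup>2) = ennreal (1/d) * (ennreal d * ennreal ((f x)\<^sup>2))"
    using d by (simp add: ennreal_mult[symmetric] mult.assoc[symmetric])
  also have "\<dots> \<le> ennreal (1/d) * (2 * nsq_on {x..x+d} f + (2 * ennreal d * ?N) * ennreal d)"
    by (rule mult_left_mono[OF 1]) simp
  finally show ?thesis using 2 by simp
qed

lemma nn_lin_sq:
  assumes "a \<ge> 0" "b \<ge> 0" and [measurable]: "f \<in> borel_measurable borel" "g \<in> borel_measurable borel"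
  shows "(\<integral>\<^sup>+y. ennreal (a * (f y)\<^sup>2 + b * (g y)\<^sup>2) \<partial>lborel) =
    ennreal a * nsq f + ennreal b * nsq g"
  using assms(1,2) by (simp add: ennreal_plus ennreal_mult nn_integral_add nn_integral_cmult)

lemma Hk_sup:
  assumes "Hk (Suc k) f A" shows "(f x)\<^sup>2 \<le> 4 * A"
proof -
  obtain g where p: "prim f g" and g: "L2 g A" and f: "L2 f A" using assms by (auto dest: Hk_L2)
  have [measurable]: "g \<in> borel_measurable borel" "f \<in> borel_measurable borel"
    using p by (auto intro: prim_borel prim_borel_left)
  have "ennreal ((f x)\<^sup>2) \<le> (\<integral>\<^sup>+y\<in>{x..x+1}. ennreal (2 / 1 * (f y)\<^sup>2 + 2 * 1 * (g y)\<^sup>2) \<partial>lborel)"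
    by (rule pointwise_sq_le[OF p]) simp
  also have "\<dots> \<le> (\<integral>\<^sup>+y. ennreal (2 * (f y)\<^sup>2 + 2 * (g y)\<^sup>2) \<partial>lborel)"
    by (intro nn_integral_mono) (auto simp: indicator_def)
  also have "\<dots> \<le> 2 * ennreal A + 2 * ennreal A"
    using f g unfolding L2_def by (subst nn_lin_sq) (auto intro!: add_mono mult_left_mono)
  also have "\<dots> = ennreal (4 * A)"
    using f by (simp add: two_ennreal L2_def ennreal_plus[symmetric] del: ennreal_plus)
  finally show ?thesis using f by (subst (asm) ennreal_le_iff) (auto simp: L2_def)
qed

lemma Hk_imp_Gk: "Hk k f A \<Longrightarrow> Gk k f (4 * A)"
proof (induction k arbitrary: f)
  case 0
  then have f: "f \<in> borel_measurable borel" "0 \<le> A" "nsq f \<le> ennreal A"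
    by (auto simp: L2_def)
  have "nsq_on {x..x+1} f \<le> ennreal A" for x
    by (rule order_trans[OF nn_integral_mono f(3)]) (auto simp: indicator_def)
  then have "U2 f A" using f by (simp add: U2_def)
  then show ?case using f by (auto intro: U2_mono)
next
  case (Suc k)
  then show ?case using Hk_sup[OF Suc.prems] Hk_nonneg[OF Suc.prems] by auto
qed

text \<open>\<open>pointwise_sq_le\<close> bounds f(x)^2 by an integral over [x, x+d]. After Fubini
  a point y carries the integral of m^2 over [y-d, y], which lies in a unit interval because d \<le>
  1. The free length d trades f against its derivative.\<close>

lemma U2_Hk_mult_interp:
  assumes m: "U2 m B" and p: "prim f g" and d: "0 < d" "d \<le> 1"
  shows "nsq (\<lambda>x. m x * f x) \<le>
     ennreal B * (\<integral>\<^sup>+y. ennreal (2 / d * (f y)\<^sup>2 + 2 * d * (g y)\<^sup>2) \<partial>lborel)"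
proof -
  have [measurable]: "g \<in> borel_measurable borel" "f \<in> borel_measurable borel" "m \<in> borel_measurable borel"
    using p m by (auto intro: prim_borel prim_borel_left simp: U2_def)
  let ?q = "\<lambda>y. ennreal (2 / d * (f y)\<^sup>2 + 2 * d * (g y)\<^sup>2)"
  have ind: "(indicator {fst z..fst z+d} (snd z) :: ennreal) = (if fst z \<le> snd z \<and> snd z \<le> fst z + d then 1 else 0)" for z :: "real \<times> real"
    by (auto simp: indicator_def)
  have [measurable]: "(\<lambda>z::real\<times>real. indicator {fst z..fst z+d} (snd z) :: ennreal) \<in> borel_measurable (borel \<Otimes>\<^sub>M borel)"
    unfolding ind by measurable
  have "nsq (\<lambda>x. m x * f x) \<le>
     (\<integral>\<^sup>+x. ennreal ((m x)\<^sup>2) * (\<integral>\<^sup>+y\<in>{x..x+d}. ?q y \<partial>lborel) \<partial>lborel)"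
    unfolding power_mult_distrib ennreal_mult[OF zero_le_power2 zero_le_power2]
    by (intro nn_integral_mono mult_left_mono pointwise_sq_le[OF p d(1)]) simp
  also have "\<dots> = (\<integral>\<^sup>+x. (\<integral>\<^sup>+y. ennreal ((m x)\<^sup>2) * (?q y * indicator {x..x+d} y) \<partial>lborel) \<partial>lborel)"
    by (intro nn_integral_cong nn_integral_cmult[symmetric]) auto
  also have "\<dots> = (\<integral>\<^sup>+y. (\<integral>\<^sup>+x. ennreal ((m x)\<^sup>2) * (?q y * indicator {x..x+d} y) \<partial>lborel) \<partial>lborel)"
    by (rule lborel_pair.Fubini'[symmetric]) measurable
  also have "\<dots> \<le> (\<integral>\<^sup>+y. ennreal B * ?q y \<partial>lborel)"
  proof (intro nn_integral_mono)
    fix y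
    have "(\<integral>\<^sup>+x. ennreal ((m x)\<^sup>2) * (?q y * indicator {x..x+d} y) \<partial>lborel)
       \<le> (\<integral>\<^sup>+x. (ennreal ((m x)\<^sup>2) * indicator {y-1..y-1+1} x) * ?q y \<partial>lborel)"
      using d by (intro nn_integral_mono) (auto simp: indicator_def)
    also have "\<dots> = nsq_on {y-1..y-1+1} m * ?q y"
      by (rule nn_integral_multc) measurable
    also have "\<dots> \<le> ennreal B * ?q y"
      using m unfolding U2_def by (intro mult_right_mono) (blast, simp)
    finally show "(\<integral>\<^sup>+x. ennreal ((m x)\<^sup>2) * (?q y * indicator {x..x+d} y) \<partial>lborel) \<le> ennreal B * ?q y" .
  qed
  also have "\<dots> = ennreal B * (\<integral>\<^sup>+y. ?q y \<partial>lborel)" by (rule nn_integral_cmult) measurable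
  finally show ?thesis .
qed

lemma L2_U2_H1:
  assumes m: "U2 m B" and f: "Hk (Suc k) f A"
  shows "L2 (\<lambda>x. m x * f x) (4 * B * A)"
proof -
  obtain g where p: "prim f g" and g: "L2 g A" and fA: "L2 f A" using f by (auto dest: Hk_L2)
  have [measurable]: "g \<in> borel_measurable borel" "f \<in> borel_measurable borel" "m \<in> borel_measurable borel"
    using p m by (auto intro: prim_borel prim_borel_left simp: U2_def)
  have nn: "0 \<le> A" "0 \<le> B" using fA m by (auto simp: L2_def U2_def)
  have "nsq (\<lambda>x. m x * f x) \<le>
     ennreal B * (\<integral>\<^sup>+y. ennreal (2 / 1 * (f y)\<^sup>2 + 2 * 1 * (g y)\<^sup>2) \<partial>lborel)"
    by (rule U2_Hk_mult_interp[OF m p]) auto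
  also have "\<dots> \<le> ennreal B * (2 * ennreal A + 2 * ennreal A)"
    using fA g unfolding L2_def by (subst nn_lin_sq) (auto intro!: add_mono mult_left_mono)
  also have "\<dots> = ennreal (4 * B * A)"
    using nn by (simp add: two_ennreal ennreal_plus[symmetric] ennreal_mult[symmetric] mult.assoc del: ennreal_plus)
  finally show ?thesis using nn by (simp add: L2_def)
qed

lemma L2_bounded_mult:
  assumes "f \<in> borel_measurable borel" "\<And>x. (f x)\<^sup>2 \<le> B" "L2 g A"
  shows "L2 (\<lambda>x. f x * g x) (B * A)"
proof -
  have [measurable]: "g \<in> borel_measurable borel" "f \<in> borel_measurable borel"
    using assms by (auto simp: L2_def)
  have B: "0 \<le> B" using assms(2)[of 0] zero_le_power2 order_trans by blast
  have "nsq (\<lambda>x. f x * g x) \<le> (\<integral>\<^sup>+x. ennreal B * ennreal ((g x)\<^sup>2) \<partial>lborel)"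
    by (intro nn_integral_mono) (simp add: power_mult_distrib ennreal_mult ennreal_leI assms mult_right_mono)
  also have "\<dots> = ennreal B * nsq g"
    by (rule nn_integral_cmult) measurable
  also have "\<dots> \<le> ennreal B * ennreal A" using assms(3) by (intro mult_left_mono) (auto simp: L2_def)
  finally show ?thesis using assms(3) B by (simp add: L2_def ennreal_mult)
qed

lemma U2_bounded_mult:
  assumes "f \<in> borel_measurable borel" "\<And>x. (f x)\<^sup>2 \<le> B" "U2 g A"
  shows "U2 (\<lambda>x. f x * g x) (B * A)"
proof -
  have [measurable]: "g \<in> borel_measurable borel" "f \<in> borel_measurable borel"
    using assms by (auto simp: U2_def)
  have B: "0 \<le> B" using assms(2)[of 0] zero_le_power2 order_trans by blast
  have "(nsq_on {x..x+1} (\<lambda>y. f y * g y)) \<le> ennreal B * ennreal A" for x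
  proof -
    have "(nsq_on {x..x+1} (\<lambda>y. f y * g y))
       \<le> (\<integral>\<^sup>+y. ennreal B * (ennreal ((g y)\<^sup>2) * indicator {x..x+1} y) \<partial>lborel)"
      by (intro nn_integral_mono)
        (simp add: power_mult_distrib ennreal_mult ennreal_leI assms mult_right_mono mult.assoc[symmetric])
    also have "\<dots> = ennreal B * nsq_on {x..x+1} g"
      by (rule nn_integral_cmult) measurable
    also have "\<dots> \<le> ennreal B * ennreal A" using assms(3) by (intro mult_left_mono) (auto simp: U2_def)
    finally show ?thesis .
  qed
  then show ?thesis using assms(3) B by (simp add: U2_def ennreal_mult)
qed

text \<open>The condition \<open>0 < j + k\<close> excludes a \<open>U2\<close> function times an
  \<open>L2\<close> function, a product that need not be in L^2. It survives differentiation, since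
  each term of the product rule lowers only one factor; adding the two terms costs a factor 4 per
  order.\<close>

lemma Hk_mult:
  assumes "Gk j f B" "Hk k g A" "m \<le> j" "m \<le> k" "0 < j + k"
  shows "Hk m (\<lambda>x. f x * g x) (4 ^ Suc m * B * A)"
  using assms
proof (induction m arbitrary: j k f g)
  case 0
  have nn: "0 \<le> A" "0 \<le> B" using 0 by (auto intro: Hk_nonneg Gk_nonneg)
  show ?case
  proof (cases j)
    case 0
    then obtain k' where "k = Suc k'" using \<open>0 < j + k\<close> by (cases k) auto
    then show ?thesis using L2_U2_H1[of f B k' g A] \<open>Gk j f B\<close> \<open>Hk k g A\<close> 0 by simp
  next
    case (Suc j')
    have "L2 (\<lambda>x. f x * g x) (B * A)"
      by (rule L2_bounded_mult[OF Gk_borel[OF \<open>Gk j f B\<close>] _ Hk_L2[OF \<open>Hk k g A\<close>]])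
        (use \<open>Gk j f B\<close> Suc in simp)
    moreover have "B * A \<le> 4 * B * A" using mult_nonneg_nonneg[OF nn(2,1)] by linarith
    ultimately have "L2 (\<lambda>x. f x * g x) (4 * B * A)" by (rule L2_mono)
    then show ?thesis by simp
  qed
next
  case (Suc m)
  obtain j' k' where jk: "j = Suc j'" "k = Suc k'" using Suc.prems by (cases j; cases k) auto
  obtain f' g' where f': "prim f f'" "Gk j' f' B" and g': "prim g g'" "Hk k' g' A"
    using Suc.prems jk by auto
  have nn: "0 \<le> A" "0 \<le> B" using Suc by (auto intro: Hk_nonneg Gk_nonneg)
  have 1: "Hk m (\<lambda>x. f' x * g x) (4 ^ Suc m * B * A)"
    using Suc.IH[of j' f' k g] f' Suc.prems jk by simp
  have 2: "Hk m (\<lambda>x. f x * g' x) (4 ^ Suc m * B * A)"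
    using Suc.IH[of j f k' g'] g' Suc.prems jk by simp
  have 3: "Hk m (\<lambda>x. f' x * g x + f x * g' x) (4 ^ Suc (Suc m) * B * A)"
    using Hk_add[OF 1 2] by (simp add: mult_ac)
  have "L2 (\<lambda>x. f x * g x) (B * A)"
    by (rule L2_bounded_mult[OF Gk_borel[OF Suc.prems(1)] _ Hk_L2[OF Suc.prems(2)]])
      (use Suc.prems(1) jk in simp)
  moreover have "1 * (B * A) \<le> 4 ^ Suc (Suc m) * (B * A)"
    using nn by (intro mult_right_mono one_le_power) auto
  ultimately have "L2 (\<lambda>x. f x * g x) (4 ^ Suc (Suc m) * B * A)"
    by (auto intro: L2_mono simp: mult.assoc)
  then show ?case using 3 prim_mult[OF f'(1) g'(1)] by auto
qed

lemma Gk_mult: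
  assumes "Gk j f B" "Gk k g A" "m \<le> j" "m \<le> k" "0 < j + k"
  shows "Gk m (\<lambda>x. f x * g x) (4 ^ Suc m * B * A)"
  using assms
proof (induction m arbitrary: j k f g)
  case 0
  have nn: "0 \<le> A" "0 \<le> B" using 0 by (auto intro: Gk_nonneg)
  have "U2 (\<lambda>x. f x * g x) (B * A)"
  proof (cases j)
    case 0
    then obtain k' where "k = Suc k'" using \<open>0 < j + k\<close> by (cases k) auto
    then have "U2 (\<lambda>x. g x * f x) (A * B)" using \<open>Gk j f B\<close> \<open>Gk k g A\<close> 0
      by (intro U2_bounded_mult) (auto intro: Gk_borel prim_borel_left)
    then show ?thesis by (simp add: mult.commute)
  next
    case (Suc j')
    have "U2 g A" using Gk_lower[OF \<open>Gk k g A\<close>, of 0] by simp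
    then show ?thesis
      by (rule U2_bounded_mult[OF Gk_borel[OF \<open>Gk j f B\<close>], rotated])
        (use \<open>Gk j f B\<close> Suc in simp)
  qed
  moreover have "B * A \<le> 4 * B * A" using mult_nonneg_nonneg[OF nn(2,1)] by linarith
  ultimately have "U2 (\<lambda>x. f x * g x) (4 * B * A)" by (rule U2_mono)
  then show ?case by simp
next
  case (Suc m)
  obtain j' k' where jk: "j = Suc j'" "k = Suc k'" using Suc.prems by (cases j; cases k) auto
  obtain f' g' where f': "prim f f'" "Gk j' f' B" and g': "prim g g'" "Gk k' g' A"
    using Suc.prems jk by auto
  have nn: "0 \<le> A" "0 \<le> B" using Suc by (auto intro: Gk_nonneg)
  have 1: "Gk m (\<lambda>x. f' x * g x) (4 ^ Suc m * B * A)"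
    using Suc.IH[of j' f' k g] f' Suc.prems jk by simp
  have 2: "Gk m (\<lambda>x. f x * g' x) (4 ^ Suc m * B * A)"
    using Suc.IH[of j f k' g'] g' Suc.prems jk by simp
  have 3: "Gk m (\<lambda>x. f' x * g x + f x * g' x) (4 ^ Suc (Suc m) * B * A)"
    using Gk_add[OF 1 2] by (simp add: mult_ac)
  have "(f x * g x)\<^sup>2 \<le> 4 ^ Suc (Suc m) * B * A" for x
  proof -
    have "(f x * g x)\<^sup>2 \<le> B * A"
      unfolding power_mult_distrib using Suc.prems jk nn by (intro mult_mono) auto
    also have "1 * (B * A) \<le> 4 ^ Suc (Suc m) * (B * A)"
      using nn by (intro mult_right_mono one_le_power) auto
    finally show ?thesis by (simp add: mult.assoc)
  qed
  then show ?case using 3 nn prim_mult[OF f'(1) g'(1)] by auto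
qed

section \<open>Difference quotients\<close>

definition dq :: "real \<Rightarrow> (real \<Rightarrow> real) \<Rightarrow> real \<Rightarrow> real" where
  "dq h f x = (f (x + h) - f x) / h"

primrec dqs :: "real list \<Rightarrow> (real \<Rightarrow> real) \<Rightarrow> real \<Rightarrow> real" where
  "dqs [] f = f"
| "dqs (h # hs) f = dq h (dqs hs f)"

lemma dq_add: "dq h (\<lambda>x. f x + g x) = (\<lambda>x. dq h f x + dq h g x)"
  by (auto simp: dq_def add_divide_distrib diff_divide_distrib)

lemma dq_cmul: "dq h (\<lambda>x. c * f x) = (\<lambda>x. c * dq h f x)"
  by (auto simp: dq_def right_diff_distrib)

lemma dqs_add: "dqs hs (\<lambda>x. f x + g x) = (\<lambda>x. dqs hs f x + dqs hs g x)"
  by (induction hs) (auto simp: dq_add)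

lemma dqs_cmul: "dqs hs (\<lambda>x. c * f x) = (\<lambda>x. c * dqs hs f x)"
  by (induction hs) (auto simp: dq_cmul)

lemma dqs_append: "dqs (hs @ gs) f = dqs hs (dqs gs f)"
  by (induction hs) auto

text \<open>A zero step is harmless: division by zero makes both sides 0.\<close>

lemma dq_mult: "dq h (\<lambda>x. f x * g x) = (\<lambda>x. f x * dq h g x + dq h f x * g (x + h))"
  by (cases "h = 0") (auto simp: dq_def field_simps)

lemma prim_dq: "prim f g \<Longrightarrow> prim (dq h f) (dq h g)"
  using prim_cmul[OF prim_diff[OF prim_shift[of f g h]], of f g "1/h"] by (simp add: dq_def[abs_def])

lemma L2_shift: assumes "L2 f A" shows "L2 (\<lambda>x. f (x + h)) A"
proof -
  have [measurable]: "f \<in> borel_measurable borel" using assms by (simp add: L2_def)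
  show ?thesis
    using assms nn_integral_real_affine[of "\<lambda>x. ennreal ((f x)\<^sup>2)" 1 h]
    by (simp add: L2_def add.commute)
qed

lemma Hk_shift: "Hk k f A \<Longrightarrow> Hk k (\<lambda>x. f (x + h)) A"
proof (induction k arbitrary: f)
  case (Suc k)
  then obtain g where "prim f g" "Hk k g A" by auto
  then show ?case using Suc prim_shift[of f g h] by (auto intro: L2_shift)
qed (auto intro: L2_shift)

lemma ind_shift_measurable [measurable]:
  "(\<lambda>z::real\<times>real. indicator {fst z..fst z+d} (snd z) :: ennreal) \<in> borel_measurable (borel \<Otimes>\<^sub>M borel)"
proof -
  have "(\<lambda>z::real\<times>real. indicator {fst z..fst z+d} (snd z) :: ennreal)
      = (\<lambda>z. if fst z \<le> snd z \<and> snd z \<le> fst z + d then 1 else 0)"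
    by (auto simp: indicator_def)
  also have "\<dots> \<in> borel_measurable (borel \<Otimes>\<^sub>M borel)" by measurable
  finally show ?thesis .
qed

lemma nn_average:
  assumes [measurable]: "q \<in> borel_measurable borel" and d: "d \<ge> 0"
  shows "(\<integral>\<^sup>+x. (\<integral>\<^sup>+y\<in>{x..x+d}. q y \<partial>lborel) \<partial>lborel) = ennreal d * (\<integral>\<^sup>+y. q y \<partial>lborel)"
proof -
  have "(\<integral>\<^sup>+x. (\<integral>\<^sup>+y\<in>{x..x+d}. q y \<partial>lborel) \<partial>lborel)
      = (\<integral>\<^sup>+y. (\<integral>\<^sup>+x. q y * indicator {x..x+d} y \<partial>lborel) \<partial>lborel)"
    by (rule lborel_pair.Fubini'[symmetric]) measurable
  also have "\<dots> = (\<integral>\<^sup>+y. ennreal d * q y \<partial>lborel)"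
  proof (intro nn_integral_cong)
    fix y
    have "(\<integral>\<^sup>+x. q y * indicator {x..x+d} y \<partial>lborel) = (\<integral>\<^sup>+x\<in>{y-d..y}. q y \<partial>lborel)"
      by (intro nn_integral_cong) (auto simp: indicator_def)
    also have "\<dots> = ennreal d * q y"
      using d by (simp add: nn_integral_cmult_indicator mult.commute)
    finally show "(\<integral>\<^sup>+x. q y * indicator {x..x+d} y \<partial>lborel) = ennreal d * q y" .
  qed
  also have "\<dots> = ennreal d * (\<integral>\<^sup>+y. q y \<partial>lborel)" by (rule nn_integral_cmult) measurable
  finally show ?thesis .
qed

lemma dq_sq_le:
  assumes p: "prim f g" and h: "h > 0"
  shows "ennreal ((dq h f x)\<^sup>2) \<le> ennreal (1 / h) * nsq_on {x..x+h} g"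
proof -
  have "ennreal ((dq h f x)\<^sup>2) = ennreal (1 / h\<^sup>2) * ennreal ((f (x + h) - f x)\<^sup>2)"
    by (simp add: dq_def power_divide ennreal_mult[symmetric])
  also have "\<dots> \<le> ennreal (1 / h\<^sup>2) * (ennreal h * nsq_on {x..x+h} g)"
    using cs_prim[OF p, of x "x + h"] h by (intro mult_left_mono) auto
  also have "\<dots> = ennreal (1 / h) * nsq_on {x..x+h} g"
    using h by (simp add: mult.assoc[symmetric] ennreal_mult[symmetric] power2_eq_square)
  finally show ?thesis .
qed

text \<open>Cauchy-Schwarz bounds the squared quotient by the mean of g^2 over [x, x+h], and by
  \<open>nn_average\<close> these means integrate to the integral of g^2. The bound is uniform in
  the step.\<close>

lemma L2_dq:
  assumes p: "prim f g" and g: "L2 g A" and h: "h > 0"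
  shows "L2 (dq h f) A"
proof -
  have [measurable]: "g \<in> borel_measurable borel" "f \<in> borel_measurable borel"
    using p by (auto intro: prim_borel prim_borel_left)
  have m: "dq h f \<in> borel_measurable borel" unfolding dq_def[abs_def] by measurable
  have "nsq (dq h f) \<le>
     (\<integral>\<^sup>+x. ennreal (1 / h) * nsq_on {x..x+h} g \<partial>lborel)"
    by (intro nn_integral_mono dq_sq_le p h)
  also have "\<dots> = ennreal (1 / h) * (\<integral>\<^sup>+x. (nsq_on {x..x+h} g) \<partial>lborel)"
    by (rule nn_integral_cmult) measurable
  also have "\<dots> = ennreal (1 / h) * (ennreal h * nsq g)"
    using h by (subst nn_average) auto
  also have "\<dots> = nsq g"
    using h by (simp add: mult.assoc[symmetric] ennreal_mult[symmetric])
  finally show ?thesis using g m by (auto simp: L2_def)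
qed

lemma Hk_dq: "Hk (Suc k) f A \<Longrightarrow> h > 0 \<Longrightarrow> Hk k (dq h f) A"
proof (induction k arbitrary: f)
  case 0
  then show ?case using L2_dq by auto
next
  case (Suc k)
  then obtain g where g: "prim f g" "Hk (Suc k) g A" by auto
  then show ?case using Suc.IH[OF g(2)] prim_dq[OF g(1), of h] L2_dq[OF g(1)] Hk_L2[OF g(2)] Suc.prems by auto
qed

lemma prim_dqs: "prim f g \<Longrightarrow> prim (dqs hs f) (dqs hs g)"
  by (induction hs) (auto intro: prim_dq)

lemma L2_dqs: "Hk (length hs) f A \<Longrightarrow> set hs \<subseteq> {0<..} \<Longrightarrow> L2 (dqs hs f) A"
proof (induction hs arbitrary: f rule: rev_induct)
  case (snoc h hs)
  then show ?case using Hk_dq[of "length hs" f A h] by (simp add: dqs_append)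
qed simp

text \<open>On [x, x+1] the quotient with h \<le> 1 sees \<open>g\<close> on [x, x+2]; two unit
  intervals give the factor 2.\<close>

lemma U2_dq:
  assumes p: "prim f g" and g: "U2 g B" and h: "0 < h" "h \<le> 1"
  shows "U2 (dq h f) (2 * B)"
proof -
  have [measurable]: "g \<in> borel_measurable borel" "f \<in> borel_measurable borel"
    using p by (auto intro: prim_borel prim_borel_left)
  have m: "dq h f \<in> borel_measurable borel" unfolding dq_def[abs_def] by measurable
  have B: "0 \<le> B" using g by (simp add: U2_def)
  have "(nsq_on {x..x+1} (\<lambda>y. dq h f y)) \<le> ennreal (2 * B)" for x
  proof -
    let ?q = "\<lambda>r. ennreal ((g r)\<^sup>2) * indicator {x..x+2} r"
    have "(nsq_on {x..x+1} (\<lambda>y. dq h f y)) \<le>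
       (\<integral>\<^sup>+y. ennreal (1 / h) * (\<integral>\<^sup>+r\<in>{y..y+h}. ?q r \<partial>lborel) \<partial>lborel)"
    proof (intro nn_integral_mono)
      fix y
      show "ennreal ((dq h f y)\<^sup>2) * indicator {x..x+1} y
         \<le> ennreal (1 / h) * (\<integral>\<^sup>+r\<in>{y..y+h}. ?q r \<partial>lborel)"
      proof (cases "y \<in> {x..x+1}")
        case True
        have "nsq_on {y..y+h} g \<le> (\<integral>\<^sup>+r\<in>{y..y+h}. ?q r \<partial>lborel)"
          using True h by (intro nn_integral_mono) (auto simp: indicator_def)
        then show ?thesis using order_trans[OF dq_sq_le[OF p h(1), of y] mult_left_mono] True by simp
      qed simp
    qed
    also have "\<dots> = ennreal (1 / h) * (\<integral>\<^sup>+y. (\<integral>\<^sup>+r\<in>{y..y+h}. ?q r \<partial>lborel) \<partial>lborel)"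
      by (rule nn_integral_cmult) measurable
    also have "\<dots> = ennreal (1 / h) * (ennreal h * (\<integral>\<^sup>+r. ?q r \<partial>lborel))"
      using h by (subst nn_average) auto
    also have "\<dots> = (\<integral>\<^sup>+r. ?q r \<partial>lborel)"
      using h by (simp add: mult.assoc[symmetric] ennreal_mult[symmetric])
    also have "\<dots> \<le> (\<integral>\<^sup>+r. ennreal ((g r)\<^sup>2) * indicator {x..x+1} r + ennreal ((g r)\<^sup>2) * indicator {x+1..x+1+1} r \<partial>lborel)"
      by (intro nn_integral_mono) (auto simp: indicator_def)
    also have "\<dots> = nsq_on {x..x+1} g + nsq_on {x+1..x+1+1} g"
      by (rule nn_integral_add) measurable
    also have "\<dots> \<le> ennreal B + ennreal B" using g unfolding U2_def by (intro add_mono) blast+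
    also have "\<dots> = ennreal (2 * B)" using B by (simp add: ennreal_plus[symmetric] del: ennreal_plus)
    finally show ?thesis .
  qed
  then show ?thesis using m B by (simp add: U2_def)
qed

lemma dq_bounded:
  assumes p: "prim f g" and g: "\<And>x. (g x)\<^sup>2 \<le> B" and h: "0 < h"
  shows "(dq h f x)\<^sup>2 \<le> B"
proof -
  have B: "0 \<le> B" using g[of 0] zero_le_power2 order_trans by blast
  have "ennreal ((dq h f x)\<^sup>2) \<le> ennreal (1 / h) * nsq_on {x..x+h} g"
    by (rule dq_sq_le[OF p h])
  also have "\<dots> \<le> ennreal (1 / h) * (\<integral>\<^sup>+r\<in>{x..x+h}. ennreal B \<partial>lborel)"
    using g by (intro mult_left_mono nn_integral_mono mult_right_mono ennreal_leI) auto
  also have "\<dots> = ennreal B"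
    using h B by (simp add: nn_integral_cmult_indicator ennreal_mult[symmetric])
  finally show ?thesis using B by simp
qed

lemma Gk_dq: "Gk (Suc k) f B \<Longrightarrow> 0 < h \<Longrightarrow> h \<le> 1 \<Longrightarrow> Gk k (dq h f) (2 * B)"
proof (induction k arbitrary: f)
  case 0
  then show ?case using U2_dq by auto
next
  case (Suc k)
  then obtain g where g: "prim f g" "Gk (Suc k) g B" by auto
  have B: "0 \<le> B" using Suc.prems by auto
  have "(dq h f x)\<^sup>2 \<le> 2 * B" for x
    using dq_bounded[OF g(1), of B h x] g(2) Suc.prems B by auto
  then show ?case using Suc.IH[OF g(2)] prim_dq[OF g(1), of h] Suc.prems B by auto
qed

lemma prim_DERIV:
  assumes p: "prim f g" and c: "continuous_on UNIV g"
  shows "(f has_real_derivative g x) (at x)"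
proof -
  have "((\<lambda>u. integral {x-1..u} g) has_vector_derivative g x) (at x within {x-1..x+1})"
    by (rule integral_has_vector_derivative) (auto intro: continuous_on_subset[OF c])
  then have "((\<lambda>u. integral {x-1..u} g) has_real_derivative g x) (at x within {x-1..x+1})"
    by (simp add: has_real_derivative_iff_has_vector_derivative)
  then have "((\<lambda>u. integral {x-1..u} g) has_real_derivative g x) (at x)"
    by (subst (asm) at_within_interior[of x]) auto
  then have "((\<lambda>u. f (x-1) + integral {x-1..u} g) has_real_derivative g x) (at x)"
    by (auto intro!: derivative_eq_intros)
  moreover have "\<forall>\<^sub>F u in nhds x. f (x-1) + integral {x-1..u} g = f u"
  proof (rule eventually_nhds_in_open[of "{x-1<..}" x, THEN eventually_mono])
    fix u assume "u \<in> {x-1<..}"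
    then show "f (x-1) + integral {x-1..u} g = f u"
      using prim_has_integral[OF p, of "x-1" u] by (auto dest!: integral_unique)
  qed auto
  ultimately show ?thesis using DERIV_cong_ev[OF refl _ refl] by metis
qed

text \<open>\<open>f\<close> is continuous, so the mean value theorem turns the quotient into f(z)
  with z between x and x + h; Cauchy-Schwarz for f(z) - f(x) gives an error of first order in
  h.\<close>

lemma L2_dq_diff:
  assumes q: "prim F f" and p: "prim f g" and g: "L2 g A" and h: "h > 0"
  shows "L2 (\<lambda>x. dq h F x - f x) (h\<^sup>2 * A)"
proof -
  have [measurable]: "g \<in> borel_measurable borel" "f \<in> borel_measurable borel" "F \<in> borel_measurable borel"
    using p q by (auto intro: prim_borel prim_borel_left)
  have m: "(\<lambda>x. dq h F x - f x) \<in> borel_measurable borel" unfolding dq_def by measurable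
  have pt: "ennreal ((dq h F x - f x)\<^sup>2) \<le> ennreal h * nsq_on {x..x+h} g" for x
  proof -
    obtain z where z: "x < z" "z < x + h" "F (x+h) - F x = h * f z"
      using MVT2[of x "x+h" F f] h prim_DERIV[OF q prim_continuous_on[OF p]] by auto
    then have "ennreal ((dq h F x - f x)\<^sup>2) = ennreal ((f z - f x)\<^sup>2)" using h by (simp add: dq_def)
    also have "\<dots> \<le> ennreal (z - x) * nsq_on {x..z} g"
      using cs_prim[OF p] z by simp
    also have "\<dots> \<le> ennreal h * nsq_on {x..x+h} g"
      using z by (intro mult_mono nn_integral_mono ennreal_leI mult_left_mono) (auto simp: indicator_def)
    finally show ?thesis .
  qed
  have "nsq (\<lambda>x. dq h F x - f x) \<le>
     (\<integral>\<^sup>+x. ennreal h * nsq_on {x..x+h} g \<partial>lborel)"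
    by (intro nn_integral_mono pt)
  also have "\<dots> = ennreal h * (\<integral>\<^sup>+x. (nsq_on {x..x+h} g) \<partial>lborel)"
    by (rule nn_integral_cmult) measurable
  also have "\<dots> = ennreal h * (ennreal h * nsq g)"
    using h by (subst nn_average) auto
  also have "\<dots> \<le> ennreal h * (ennreal h * ennreal A)"
    using g by (intro mult_left_mono) (auto simp: L2_def)
  also have "\<dots> = ennreal (h\<^sup>2 * A)"
    using h g by (simp add: L2_def ennreal_mult[symmetric] power2_eq_square mult.assoc)
  finally show ?thesis using m g by (simp add: L2_def)
qed

lemma L2_diff: "L2 f A \<Longrightarrow> L2 g B \<Longrightarrow> L2 (\<lambda>x. f x - g x) (2 * (A + B))"
  using L2_add[of f A "\<lambda>x. - 1 * g x" B] L2_cmul[of g B "-1"] by simp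

lemma L2_dq_plain:
  assumes "L2 f A" and h: "h > 0" shows "L2 (dq h f) (4 / h\<^sup>2 * A)"
  using L2_cmul[OF L2_diff[OF L2_shift[OF assms(1), of h] assms(1)], of "1/h"]
  by (simp add: dq_def[abs_def] power_divide)

text \<open>The constant depends on the steps and blows up as they shrink. It serves where the steps
  are fixed and the bound \<open>A\<close> itself tends to 0.\<close>

lemma L2_dqs_plain:
  assumes "L2 f A" and "set hs \<subseteq> {0<..}"
  obtains c where "c \<ge> 0" "\<And>f A. L2 f A \<Longrightarrow> L2 (dqs hs f) (c * A)"
proof -
  have "\<exists>c\<ge>0. \<forall>f A. L2 f A \<longrightarrow> L2 (dqs hs f) (c * A)" using assms(2)
  proof (induction hs)
    case Nil then show ?case by (auto intro: exI[of _ 1])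
  next
    case (Cons h hs)
    then obtain c where c: "c \<ge> 0" "\<And>f A. L2 f A \<Longrightarrow> L2 (dqs hs f) (c * A)" by auto
    have "L2 (dqs (h # hs) f) (4 / h\<^sup>2 * c * A)" if "L2 f A" for f A
      using L2_dq_plain[OF c(2)[OF that], of h] Cons.prems by (simp add: mult.assoc)
    moreover have "4 / h\<^sup>2 * c \<ge> 0" using c by simp
    ultimately show ?case by blast
  qed
  then show ?thesis using that by blast
qed

text \<open>Writing \<open>f' = dq h f - (dq h f - f')\<close> and choosing \<open>h\<close> small.\<close>

lemma interp_step:
  assumes p: "prim f f1" and f1: "Hk (Suc k) f1 M" and f: "L2 f L" and h: "h > 0"
  shows "L2 f1 (8 / h\<^sup>2 * L + 2 * h\<^sup>2 * M)"
proof -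
  obtain f2 where f2: "prim f1 f2" "L2 f2 M" using f1 by (auto dest: Hk_L2)
  have "L2 (\<lambda>x. dq h f x - (dq h f x - f1 x)) (2 * (4 / h\<^sup>2 * L + h\<^sup>2 * M))"
    by (intro L2_diff L2_dq_plain f h L2_dq_diff[OF p f2])
  then show ?thesis by (simp add: algebra_simps)
qed

text \<open>An inequality of Ehrling type: the intermediate norm costs an arbitrarily small part of
  the top norm. The induction passes to f', whose L^2 norm is bounded in terms of f and of the top
  norm by \<open>interp_step\<close>.\<close>

lemma interp:
  assumes "\<eta> > 0"
  shows "\<exists>C>0. \<forall>f M L. Hk (Suc k) f M \<longrightarrow> L2 f L \<longrightarrow> Hk k f (\<eta> * M + C * L)"
  using assms
proof (induction k arbitrary: \<eta>)
  case 0
  have "Hk 0 f (\<eta> * M + 1 * L)" if "Hk (Suc 0) f M" "L2 f L" for f M L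
    using that Hk_nonneg[OF that(1)] 0 by (auto intro: L2_mono)
  then show ?case by (intro exI[of _ 1]) auto
next
  case (Suc k)
  obtain C where C: "C > 0" "\<And>f M L. Hk (Suc k) f M \<Longrightarrow> L2 f L \<Longrightarrow> Hk k f (\<eta>/2 * M + C * L)"
    using Suc.IH[of "\<eta>/2"] Suc.prems by auto
  \<comment> \<open>With this step the term C * 2 * h^2 * M coming from \<open>interp_step\<close>
    equals \<eta>/2 * M, the half that the induction hypothesis leaves free.\<close>
  define h where "h = sqrt (\<eta> / (4 * C))"
  have h: "h > 0" "h\<^sup>2 = \<eta> / (4 * C)" using C Suc.prems by (auto simp: h_def)
  define D where "D = max 1 (C * (8 / h\<^sup>2))"
  have "Hk (Suc k) f (\<eta> * M + D * L)" if H: "Hk (Suc (Suc k)) f M" and L: "L2 f L" for f M L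
  proof -
    have nn: "0 \<le> M" "0 \<le> L" using Hk_nonneg[OF H] L by (auto simp: L2_def)
    obtain f1 where f1: "prim f f1" "Hk (Suc k) f1 M" using H by auto
    have "Hk k f1 (\<eta>/2 * M + C * (8 / h\<^sup>2 * L + 2 * h\<^sup>2 * M))"
      by (rule C(2)[OF f1(2) interp_step[OF f1(1,2) L h(1)]])
    also have "\<eta>/2 * M + C * (8 / h\<^sup>2 * L + 2 * h\<^sup>2 * M) = \<eta> * M + C * (8 / h\<^sup>2) * L"
      using C by (simp add: h(2) algebra_simps)
    finally have "Hk k f1 (\<eta> * M + C * (8 / h\<^sup>2) * L)" .
    moreover have "C * (8 / h\<^sup>2) * L \<le> D * L"
      by (rule mult_right_mono) (use nn in \<open>simp_all only: D_def max.cobounded2\<close>)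
    ultimately have "Hk k f1 (\<eta> * M + D * L)" by (auto intro: Hk_mono)
    moreover have "L2 f (\<eta> * M + D * L)"
    proof (rule L2_mono[OF L])
      have "1 * L \<le> D * L" using nn by (intro mult_right_mono) (auto simp: D_def)
      then show "L \<le> \<eta> * M + D * L" using nn Suc.prems by (simp add: add_increasing)
    qed
    ultimately show ?thesis using f1 by auto
  qed
  then show ?case by (intro exI[of _ D]) (auto simp: D_def)
qed

section \<open>Limits of difference quotients\<close>

text \<open>Lebesgue's differentiation theorem along the steps 1/(n+1).\<close>

lemma prim_dq_AE:
  assumes p: "prim f g"
  shows "AE x in lborel. (\<lambda>n. dq (1 / Suc n) f x) \<longlonglongrightarrow> g x"
proof -
  have int: "\<And>a b. g integrable_on cbox a b"
  proof -
    fix a b show "g integrable_on cbox a b"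
      using prim_has_integral[OF p, of a b] by (cases "a \<le> b") auto
  qed
  have "\<exists>N. negligible N \<and> (\<forall>x e. x \<notin> N \<longrightarrow> 0 < e \<longrightarrow> (\<exists>d>0. \<forall>h. 0 < h \<and> h < d \<longrightarrow>
        norm (integral (cbox x (x + h *\<^sub>R One)) g /\<^sub>R h ^ DIM(real) - g x) < e))"
    by (rule integrable_ccontinuous_explicit[OF int]) blast
  then obtain N where N: "negligible N"
    "\<And>x e. x \<notin> N \<Longrightarrow> 0 < e \<Longrightarrow> \<exists>d>0. \<forall>h. 0 < h \<and> h < d \<longrightarrow>
        norm (integral (cbox x (x + h *\<^sub>R One)) g /\<^sub>R h ^ DIM(real) - g x) < e"
    by blast
  have lim: "(\<lambda>n. dq (1 / Suc n) f x) \<longlonglongrightarrow> g x" if x: "x \<notin> N" for x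
  proof (rule LIMSEQ_I)
    fix e :: real assume "0 < e"
    from N(2)[OF x this] obtain d where d: "d > 0" "\<And>h. 0 < h \<Longrightarrow> h < d \<Longrightarrow>
        norm (integral (cbox x (x + h *\<^sub>R One)) g /\<^sub>R h ^ DIM(real) - g x) < e"
      by blast
    obtain n0 where n0: "1 / real (Suc n0) < d"
      using reals_Archimedean[OF d(1)] by (metis inverse_eq_divide)
    have "norm (dq (1 / Suc n) f x - g x) < e" if "n \<ge> n0" for n
    proof -
      have "1 / real (Suc n) \<le> 1 / real (Suc n0)" using that by (simp add: frac_le)
      then have "norm (integral {x..x + 1 / Suc n} g /\<^sub>R (1 / Suc n) - g x) < e"
        using d(2)[of "1 / Suc n"] n0 by simp
      moreover have "integral {x..x + 1 / Suc n} g = f (x + 1 / Suc n) - f x"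
        using prim_has_integral[OF p, of x "x + 1 / Suc n"] by (auto dest: integral_unique)
      ultimately show ?thesis by (simp add: dq_def divide_inverse mult.commute)
    qed
    then show "\<exists>no. \<forall>n\<ge>no. norm (dq (1 / Suc n) f x - g x) < e" by blast
  qed
  have "AE x in lebesgue. (\<lambda>n. dq (1 / Suc n) f x) \<longlonglongrightarrow> g x"
    using N(1) lim by (intro AE_I'[of N]) (auto simp: negligible_iff_null_sets)
  then show ?thesis by (simp add: AE_completion_iff)
qed

lemma prim_unique_AE:
  assumes "prim f g1" "prim f g2" shows "AE x in lborel. g1 x = g2 x"
  using prim_dq_AE[OF assms(1)] prim_dq_AE[OF assms(2)]
  by eventually_elim (rule LIMSEQ_unique)

lemma L2_cong_AE:
  assumes "AE x in lborel. f x = g x" "L2 f A" "g \<in> borel_measurable borel" shows "L2 g A"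
proof -
  have "nsq f = nsq g"
    by (rule nn_integral_cong_AE) (use assms(1) in eventually_elim, simp)
  then show ?thesis using assms by (simp add: L2_def)
qed

lemma Hk_deriv:
  assumes H: "Hk (Suc k) f A" and d: "\<And>x. (f has_real_derivative f' x) (at x)"
    and c: "continuous_on UNIV f'"
  shows "Hk k f' A"
proof -
  obtain g where g: "prim f g" "Hk k g A" using H by auto
  have p: "prim f f'" using d c by (rule prim_deriv)
  show ?thesis
  proof (cases k)
    case 0
    then show ?thesis using L2_cong_AE[OF prim_unique_AE[OF g(1) p]] g(2) prim_borel[OF p] by simp
  next
    case (Suc k')
    then have "continuous_on UNIV g" using g(2) by (auto intro: prim_continuous_on)
    then have "(f has_real_derivative g x) (at x)" for x by (rule prim_DERIV[OF g(1)])
    then have "g = f'" using d DERIV_unique by blast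
    then show ?thesis using g by simp
  qed
qed

lemma L2_fatou:
  assumes F: "\<And>n. L2 (F n) (A n)" and lim: "AE x in lborel. (\<lambda>n. F n x) \<longlonglongrightarrow> f x"
    and A: "A \<longlonglongrightarrow> B" and f: "f \<in> borel_measurable borel"
  shows "L2 f B"
proof -
  have [measurable]: "F n \<in> borel_measurable borel" for n using F[of n] by (simp add: L2_def)
  have B: "0 \<le> B" using F by (intro LIMSEQ_le_const[OF A]) (auto simp: L2_def)
  have "nsq f = (\<integral>\<^sup>+x. liminf (\<lambda>n. ennreal ((F n x)\<^sup>2)) \<partial>lborel)"
  proof (rule nn_integral_cong_AE, use lim in eventually_elim)
    case (elim x)
    then have "(\<lambda>n. ennreal ((F n x)\<^sup>2)) \<longlonglongrightarrow> ennreal ((f x)\<^sup>2)" by (intro tendsto_intros)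
    from lim_imp_Liminf[OF _ this] show ?case by simp
  qed
  also have "\<dots> \<le> liminf (\<lambda>n. \<integral>\<^sup>+x. ennreal ((F n x)\<^sup>2) \<partial>lborel)"
    by (rule nn_integral_liminf) measurable
  also have "\<dots> \<le> liminf (\<lambda>n. ennreal (A n))"
    using F by (intro Liminf_mono) (auto simp: L2_def)
  also have "\<dots> = ennreal B" using A by (intro lim_imp_Liminf tendsto_intros) auto
  finally show ?thesis using B f by (simp add: L2_def)
qed

lemma AE_dqs_lim:
  assumes "AE x in lborel. (\<lambda>n. F n x) \<longlonglongrightarrow> f x"
  shows "AE x in lborel. (\<lambda>n. dqs hs (F n) x) \<longlonglongrightarrow> dqs hs f x"
proof (induction hs)
  case (Cons h hs)
  obtain N where N: "N \<in> null_sets lborel" "{x. \<not> ((\<lambda>n. dqs hs (F n) x) \<longlonglongrightarrow> dqs hs f x)} \<subseteq> N"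
    using Cons.IH by (auto simp: eventually_ae_filter)
  \<comment> \<open>The exceptional set for the argument x + h is a translate of that for x.\<close>
  have "{x. x - (- h) \<in> N} \<in> null_sets lborel" by (rule null_sets_translation[OF N(1)])
  then have "AE x in lborel. (\<lambda>n. dqs hs (F n) (x + h)) \<longlonglongrightarrow> dqs hs f (x + h)"
    by (rule AE_I') (use N(2) in auto)
  with Cons.IH show ?case
    by eventually_elim (cases "h = 0", auto simp: dq_def intro!: tendsto_intros)
qed (use assms in simp)

text \<open>These steps suffice for limits, and since there are countably many of them, suprema over
  lists of steps stay measurable in time.\<close>

definition unit_fractions :: "real set" where
  "unit_fractions = range (\<lambda>n. 1 / real (Suc n))"

lemma unit_fractions_bounds: "h \<in> unit_fractions \<Longrightarrow> 0 < h \<and> h \<le> 1"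
  by (auto simp: unit_fractions_def)

lemma unit_fractions_subset: "set hs \<subseteq> unit_fractions \<Longrightarrow> set hs \<subseteq> {0<..}"
  using unit_fractions_bounds by force

lemma dqs_borel: "f \<in> borel_measurable borel \<Longrightarrow> dqs hs f \<in> borel_measurable borel"
  by (induction hs) (auto simp: dq_def[abs_def])

text \<open>The last entry of a list is the innermost quotient. Its step is sent to 0 with all
  others fixed, and Fatou's lemma keeps the bound; repeating this turns every quotient into a
  derivative.\<close>

lemma L2_top_of_dqs:
  assumes "\<And>j. j < k \<Longrightarrow> prim (d j) (d (Suc j))" "d k \<in> borel_measurable borel"
    and "\<And>hs. length hs = k \<Longrightarrow> set hs \<subseteq> unit_fractions \<Longrightarrow> L2 (dqs hs (d 0)) A"
  shows "L2 (d k) A"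
  using assms
proof (induction k arbitrary: d)
  case 0
  then show ?case using 0(3)[of "[]"] by simp
next
  case (Suc k)
  show ?case
  proof (rule Suc.IH[of "\<lambda>j. d (Suc j)"])
    fix hs :: "real list" assume hs: "length hs = k" "set hs \<subseteq> unit_fractions"
    have p: "prim (d 0) (d (Suc 0))" using Suc.prems by auto
    show "L2 (dqs hs (d (Suc 0))) A"
    proof (rule L2_fatou)
      show "AE x in lborel. (\<lambda>n. dqs hs (dq (1 / Suc n) (d 0)) x) \<longlonglongrightarrow> dqs hs (d (Suc 0)) x"
        by (rule AE_dqs_lim[OF prim_dq_AE[OF p]])
      show "L2 (dqs hs (dq (1 / Suc n) (d 0))) A" for n
        using Suc.prems(3)[of "hs @ [1 / Suc n]"] hs by (auto simp: dqs_append unit_fractions_def)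
    qed (auto intro: dqs_borel prim_borel[OF p])
  qed (use Suc.prems in auto)
qed

lemma Hk_chain:
  "Hk k f A \<longleftrightarrow> (\<exists>d. d 0 = f \<and> (\<forall>j<k. prim (d j) (d (Suc j))) \<and> (\<forall>j\<le>k. L2 (d j) A))"
proof (induction k arbitrary: f)
  case 0 show ?case by (auto intro: exI[of _ "\<lambda>_. f"])
next
  case (Suc k)
  show ?case
  proof
    assume H: "Hk (Suc k) f A"
    then obtain g where g: "prim f g" "Hk k g A" "L2 f A" by auto
    then obtain d where d: "d 0 = g" "\<forall>j<k. prim (d j) (d (Suc j))" "\<forall>j\<le>k. L2 (d j) A"
      using Suc.IH by auto
    have "prim (case_nat f d j) (case_nat f d (Suc j))" if "j < Suc k" for j
    proof (cases j)
      case 0 then show ?thesis using g(1) d(1) by simp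
    next
      case (Suc j') then show ?thesis using that d(2) by simp
    qed
    moreover have "L2 (case_nat f d j) A" if "j \<le> Suc k" for j
    proof (cases j)
      case 0 then show ?thesis using g(3) by simp
    next
      case (Suc j') then show ?thesis using that d(3) by simp
    qed
    ultimately show "\<exists>d. d 0 = f \<and> (\<forall>j<Suc k. prim (d j) (d (Suc j))) \<and> (\<forall>j\<le>Suc k. L2 (d j) A)"
      by (intro exI[of _ "case_nat f d"]) simp
  next
    assume "\<exists>d. d 0 = f \<and> (\<forall>j<Suc k. prim (d j) (d (Suc j))) \<and> (\<forall>j\<le>Suc k. L2 (d j) A)"
    then obtain d where d: "d 0 = f" "\<forall>j<Suc k. prim (d j) (d (Suc j))" "\<forall>j\<le>Suc k. L2 (d j) A" by auto
    have "Hk k (d (Suc 0)) A"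
      unfolding Suc.IH[of "d (Suc 0)"] by (rule exI[of _ "\<lambda>j. d (Suc j)"]) (use d in simp)
    moreover have "prim f (d (Suc 0))" "L2 f A" using d by auto
    ultimately show "Hk (Suc k) f A" by (simp, blast)
  qed
qed

text \<open>\<open>A0\<close> provides the existence of the derivatives, the size comes from the
  quotients. This separates qualitative regularity from the quantitative bound that is to be
  proved.\<close>

lemma Hk_of_dqs:
  assumes H: "Hk k f A0"
    and D: "\<And>hs. length hs \<le> k \<Longrightarrow> set hs \<subseteq> unit_fractions \<Longrightarrow> L2 (dqs hs f) A"
  shows "Hk k f A"
proof -
  obtain d where d: "d 0 = f" "\<And>j. j < k \<Longrightarrow> prim (d j) (d (Suc j))" "\<And>j. j \<le> k \<Longrightarrow> L2 (d j) A0"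
    using H unfolding Hk_chain by blast
  have "L2 (d j) A" if "j \<le> k" for j
  proof (rule L2_top_of_dqs)
    show "prim (d i) (d (Suc i))" if "i < j" for i using d(2) that \<open>j \<le> k\<close> by simp
    show "d j \<in> borel_measurable borel" using d(3)[OF that] by (simp add: L2_def)
    show "L2 (dqs hs (d 0)) A" if "length hs = j" "set hs \<subseteq> unit_fractions" for hs
      unfolding d(1) using that \<open>j \<le> k\<close> by (intro D) simp_all
  qed
  then show ?thesis unfolding Hk_chain using d by auto
qed

text \<open>Peeling off the innermost quotient, dq h (g f) = g dq h f + (dq h g) f(. + h), and the
  second term leaves only the remaining quotients on f. Hence k + 1 quotients cost k derivatives of
  f, uniformly in the steps.\<close>

lemma comm_bound:
  "\<exists>C>0. \<forall>hs f g A B. length hs = Suc k \<longrightarrow> set hs \<subseteq> {0<..1} \<longrightarrow> Hk k f A \<longrightarrow> Gk (Suc (Suc k)) g B \<longrightarrow>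
     L2 (\<lambda>x. dqs hs (\<lambda>y. g y * f y) x - g x * dqs hs f x) (C * B * A)"
proof (induction k)
  case 0
  have *: "L2 (\<lambda>x. dqs hs (\<lambda>y. g y * f y) x - g x * dqs hs f x) (2 * B * A)"
    if H: "length hs = Suc 0" "set hs \<subseteq> {0<..1}" "Hk 0 f A" "Gk (Suc (Suc 0)) g B" for hs f g A B
  proof -
    obtain h where h: "hs = [h]" "0 < h" "h \<le> 1" using H(1,2) by (auto simp: length_Suc_conv)
    have g: "Gk (Suc 0) (dq h g) (2 * B)" by (rule Gk_dq[OF H(4) h(2,3)])
    have "L2 (\<lambda>x. dq h g x * f (x + h)) (2 * B * A)"
      using L2_bounded_mult[OF Gk_borel[OF g] _ L2_shift] g H(3) by simp
    then show ?thesis by (simp add: h dq_mult)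
  qed
  show ?case by (intro exI[of _ 2] conjI allI impI, simp) (rule *)
next
  case (Suc k)
  then obtain C where C: "C > 0" "\<And>hs f g A B. length hs = Suc k \<Longrightarrow> set hs \<subseteq> {0<..1} \<Longrightarrow> Hk k f A \<Longrightarrow>
     Gk (Suc (Suc k)) g B \<Longrightarrow> L2 (\<lambda>x. dqs hs (\<lambda>y. g y * f y) x - g x * dqs hs f x) (C * B * A)"
    by blast
  define D where "D = 2 * (C + 4 ^ Suc (Suc k) * 2)"
  have *: "L2 (\<lambda>x. dqs hs (\<lambda>y. g y * f y) x - g x * dqs hs f x) (D * B * A)"
    if H: "length hs = Suc (Suc k)" "set hs \<subseteq> {0<..1}" "Hk (Suc k) f A" "Gk (Suc (Suc (Suc k))) g B" for hs f g A B
  proof -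
    obtain gs h where hs: "hs = gs @ [h]" using H(1) by (cases hs rule: rev_cases) auto
    have h: "0 < h" "h \<le> 1" "length gs = Suc k" "set gs \<subseteq> {0<..1}" using H hs by auto
    have 1: "L2 (\<lambda>x. dqs gs (\<lambda>y. g y * dq h f y) x - g x * dqs gs (dq h f) x) (C * B * A)"
      using C(2)[OF h(3,4) Hk_dq[OF H(3) h(1)] Gk_Suc_lower[OF H(4)]] .
    have "Hk (Suc k) (\<lambda>x. dq h g x * f (x + h)) (4 ^ Suc (Suc k) * (2 * B) * A)"
      by (rule Hk_mult[OF Gk_dq[OF H(4) h(1,2)] Hk_shift[OF H(3)]]) auto
    then have 2: "L2 (dqs gs (\<lambda>x. dq h g x * f (x + h))) (4 ^ Suc (Suc k) * (2 * B) * A)"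
      using h by (intro L2_dqs) auto
    have "(\<lambda>x. dqs hs (\<lambda>y. g y * f y) x - g x * dqs hs f x) = (\<lambda>x. (dqs gs (\<lambda>y. g y * dq h f y) x - g x * dqs gs (dq h f) x)
        + dqs gs (\<lambda>x. dq h g x * f (x + h)) x)"
      by (simp only: hs dqs_append dqs.simps dq_mult dqs_add) (rule ext, simp)
    moreover have "2 * (C * B * A + 4 ^ Suc (Suc k) * (2 * B) * A) = D * B * A" by (simp add: D_def algebra_simps)
    ultimately show ?thesis using L2_add[OF 1 2] by simp
  qed
  have "D > 0" using C(1) by (simp add: D_def add_pos_pos)
  then show ?case by (intro exI[of _ D] conjI allI impI) (assumption, rule *)
qed

section \<open>Families of functions\<close>

text \<open>Bounds that are uniform over a family, with the constants hidden.\<close>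

definition OH :: "nat \<Rightarrow> 'i set \<Rightarrow> ('i \<Rightarrow> real \<Rightarrow> real) \<Rightarrow> ('i \<Rightarrow> real) \<Rightarrow> bool" where
  "OH k I f A \<longleftrightarrow> (\<exists>C>0. \<forall>i\<in>I. Hk k (f i) (C * A i))"

definition OG :: "nat \<Rightarrow> 'i set \<Rightarrow> ('i \<Rightarrow> real \<Rightarrow> real) \<Rightarrow> bool" where
  "OG k I f \<longleftrightarrow> (\<exists>B>0. \<forall>i\<in>I. Gk k (f i) B)"

lemma OH_I: "C > 0 \<Longrightarrow> (\<And>i. i \<in> I \<Longrightarrow> Hk k (f i) (C * A i)) \<Longrightarrow> OH k I f A" by (auto simp: OH_def)

lemma OH_1: "(\<And>i. i \<in> I \<Longrightarrow> Hk k (f i) (A i)) \<Longrightarrow> OH k I f A" by (rule OH_I[of 1]) auto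

lemma OG_I: "(\<And>i. i \<in> I \<Longrightarrow> Gk k (f i) B) \<Longrightarrow> OG k I f"
  unfolding OG_def by (intro exI[of _ "max B 1"] conjI ballI, simp) (rule Gk_mono, auto)

lemma OH_add:
  assumes "OH k I f A" "OH k I g A" shows "OH k I (\<lambda>i x. f i x + g i x) A"
proof -
  obtain C D where "C > 0" "D > 0" "\<And>i. i \<in> I \<Longrightarrow> Hk k (f i) (C * A i)" "\<And>i. i \<in> I \<Longrightarrow> Hk k (g i) (D * A i)"
    using assms by (auto simp: OH_def)
  then show ?thesis using Hk_add[of k "f _" "C * A _" "g _" "D * A _"]
    by (intro OH_I[of "2 * (C + D)"]) (auto simp: algebra_simps)
qed

lemma OH_cmul:
  assumes "OH k I f A" shows "OH k I (\<lambda>i x. c * f i x) A"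
proof -
  obtain C where C: "C > 0" "\<And>i. i \<in> I \<Longrightarrow> Hk k (f i) (C * A i)"
    using assms by (auto simp: OH_def)
  have "Hk k (\<lambda>x. c * f i x) ((c\<^sup>2 + 1) * C * A i)" if "i \<in> I" for i
  proof (rule Hk_mono[OF Hk_cmul[OF C(2)[OF that]]])
    show "c\<^sup>2 * (C * A i) \<le> (c\<^sup>2 + 1) * C * A i"
      using Hk_nonneg[OF C(2)[OF that]] by (simp add: algebra_simps)
  qed
  moreover have "(c\<^sup>2 + 1) * C > 0" using C(1) by (simp add: add_nonneg_pos)
  ultimately show ?thesis by (intro OH_I)
qed

lemma OH_minus: "OH k I f A \<Longrightarrow> OH k I (\<lambda>i x. - f i x) A"
  using OH_cmul[of k I f A "-1"] by simp

lemma OH_diff: "OH k I f A \<Longrightarrow> OH k I g A \<Longrightarrow> OH k I (\<lambda>i x. f i x - g i x) A"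
  using OH_add[OF _ OH_minus, of k I f A g] by simp

lemma OH_mult:
  assumes "OG j I f" "OH k I g A" "m \<le> j" "m \<le> k" "0 < j + k"
  shows "OH m I (\<lambda>i x. f i x * g i x) A"
proof -
  obtain B C where "B > 0" "C > 0" "\<And>i. i \<in> I \<Longrightarrow> Gk j (f i) B" "\<And>i. i \<in> I \<Longrightarrow> Hk k (g i) (C * A i)"
    using assms by (auto simp: OH_def OG_def)
  then show ?thesis using Hk_mult[OF _ _ assms(3-5), of "f _" B "g _" "C * A _"]
    by (intro OH_I[of "4 ^ Suc m * B * C"]) (auto simp: mult.assoc)
qed

lemma OH_mult': "OH k I g A \<Longrightarrow> OG j I f \<Longrightarrow> m \<le> j \<Longrightarrow> m \<le> k \<Longrightarrow> 0 < j + k \<Longrightarrow>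
    OH m I (\<lambda>i x. g i x * f i x) A"
  using OH_mult[of j I f k g A m] by (simp add: mult.commute)

lemma OG_mult:
  assumes "OG j I f" "OG k I g" "m \<le> j" "m \<le> k" "0 < j + k"
  shows "OG m I (\<lambda>i x. f i x * g i x)"
proof -
  obtain B C where "\<And>i. i \<in> I \<Longrightarrow> Gk j (f i) B" "\<And>i. i \<in> I \<Longrightarrow> Gk k (g i) C"
    using assms by (auto simp: OG_def)
  then show ?thesis using Gk_mult[OF _ _ assms(3-5), of "f _" B "g _" C]
    by (intro OG_I[of _ _ _ "4 ^ Suc m * B * C"]) auto
qed

lemma OG_add:
  assumes "OG k I f" "OG k I g" shows "OG k I (\<lambda>i x. f i x + g i x)"
proof -
  obtain C D where "\<And>i. i \<in> I \<Longrightarrow> Gk k (f i) C" "\<And>i. i \<in> I \<Longrightarrow> Gk k (g i) D"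
    using assms by (auto simp: OG_def)
  then show ?thesis using Gk_add[of k "f _" "C" "g _" "D"]
    by (intro OG_I[of _ _ _ "2 * (C + D)"]) auto
qed

lemma OG_const: "OG k I (\<lambda>i x. c)"
  by (intro OG_I[of _ _ _ "c\<^sup>2"] Gk_const)

lemma OG_cmul: assumes "OG k I f" shows "OG k I (\<lambda>i x. c * f i x)"
proof -
  obtain C where "\<And>i. i \<in> I \<Longrightarrow> Gk k (f i) C" using assms by (auto simp: OG_def)
  then show ?thesis using Gk_cmul[of k "f _" C c] by (intro OG_I[of _ _ _ "c\<^sup>2 * C"]) auto
qed

lemma OG_minus: "OG k I f \<Longrightarrow> OG k I (\<lambda>i x. - f i x)"
  using OG_cmul[of k I f "-1"] by simp

lemma OG_diff: "OG k I f \<Longrightarrow> OG k I g \<Longrightarrow> OG k I (\<lambda>i x. f i x - g i x)"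
  using OG_add[OF _ OG_minus, of k I f g] by simp

lemma OH_lower: "OH k I f A \<Longrightarrow> j \<le> k \<Longrightarrow> OH j I f A"
  unfolding OH_def by (blast intro: Hk_lower)

lemma OG_lower: "OG k I f \<Longrightarrow> j \<le> k \<Longrightarrow> OG j I f"
  unfolding OG_def by (blast intro: Gk_lower)

lemma OH_weight:
  assumes "OH k I f A" "c > 0" "\<And>i. i \<in> I \<Longrightarrow> A i \<le> c * B i"
  shows "OH k I f B"
proof -
  obtain C where C: "C > 0" "\<And>i. i \<in> I \<Longrightarrow> Hk k (f i) (C * A i)"
    using assms by (auto simp: OH_def)
  have "Hk k (f i) (C * c * B i)" if "i \<in> I" for i
    using C assms(3)[OF that] that by (intro Hk_mono[OF C(2)]) (auto simp: mult.assoc)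
  then show ?thesis using C assms(2) by (intro OH_I[of "C * c"]) auto
qed

lemma OH_imp_OG:
  assumes "OH k I f A" "\<And>i. i \<in> I \<Longrightarrow> A i \<le> b" shows "OG k I f"
proof -
  obtain C where C: "C > 0" "\<And>i. i \<in> I \<Longrightarrow> Hk k (f i) (C * A i)"
    using assms by (auto simp: OH_def)
  have "Gk k (f i) (4 * (C * b))" if "i \<in> I" for i
    using C assms(2)[OF that] that by (intro Gk_mono[OF Hk_imp_Gk[OF C(2)]]) auto
  then show ?thesis by (rule OG_I)
qed

lemma OH_dq:
  assumes "OH (Suc k) I f A" "\<And>i. i \<in> I \<Longrightarrow> 0 < h i" shows "OH k I (\<lambda>i. dq (h i) (f i)) A"
proof -
  obtain C where "C > 0" "\<And>i. i \<in> I \<Longrightarrow> Hk (Suc k) (f i) (C * A i)"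
    using assms by (auto simp: OH_def)
  then show ?thesis using assms(2) by (intro OH_I[of C]) (auto intro!: Hk_dq simp del: Hk.simps)
qed

lemma OH_cong: "(\<And>i x. i \<in> I \<Longrightarrow> f i x = g i x) \<Longrightarrow> OH k I f A \<Longrightarrow> OH k I g A"
  unfolding OH_def by (metis ext)

lemma OG_cong: "(\<And>i x. i \<in> I \<Longrightarrow> f i x = g i x) \<Longrightarrow> OG k I f \<Longrightarrow> OG k I g"
  unfolding OG_def by (metis ext)

lemma OH_deriv:
  assumes "OH (Suc k) I f A" "\<And>i x. i \<in> I \<Longrightarrow> (f i has_real_derivative f' i x) (at x)"
    "\<And>i. i \<in> I \<Longrightarrow> continuous_on UNIV (f' i)"
  shows "OH k I f' A"
  using assms(1) Hk_deriv[OF _ assms(2,3)] unfolding OH_def by blast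

lemma OH_prim:
  assumes "OH 0 I f A" "OH k I f' A" "\<And>i. i \<in> I \<Longrightarrow> prim (f i) (f' i)"
  shows "OH (Suc k) I f A"
proof -
  obtain C D where CD: "C > 0" "D > 0" "\<And>i. i \<in> I \<Longrightarrow> Hk 0 (f i) (C * A i)" "\<And>i. i \<in> I \<Longrightarrow> Hk k (f' i) (D * A i)"
    using assms by (auto simp: OH_def)
  have "Hk (Suc k) (f i) ((C + D) * A i)" if i: "i \<in> I" for i
  proof -
    have nn: "0 \<le> C * A i" "0 \<le> D * A i"
      using Hk_nonneg[OF CD(3)[OF i]] Hk_nonneg[OF CD(4)[OF i]] by auto
    have "L2 (f i) ((C + D) * A i)"
      by (rule L2_mono[OF CD(3)[OF i, simplified]]) (use nn in \<open>simp add: algebra_simps\<close>)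
    moreover have "Hk k (f' i) ((C + D) * A i)"
      by (rule Hk_mono[OF CD(4)[OF i]]) (use nn in \<open>simp add: algebra_simps\<close>)
    ultimately show ?thesis using assms(3)[OF i] by (simp, blast)
  qed
  then show ?thesis using CD by (intro OH_I[of "C + D"]) auto
qed

lemma OG_prim:
  assumes "\<And>i x. i \<in> I \<Longrightarrow> (f i x)\<^sup>2 \<le> B" "OG k I f'" "\<And>i. i \<in> I \<Longrightarrow> prim (f i) (f' i)"
  shows "OG (Suc k) I f"
proof -
  obtain D where D: "D > 0" "\<And>i. i \<in> I \<Longrightarrow> Gk k (f' i) D" using assms by (auto simp: OG_def)
  have "Gk (Suc k) (f i) (max B D)" if i: "i \<in> I" for i
    using assms(1)[OF i] assms(3)[OF i] Gk_mono[OF D(2)[OF i], of "max B D"] D(1)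
    by (auto simp: le_max_iff_disj)
  then show ?thesis by (rule OG_I)
qed

section \<open>Weak derivatives\<close>

primrec diff_n :: "nat \<Rightarrow> (real \<Rightarrow> real) \<Rightarrow> bool" where
  "diff_n 0 f = (f differentiable_on UNIV)"
| "diff_n (Suc k) f = (f differentiable_on UNIV \<and> diff_n k (deriv f))"

lemma diff_n_iff: "diff_n k f \<longleftrightarrow> (\<forall>j\<le>k. (deriv ^^ j) f differentiable_on UNIV)"
proof (induction k arbitrary: f)
  case (Suc k)
  show ?case
  proof
    assume a: "diff_n (Suc k) f"
    then have b: "\<forall>j\<le>k. (deriv ^^ j) (deriv f) differentiable_on UNIV" using Suc by simp
    show "\<forall>j\<le>Suc k. (deriv ^^ j) f differentiable_on UNIV"
    proof (intro allI impI)
      fix j assume "j \<le> Suc k"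
      then show "(deriv ^^ j) f differentiable_on UNIV"
        using a b by (cases j) (auto simp: funpow_swap1)
    qed
  next
    assume a: "\<forall>j\<le>Suc k. (deriv ^^ j) f differentiable_on UNIV"
    have "(deriv ^^ j) (deriv f) differentiable_on UNIV" if "j \<le> k" for j
      using a[rule_format, of "Suc j"] that by (simp add: funpow_swap1)
    then show "diff_n (Suc k) f" using Suc a[rule_format, of 0] by simp
  qed
qed simp

lemma smooth_diff_n: "smooth f \<longleftrightarrow> (\<forall>k. diff_n k f)"
  unfolding smooth_def diff_n_iff by blast

lemma diff_n_diff: "diff_n k f \<Longrightarrow> f differentiable_on UNIV" by (cases k) auto

lemma diff_n_lower: "diff_n (Suc k) f \<Longrightarrow> diff_n k f"
  unfolding diff_n_iff by auto

lemma differentiable_on_DERIV: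
  "f differentiable_on UNIV \<Longrightarrow> (f has_real_derivative deriv f x) (at x)"
  by (simp add: differentiable_on_def DERIV_deriv_iff_real_differentiable)

lemma diff_n_DERIV: "diff_n k f \<Longrightarrow> (f has_real_derivative deriv f x) (at x)"
  by (rule differentiable_on_DERIV[OF diff_n_diff])

lemma smooth_DERIV: "smooth f \<Longrightarrow> (f has_real_derivative deriv f x) (at x)"
  using diff_n_DERIV smooth_diff_n by blast

lemma smooth_deriv: "smooth f \<Longrightarrow> smooth (deriv f)"
  unfolding smooth_diff_n by (metis diff_n.simps(2))

lemma smoothI:
  assumes "\<And>x. (f has_real_derivative f' x) (at x)" "smooth f'" shows "smooth f"
proof -
  have "deriv f = f'" using assms(1) by (auto intro!: DERIV_imp_deriv)
  moreover have "f differentiable_on UNIV"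
    using assms(1) by (auto simp: differentiable_on_def real_differentiable_def)
  ultimately have "diff_n (Suc k) f" for k using assms(2) by (simp add: smooth_diff_n)
  then show ?thesis unfolding smooth_diff_n using diff_n_lower by blast
qed

lemma smooth_continuous_on: "smooth f \<Longrightarrow> continuous_on S f"
  by (meson smooth_DERIV DERIV_isCont continuous_at_imp_continuous_on)

lemma smooth_borel: "smooth f \<Longrightarrow> f \<in> borel_measurable borel"
  by (intro borel_measurable_continuous_onI smooth_continuous_on)

lemma differentiable_onI_DERIV:
  "(\<And>x. (f has_real_derivative f' x) (at x)) \<Longrightarrow> f differentiable_on UNIV"
  by (auto simp: differentiable_on_def real_differentiable_def)

lemma deriv_eqI: "(\<And>x. (f has_real_derivative f' x) (at x)) \<Longrightarrow> deriv f = f'"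
  by (auto intro!: DERIV_imp_deriv)

lemma diff_n_add: "diff_n k f \<Longrightarrow> diff_n k g \<Longrightarrow> diff_n k (\<lambda>x. f x + g x)"
proof (induction k arbitrary: f g)
  case (Suc k)
  have d: "((\<lambda>x. f x + g x) has_real_derivative deriv f x + deriv g x) (at x)" for x
    using Suc.prems by (intro derivative_intros) (auto intro!: differentiable_on_DERIV)
  show ?case using Suc by (simp add: deriv_eqI[OF d] differentiable_onI_DERIV[OF d])
qed (simp add: differentiable_on_add)

lemma diff_n_mult: "diff_n k f \<Longrightarrow> diff_n k g \<Longrightarrow> diff_n k (\<lambda>x. f x * g x)"
proof (induction k arbitrary: f g)
  case (Suc k)
  have d: "((\<lambda>x. f x * g x) has_real_derivative deriv f x * g x + f x * deriv g x) (at x)" for x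
    using Suc.prems
    by (auto intro!: derivative_eq_intros differentiable_on_DERIV)
  have "diff_n k (\<lambda>x. deriv f x * g x + f x * deriv g x)"
    using Suc.prems diff_n_lower[OF Suc.prems(1)] diff_n_lower[OF Suc.prems(2)]
    by (intro diff_n_add Suc.IH) simp_all
  then show ?case by (simp add: deriv_eqI[OF d] differentiable_onI_DERIV[OF d])
next
  case 0
  then show ?case by (simp add: differentiable_on_mult)
qed

lemma diff_n_affine: "diff_n k f \<Longrightarrow> diff_n k (\<lambda>x. c * f (a * x + b))"
proof (induction k arbitrary: f c)
  case (Suc k)
  have d: "((\<lambda>x. c * f (a * x + b)) has_real_derivative (c * a) * deriv f (a * x + b)) (at x)" for x
    using Suc.prems
    by (auto intro!: derivative_eq_intros DERIV_chain2[of f] differentiable_on_DERIV)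
  show ?case using Suc by (simp add: deriv_eqI[OF d] differentiable_onI_DERIV[OF d])
next
  case 0
  have d: "((\<lambda>x. c * f (a * x + b)) has_real_derivative (c * a) * deriv f (a * x + b)) (at x)" for x
    using 0 by (auto intro!: derivative_eq_intros DERIV_chain2[of f] differentiable_on_DERIV)
  show ?case using differentiable_onI_DERIV[OF d] by simp
qed

lemma smooth_add: "smooth f \<Longrightarrow> smooth g \<Longrightarrow> smooth (\<lambda>x. f x + g x)"
  by (simp add: smooth_diff_n diff_n_add)

lemma smooth_mult: "smooth f \<Longrightarrow> smooth g \<Longrightarrow> smooth (\<lambda>x. f x * g x)"
  by (simp add: smooth_diff_n diff_n_mult)

lemma smooth_affine: "smooth f \<Longrightarrow> smooth (\<lambda>x. c * f (a * x + b))"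
  by (simp add: smooth_diff_n diff_n_affine)

text \<open>The functions \<open>p (1/x) exp (-1/x)\<close> for \<open>x > 0\<close>, extended by zero, are closed under differentiation.\<close>

definition flat :: "real poly \<Rightarrow> real \<Rightarrow> real" where
  "flat p x = (if x > 0 then poly p (1 / x) * exp (- (1 / x)) else 0)"

lemma poly_exp_tendsto_0: "((\<lambda>y. poly q y * exp (- y)) \<longlongrightarrow> 0) (at_top :: real filter)"
proof -
  have "((\<lambda>y. \<Sum>i\<le>degree q. coeff q i * (y ^ i / exp y)) \<longlongrightarrow> (\<Sum>i\<le>degree q. coeff q i * 0)) at_top"
    by (intro tendsto_sum tendsto_mult tendsto_const tendsto_power_div_exp_0)
  then show ?thesis
    by (simp add: poly_altdef exp_minus divide_inverse sum_distrib_right mult.assoc)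
qed

text \<open>With y = 1/x the derivative of p(y) exp(-y) is y^2 (p - p')(y) exp(-y), whence the
  factor \<open>[:0, 0, 1:]\<close>. At 0 the difference quotients vanish in the limit because the
  exponential beats every polynomial.\<close>

lemma flat_deriv: "(flat p has_real_derivative flat ([:0, 0, 1:] * (p - pderiv p)) x) (at x)"
proof -
  consider "x > 0" | "x < 0" | "x = 0" by linarith
  then show ?thesis
  proof cases
    case 1
    have "((\<lambda>x. poly p (1 / x) * exp (- (1 / x))) has_real_derivative
        flat ([:0, 0, 1:] * (p - pderiv p)) x) (at x)"
      using 1 by (auto intro!: derivative_eq_intros DERIV_chain2[OF poly_DERIV]
          simp: flat_def power2_eq_square field_simps)
    moreover have "\<forall>\<^sub>F y in nhds x. (poly p (1 / y) * exp (- (1 / y))) = flat p y"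
      using eventually_nhds_in_open[of "{0<..}" x] 1 by (auto elim!: eventually_mono simp: flat_def)
    ultimately show ?thesis using DERIV_cong_ev[OF refl _ refl] by metis
  next
    case 2
    have "((\<lambda>x. 0) has_real_derivative flat ([:0, 0, 1:] * (p - pderiv p)) x) (at x)"
      using 2 by (auto simp: flat_def)
    moreover have ev: "\<forall>\<^sub>F y in nhds x. 0 = flat p y"
      using eventually_nhds_in_open[of "{..<0}" x] 2 by (auto elim!: eventually_mono simp: flat_def)
    ultimately show ?thesis using iffD1[OF DERIV_cong_ev[OF refl ev refl]] by blast
  next
    case 3
    have "((\<lambda>y. poly ([:0, 1:] * p) y * exp (- y)) \<longlongrightarrow> 0) at_top" by (rule poly_exp_tendsto_0)
    then have "((\<lambda>h. poly ([:0, 1:] * p) (inverse h) * exp (- inverse h)) \<longlongrightarrow> 0) (at_right 0)"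
      by (rule filterlim_compose) (rule filterlim_inverse_at_top_right)
    then have "((\<lambda>h. (flat p (0 + h) - flat p 0) / h) \<longlongrightarrow> 0) (at_right 0)"
      by (rule Lim_transform_eventually)
        (auto simp: eventually_at_filter flat_def field_simps intro!: always_eventually)
    moreover have "((\<lambda>h. (flat p (0 + h) - flat p 0) / h) \<longlongrightarrow> 0) (at_left 0)"
      by (rule Lim_transform_eventually[OF tendsto_const])
        (auto simp: eventually_at_filter flat_def intro!: always_eventually)
    ultimately have "((\<lambda>h. (flat p (0 + h) - flat p 0) / h) \<longlongrightarrow> 0) (at 0)"
      by (simp add: filterlim_at_split)
    then show ?thesis using 3 by (simp add: DERIV_def flat_def)
  qed
qed

lemma smooth_flat: "smooth (flat p)"
proof -
  have "diff_n k (flat p)" for k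
    by (induction k arbitrary: p)
      (auto simp: deriv_eqI[OF flat_deriv] intro: differentiable_onI_DERIV[OF flat_deriv])
  then show ?thesis by (simp add: smooth_diff_n)
qed

text \<open>Test functions with values in [0,1] that tend pointwise to the indicator function of the
  open interval from a to b as n grows.\<close>

definition bump :: "nat \<Rightarrow> real \<Rightarrow> real \<Rightarrow> real \<Rightarrow> real" where
  "bump n a b x = flat 1 (real (Suc n) * (x - a)) * flat 1 (real (Suc n) * (b - x))"

lemma bump_smooth: "smooth (bump n a b)"
proof -
  have "smooth (\<lambda>x. (1 * flat 1 (real (Suc n) * x + (- (real (Suc n) * a)))) * (1 * flat 1 ((- real (Suc n)) * x + real (Suc n) * b)))"
    by (intro smooth_mult smooth_affine smooth_flat)
  moreover have "(\<lambda>x. (1 * flat 1 (real (Suc n) * x + (- (real (Suc n) * a)))) * (1 * flat 1 ((- real (Suc n)) * x + real (Suc n) * b)))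
      = bump n a b"
    unfolding bump_def by (intro ext) (simp add: algebra_simps)
  ultimately show ?thesis by simp
qed

lemma bump_outside: "x \<notin> {a<..<b} \<Longrightarrow> bump n a b x = 0"
  by (auto simp: bump_def flat_def zero_less_mult_iff)

lemma bump_test: "test_function (bump n a b)"
  unfolding test_function_def
  by (intro conjI bump_smooth exI[of _ "\<bar>a\<bar> + \<bar>b\<bar>"]) (auto intro!: bump_outside)

lemma bump_bounds: "0 \<le> bump n a b x" "bump n a b x \<le> 1"
  by (auto simp: bump_def flat_def intro!: mult_le_one)

lemma bump_pos: "x \<in> {a<..<b} \<Longrightarrow> 0 < bump n a b x"
  by (auto simp: bump_def flat_def)

lemma bump_lim: "x \<in> {a<..<b} \<Longrightarrow> (\<lambda>n. bump n a b x) \<longlonglongrightarrow> 1"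
proof -
  assume x: "x \<in> {a<..<b}"
  have l: "(\<lambda>n. exp (- (1 / (real (Suc n) * d)))) \<longlonglongrightarrow> 1" if "d > 0" for d :: real
  proof -
    have "(\<lambda>n. (1 / d) * (1 / real (Suc n))) \<longlonglongrightarrow> (1 / d) * 0"
      using LIMSEQ_inverse_real_of_nat by (intro tendsto_mult tendsto_const) (simp add: inverse_eq_divide)
    then have "(\<lambda>n. exp (- ((1 / d) * (1 / real (Suc n))))) \<longlonglongrightarrow> exp (- ((1 / d) * 0))"
      by (intro tendsto_exp tendsto_minus)
    then show ?thesis by (simp add: mult.commute)
  qed
  have "(\<lambda>n. exp (- (1 / (real (Suc n) * (x - a)))) * exp (- (1 / (real (Suc n) * (b - x))))) \<longlonglongrightarrow> 1 * 1"
    using x by (intro tendsto_mult l) auto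
  then show ?thesis using x by (simp add: bump_def flat_def del: of_nat_Suc)
qed

section \<open>The fundamental lemma and primitives of locally integrable functions\<close>

definition loc_int :: "(real \<Rightarrow> real) \<Rightarrow> bool" where
  "loc_int f \<longleftrightarrow> f \<in> borel_measurable borel \<and> (\<forall>a b. set_integrable lborel {a..b} f)"

lemma loc_int_prim: "prim f g \<Longrightarrow> loc_int g"
  by (simp add: loc_int_def prim_borel prim_integrable)

lemma loc_int_continuous: "continuous_on UNIV f \<Longrightarrow> loc_int f"
  by (auto simp: loc_int_def borel_measurable_continuous_onI intro!: borel_integrable_atLeastAtMost'
      continuous_on_subset[of UNIV f])

lemma loc_int_diff: "loc_int f \<Longrightarrow> loc_int g \<Longrightarrow> loc_int (\<lambda>x. f x - g x)"
  by (auto simp: loc_int_def)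

lemma test_borel: "test_function \<phi> \<Longrightarrow> \<phi> \<in> borel_measurable borel"
  by (simp add: test_function_def smooth_borel)

lemma test_supportE:
  assumes "test_function \<phi>"
  obtains R where "R > 0" "\<And>x. x \<notin> {-R..R} \<Longrightarrow> \<phi> x = 0"
proof -
  obtain R where "\<And>x. R < \<bar>x\<bar> \<Longrightarrow> \<phi> x = 0" using assms by (auto simp: test_function_def)
  then have "\<And>x. x \<notin> {-(\<bar>R\<bar> + 1)..\<bar>R\<bar> + 1} \<Longrightarrow> \<phi> x = 0" by (auto simp: abs_real_def split: if_splits)
  then show ?thesis using that[of "\<bar>R\<bar> + 1"] by simp
qed

lemma test_mult_set:
  fixes f :: "real \<Rightarrow> real"
  assumes "\<And>x. x \<notin> {-R..R} \<Longrightarrow> \<phi> x = 0"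
  shows "(\<lambda>x. \<phi> x * f x) = (\<lambda>x. indicator {-R..R} x *\<^sub>R (f x * \<phi> x))"
  using assms by (auto simp: indicator_def fun_eq_iff)

lemma test_mult_integrable:
  assumes "test_function \<phi>" "loc_int f" shows "integrable lborel (\<lambda>x. \<phi> x * f x)"
proof -
  obtain R where R: "\<And>x. x \<notin> {-R..R} \<Longrightarrow> \<phi> x = 0" using assms(1) by (rule test_supportE) blast
  have "set_integrable lborel {-R..R} (\<lambda>x. f x * \<phi> x)"
    using assms by (intro set_integrable_mult_continuous) (auto simp: loc_int_def test_function_def smooth_continuous_on)
  then show ?thesis unfolding set_integrable_def by (subst test_mult_set[OF R])
qed

lemma test_deriv: assumes "test_function \<phi>" shows "test_function (deriv \<phi>)"
proof -
  obtain R where R: "\<And>x. R < \<bar>x\<bar> \<Longrightarrow> \<phi> x = 0" and s: "smooth \<phi>" using assms by (auto simp: test_function_def)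
  have "deriv \<phi> x = 0" if "R < \<bar>x\<bar>" for x
  proof -
    have "open {x::real. R < \<bar>x\<bar>}" by (intro open_Collect_less continuous_intros)
    then have "\<forall>\<^sub>F y in nhds x. \<phi> y = 0"
      using eventually_nhds_in_open[of "{x. R < \<bar>x\<bar>}" x] that R by (auto elim!: eventually_mono)
    then have "(\<phi> has_real_derivative 0) (at x)"
      using DERIV_cong_ev[of x x \<phi> "\<lambda>_. 0" 0 0] by simp
    then show ?thesis by (rule DERIV_imp_deriv)
  qed
  then show ?thesis using s by (auto simp: test_function_def smooth_deriv)
qed

lemma test_funpow: "test_function \<phi> \<Longrightarrow> test_function ((deriv ^^ k) \<phi>)"
  by (induction k) (auto intro: test_deriv)

text \<open>Testing with \<open>bump n a b\<close> and dominated convergence show that f has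
  integral 0 over every interval. Hence f is an almost-everywhere derivative of the zero
  function.\<close>

lemma fundamental_lemma:
  assumes f: "loc_int f" and z: "\<And>\<phi>. test_function \<phi> \<Longrightarrow> (LINT x|lborel. \<phi> x * f x) = 0"
  shows "AE x in lborel. f x = 0"
proof -
  have [measurable]: "f \<in> borel_measurable borel" using f by (simp add: loc_int_def)
  have "(LINT x:{a..b}|lborel. f x) = 0" if "a \<le> b" for a b
  proof -
    have i: "integrable lborel (\<lambda>x. indicator {a..b} x * f x)"
      using f by (auto simp: loc_int_def set_integrable_def)
    have [measurable]: "bump n a b \<in> borel_measurable borel" for n by (intro smooth_borel bump_smooth)
    have "(\<lambda>n. LINT x|lborel. bump n a b x * f x) \<longlonglongrightarrow> (LINT x|lborel. indicator {a<..<b} x * f x)"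
    proof (rule integral_dominated_convergence[where w="\<lambda>x. norm (indicator {a..b} x * f x)"])
      show "AE x in lborel. (\<lambda>n. bump n a b x * f x) \<longlonglongrightarrow> indicator {a<..<b} x * f x"
      proof (intro AE_I2)
        fix x show "(\<lambda>n. bump n a b x * f x) \<longlonglongrightarrow> indicator {a<..<b} x * f x"
          using tendsto_mult[OF bump_lim tendsto_const, of x a b "f x"]
          by (cases "x \<in> {a<..<b}") (simp_all add: bump_outside)
      qed
      show "AE x in lborel. norm (bump n a b x * f x) \<le> norm (indicator {a..b} x * f x)" for n
      proof (intro AE_I2)
        fix x show "norm (bump n a b x * f x) \<le> norm (indicator {a..b} x * f x)"
          using bump_bounds[of n a b x] mult_right_mono[OF bump_bounds(2)[of n a b x], of "\<bar>f x\<bar>"]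
          by (cases "x \<in> {a..b}") (auto simp: abs_mult bump_outside)
      qed
      show "integrable lborel (\<lambda>x. norm (indicator {a..b} x * f x))" using i by (rule integrable_norm)
    qed measurable
    then have "(LINT x|lborel. indicator {a<..<b} x * f x) = 0"
      by (simp add: z[OF bump_test] LIMSEQ_const_iff)
    moreover have "(LINT x|lborel. indicator {a<..<b} x * f x) = (LINT x|lborel. indicator {a..b} x * f x)"
      by (rule integral_discrete_difference[where X="{a, b}"]) (auto simp: indicator_def)
    ultimately show ?thesis by (simp add: set_lebesgue_integral_def)
  qed
  then have "prim (\<lambda>_. 0) f" using f by (auto simp: prim_def loc_int_def)
  then show ?thesis by (rule prim_unique_AE) (rule prim_const)
qed

lemma prim_exists:
  assumes g: "loc_int g" obtains f where "prim f g" "f a = 0"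
proof -
  \<comment> \<open>The signed integral from a to x: one of the two intervals is empty or a single
    point.\<close>
  define f where "f x = integral {a..x} g - integral {x..a} g" for x
  have i: "g integrable_on {c..d}" for c d
    using g set_borel_integral_eq_integral(1)[of "{c..d}" g] by (auto simp: loc_int_def)
  have n: "integral {d..c} g = 0" if "c \<le> d" for c d
    using that by (cases "c = d") auto
  have "(g has_integral (f d - f c)) {c..d}" if cd: "c \<le> d" for c d
  proof -
    consider "a \<le> c" | "d \<le> a" | "c \<le> a" "a \<le> d" by linarith
    then have "f d - f c = integral {c..d} g"
    proof cases
      case 1
      then show ?thesis using Henstock_Kurzweil_Integration.integral_combine[of a c d g] cd i n[of a c] n[of a d] by (simp add: f_def)
    next
      case 2
      then show ?thesis using Henstock_Kurzweil_Integration.integral_combine[of c d a g] cd i n[of c a] n[of d a] by (simp add: f_def)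
    next
      case 3
      then show ?thesis using Henstock_Kurzweil_Integration.integral_combine[of c a d g] cd i n[of c a] n[of a d] by (simp add: f_def)
    qed
    then show ?thesis using i by (simp add: has_integral_integrable_integral)
  qed
  then have "prim f g" using g by (intro primI_HK) (auto simp: loc_int_def)
  then show ?thesis using that by (simp add: f_def)
qed

lemma test_by_parts:
  assumes t: "test_function \<phi>" and p: "prim F g"
  shows "(LINT x|lborel. deriv \<phi> x * F x) = - (LINT x|lborel. \<phi> x * g x)"
proof -
  have s: "smooth \<phi>" using t by (simp add: test_function_def)
  obtain R where R: "R > 0" "\<And>x. x \<notin> {-R..R} \<Longrightarrow> \<phi> x = 0" using t by (rule test_supportE) blast
  obtain R' where R': "R' > 0" "\<And>x. x \<notin> {-R'..R'} \<Longrightarrow> deriv \<phi> x = 0"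
    using test_deriv[OF t] by (rule test_supportE) blast
  define Q where "Q = R + R'"
  have Q: "Q \<ge> 0" "\<phi> (-Q) = 0" "\<phi> Q = 0" "\<And>x. x \<notin> {-Q..Q} \<Longrightarrow> \<phi> x = 0" "\<And>x. x \<notin> {-Q..Q} \<Longrightarrow> deriv \<phi> x = 0"
    using R R' by (auto simp: Q_def)
  have pp: "prim \<phi> (deriv \<phi>)"
    by (rule prim_deriv) (auto intro: smooth_DERIV s smooth_continuous_on smooth_deriv)
  have pm: "prim (\<lambda>x. \<phi> x * F x) (\<lambda>x. deriv \<phi> x * F x + \<phi> x * g x)" by (rule prim_mult[OF pp p])
  have i1: "integrable lborel (\<lambda>x. deriv \<phi> x * F x)"
    by (intro test_mult_integrable test_deriv t loc_int_continuous prim_continuous_on[OF p])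
  have i2: "integrable lborel (\<lambda>x. \<phi> x * g x)"
    by (intro test_mult_integrable t loc_int_prim[OF p])
  have "deriv \<phi> x * F x + \<phi> x * g x = indicator {-Q..Q} x *\<^sub>R (deriv \<phi> x * F x + \<phi> x * g x)" for x
    using Q(4,5)[of x] by (cases "x \<in> {-Q..Q}") auto
  then have "(LINT x|lborel. deriv \<phi> x * F x + \<phi> x * g x) = (LINT x:{-Q..Q}|lborel. deriv \<phi> x * F x + \<phi> x * g x)"
    unfolding set_lebesgue_integral_def by (rule Bochner_Integration.integral_cong[OF refl])
  also have "\<dots> = 0" using prim_eq[OF pm, of "-Q" Q] Q by simp
  finally show ?thesis using i1 i2 by simp
qed

text \<open>Every test function differs by a multiple of a fixed bump \<eta> from the derivative of
  a test function. So f acts on test functions like the constant c obtained by testing with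
  \<eta>.\<close>

lemma du_bois_reymond:
  assumes f: "loc_int f" and z: "\<And>\<phi>. test_function \<phi> \<Longrightarrow> (LINT x|lborel. deriv \<phi> x * f x) = 0"
  obtains c where "AE x in lborel. f x = c"
proof -
  define \<eta> where "\<eta> = bump 0 (-1) 1"
  have \<eta>: "test_function \<eta>" unfolding \<eta>_def by (rule bump_test)
  have one: "loc_int (\<lambda>_. 1)" by (intro loc_int_continuous continuous_on_const)
  have i\<eta>: "integrable lborel \<eta>" using test_mult_integrable[OF \<eta> one] by simp
  have "(LINT x|lborel. \<eta> x) \<noteq> 0"
  proof
    assume "(LINT x|lborel. \<eta> x) = 0"
    then have "AE x in lborel. \<eta> x = 0"
      using integral_nonneg_eq_0_iff_AE[OF i\<eta>] bump_bounds by (simp add: \<eta>_def)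
    then have "AE x in lborel. x \<notin> {-1<..<1::real}"
      by eventually_elim (use bump_pos[of _ "-1" 1 0] in \<open>force simp: \<eta>_def\<close>)
    then have "emeasure lborel {-1<..<1::real} = 0"
      by (subst (asm) AE_iff_measurable[of "{-1<..<1}"]) auto
    then show False by simp
  qed
  define m where "m = (LINT x|lborel. \<eta> x)"
  have m: "m \<noteq> 0" unfolding m_def by fact
  define c where "c = (LINT x|lborel. \<eta> x * f x) / m"
  have "AE x in lborel. f x - c = 0"
  proof (rule fundamental_lemma)
    show "loc_int (\<lambda>x. f x - c)" by (intro loc_int_diff f loc_int_continuous continuous_on_const)
    fix \<phi> assume t: "test_function \<phi>"
    define k where "k = (LINT x|lborel. \<phi> x) / m"
    \<comment> \<open>\<open>\<psi>\<close> has integral 0, so its primitive \<open>\<Phi>\<close>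
      with value 0 at -Q vanishes on both sides outside [-Q, Q] and is an admissible test
      function.\<close>
    define \<psi> where "\<psi> x = \<phi> x + (- k) * \<eta> x" for x
    have s\<psi>: "smooth \<psi>" unfolding \<psi>_def using t \<eta> smooth_affine[of \<eta> "-k" 1 0]
      by (intro smooth_add) (auto simp: test_function_def)
    obtain R where R: "R > 0" "\<And>x. x \<notin> {-R..R} \<Longrightarrow> \<phi> x = 0" using t by (rule test_supportE) blast
    obtain R' where R': "R' > 0" "\<And>x. x \<notin> {-R'..R'} \<Longrightarrow> \<eta> x = 0" using \<eta> by (rule test_supportE) blast
    define Q where "Q = R + R'"
    have Q: "Q > 0" "\<And>x. x \<notin> {-Q..Q} \<Longrightarrow> \<psi> x = 0"
      using R R' by (auto simp: Q_def \<psi>_def)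
    have i\<phi>: "integrable lborel \<phi>" using test_mult_integrable[OF t one] by simp
    have int0: "(LINT x|lborel. \<psi> x) = 0" using i\<phi> i\<eta> m by (simp add: \<psi>_def k_def m_def)
    obtain \<Phi> where \<Phi>: "prim \<Phi> \<psi>" "\<Phi> (-Q) = 0"
      using prim_exists[OF loc_int_continuous[OF smooth_continuous_on[OF s\<psi>]]] by blast
    have d: "(\<Phi> has_real_derivative \<psi> x) (at x)" for x
      by (rule prim_DERIV[OF \<Phi>(1) smooth_continuous_on[OF s\<psi>]])
    have "\<Phi> x = 0" if x: "\<bar>x\<bar> > Q" for x
    proof (cases "x < 0")
      case True
      have "(LINT y:{x..-Q}|lborel. \<psi> y) = (LINT y:{x..-Q}|lborel. 0)"
        unfolding set_lebesgue_integral_def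
        by (rule integral_discrete_difference[where X="{-Q}"]) (use Q in \<open>auto simp: indicator_def\<close>)
      then show ?thesis using prim_eq[OF \<Phi>(1), of x "-Q"] \<Phi>(2) True x by simp
    next
      case False
      have "(LINT y:{-Q..x}|lborel. \<psi> y) = (LINT y|lborel. \<psi> y)"
        unfolding set_lebesgue_integral_def
      proof (intro Bochner_Integration.integral_cong refl)
        fix y show "indicator {-Q..x} y *\<^sub>R \<psi> y = \<psi> y"
          using Q(2)[of y] x False by (cases "y \<in> {-Q..Q}") (auto simp: indicator_def)
      qed
      then show ?thesis using prim_eq[OF \<Phi>(1), of "-Q" x] \<Phi>(2) False x int0 Q by simp
    qed
    then have "test_function \<Phi>" using smoothI[OF d s\<psi>] by (auto simp: test_function_def)
    then have "(LINT x|lborel. \<psi> x * f x) = 0" using z[of \<Phi>] deriv_eqI[OF d] by simp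
    moreover have "(LINT x|lborel. \<psi> x * f x) = (LINT x|lborel. \<phi> x * f x) - k * (LINT x|lborel. \<eta> x * f x)"
      using test_mult_integrable[OF t f] test_mult_integrable[OF \<eta> f]
      by (simp add: \<psi>_def distrib_right mult.assoc left_diff_distrib)
    ultimately show "(LINT x|lborel. \<phi> x * (f x - c)) = 0"
      using test_mult_integrable[OF t f] i\<phi> m
      by (simp add: right_diff_distrib k_def c_def)
  qed
  then show ?thesis using that[of c] by auto
qed

text \<open>The difference of f and any primitive of g has zero weak derivative, so it is constant
  almost everywhere; the constant is absorbed into the primitive.\<close>

lemma weak_deriv_prim:
  assumes f: "loc_int f" and g: "loc_int g"
    and w: "\<And>\<phi>. test_function \<phi> \<Longrightarrow> (LINT x|lborel. deriv \<phi> x * f x) = - (LINT x|lborel. \<phi> x * g x)"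
  obtains F where "prim F g" "AE x in lborel. F x = f x"
proof -
  obtain G where G: "prim G g" using prim_exists[OF g] by blast
  have lG: "loc_int G" by (intro loc_int_continuous prim_continuous_on[OF G])
  have "(LINT x|lborel. deriv \<phi> x * (f x - G x)) = 0" if t: "test_function \<phi>" for \<phi>
    using w[OF t] test_by_parts[OF t G] test_mult_integrable[OF test_deriv[OF t] f]
      test_mult_integrable[OF test_deriv[OF t] lG] by (simp add: right_diff_distrib)
  then obtain c where c: "AE x in lborel. f x - G x = c"
    using du_bois_reymond[OF loc_int_diff[OF f lG]] by blast
  have "prim (\<lambda>x. G x + c) g" using prim_add[OF G prim_const[of c]] by simp
  moreover have "AE x in lborel. G x + c = f x" using c by eventually_elim simp
  ultimately show ?thesis using that by blast
qed

lemma prim_cong_AE: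
  assumes p: "prim f g" and ae: "AE x in lborel. g x = g' x" and m: "g' \<in> borel_measurable borel"
  shows "prim f g'"
proof -
  have [measurable]: "g \<in> borel_measurable borel" "g' \<in> borel_measurable borel" using p m by (auto dest: prim_borel)
  have "set_integrable lborel {a..b} g' \<longleftrightarrow> set_integrable lborel {a..b} g" for a b
    unfolding set_integrable_def by (rule integrable_cong_AE) (use ae in \<open>auto elim!: eventually_mono\<close>)
  moreover have "(LINT x:{a..b}|lborel. g' x) = (LINT x:{a..b}|lborel. g x)" for a b
    unfolding set_lebesgue_integral_def by (rule integral_cong_AE) (use ae in \<open>auto elim!: eventually_mono\<close>)
  ultimately show ?thesis using p m by (simp add: prim_def)
qed

lemma continuous_AE_eq:
  fixes f g :: "real \<Rightarrow> real"
  assumes f: "continuous_on UNIV f" and g: "continuous_on UNIV g" and ae: "AE x in lborel. f x = g x"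
  shows "f = g"
proof -
  obtain F where F: "prim F f" using prim_exists[OF loc_int_continuous[OF f]] by blast
  then have F': "prim F g" by (rule prim_cong_AE[OF _ ae borel_measurable_continuous_onI[OF g]])
  show ?thesis using DERIV_unique[OF prim_DERIV[OF F f] prim_DERIV[OF F' g]] by blast
qed

section \<open>From weak derivatives to chains of primitives\<close>

lemma in_L2_loc_int: assumes "in_L2 (f :: real \<Rightarrow> real)" shows "loc_int f"
proof -
  have [measurable]: "f \<in> borel_measurable borel" and i: "integrable lborel (\<lambda>x. (f x)\<^sup>2)"
    using assms by (auto simp: in_L2_def)
  have "set_integrable lborel {a..b} f" for a b
    unfolding set_integrable_def
  proof (rule Bochner_Integration.integrable_bound)
    have "integrable lborel (indicator {a..b} :: real \<Rightarrow> real)"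
      by (rule integrable_real_indicator) (auto simp: emeasure_lborel_Icc_eq)
    then show "integrable lborel (\<lambda>x. indicator {a..b} x + (f x)\<^sup>2)" using i by simp
    have "\<bar>f x\<bar> \<le> 1 + (f x)\<^sup>2" for x
      using sum_squares_bound[of 1 "\<bar>f x\<bar>"] by simp
    then show "AE x in lborel. norm (indicator {a..b} x *\<^sub>R f x) \<le> norm (indicator {a..b} x + (f x)\<^sup>2)"
      by (auto simp: indicator_def)
  qed measurable
  then show ?thesis by (simp add: loc_int_def)
qed

lemma in_L2_nn:
  assumes "in_L2 (f :: real \<Rightarrow> real)"
  shows "nsq f = ennreal ((L2_norm f)\<^sup>2)"
proof -
  have "integrable lborel (\<lambda>x. (f x)\<^sup>2)" using assms by (simp add: in_L2_def)
  moreover have "(L2_norm f)\<^sup>2 = (LINT x|lborel. (f x)\<^sup>2)"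
    by (simp add: L2_norm_def)
  ultimately show ?thesis by (simp add: nn_integral_eq_integral)
qed

lemma L2_norm_le_iff:
  assumes "in_L2 (f :: real \<Rightarrow> real)" shows "L2 f A \<longleftrightarrow> (L2_norm f)\<^sup>2 \<le> A"
proof -
  have f: "f \<in> borel_measurable borel" using assms by (simp add: in_L2_def)
  show ?thesis
  proof
    assume "L2 f A" then show "(L2_norm f)\<^sup>2 \<le> A" using in_L2_nn[OF assms] by (auto simp: L2_def)
  next
    assume a: "(L2_norm f)\<^sup>2 \<le> A"
    then have "0 \<le> A" using zero_le_power2 order_trans by blast
    then show "L2 f A" using in_L2_nn[OF assms] f a by (simp add: L2_def ennreal_leI)
  qed
qed

lemma weak_deriv_spec:
  assumes "in_Hs s f" "k \<le> s"
  shows "in_L2 (weak_deriv k f)" "has_weak_deriv k f (weak_deriv k f)"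
proof -
  have "\<exists>g. in_L2 g \<and> has_weak_deriv k f g" using assms by (auto simp: in_Hs_def)
  from someI_ex[OF this] show "in_L2 (weak_deriv k f)" "has_weak_deriv k f (weak_deriv k f)"
    by (auto simp: weak_deriv_def)
qed

lemma in_Hs_lower: "in_Hs s f \<Longrightarrow> j \<le> s \<Longrightarrow> in_Hs j f"
  by (auto simp: in_Hs_def)

text \<open>Even at order 0 \<open>weak_deriv\<close> is an arbitrary choice, tied to f only by
  testing.\<close>

lemma weak_deriv_0: assumes "in_Hs s (f :: real \<Rightarrow> real)" shows "AE x in lborel. weak_deriv 0 f x = f x"
proof -
  have l: "loc_int (weak_deriv 0 f)" "loc_int f"
    using weak_deriv_spec(1)[OF assms, of 0] assms by (auto intro!: in_L2_loc_int simp: in_Hs_def)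
  have "AE x in lborel. weak_deriv 0 f x - f x = 0"
  proof (rule fundamental_lemma[OF loc_int_diff[OF l]])
    fix \<phi> assume t: "test_function \<phi>"
    have "(LINT x|lborel. \<phi> x * f x) = (LINT x|lborel. \<phi> x * weak_deriv 0 f x)"
      using weak_deriv_spec(2)[OF assms, of 0] t by (auto simp: has_weak_deriv_def)
    then show "(LINT x|lborel. \<phi> x * (weak_deriv 0 f x - f x)) = 0"
      using test_mult_integrable[OF t l(1)] test_mult_integrable[OF t l(2)] by (simp add: right_diff_distrib)
  qed
  then show ?thesis by eventually_elim simp
qed

lemma weak_deriv_Suc:
  assumes "in_Hs s (f :: real \<Rightarrow> real)" "k < s" "test_function \<phi>"
  shows "(LINT x|lborel. deriv \<phi> x * weak_deriv k f x) = - (LINT x|lborel. \<phi> x * weak_deriv (Suc k) f x)"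
proof -
  have "(LINT x|lborel. (deriv ^^ k) (deriv \<phi>) x * f x) = (-1) ^ k * (LINT x|lborel. deriv \<phi> x * weak_deriv k f x)"
    using weak_deriv_spec(2)[OF assms(1), of k] assms(2) test_deriv[OF assms(3)] by (simp add: has_weak_deriv_def)
  moreover have "(LINT x|lborel. (deriv ^^ Suc k) \<phi> x * f x) = (-1) ^ Suc k * (LINT x|lborel. \<phi> x * weak_deriv (Suc k) f x)"
    using weak_deriv_spec(2)[OF assms(1), of "Suc k"] assms(2,3) by (simp add: has_weak_deriv_def del: funpow.simps)
  ultimately show ?thesis by (cases "even k") (auto simp: funpow_swap1)
qed

text \<open>Consecutive weak derivatives are linked by \<open>weak_deriv_Suc\<close>, so each order
  below s has an absolutely continuous representative. At order 0 continuity of f identifies this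
  representative with f at every point.\<close>

lemma Hs_chain:
  assumes H: "in_Hs s (f :: real \<Rightarrow> real)" and c: "continuous_on UNIV f"
  obtains d where "d 0 = f" "\<And>j. j < s \<Longrightarrow> prim (d j) (d (Suc j))"
    "\<And>j. j \<le> s \<Longrightarrow> in_L2 (d j)" "\<And>j. j \<le> s \<Longrightarrow> L2_norm (d j) = L2_norm (weak_deriv j f)"
proof -
  have l: "loc_int (weak_deriv k f)" if "k \<le> s" for k
    using weak_deriv_spec(1)[OF H that] by (rule in_L2_loc_int)
  have "\<exists>F. prim F (weak_deriv (Suc k) f) \<and> (AE x in lborel. F x = weak_deriv k f x)" if "k < s" for k
  proof -
    have k: "k \<le> s" "Suc k \<le> s" using that by auto
    show ?thesis by (rule weak_deriv_prim[OF l[OF k(1)] l[OF k(2)] weak_deriv_Suc[OF H that]]) blast+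
  qed
  then obtain F where F: "\<And>k. k < s \<Longrightarrow> prim (F k) (weak_deriv (Suc k) f)"
    "\<And>k. k < s \<Longrightarrow> AE x in lborel. F k x = weak_deriv k f x" by metis
  \<comment> \<open>\<open>F k\<close> is the absolutely continuous representative of order k. None
    is available at the top order s, where the chosen weak derivative is kept.\<close>
  define d where "d k = (if k = 0 then f else if k < s then F k else weak_deriv k f)" for k
  have F0: "F 0 = f" if "0 < s"
  proof (rule continuous_AE_eq[OF prim_continuous_on[OF F(1)[OF that]] c])
    show "AE x in lborel. F 0 x = f x"
      using F(2)[OF that] weak_deriv_0[OF H] by eventually_elim simp
  qed
  have ae: "AE x in lborel. d k x = weak_deriv k f x" if "k \<le> s" for k
  proof (cases "k = 0")
    case True
    then show ?thesis using weak_deriv_0[OF H] by (auto simp: d_def elim!: eventually_mono)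
  next
    case False
    then show ?thesis using F(2)[of k] that by (cases "k < s") (auto simp: d_def)
  qed
  have b: "d k \<in> borel_measurable borel" if "k \<le> s" for k
    using that c F(1)[of k] l[OF that]
    by (auto simp: d_def loc_int_def intro: borel_measurable_continuous_onI dest: prim_borel_left)
  have n: "(LINT x|lborel. (d k x)\<^sup>2) = (LINT x|lborel. (weak_deriv k f x)\<^sup>2)"
    "integrable lborel (\<lambda>x. (d k x)\<^sup>2)" if k: "k \<le> s" for k
  proof -
    have [measurable]: "d k \<in> borel_measurable borel" "weak_deriv k f \<in> borel_measurable borel"
      using b[OF k] l[OF k] by (auto simp: loc_int_def)
    show "(LINT x|lborel. (d k x)\<^sup>2) = (LINT x|lborel. (weak_deriv k f x)\<^sup>2)"
      by (rule integral_cong_AE) (use ae[OF k] in \<open>auto elim!: eventually_mono\<close>)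
    have "integrable lborel (\<lambda>x. (weak_deriv k f x)\<^sup>2)" using weak_deriv_spec(1)[OF H k] by (simp add: in_L2_def)
    then show "integrable lborel (\<lambda>x. (d k x)\<^sup>2)"
      by (subst integrable_cong_AE[where g="\<lambda>x. (weak_deriv k f x)\<^sup>2"]) (use ae[OF k] in \<open>auto elim!: eventually_mono\<close>)
  qed
  show ?thesis
  proof (rule that[of d])
    show "d 0 = f" by (simp add: d_def)
    show "prim (d j) (d (Suc j))" if "j < s" for j
    proof -
      have "d j = F j" using that F0 by (auto simp: d_def)
      moreover have "AE x in lborel. weak_deriv (Suc j) f x = d (Suc j) x"
        using ae[of "Suc j"] that by (auto elim!: eventually_mono)
      ultimately show ?thesis using prim_cong_AE[OF F(1)[OF that]] b[of "Suc j"] that by auto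
    qed
    show "in_L2 (d j)" if "j \<le> s" for j using b[OF that] n(2)[OF that] by (simp add: in_L2_def)
    show "L2_norm (d j) = L2_norm (weak_deriv j f)" if "j \<le> s" for j
      using n(1)[OF that] by (simp add: L2_norm_def)
  qed
qed

lemma Hs_norm_sq: "(Hs_norm s f)\<^sup>2 = (\<Sum>k\<le>s. (L2_norm (weak_deriv k f))\<^sup>2)"
  by (simp add: Hs_norm_def sum_nonneg)

lemma Hk_of_Hs:
  assumes H: "in_Hs s (f :: real \<Rightarrow> real)" and c: "continuous_on UNIV f"
  shows "Hk s f ((Hs_norm s f)\<^sup>2)"
proof -
  obtain d where d: "d 0 = f" "\<And>j. j < s \<Longrightarrow> prim (d j) (d (Suc j))"
    "\<And>j. j \<le> s \<Longrightarrow> in_L2 (d j)" "\<And>j. j \<le> s \<Longrightarrow> L2_norm (d j) = L2_norm (weak_deriv j f)"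
    by (rule Hs_chain[OF H c]) blast
  have "L2 (d j) ((Hs_norm s f)\<^sup>2)" if "j \<le> s" for j
    unfolding L2_norm_le_iff[OF d(3)[OF that]] d(4)[OF that] Hs_norm_sq
    using that by (intro member_le_sum) auto
  then show ?thesis unfolding Hk_chain using d(1,2) by blast
qed

text \<open>\<open>Hk\<close> bounds the s + 1 orders separately, whereas the Sobolev norm sums
  them.\<close>

lemma Hs_norm_le:
  assumes H: "in_Hs s (f :: real \<Rightarrow> real)" and c: "continuous_on UNIV f" and A: "Hk s f A"
  shows "(Hs_norm s f)\<^sup>2 \<le> (s + 1) * A"
proof -
  obtain d where d: "d 0 = f" "\<And>j. j < s \<Longrightarrow> prim (d j) (d (Suc j))"
    "\<And>j. j \<le> s \<Longrightarrow> in_L2 (d j)" "\<And>j. j \<le> s \<Longrightarrow> L2_norm (d j) = L2_norm (weak_deriv j f)"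
    by (rule Hs_chain[OF H c]) blast
  have "(L2_norm (weak_deriv j f))\<^sup>2 \<le> A" if j: "j \<le> s" for j
  proof -
    have "L2 (d j) A"
    proof (rule L2_top_of_dqs)
      show "prim (d i) (d (Suc i))" if "i < j" for i using d(2) that j by simp
      show "d j \<in> borel_measurable borel" using d(3)[OF j] by (simp add: in_L2_def)
      show "L2 (dqs hs (d 0)) A" if "length hs = j" "set hs \<subseteq> unit_fractions" for hs
        unfolding d(1) using that j by (intro L2_dqs Hk_lower[OF A] unit_fractions_subset) auto
    qed
    then show ?thesis using L2_norm_le_iff[OF d(3)[OF j]] d(4)[OF j] by simp
  qed
  then have "(Hs_norm s f)\<^sup>2 \<le> (\<Sum>k\<le>s. A)" unfolding Hs_norm_sq by (intro sum_mono) auto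
  then show ?thesis by (simp add: algebra_simps)
qed

section \<open>Vector-valued functions and their components\<close>

lemma in_L2_linear:
  fixes f :: "real \<Rightarrow> 'a::euclidean_space" and l :: "'a \<Rightarrow> 'b::euclidean_space"
  assumes "bounded_linear l" "in_L2 f" shows "in_L2 (\<lambda>x. l (f x))"
proof -
  interpret bounded_linear l by fact
  obtain K where K: "K > 0" "\<And>x. norm (l x) \<le> norm x * K" using pos_bounded by blast
  have [measurable]: "f \<in> borel_measurable borel" using assms(2) by (simp add: in_L2_def)
  have [measurable]: "l \<in> borel_measurable borel"
    by (rule borel_measurable_continuous_onI) (simp add: continuous_on isCont_def[symmetric] continuous_on_eq_continuous_at linear_continuous_on assms)
  have "integrable lborel (\<lambda>x. (norm (l (f x)))\<^sup>2)"
  proof (rule Bochner_Integration.integrable_bound)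
    show "integrable lborel (\<lambda>x. K\<^sup>2 * (norm (f x))\<^sup>2)" using assms(2) by (simp add: in_L2_def)
    have "(norm (l (f x)))\<^sup>2 \<le> K\<^sup>2 * (norm (f x))\<^sup>2" for x
      using power_mono[OF K(2)[of "f x"], of 2] by (simp add: power_mult_distrib mult.commute)
    then show "AE x in lborel. norm ((norm (l (f x)))\<^sup>2) \<le> norm (K\<^sup>2 * (norm (f x))\<^sup>2)" by simp
  qed measurable
  then show ?thesis by (simp add: in_L2_def)
qed

lemma test_scaleR_integrable:
  fixes f :: "real \<Rightarrow> 'a::euclidean_space"
  assumes t: "test_function \<phi>" and f: "in_L2 f" shows "integrable lborel (\<lambda>x. \<phi> x *\<^sub>R f x)"
proof -
  have [measurable]: "f \<in> borel_measurable borel" "\<phi> \<in> borel_measurable borel"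
    using f test_borel[OF t] by (auto simp: in_L2_def)
  have n: "in_L2 (\<lambda>x. norm (f x))" using f by (auto simp: in_L2_def)
  have "integrable lborel (\<lambda>x. \<phi> x * norm (f x))"
    by (rule test_mult_integrable[OF t in_L2_loc_int[OF n]])
  then show ?thesis by (rule Bochner_Integration.integrable_bound) auto
qed

lemma weak_deriv_linear:
  fixes f :: "real \<Rightarrow> 'a::euclidean_space" and l :: "'a \<Rightarrow> 'b::euclidean_space"
  assumes l: "bounded_linear l" and f: "in_L2 f" and g: "in_L2 g" and w: "has_weak_deriv k f g"
  shows "has_weak_deriv k (\<lambda>x. l (f x)) (\<lambda>x. l (g x))"
  unfolding has_weak_deriv_def
proof (intro allI impI)
  interpret bounded_linear l by fact
  fix \<phi> assume t: "test_function \<phi>"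
  have "(LINT x|lborel. (deriv ^^ k) \<phi> x *\<^sub>R l (f x)) = l (LINT x|lborel. (deriv ^^ k) \<phi> x *\<^sub>R f x)"
    by (subst integral_bounded_linear[OF l test_scaleR_integrable[OF test_funpow[OF t] f], symmetric]) (simp add: scaleR)
  also have "\<dots> = (-1) ^ k *\<^sub>R l (LINT x|lborel. \<phi> x *\<^sub>R g x)"
    using w t by (simp add: has_weak_deriv_def scaleR)
  also have "l (LINT x|lborel. \<phi> x *\<^sub>R g x) = (LINT x|lborel. \<phi> x *\<^sub>R l (g x))"
    by (subst integral_bounded_linear[OF l test_scaleR_integrable[OF t g], symmetric]) (simp add: scaleR)
  finally show "(LINT x|lborel. (deriv ^^ k) \<phi> x *\<^sub>R l (f x)) = (-1) ^ k *\<^sub>R (LINT x|lborel. \<phi> x *\<^sub>R l (g x))" .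
qed

lemma in_Hs_linear:
  fixes f :: "real \<Rightarrow> 'a::euclidean_space" and l :: "'a \<Rightarrow> 'b::euclidean_space"
  assumes "bounded_linear l" "in_Hs s f" shows "in_Hs s (\<lambda>x. l (f x))"
  unfolding in_Hs_def
proof (intro conjI allI impI)
  have f: "in_L2 f" using assms(2) by (simp add: in_Hs_def)
  show "in_L2 (\<lambda>x. l (f x))" by (rule in_L2_linear[OF assms(1) f])
  fix k assume "k \<le> s"
  note g = weak_deriv_spec[OF assms(2) this]
  show "\<exists>g. in_L2 g \<and> has_weak_deriv k (\<lambda>x. l (f x)) g"
    using in_L2_linear[OF assms(1) g(1)] weak_deriv_linear[OF assms(1) f g] by blast
qed

lemma weak_deriv_AE_unique:
  fixes f :: "real \<Rightarrow> real"
  assumes "in_L2 g1" "in_L2 g2" "has_weak_deriv k f g1" "has_weak_deriv k f g2"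
  shows "AE x in lborel. g1 x = g2 x"
proof -
  have "AE x in lborel. g1 x - g2 x = 0"
  proof (rule fundamental_lemma[OF loc_int_diff])
    fix \<phi> assume t: "test_function \<phi>"
    have "(-1::real) ^ k * (LINT x|lborel. \<phi> x * g1 x) = (-1) ^ k * (LINT x|lborel. \<phi> x * g2 x)"
      using assms(3,4) t by (simp add: has_weak_deriv_def)
    then show "(LINT x|lborel. \<phi> x * (g1 x - g2 x)) = 0"
      using test_mult_integrable[OF t in_L2_loc_int[OF assms(1)]] test_mult_integrable[OF t in_L2_loc_int[OF assms(2)]]
      by (simp add: right_diff_distrib)
  qed (use assms in_L2_loc_int in auto)
  then show ?thesis by eventually_elim simp
qed

lemma L2_norm_sq: "(L2_norm f)\<^sup>2 = (LINT x|lborel. (norm (f x))\<^sup>2)"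
  by (simp add: L2_norm_def)

lemma L2_norm_components:
  fixes f :: "real \<Rightarrow> 'a::euclidean_space"
  assumes "in_L2 f" shows "(L2_norm f)\<^sup>2 = (\<Sum>b\<in>Basis. (L2_norm (\<lambda>x. f x \<bullet> b))\<^sup>2)"
proof -
  have i: "integrable lborel (\<lambda>x. (f x \<bullet> b)\<^sup>2)" for b
    using in_L2_linear[OF bounded_linear_inner_left assms, of b] by (simp add: in_L2_def)
  have "(norm v)\<^sup>2 = (\<Sum>b\<in>Basis. (v \<bullet> b)\<^sup>2)" for v :: 'a
    unfolding norm_eq_sqrt_inner euclidean_inner[of v v] by (simp add: power2_eq_square sum_nonneg)
  then have "(LINT x|lborel. (norm (f x))\<^sup>2) = (LINT x|lborel. (\<Sum>b\<in>Basis. (f x \<bullet> b)\<^sup>2))"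
    by simp
  then have "(L2_norm f)\<^sup>2 = \<dots>" by (simp only: L2_norm_sq)
  also have "\<dots> = (\<Sum>b\<in>Basis. (LINT x|lborel. (f x \<bullet> b)\<^sup>2))"
    using i by (intro Bochner_Integration.integral_sum)
  also have "\<dots> = (\<Sum>b\<in>Basis. (L2_norm (\<lambda>x. f x \<bullet> b))\<^sup>2)" by (simp add: L2_norm_sq)
  finally show ?thesis .
qed

text \<open>The choice inside \<open>weak_deriv\<close> need not commute with taking components. The
  two choices agree almost everywhere, which is enough for the norms.\<close>

lemma Hs_norm_components:
  fixes f :: "real \<Rightarrow> 'a::euclidean_space"
  assumes H: "in_Hs s f" shows "(Hs_norm s f)\<^sup>2 = (\<Sum>b\<in>Basis. (Hs_norm s (\<lambda>x. f x \<bullet> b))\<^sup>2)"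
proof -
  have "(L2_norm (weak_deriv k f))\<^sup>2 = (\<Sum>b\<in>Basis. (L2_norm (weak_deriv k (\<lambda>x. f x \<bullet> b)))\<^sup>2)" if k: "k \<le> s" for k
  proof -
    note g = weak_deriv_spec[OF H k]
    have "L2_norm (\<lambda>x. weak_deriv k f x \<bullet> b) = L2_norm (weak_deriv k (\<lambda>x. f x \<bullet> b))" for b
    proof -
      note l = bounded_linear_inner_left[of b]
      note g' = weak_deriv_spec[OF in_Hs_linear[OF l H] k]
      have 1: "in_L2 (\<lambda>x. weak_deriv k f x \<bullet> b)" by (rule in_L2_linear[OF l g(1)])
      have ae: "AE x in lborel. weak_deriv k f x \<bullet> b = weak_deriv k (\<lambda>x. f x \<bullet> b) x"
        using H by (intro weak_deriv_AE_unique[OF 1 g'(1) _ g'(2)] weak_deriv_linear[OF l _ g]) (simp add: in_Hs_def)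
      have [measurable]: "(\<lambda>x. weak_deriv k f x \<bullet> b) \<in> borel_measurable borel"
        "weak_deriv k (\<lambda>x. f x \<bullet> b) \<in> borel_measurable borel"
        using 1 g'(1) by (auto simp: in_L2_def)
      have "(LINT x|lborel. (weak_deriv k f x \<bullet> b)\<^sup>2) = (LINT x|lborel. (weak_deriv k (\<lambda>x. f x \<bullet> b) x)\<^sup>2)"
        by (rule integral_cong_AE) (use ae in \<open>auto elim!: eventually_mono\<close>)
      then show ?thesis by (simp add: L2_norm_def)
    qed
    then show ?thesis using L2_norm_components[OF g(1)] by simp
  qed
  then show ?thesis unfolding Hs_norm_sq by (simp add: sum.swap[of _ Basis])
qed

section \<open>Two evolution estimates\<close>

definition cont2 :: "real \<Rightarrow> (real \<Rightarrow> real \<Rightarrow> real) \<Rightarrow> bool" where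
  "cont2 T f \<longleftrightarrow> continuous_on (UNIV \<times> {0..T}) (\<lambda>p. f (fst p) (snd p))"

lemma cont2_const: "cont2 T (\<lambda>x t. c)" by (simp add: cont2_def)

lemma cont2_add: "cont2 T f \<Longrightarrow> cont2 T g \<Longrightarrow> cont2 T (\<lambda>x t. f x t + g x t)"
  unfolding cont2_def by (intro continuous_intros)

lemma cont2_diff: "cont2 T f \<Longrightarrow> cont2 T g \<Longrightarrow> cont2 T (\<lambda>x t. f x t - g x t)"
  unfolding cont2_def by (intro continuous_intros)

lemma cont2_minus: "cont2 T f \<Longrightarrow> cont2 T (\<lambda>x t. - f x t)"
  unfolding cont2_def by (intro continuous_intros)

lemma cont2_mult: "cont2 T f \<Longrightarrow> cont2 T g \<Longrightarrow> cont2 T (\<lambda>x t. f x t * g x t)"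
  unfolding cont2_def by (intro continuous_intros)

lemma cont2_power: "cont2 T f \<Longrightarrow> cont2 T (\<lambda>x t. f x t ^ n)"
  unfolding cont2_def by (intro continuous_intros)

lemma cont2_inverse: "cont2 T f \<Longrightarrow> (\<And>x t. t \<in> {0..T} \<Longrightarrow> f x t \<noteq> 0) \<Longrightarrow> cont2 T (\<lambda>x t. inverse (f x t))"
  unfolding cont2_def by (intro continuous_intros) auto

lemma cont2_x: "continuous_on UNIV g \<Longrightarrow> cont2 T (\<lambda>x t. g x)"
  unfolding cont2_def by (rule continuous_on_compose2[of UNIV g _ fst]) (auto intro: continuous_on_fst continuous_on_id)

lemma cont2_t: "continuous_on {0..T} g \<Longrightarrow> cont2 T (\<lambda>x t. g t)"
  unfolding cont2_def by (rule continuous_on_compose2[of "{0..T}" g _ snd]) (auto intro: continuous_on_snd continuous_on_id)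

lemma cont2_comp:
  assumes "cont2 T f" "cont2 T X" shows "cont2 T (\<lambda>z t. f (X z t) t)"
  unfolding cont2_def
proof -
  have "continuous_on (UNIV \<times> {0..T}) (\<lambda>p. (\<lambda>q. f (fst q) (snd q)) (X (fst p) (snd p), snd p))"
    using assms(2) unfolding cont2_def
    by (intro continuous_on_compose2[OF assms(1)[unfolded cont2_def]]) (auto intro!: continuous_intros)
  then show "continuous_on (UNIV \<times> {0..T}) (\<lambda>p. f (X (fst p) (snd p)) (snd p))" by simp
qed

lemma cont2_comp1: "continuous_on UNIV g \<Longrightarrow> cont2 T X \<Longrightarrow> cont2 T (\<lambda>z t. g (X z t))"
  using cont2_comp[OF cont2_x] by blast

lemma cont2_shift: "cont2 T f \<Longrightarrow> cont2 T (\<lambda>x t. f (x + h) t)"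
  by (rule cont2_comp) (auto intro!: cont2_x continuous_intros)

lemma cont2_dq: "cont2 T f \<Longrightarrow> cont2 T (\<lambda>x t. dq h (\<lambda>y. f y t) x)"
  using cont2_mult[OF cont2_const[of T "1/h"] cont2_diff[OF cont2_shift]] by (simp add: dq_def)

lemma cont2_dqs: "cont2 T f \<Longrightarrow> cont2 T (\<lambda>x t. dqs hs (\<lambda>y. f y t) x)"
  by (induction hs) (auto dest: cont2_dq)

lemma cont2_slice_x: "cont2 T f \<Longrightarrow> t \<in> {0..T} \<Longrightarrow> continuous_on S (\<lambda>x. f x t)"
  unfolding cont2_def by (rule continuous_on_compose2[of _ "\<lambda>p. f (fst p) (snd p)" S "\<lambda>x. (x, t)", simplified])
    (auto intro!: continuous_intros)

lemma cont2_slice_t: "cont2 T f \<Longrightarrow> S \<subseteq> {0..T} \<Longrightarrow> continuous_on S (f x)"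
  unfolding cont2_def by (rule continuous_on_compose2[of _ "\<lambda>p. f (fst p) (snd p)" S "\<lambda>t. (x, t)", simplified])
    (auto intro!: continuous_intros)

lemma cont2_measurable:
  assumes "cont2 T f"
  shows "(\<lambda>p. indicator {0..T} (snd p) * f (fst p) (snd p)) \<in> borel_measurable (borel \<Otimes>\<^sub>M borel)"
proof -
  have "closed (UNIV \<times> {0..T} :: (real \<times> real) set)" by (intro closed_Times) auto
  then have "(\<lambda>p. indicator (UNIV \<times> {0..T}) p *\<^sub>R f (fst p) (snd p)) \<in> borel_measurable borel"
    using assms unfolding cont2_def by (intro borel_measurable_continuous_on_indicator) auto
  moreover have "indicator (UNIV \<times> {0..T}) p = (indicator {0..T} (snd p) :: real)" for p :: "real \<times> real"
    by (cases p) (auto simp: indicator_def)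
  ultimately show ?thesis by (simp add: borel_prod)
qed

lemma cont2_integral:
  assumes "cont2 T f" shows "continuous_on {0..T} (\<lambda>t. integral {a..b} (\<lambda>x. f x t))"
proof -
  have "continuous_on ({0..T} \<times> cbox a b) (\<lambda>q. (\<lambda>p. f (fst p) (snd p)) (snd q, fst q))"
    using assms unfolding cont2_def
    by (rule continuous_on_compose2) (auto intro!: continuous_intros)
  then have "continuous_on ({0..T} \<times> cbox a b) (\<lambda>(t, x). f x t)" by (simp add: split_beta')
  then have "continuous_on {0..T} (\<lambda>t. integral (cbox a b) (\<lambda>x. f x t))" by (rule integral_continuous_on_param)
  then show ?thesis by simp
qed

text \<open>The right side of Gronwall's inequality at rate \<Lambda>. With values in
  \<open>ennreal\<close> it is monotone in \<open>g\<close> without any measurability; later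
  \<open>g\<close> contains the top-order norm, which is replaced by an explicit bound before the
  integral is evaluated.\<close>

definition Duh :: "real \<Rightarrow> real \<Rightarrow> (real \<Rightarrow> real) \<Rightarrow> real \<Rightarrow> ennreal" where
  "Duh \<Lambda> A g t = ennreal (exp (- \<Lambda> * t) * A)
     + (\<integral>\<^sup>+s\<in>{0..t}. ennreal (exp (- \<Lambda> * (t - s)) * g s) \<partial>lborel)"

section \<open>Gronwall's inequality and damped ordinary differential equations\<close>

lemma gronwall:
  fixes y y' G :: "real \<Rightarrow> real"
  assumes t: "t \<in> {0..T}"
    and d: "\<And>r. r \<in> {0..T} \<Longrightarrow> (y has_real_derivative y' r) (at r within {0..T})"
    and le: "\<And>r. r \<in> {0..T} \<Longrightarrow> y' r \<le> - \<Lambda> * y r + G r"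
    and G: "continuous_on {0..T} G"
  shows "y t \<le> exp (- \<Lambda> * t) * y 0 + integral {0..t} (\<lambda>r. exp (- \<Lambda> * (t - r)) * G r)"
proof -
  define \<phi> where "\<phi> r = exp (\<Lambda> * r) * y r - integral {0..r} (\<lambda>q. exp (\<Lambda> * q) * G q)" for r
  have cE: "continuous_on {0..T} (\<lambda>q. exp (\<Lambda> * q) * G q)" by (intro continuous_intros G)
  have d\<phi>: "(\<phi> has_real_derivative (\<Lambda> * exp (\<Lambda> * r) * y r + exp (\<Lambda> * r) * y' r) - exp (\<Lambda> * r) * G r) (at r within {0..T})"
    if r: "r \<in> {0..T}" for r
  proof -
    have "((\<lambda>r. integral {0..r} (\<lambda>q. exp (\<Lambda> * q) * G q)) has_real_derivative exp (\<Lambda> * r) * G r) (at r within {0..T})"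
      using integral_has_vector_derivative[OF cE r] by (simp add: has_real_derivative_iff_has_vector_derivative)
    then show ?thesis unfolding \<phi>_def
      by (auto intro!: derivative_eq_intros d[OF r])
  qed
  have "\<phi> t \<le> \<phi> 0"
  proof (rule DERIV_nonpos_imp_decreasing_open[of 0 t \<phi>])
    show "0 \<le> t" using t by simp
    have "continuous_on {0..T} \<phi>"
      unfolding continuous_on_eq_continuous_within using DERIV_continuous[OF d\<phi>] by blast
    then show "continuous_on {0..t} \<phi>" using t by (auto intro: continuous_on_subset)
    fix r assume r: "0 < r" "r < t"
    then have rT: "r \<in> {0..T}" "r \<in> interior {0..T}" using t by auto
    have "(\<phi> has_real_derivative (\<Lambda> * exp (\<Lambda> * r) * y r + exp (\<Lambda> * r) * y' r) - exp (\<Lambda> * r) * G r) (at r)"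
      using d\<phi>[OF rT(1)] at_within_interior[OF rT(2)] by simp
    moreover have "(\<Lambda> * exp (\<Lambda> * r) * y r + exp (\<Lambda> * r) * y' r) - exp (\<Lambda> * r) * G r \<le> 0"
    proof -
      have "exp (\<Lambda> * r) * (\<Lambda> * y r + y' r - G r) \<le> 0"
        using le[OF rT(1)] by (intro mult_nonneg_nonpos) auto
      then show ?thesis by (simp add: algebra_simps)
    qed
    ultimately show "\<exists>y. (\<phi> has_real_derivative y) (at r) \<and> y \<le> 0" by blast
  qed
  then have "exp (\<Lambda> * t) * y t \<le> y 0 + integral {0..t} (\<lambda>q. exp (\<Lambda> * q) * G q)"
    by (simp add: \<phi>_def)
  then have "exp (- \<Lambda> * t) * (exp (\<Lambda> * t) * y t) \<le> exp (- \<Lambda> * t) * (y 0 + integral {0..t} (\<lambda>q. exp (\<Lambda> * q) * G q))"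
    by (intro mult_left_mono) auto
  also have "exp (- \<Lambda> * t) * (exp (\<Lambda> * t) * y t) = y t" by (simp add: mult.assoc[symmetric] exp_add[symmetric])
  also have "exp (- \<Lambda> * t) * (y 0 + integral {0..t} (\<lambda>q. exp (\<Lambda> * q) * G q))
      = exp (- \<Lambda> * t) * y 0 + integral {0..t} (\<lambda>q. exp (- \<Lambda> * t) * (exp (\<Lambda> * q) * G q))"
    by (simp add: distrib_left)
  also have "(\<lambda>q. exp (- \<Lambda> * t) * (exp (\<Lambda> * q) * G q)) = (\<lambda>q. exp (- \<Lambda> * (t - q)) * G q)"
  proof (rule ext)
    fix q
    have "exp (- \<Lambda> * (t - q)) = exp (- \<Lambda> * t) * exp (\<Lambda> * q)"
      by (simp add: mult_exp_exp right_diff_distrib)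
    then show "exp (- \<Lambda> * t) * (exp (\<Lambda> * q) * G q) = exp (- \<Lambda> * (t - q)) * G q" by simp
  qed
  finally show ?thesis by simp
qed

lemma nn_of_HK:
  fixes f :: "real \<Rightarrow> real"
  assumes "continuous_on {a..b} f" "\<And>x. x \<in> {a..b} \<Longrightarrow> 0 \<le> f x"
  shows "ennreal (integral {a..b} f) = (\<integral>\<^sup>+x\<in>{a..b}. ennreal (f x) \<partial>lborel)"
proof -
  have s: "set_integrable lborel {a..b} f" by (rule borel_integrable_atLeastAtMost'[OF assms(1)])
  have "(\<integral>\<^sup>+x\<in>{a..b}. ennreal (f x) \<partial>lborel) = (\<integral>\<^sup>+x. ennreal (indicator {a..b} x * f x) \<partial>lborel)"
    by (intro nn_integral_cong) (auto simp: indicator_def)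
  also have "\<dots> = ennreal (LINT x|lborel. indicator {a..b} x * f x)"
    using s assms(2) by (intro nn_integral_eq_integral) (auto simp: set_integrable_def indicator_def)
  also have "(LINT x|lborel. indicator {a..b} x * f x) = integral {a..b} f"
    using set_borel_integral_eq_integral(2)[OF s] by (simp add: set_lebesgue_integral_def)
  finally show ?thesis by simp
qed

text \<open>Gronwall's inequality at each fixed x, followed by Tonelli, so that no derivative of an
  integral over the line is taken. Young's inequality gives half of the damping 2 a0 to the source;
  this leaves the rate a0 and costs the factor 1/a0.\<close>

lemma damped_ode:
  fixes r a S :: "real \<Rightarrow> real \<Rightarrow> real"
  assumes a0: "a0 > 0" and t: "t \<in> {0..T}"
    and d: "\<And>x q. q \<in> {0..T} \<Longrightarrow> ((\<lambda>q. r x q) has_real_derivative (- a x q * r x q + S x q)) (at q within {0..T})"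
    and a: "\<And>x q. q \<in> {0..T} \<Longrightarrow> a0 \<le> a x q"
    and S: "cont2 T S" and r: "r0 \<in> borel_measurable borel" "\<And>x. r x 0 = r0 x" and A: "L2 r0 A"
    and g: "\<And>q. q \<in> {0..T} \<Longrightarrow> L2 (\<lambda>x. S x q) (g q)"
  shows "nsq (\<lambda>x. r x t) \<le> Duh a0 A (\<lambda>q. g q / a0) t"
proof -
  let ?E = "\<lambda>q. exp (- a0 * (t - q))"
  have pt: "(r x t)\<^sup>2 \<le> exp (- a0 * t) * (r0 x)\<^sup>2 + integral {0..t} (\<lambda>q. ?E q * ((S x q)\<^sup>2 / a0))" for x
  proof -
    have "(r x t)\<^sup>2 \<le> exp (- a0 * t) * (r x 0)\<^sup>2 + integral {0..t} (\<lambda>q. ?E q * ((S x q)\<^sup>2 / a0))"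
    proof (rule gronwall[OF t])
      fix q assume q: "q \<in> {0..T}"
      show "((\<lambda>q. (r x q)\<^sup>2) has_real_derivative 2 * r x q * (- a x q * r x q + S x q)) (at q within {0..T})"
        by (auto intro!: derivative_eq_intros d[OF q])
      have "2 * (r x q * S x q) \<le> a0 * (r x q)\<^sup>2 + (S x q)\<^sup>2 / a0"
      proof -
        have "0 \<le> (a0 * r x q - S x q)\<^sup>2 / a0" using a0 by simp
        then show ?thesis using a0 by (simp add: power2_eq_square field_simps)
      qed
      moreover have "a0 * (r x q)\<^sup>2 \<le> a x q * (r x q)\<^sup>2" using a[OF q] by (intro mult_right_mono) auto
      ultimately show "2 * r x q * (- a x q * r x q + S x q) \<le> - a0 * (r x q)\<^sup>2 + (S x q)\<^sup>2 / a0"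
        by (simp add: power2_eq_square algebra_simps)
    next
      show "continuous_on {0..T} (\<lambda>q. (S x q)\<^sup>2 / a0)"
        using a0 by (intro continuous_intros cont2_slice_t[OF S]) auto
    qed
    then show ?thesis using r by simp
  qed
  have tT: "{0..t} \<subseteq> {0..T}" using t by auto
  have pt2: "ennreal ((r x t)\<^sup>2) \<le> ennreal (exp (- a0 * t)) * ennreal ((r0 x)\<^sup>2)
      + (\<integral>\<^sup>+q\<in>{0..t}. ennreal (?E q / a0) * ennreal ((S x q)\<^sup>2) \<partial>lborel)" for x
  proof -
    have c: "continuous_on {0..t} (\<lambda>q. ?E q * ((S x q)\<^sup>2 / a0))"
      using a0 by (intro continuous_intros cont2_slice_t[OF S tT]) auto
    have "ennreal (integral {0..t} (\<lambda>q. ?E q * ((S x q)\<^sup>2 / a0))) =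
        (\<integral>\<^sup>+q\<in>{0..t}. ennreal (?E q * ((S x q)\<^sup>2 / a0)) \<partial>lborel)"
      using a0 by (intro nn_of_HK c) auto
    also have "\<dots> = (\<integral>\<^sup>+q\<in>{0..t}. ennreal (?E q / a0) * ennreal ((S x q)\<^sup>2) \<partial>lborel)"
      using a0 by (intro nn_integral_cong) (simp add: ennreal_mult[symmetric])
    finally have e: "ennreal (integral {0..t} (\<lambda>q. ?E q * ((S x q)\<^sup>2 / a0))) = \<dots>" .
    have "ennreal ((r x t)\<^sup>2) \<le> ennreal (exp (- a0 * t) * (r0 x)\<^sup>2 + integral {0..t} (\<lambda>q. ?E q * ((S x q)\<^sup>2 / a0)))"
      by (rule ennreal_leI[OF pt])
    also have "\<dots> = ennreal (exp (- a0 * t) * (r0 x)\<^sup>2) + ennreal (integral {0..t} (\<lambda>q. ?E q * ((S x q)\<^sup>2 / a0)))"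
      using a0 by (intro ennreal_plus integral_nonneg integrable_continuous_interval c) auto
    finally show ?thesis unfolding e by (simp add: ennreal_mult)
  qed
  have [measurable]: "(\<lambda>p. indicator {0..T} (snd p) * S (fst p) (snd p)) \<in> borel_measurable (borel \<Otimes>\<^sub>M borel)"
    by (rule cont2_measurable[OF S])
  have [measurable]: "r0 \<in> borel_measurable borel" by (rule r)
  define W where "W p = ennreal (?E (snd p) / a0) * ennreal ((indicator {0..T} (snd p) * S (fst p) (snd p))\<^sup>2) * indicator {0..t} (snd p)" for p :: "real \<times> real"
  have [measurable]: "W \<in> borel_measurable (borel \<Otimes>\<^sub>M borel)" unfolding W_def[abs_def] by measurable
  have We: "ennreal (?E q / a0) * ennreal ((S x q)\<^sup>2) * indicator {0..t} q = W (x, q)" for x q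
    using tT by (auto simp: W_def indicator_def)
  have "nsq (\<lambda>x. r x t) \<le>
     (\<integral>\<^sup>+x. ennreal (exp (- a0 * t)) * ennreal ((r0 x)\<^sup>2) + (\<integral>\<^sup>+q. W (x, q) \<partial>lborel) \<partial>lborel)"
    using pt2 unfolding We by (intro nn_integral_mono)
  also have "\<dots> = ennreal (exp (- a0 * t)) * nsq r0 + (\<integral>\<^sup>+x. (\<integral>\<^sup>+q. W (x, q) \<partial>lborel) \<partial>lborel)"
    by (subst nn_integral_add) (auto simp: nn_integral_cmult)
  also have "(\<integral>\<^sup>+x. (\<integral>\<^sup>+q. W (x, q) \<partial>lborel) \<partial>lborel) = (\<integral>\<^sup>+q. (\<integral>\<^sup>+x. W (x, q) \<partial>lborel) \<partial>lborel)"
    by (rule lborel_pair.Fubini'[symmetric]) (simp add: split_beta')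
  also have "\<dots> \<le> (\<integral>\<^sup>+q\<in>{0..t}. ennreal (?E q * (g q / a0)) \<partial>lborel)"
  proof (intro nn_integral_mono)
    fix q
    show "(\<integral>\<^sup>+x. W (x, q) \<partial>lborel) \<le> ennreal (?E q * (g q / a0)) * indicator {0..t} q"
    proof (cases "q \<in> {0..t}")
      case True
      then have q: "q \<in> {0..T}" using tT by auto
      have m: "(\<lambda>x. S x q) \<in> borel_measurable borel" using g[OF q] by (simp add: L2_def)
      have "(\<integral>\<^sup>+x. W (x, q) \<partial>lborel) = (\<integral>\<^sup>+x. ennreal (?E q / a0) * ennreal ((S x q)\<^sup>2) \<partial>lborel)"
        using True q by (intro nn_integral_cong) (simp add: W_def)
      also have "\<dots> = ennreal (?E q / a0) * nsq (\<lambda>x. S x q)"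
        using m by (intro nn_integral_cmult) measurable
      also have "\<dots> \<le> ennreal (?E q / a0) * ennreal (g q)"
        using g[OF q] by (intro mult_left_mono) (auto simp: L2_def)
      also have "\<dots> = ennreal (?E q * (g q / a0))"
        using g[OF q] a0 by (simp add: ennreal_mult[symmetric] L2_def)
      finally show ?thesis using True by simp
    qed (simp add: W_def)
  qed
  also have "ennreal (exp (- a0 * t)) * nsq r0 \<le> ennreal (exp (- a0 * t) * A)"
    using A by (simp add: L2_def ennreal_mult mult_left_mono)
  finally show ?thesis unfolding Duh_def by (simp add: add_mono)
qed

section \<open>Energy estimate for a parabolic equation with rough drift\<close>

lemma integral_boundary_zero:
  fixes f :: "real \<Rightarrow> real"
  assumes "a \<le> b" "\<And>x. x \<in> {a..b} \<Longrightarrow> (f has_real_derivative f' x) (at x)" "f a = 0" "f b = 0"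
  shows "(f' has_integral 0) {a..b}"
  using fundamental_theorem_of_calculus[of a b f f'] assms
  by (auto simp: has_real_derivative_iff_has_vector_derivative intro: has_vector_derivative_at_within)

text \<open>In the application, with weight \<chi>, one has a = \<chi> v_zz, \<mu> = \<chi> m v_z, q
  = \<chi> r, d = \<chi> v, e = \<chi>' v_z. Then g a + \<mu> + q is \<chi> v_t, and the other
  factor is the multiplier from differentiating the weighted norms of v and v_z. One half of the
  dissipation 2 g0 a^2 absorbs the mixed terms.\<close>

lemma energy_pointwise:
  fixes a \<mu> q d e g :: real
  assumes g: "0 < g0" "g0 \<le> g" "g \<le> g1"
  shows "2 * (g * a + \<mu> + q) * (d - 2 * e - a) \<le>
     - g0 * a\<^sup>2 + (8 * (2 * g1\<^sup>2 / g0 + 1) + 2 * (2 / g0 + 1)) * (d\<^sup>2 + e\<^sup>2 + \<mu>\<^sup>2 + q\<^sup>2)"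
proof -
  define w p where "w = d - 2 * e" and "p = \<mu> + q"
  have 1: "2 * g * a * w \<le> g0 / 2 * a\<^sup>2 + 2 * g1\<^sup>2 / g0 * w\<^sup>2"
  proof -
    have "0 \<le> (g0 * a - 2 * g * w)\<^sup>2 / (2 * g0)" using g by simp
    also have "\<dots> = g0 / 2 * a\<^sup>2 - 2 * g * a * w + 2 * g\<^sup>2 / g0 * w\<^sup>2"
      using g by (simp add: power2_eq_square field_simps)
    finally have "2 * g * a * w \<le> g0 / 2 * a\<^sup>2 + 2 * g\<^sup>2 / g0 * w\<^sup>2" by simp
    also have "2 * g\<^sup>2 / g0 * w\<^sup>2 \<le> 2 * g1\<^sup>2 / g0 * w\<^sup>2"
      using g by (intro mult_right_mono divide_right_mono mult_left_mono power_mono) auto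
    finally show ?thesis by simp
  qed
  have 2: "- 2 * p * a \<le> g0 / 2 * a\<^sup>2 + 2 / g0 * p\<^sup>2"
  proof -
    have "0 \<le> (g0 * a + 2 * p)\<^sup>2 / (2 * g0)" using g by simp
    also have "\<dots> = g0 / 2 * a\<^sup>2 + 2 * p * a + 2 / g0 * p\<^sup>2"
      using g by (simp add: power2_eq_square field_simps)
    finally show ?thesis by simp
  qed
  have 3: "2 * p * w \<le> p\<^sup>2 + w\<^sup>2" by (rule sum_squares_bound)
  have 4: "- 2 * g * a\<^sup>2 \<le> - 2 * g0 * a\<^sup>2" using g by (auto intro!: mult_right_mono)
  have "2 * (g * a + \<mu> + q) * (d - 2 * e - a) = - 2 * g * a\<^sup>2 + 2 * g * a * w + 2 * p * w + - 2 * p * a"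
    by (simp add: w_def p_def power2_eq_square algebra_simps)
  also have "\<dots> \<le> - g0 * a\<^sup>2 + (2 * g1\<^sup>2 / g0 + 1) * w\<^sup>2 + (2 / g0 + 1) * p\<^sup>2"
    using 1 2 3 4 by (simp add: algebra_simps)
  also have "(2 * g1\<^sup>2 / g0 + 1) * w\<^sup>2 \<le> (2 * g1\<^sup>2 / g0 + 1) * (8 * (d\<^sup>2 + e\<^sup>2))"
  proof (rule mult_left_mono)
    have "w\<^sup>2 \<le> 2 * d\<^sup>2 + 2 * (- 2 * e)\<^sup>2" using sq_sum_le[of d "- 2 * e"] by (simp add: w_def)
    also have "\<dots> = 2 * d\<^sup>2 + 8 * e\<^sup>2" by (simp add: power_mult_distrib)
    also have "\<dots> \<le> 8 * d\<^sup>2 + 8 * e\<^sup>2" by (intro add_right_mono mult_right_mono) auto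
    finally show "w\<^sup>2 \<le> 8 * (d\<^sup>2 + e\<^sup>2)" by (simp add: distrib_left)
  qed (use g in simp)
  also have "(2 / g0 + 1) * p\<^sup>2 \<le> (2 / g0 + 1) * (2 * (\<mu>\<^sup>2 + q\<^sup>2))"
    using g sq_sum_le[of \<mu> q] by (intro mult_left_mono) (auto simp: p_def)
  finally have "2 * (g * a + \<mu> + q) * (d - 2 * e - a) \<le> - g0 * a\<^sup>2 + 8 * (2 * g1\<^sup>2 / g0 + 1) * (d\<^sup>2 + e\<^sup>2)
      + 2 * (2 / g0 + 1) * (\<mu>\<^sup>2 + q\<^sup>2)" by (simp only: mult_ac)
  also have "\<dots> \<le> - g0 * a\<^sup>2 + (8 * (2 * g1\<^sup>2 / g0 + 1) + 2 * (2 / g0 + 1)) * (d\<^sup>2 + e\<^sup>2)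
      + (8 * (2 * g1\<^sup>2 / g0 + 1) + 2 * (2 / g0 + 1)) * (\<mu>\<^sup>2 + q\<^sup>2)"
    using g by (intro add_mono mult_right_mono order_refl) auto
  finally show ?thesis by (simp only: distrib_left add.assoc)
qed

definition par_A :: "real \<Rightarrow> real \<Rightarrow> real" where
  "par_A g0 g1 = 8 * (2 * g1\<^sup>2 / g0 + 1) + 2 * (2 / g0 + 1)"

lemma par_A_pos: assumes "g0 > 0" shows "par_A g0 g1 > 0"
proof -
  have "0 < 8 * (2 * g1\<^sup>2 / g0 + 1)" using assms by (intro mult_pos_pos add_nonneg_pos) auto
  moreover have "0 < 2 * (2 / g0 + 1)" using assms by (intro mult_pos_pos add_nonneg_pos) auto
  ultimately show ?thesis unfolding par_A_def by (rule add_pos_pos)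
qed

text \<open>Chosen such that par_A * B * 4 * d \<le> g0/4: interpolating the drift term with this
  length costs at most a quarter of the remaining dissipation.\<close>

definition par_d :: "real \<Rightarrow> real \<Rightarrow> real \<Rightarrow> real" where
  "par_d g0 g1 B = min 1 (g0 / (16 * par_A g0 g1 * (B + 1)))"

text \<open>Independent of \<Lambda>, which keeps the factor of the source independent of the decay
  rate.\<close>

definition par_K :: "real \<Rightarrow> real \<Rightarrow> real \<Rightarrow> real" where
  "par_K g0 g1 B = par_A g0 g1 * (1 + B * (2 / par_d g0 g1 B + 4))"

text \<open>The price of the rate \<Lambda>; it is paid in the norm of v without
  derivatives.\<close>

definition par_C :: "real \<Rightarrow> real \<Rightarrow> real \<Rightarrow> real \<Rightarrow> real" where
  "par_C \<Lambda> g0 g1 B = (par_K g0 g1 B + \<Lambda>) * (2 + (par_K g0 g1 B + \<Lambda>) / (2 * g0))"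

lemma prim_cut:
  fixes f f' :: "real \<Rightarrow> real"
  assumes R: "R > 0" and p: "prim f f'" and z: "f (- R) = 0" "f R = 0"
  shows "prim (\<lambda>x. indicator {-R..R} x * f x) (\<lambda>x. indicator {-R..R} x * f' x)"
proof -
  have [measurable]: "f' \<in> borel_measurable borel" using p by (rule prim_borel)
  have "set_integrable lborel {a..b} (\<lambda>x. indicator {-R..R} x * f' x)
    \<and> (LINT x:{a..b}|lborel. indicator {-R..R} x * f' x) = indicator {-R..R} b * f b - indicator {-R..R} a * f a"
    if ab: "a \<le> b" for a b
  proof -
    have e: "indicator {a..b} x *\<^sub>R (indicator {-R..R} x * f' x) = indicator {max a (-R)..min b R} x *\<^sub>R f' x" for x
      by (auto simp: indicator_def)
    have i: "set_integrable lborel {a..b} (\<lambda>x. indicator {-R..R} x * f' x)"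
      using prim_integrable[OF p, of "max a (-R)" "min b R"] unfolding set_integrable_def e .
    have "(LINT x:{a..b}|lborel. indicator {-R..R} x * f' x) = (LINT x:{max a (-R)..min b R}|lborel. f' x)"
      unfolding set_lebesgue_integral_def e ..
    also have "\<dots> = indicator {-R..R} b * f b - indicator {-R..R} a * f a"
    proof (cases "max a (-R) \<le> min b R")
      case True
      have "f (min b R) = indicator {-R..R} b * f b" "f (max a (-R)) = indicator {-R..R} a * f a"
        using True z R by (auto simp: indicator_def min_def max_def split: if_splits)
      then show ?thesis using prim_eq[OF p True] by simp
    next
      case False
      then have "{max a (-R)..min b R} = {}" by simp
      then have 0: "(LINT x:{max a (-R)..min b R}|lborel. f' x) = 0" by (simp only: set_lebesgue_integral_def) simp
      have "indicator {-R..R} b * f b = 0" "indicator {-R..R} a * f a = 0"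
        using False ab R by (auto simp: indicator_def)
      then show ?thesis by (simp only: 0)
    qed
    finally show ?thesis using i by simp
  qed
  then show ?thesis by (simp add: prim_def)
qed

text \<open>Pointwise derivatives and continuity only: neither decay of the terms at infinity nor a
  time derivative of \<open>vz\<close> is assumed. Hence the localisation to [-R, R] below.\<close>

locale parabolic =
  fixes T :: real and v vz vzz vt \<gamma> m r :: "real \<Rightarrow> real \<Rightarrow> real"
  assumes T: "T > 0"
    and cont: "cont2 T v" "cont2 T vz" "cont2 T vzz" "cont2 T vt" "cont2 T \<gamma>" "cont2 T m" "cont2 T r"
    and dz: "\<And>x t. t \<in> {0..T} \<Longrightarrow> ((\<lambda>x. v x t) has_real_derivative vz x t) (at x)"
    and dzz: "\<And>x t. t \<in> {0..T} \<Longrightarrow> ((\<lambda>x. vz x t) has_real_derivative vzz x t) (at x)"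
    and dt: "\<And>x t. t \<in> {0..T} \<Longrightarrow> ((\<lambda>t. v x t) has_real_derivative vt x t) (at t within {0..T})"
    and eq: "\<And>x t. t \<in> {0..T} \<Longrightarrow> vt x t = \<gamma> x t * vzz x t + m x t * vz x t + r x t"
begin

text \<open>The weight vanishes at \<open>\<plusminus>R\<close>, so that no boundary terms occur.\<close>

definition chi :: "real \<Rightarrow> real \<Rightarrow> real" where "chi R x = 1 - x\<^sup>2 / R\<^sup>2"

definition chi' :: "real \<Rightarrow> real \<Rightarrow> real" where "chi' R x = - 2 * x / R\<^sup>2"

lemma chi_deriv: "R > 0 \<Longrightarrow> (chi R has_real_derivative chi' R x) (at x)"
  unfolding chi_def[abs_def] chi'_def by (auto intro!: derivative_eq_intros simp: power2_eq_square field_simps)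

lemma chi_cont: "continuous_on S (chi R)" "continuous_on S (chi' R)"
  unfolding chi_def[abs_def] chi'_def[abs_def] divide_inverse by (intro continuous_intros)+

lemma chi_boundary: "R > 0 \<Longrightarrow> chi R R = 0" "R > 0 \<Longrightarrow> chi R (- R) = 0"
  by (auto simp: chi_def)

lemma chi_bounds:
  assumes "R > 0" "x \<in> {-R..R}" shows "0 \<le> chi R x" "chi R x \<le> 1" "(chi' R x)\<^sup>2 \<le> 4 / R\<^sup>2"
proof -
  have x: "x\<^sup>2 \<le> R\<^sup>2" using assms by (simp add: abs_le_square_iff[symmetric] abs_le_iff)
  then show "0 \<le> chi R x" "chi R x \<le> 1" using assms by (auto simp: chi_def)
  have "(chi' R x)\<^sup>2 = 4 * x\<^sup>2 / (R\<^sup>2 * R\<^sup>2)" by (simp add: chi'_def power_divide power_mult_distrib power2_eq_square)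
  also have "\<dots> \<le> 4 * R\<^sup>2 / (R\<^sup>2 * R\<^sup>2)" using x by (intro divide_right_mono) auto
  also have "\<dots> = 4 / R\<^sup>2" using assms by (simp add: divide_simps power2_eq_square)
  finally show "(chi' R x)\<^sup>2 \<le> 4 / R\<^sup>2" .
qed

definition W :: "real \<Rightarrow> (real \<Rightarrow> real \<Rightarrow> real) \<Rightarrow> real \<Rightarrow> real" where
  "W R f t = integral {-R..R} (\<lambda>x. f x t)"

abbreviation "WW R f \<equiv> W R (\<lambda>x t. (chi R x)\<^sup>2 * (f x t)\<^sup>2)"
abbreviation "WE R \<equiv> W R (\<lambda>x t. (chi' R x)\<^sup>2 * (vz x t)\<^sup>2)"

lemma W_cont: "cont2 T f \<Longrightarrow> continuous_on {0..T} (W R f)"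
  unfolding W_def[abs_def] by (rule cont2_integral)

lemma W_integrable: "cont2 T f \<Longrightarrow> t \<in> {0..T} \<Longrightarrow> (\<lambda>x. f x t) integrable_on {-R..R}"
  by (intro integrable_continuous_interval cont2_slice_x)

lemma W_add: "cont2 T f \<Longrightarrow> cont2 T g \<Longrightarrow> t \<in> {0..T} \<Longrightarrow> W R (\<lambda>x t. f x t + g x t) t = W R f t + W R g t"
  unfolding W_def by (intro Henstock_Kurzweil_Integration.integral_add W_integrable)

lemma W_cmul: "W R (\<lambda>x t. c * f x t) t = c * W R f t"
  unfolding W_def by simp

lemma W_mono: "cont2 T f \<Longrightarrow> cont2 T g \<Longrightarrow> t \<in> {0..T} \<Longrightarrow> (\<And>x. x \<in> {-R..R} \<Longrightarrow> f x t \<le> g x t) \<Longrightarrow> W R f t \<le> W R g t"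
  unfolding W_def by (intro integral_le W_integrable)

lemma cchi: "cont2 T (\<lambda>x t. chi R x)" "cont2 T (\<lambda>x t. chi' R x)"
  by (intro cont2_x chi_cont)+

lemmas c2 = cont2_add cont2_diff cont2_mult cont2_power cont2_const cont2_minus cchi cont

lemma energy0:
  assumes R: "R > 0" and t: "t \<in> {0..T}"
  shows "(WW R v has_real_derivative
     W R (\<lambda>x t. (chi R x)\<^sup>2 * (2 * v x t * vt x t)) t) (at t within {0..T})"
proof -
  have "((\<lambda>t. integral (cbox (-R) R) ((\<lambda>t x. (chi R x)\<^sup>2 * (v x t)\<^sup>2) t)) has_field_derivative
      integral (cbox (-R) R) ((\<lambda>t x. (chi R x)\<^sup>2 * (2 * v x t * vt x t)) t)) (at t within {0..T})"
  proof (rule leibniz_rule_field_derivative)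
    show "((\<lambda>t. (chi R x)\<^sup>2 * (v x t)\<^sup>2) has_field_derivative (chi R x)\<^sup>2 * (2 * v x t * vt x t)) (at t within {0..T})"
      if "t \<in> {0..T}" for x t
      by (auto intro!: derivative_eq_intros dt[OF that])
    show "(\<lambda>x. (chi R x)\<^sup>2 * (v x t)\<^sup>2) integrable_on cbox (-R) R" if "t \<in> {0..T}" for t
      using W_integrable[of "\<lambda>x t. (chi R x)\<^sup>2 * (v x t)\<^sup>2" t R] that by (simp add: c2)
    have "cont2 T (\<lambda>x t. (chi R x)\<^sup>2 * (2 * v x t * vt x t))" by (intro c2)
    then have "continuous_on ({0..T} \<times> cbox (-R) R) (\<lambda>q. (\<lambda>p. (chi R (fst p))\<^sup>2 * (2 * v (fst p) (snd p) * vt (fst p) (snd p))) (snd q, fst q))"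
      unfolding cont2_def by (rule continuous_on_compose2) (auto intro!: continuous_intros)
    then show "continuous_on ({0..T} \<times> cbox (-R) R) (\<lambda>(t, x). (chi R x)\<^sup>2 * (2 * v x t * vt x t))"
      by (simp add: split_beta')
  qed (use t in auto)
  then show ?thesis by (simp add: W_def[abs_def])
qed

definition P :: "real \<Rightarrow> real \<Rightarrow> real \<Rightarrow> real" where
  "P R x t = 2 * chi R x * chi' R x * vz x t + (chi R x)\<^sup>2 * vzz x t"

lemma P_cont: "cont2 T (P R)" unfolding P_def[abs_def] by (intro c2)

lemma P_deriv: "R > 0 \<Longrightarrow> t \<in> {0..T} \<Longrightarrow> ((\<lambda>x. (chi R x)\<^sup>2 * vz x t) has_real_derivative P R x t) (at x)"
  unfolding P_def by (auto intro!: derivative_eq_intros chi_deriv dzz simp: algebra_simps)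

lemma energy1_diff:
  assumes R: "R > 0" and t: "t \<in> {0..T}" and y: "y \<in> {0..T}"
  shows "WW R vz y - WW R vz t =
    - integral {-R..R} (\<lambda>x. (v x y - v x t) * (P R x y + P R x t))"
proof -
  have "((\<lambda>x. (vz x y - vz x t) * ((chi R x)\<^sup>2 * vz x y + (chi R x)\<^sup>2 * vz x t) + (v x y - v x t) * (P R x y + P R x t)) has_integral 0) {-R..R}"
  proof (rule integral_boundary_zero)
    show "((\<lambda>x. (v x y - v x t) * ((chi R x)\<^sup>2 * vz x y + (chi R x)\<^sup>2 * vz x t)) has_real_derivative
        (vz x y - vz x t) * ((chi R x)\<^sup>2 * vz x y + (chi R x)\<^sup>2 * vz x t) + (v x y - v x t) * (P R x y + P R x t)) (at x)" for x
      by (rule derivative_eq_intros refl dz[OF t] dz[OF y] P_deriv[OF R t] P_deriv[OF R y])+ (simp add: algebra_simps)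
  qed (use R chi_boundary in auto)
  then have z: "integral {-R..R} (\<lambda>x. (vz x y - vz x t) * ((chi R x)\<^sup>2 * vz x y + (chi R x)\<^sup>2 * vz x t) + (v x y - v x t) * (P R x y + P R x t)) = 0"
    by (rule integral_unique)
  have cc: "continuous_on {-R..R} (\<lambda>x. v x s)" "continuous_on {-R..R} (\<lambda>x. vz x s)" "continuous_on {-R..R} (\<lambda>x. P R x s)"
    if "s \<in> {0..T}" for s
    using cont2_slice_x[OF cont(1) that] cont2_slice_x[OF cont(2) that] cont2_slice_x[OF P_cont that] by auto
  have "integral {-R..R} (\<lambda>x. (vz x y - vz x t) * ((chi R x)\<^sup>2 * vz x y + (chi R x)\<^sup>2 * vz x t))
      = - integral {-R..R} (\<lambda>x. (v x y - v x t) * (P R x y + P R x t))"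
    using z by (subst (asm) Henstock_Kurzweil_Integration.integral_add)
      (auto intro!: integrable_continuous_interval continuous_intros cc t y chi_cont)
  moreover have "(\<lambda>x. (vz x y - vz x t) * ((chi R x)\<^sup>2 * vz x y + (chi R x)\<^sup>2 * vz x t))
      = (\<lambda>x. (chi R x)\<^sup>2 * (vz x y)\<^sup>2 - (chi R x)\<^sup>2 * (vz x t)\<^sup>2)"
    by (auto simp: power2_eq_square algebra_simps)
  moreover have "integral {-R..R} (\<lambda>x. (chi R x)\<^sup>2 * (vz x y)\<^sup>2 - (chi R x)\<^sup>2 * (vz x t)\<^sup>2)
     = WW R vz y - WW R vz t"
    unfolding W_def using t y
    by (intro Henstock_Kurzweil_Integration.integral_diff)
      (auto intro!: integrable_continuous_interval continuous_intros cc chi_cont)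
  ultimately show ?thesis by simp
qed

text \<open>\<open>vz\<close> need not be differentiable in time; integrating the difference of the energies by parts
  moves the time difference onto \<open>v\<close>.\<close>

lemma energy1:
  assumes R: "R > 0" and t: "t \<in> {0..T}"
  shows "(WW R vz has_real_derivative
     W R (\<lambda>x t. - 2 * vt x t * P R x t) t) (at t within {0..T})"
proof -
  have cc: "continuous_on {-R..R} (\<lambda>x. v x s)" "continuous_on {-R..R} (\<lambda>x. vt x s)" "continuous_on {-R..R} (\<lambda>x. P R x s)"
    if "s \<in> {0..T}" for s
    using cont2_slice_x[OF cont(1) that] cont2_slice_x[OF cont(4) that] cont2_slice_x[OF P_cont that] by auto
  let ?f = "WW R vz"
  \<comment> \<open>\<open>H\<close> has the factor \<open>P\<close> frozen at time t and is
    differentiable by the Leibniz rule; \<open>Q\<close> is the remainder. It is o(y - t), because v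
    is Lipschitz in time on the compact set and \<open>P\<close> is continuous.\<close>
  define H where "H y = integral {-R..R} (\<lambda>x. v x y * P R x t)" for y
  define Q where "Q y = integral {-R..R} (\<lambda>x. (v x y - v x t) * (P R x y - P R x t))" for y
  have dH: "(H has_real_derivative integral {-R..R} (\<lambda>x. vt x t * P R x t)) (at t within {0..T})"
  proof -
    have "((\<lambda>s. integral (cbox (-R) R) ((\<lambda>s x. v x s * P R x t) s)) has_field_derivative
        integral (cbox (-R) R) ((\<lambda>s x. vt x s * P R x t) t)) (at t within {0..T})"
    proof (rule leibniz_rule_field_derivative[where f="\<lambda>s x. v x s * P R x t" and fx="\<lambda>s x. vt x s * P R x t"])
      show "((\<lambda>s. v x s * P R x t) has_field_derivative vt x s * P R x t) (at s within {0..T})" if "s \<in> {0..T}" for x s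
        by (auto intro!: derivative_eq_intros dt[OF that])
      show "(\<lambda>x. v x s * P R x t) integrable_on cbox (-R) R" if "s \<in> {0..T}" for s
        using that t by (auto intro!: integrable_continuous_interval continuous_intros cc)
      have "cont2 T (\<lambda>x s. vt x s * P R x t)"
        by (intro c2 cont2_x cont2_slice_x[OF P_cont t])
      then have "continuous_on ({0..T} \<times> cbox (-R) R) (\<lambda>q. (\<lambda>p. vt (fst p) (snd p) * P R (fst p) t) (snd q, fst q))"
        unfolding cont2_def by (rule continuous_on_compose2) (auto intro!: continuous_intros)
      then show "continuous_on ({0..T} \<times> cbox (-R) R) (\<lambda>(s, x). vt x s * P R x t)"
        by (simp add: split_beta')
    qed (use t in auto)
    then show ?thesis by (simp add: H_def[abs_def])
  qed
  obtain K where K: "K \<ge> 0" "\<And>x s. x \<in> {-R..R} \<Longrightarrow> s \<in> {0..T} \<Longrightarrow> \<bar>vt x s\<bar> \<le> K"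
  proof -
    have "compact ({-R..R} \<times> {0..T})" by (intro compact_Times) auto
    moreover have "continuous_on ({-R..R} \<times> {0..T}) (\<lambda>p. vt (fst p) (snd p))"
      using cont(4) unfolding cont2_def by (rule continuous_on_subset) auto
    ultimately have "bounded ((\<lambda>p. vt (fst p) (snd p)) ` ({-R..R} \<times> {0..T}))"
      by (intro compact_imp_bounded compact_continuous_image)
    then obtain K where "\<And>x s. x \<in> {-R..R} \<Longrightarrow> s \<in> {0..T} \<Longrightarrow> \<bar>vt x s\<bar> \<le> K"
      unfolding bounded_iff by force
    then show thesis using that[of "\<bar>K\<bar>"] by force
  qed
  have lip: "\<bar>v x y - v x t\<bar> \<le> K * \<bar>y - t\<bar>" if "x \<in> {-R..R}" "y \<in> {0..T}" for x y
    using field_differentiable_bound[of "{0..T}" "v x" "vt x" K y t] dt K that t by auto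
  have Qb: "\<bar>Q y / (y - t)\<bar> \<le> K * integral {-R..R} (\<lambda>x. \<bar>P R x y - P R x t\<bar>)" if y: "y \<in> {0..T}" "y \<noteq> t" for y
  proof -
    have "norm (Q y) \<le> integral {-R..R} (\<lambda>x. K * \<bar>y - t\<bar> * \<bar>P R x y - P R x t\<bar>)"
      unfolding Q_def
    proof (rule Henstock_Kurzweil_Integration.integral_norm_bound_integral)
      fix x assume x: "x \<in> {-R..R}"
      show "norm ((v x y - v x t) * (P R x y - P R x t)) \<le> K * \<bar>y - t\<bar> * \<bar>P R x y - P R x t\<bar>"
        unfolding real_norm_def abs_mult by (rule mult_right_mono[OF lip[OF x y(1)]]) simp
    qed (use y t in \<open>auto intro!: integrable_continuous_interval continuous_intros cc\<close>)
    also have "\<dots> = \<bar>y - t\<bar> * (K * integral {-R..R} (\<lambda>x. \<bar>P R x y - P R x t\<bar>))" by simp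
    finally show ?thesis using y by (simp add: divide_le_eq mult.commute)
  qed
  have Ql: "((\<lambda>y. Q y / (y - t)) \<longlongrightarrow> 0) (at t within {0..T})"
  proof (rule Lim_null_comparison)
    have "cont2 T (\<lambda>x s. \<bar>P R x s - P R x t\<bar>)"
      using cont2_diff[OF P_cont cont2_x[OF cont2_slice_x[OF P_cont t]]]
      unfolding cont2_def by (intro continuous_on_rabs)
    then have "continuous_on {0..T} (\<lambda>s. K * integral {-R..R} (\<lambda>x. \<bar>P R x s - P R x t\<bar>))"
      by (intro continuous_intros cont2_integral)
    then have "((\<lambda>s. K * integral {-R..R} (\<lambda>x. \<bar>P R x s - P R x t\<bar>)) \<longlongrightarrow> K * integral {-R..R} (\<lambda>x. \<bar>P R x t - P R x t\<bar>)) (at t within {0..T})"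
      using t unfolding continuous_on_def by blast
    then show "((\<lambda>s. K * integral {-R..R} (\<lambda>x. \<bar>P R x s - P R x t\<bar>)) \<longlongrightarrow> 0) (at t within {0..T})" by simp
    show "\<forall>\<^sub>F y in at t within {0..T}. norm (Q y / (y - t)) \<le> K * integral {-R..R} (\<lambda>x. \<bar>P R x y - P R x t\<bar>)"
      using Qb by (auto simp: eventually_at_filter intro!: always_eventually)
  qed
  have key: "?f y - ?f t = - 2 * (H y - H t) - Q y" if y: "y \<in> {0..T}" for y
  proof -
    have i1: "(\<lambda>x. v x s * P R x t) integrable_on {-R..R}" if "s \<in> {0..T}" for s
      using that t by (auto intro!: integrable_continuous_interval continuous_intros cc)
    have i2: "(\<lambda>x. (v x y - v x t) * (P R x y - P R x t)) integrable_on {-R..R}"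
      using y t by (auto intro!: integrable_continuous_interval continuous_intros cc)
    have "((\<lambda>x. 2 * (v x y * P R x t - v x t * P R x t) + (v x y - v x t) * (P R x y - P R x t)) has_integral (2 * (H y - H t) + Q y)) {-R..R}"
      unfolding H_def Q_def by (intro has_integral_add has_integral_mult_right has_integral_diff integrable_integral i1 i2 y t)
    moreover have "(\<lambda>x. 2 * (v x y * P R x t - v x t * P R x t) + (v x y - v x t) * (P R x y - P R x t))
       = (\<lambda>x. (v x y - v x t) * (P R x y + P R x t))" by (auto simp: algebra_simps)
    ultimately show ?thesis using energy1_diff[OF R t y] by (simp add: integral_unique)
  qed
  have "((\<lambda>y. (H y - H t) / (y - t)) \<longlongrightarrow> integral {-R..R} (\<lambda>x. vt x t * P R x t)) (at t within {0..T})"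
    using dH by (simp add: has_field_derivative_iff)
  then have "((\<lambda>y. - 2 * ((H y - H t) / (y - t)) - Q y / (y - t)) \<longlongrightarrow> - 2 * integral {-R..R} (\<lambda>x. vt x t * P R x t) - 0) (at t within {0..T})"
    by (intro tendsto_intros Ql)
  then have "((\<lambda>y. (?f y - ?f t) / (y - t)) \<longlongrightarrow> - 2 * integral {-R..R} (\<lambda>x. vt x t * P R x t) - 0) (at t within {0..T})"
  proof (rule Lim_transform_eventually)
    show "\<forall>\<^sub>F y in at t within {0..T}. - 2 * ((H y - H t) / (y - t)) - Q y / (y - t) = (?f y - ?f t) / (y - t)"
      unfolding eventually_at_filter by (intro always_eventually allI impI) (simp add: key diff_divide_distrib)
  qed
  moreover have "W R (\<lambda>x t. - 2 * vt x t * P R x t) t = - 2 * integral {-R..R} (\<lambda>x. vt x t * P R x t)"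
    unfolding W_def by (simp add: mult.assoc)
  ultimately show ?thesis by (simp add: has_field_derivative_iff)
qed

lemma W_nn:
  assumes f: "cont2 T f" and t: "t \<in> {0..T}" and nn: "\<And>x. x \<in> {-R..R} \<Longrightarrow> 0 \<le> f x t"
  shows "ennreal (W R f t) = (\<integral>\<^sup>+x\<in>{-R..R}. ennreal (f x t) \<partial>lborel)"
  unfolding W_def by (rule nn_of_HK[OF cont2_slice_x[OF f t] nn])

lemma W_nonneg: "cont2 T f \<Longrightarrow> t \<in> {0..T} \<Longrightarrow> (\<And>x. x \<in> {-R..R} \<Longrightarrow> 0 \<le> f x t) \<Longrightarrow> 0 \<le> W R f t"
  unfolding W_def by (intro integral_nonneg W_integrable)

lemma W_le_L2:
  assumes R: "R > 0" and f: "cont2 T f" and t: "t \<in> {0..T}" and L: "L2 (\<lambda>x. f x t) A"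
  shows "WW R f t \<le> A" "W R (\<lambda>x t. (f x t)\<^sup>2) t \<le> A"
proof -
  have A: "0 \<le> A" "nsq (\<lambda>x. f x t) \<le> ennreal A" using L by (auto simp: L2_def)
  have "ennreal (W R (\<lambda>x t. (f x t)\<^sup>2) t) = (nsq_on {-R..R} (\<lambda>x. f x t))"
    by (rule W_nn[OF _ t]) (auto intro!: c2 f)
  also have "\<dots> \<le> nsq (\<lambda>x. f x t)"
    by (intro nn_integral_mono) (auto simp: indicator_def)
  finally show 2: "W R (\<lambda>x t. (f x t)\<^sup>2) t \<le> A" using A by (auto dest: order_trans)
  have "WW R f t \<le> W R (\<lambda>x t. (f x t)\<^sup>2) t"
  proof (rule W_mono[OF _ _ t])
    fix x assume "x \<in> {-R..R}"
    then have "(chi R x)\<^sup>2 \<le> 1" using chi_bounds(1,2)[OF R, of x] by (simp add: power_le_one)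
    then show "(chi R x)\<^sup>2 * (f x t)\<^sup>2 \<le> (f x t)\<^sup>2" using mult_right_mono[of "(chi R x)\<^sup>2" 1 "(f x t)\<^sup>2"] by simp
  qed (auto intro!: c2 f)
  then show "WW R f t \<le> A" using 2 by simp
qed

text \<open>The drift m is only in \<open>U2\<close>. Since \<chi> v_z vanishes at the ends, its
  extension by zero is absolutely continuous on the whole line, and \<open>U2_Hk_mult_interp\<close>
  applies to it.\<close>

lemma W_m:
  assumes R: "R > 0" and t: "t \<in> {0..T}" and B: "U2 (\<lambda>x. m x t) B" and d: "0 < d" "d \<le> 1"
  shows "W R (\<lambda>x t. (chi R x * m x t * vz x t)\<^sup>2) t \<le>
    B * (2 / d * WW R vz t
       + 4 * d * (WE R t + WW R vzz t))"
proof -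
  define f f' where "f x = chi R x * vz x t" and "f' x = chi' R x * vz x t + chi R x * vzz x t" for x
  have p: "prim f f'"
  proof (rule prim_deriv)
    show "(f has_real_derivative f' x) (at x)" for x
      unfolding f_def f'_def by (auto intro!: derivative_eq_intros chi_deriv[OF R] dzz[OF t])
    show "continuous_on UNIV f'" unfolding f'_def
      by (intro continuous_intros chi_cont cont2_slice_x[OF _ t] cont)
  qed
  have pc: "prim (\<lambda>x. indicator {-R..R} x * f x) (\<lambda>x. indicator {-R..R} x * f' x)"
    by (rule prim_cut[OF R p]) (auto simp: f_def chi_boundary R)
  have B0: "0 \<le> B" using B by (simp add: U2_def)
  let ?q = "\<lambda>x t. 2 / d * ((chi R x)\<^sup>2 * (vz x t)\<^sup>2) + 2 * d * (chi' R x * vz x t + chi R x * vzz x t)\<^sup>2"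
  have cq: "cont2 T ?q" by (intro c2)
  have "ennreal (W R (\<lambda>x t. (chi R x * m x t * vz x t)\<^sup>2) t)
      = (nsq_on {-R..R} (\<lambda>x. chi R x * m x t * vz x t))"
    by (rule W_nn[OF _ t]) (auto intro!: c2)
  also have "\<dots> = nsq (\<lambda>x. m x t * (indicator {-R..R} x * f x))"
    by (intro nn_integral_cong) (auto simp: indicator_def f_def mult_ac)
  also have "\<dots> \<le> ennreal B * (\<integral>\<^sup>+x. ennreal (2 / d * (indicator {-R..R} x * f x)\<^sup>2 + 2 * d * (indicator {-R..R} x * f' x)\<^sup>2) \<partial>lborel)"
    by (rule U2_Hk_mult_interp[OF B pc d])
  also have "(\<integral>\<^sup>+x. ennreal (2 / d * (indicator {-R..R} x * f x)\<^sup>2 + 2 * d * (indicator {-R..R} x * f' x)\<^sup>2) \<partial>lborel)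
      = (\<integral>\<^sup>+x\<in>{-R..R}. ennreal (?q x t) \<partial>lborel)"
    by (intro nn_integral_cong) (auto simp: indicator_def f_def f'_def power_mult_distrib)
  also have "\<dots> = ennreal (W R ?q t)"
    using d by (intro W_nn[symmetric] cq t) auto
  finally have "ennreal (W R (\<lambda>x t. (chi R x * m x t * vz x t)\<^sup>2) t) \<le> ennreal (B * W R ?q t)"
    using B0 by (simp add: ennreal_mult')
  moreover have q0: "0 \<le> W R ?q t" using d by (intro W_nonneg cq t) auto
  ultimately have "W R (\<lambda>x t. (chi R x * m x t * vz x t)\<^sup>2) t \<le> B * W R ?q t"
    using B0 by (subst (asm) ennreal_le_iff) auto
  also have "\<dots> \<le> B * W R (\<lambda>x t. 2 / d * ((chi R x)\<^sup>2 * (vz x t)\<^sup>2) + 4 * d * ((chi' R x)\<^sup>2 * (vz x t)\<^sup>2 + (chi R x)\<^sup>2 * (vzz x t)\<^sup>2)) t"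
  proof (rule mult_left_mono[OF _ B0], rule W_mono[OF cq _ t])
    fix x
    have "(chi' R x * vz x t + chi R x * vzz x t)\<^sup>2 \<le> 2 * ((chi' R x)\<^sup>2 * (vz x t)\<^sup>2 + (chi R x)\<^sup>2 * (vzz x t)\<^sup>2)"
      using sq_sum_le[of "chi' R x * vz x t" "chi R x * vzz x t"] by (simp add: power_mult_distrib)
    then have "2 * d * (chi' R x * vz x t + chi R x * vzz x t)\<^sup>2 \<le> 2 * d * (2 * ((chi' R x)\<^sup>2 * (vz x t)\<^sup>2 + (chi R x)\<^sup>2 * (vzz x t)\<^sup>2))"
      using d by (intro mult_left_mono) auto
    then show "?q x t \<le> 2 / d * ((chi R x)\<^sup>2 * (vz x t)\<^sup>2) + 4 * d * ((chi' R x)\<^sup>2 * (vz x t)\<^sup>2 + (chi R x)\<^sup>2 * (vzz x t)\<^sup>2)"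
      by (simp add: algebra_simps)
  qed (intro c2)
  also have "W R (\<lambda>x t. 2 / d * ((chi R x)\<^sup>2 * (vz x t)\<^sup>2) + 4 * d * ((chi' R x)\<^sup>2 * (vz x t)\<^sup>2 + (chi R x)\<^sup>2 * (vzz x t)\<^sup>2)) t
     = 2 / d * WW R vz t
       + 4 * d * (WE R t + WW R vzz t)"
    by (subst W_add[OF _ _ t] | subst W_cmul | intro c2 refl)+
  finally show ?thesis .
qed

text \<open>Integration by parts moves one derivative from v_z to \<chi>^2 v_z, and Young's
  inequality splits the product. The term \<open>WE\<close> is the error caused by differentiating
  the weight.\<close>

lemma W_interp:
  assumes R: "R > 0" and t: "t \<in> {0..T}" and eta: "\<eta> > 0"
  shows "WW R vz t \<le> \<eta> / 2 * WW R vzz t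
     + (1 / (2 * \<eta>) + 1) * WW R v t + WE R t"
proof -
  have "((\<lambda>x. vz x t * ((chi R x)\<^sup>2 * vz x t) + v x t * P R x t) has_integral 0) {-R..R}"
  proof (rule integral_boundary_zero)
    show "((\<lambda>x. v x t * ((chi R x)\<^sup>2 * vz x t)) has_real_derivative
        vz x t * ((chi R x)\<^sup>2 * vz x t) + v x t * P R x t) (at x)" for x
      by (rule derivative_eq_intros refl dz[OF t] P_deriv[OF R t])+ (simp add: algebra_simps)
  qed (use R chi_boundary in auto)
  then have z: "W R (\<lambda>x t. (chi R x)\<^sup>2 * (vz x t)\<^sup>2 + v x t * P R x t) t = 0"
    unfolding W_def by (simp add: integral_unique power2_eq_square mult_ac)
  have "WW R vz t = W R (\<lambda>x t. ((chi R x)\<^sup>2 * (vz x t)\<^sup>2 + v x t * P R x t) + - 1 * (v x t * P R x t)) t"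
    by simp
  also have "\<dots> = W R (\<lambda>x t. - 1 * (v x t * P R x t)) t"
    by (subst W_add[OF _ _ t]) (intro c2 P_cont | simp only: z add_0)+
  also have "\<dots> \<le> W R (\<lambda>x t. \<eta> / 2 * ((chi R x)\<^sup>2 * (vzz x t)\<^sup>2) + (1 / (2 * \<eta>) + 1) * ((chi R x)\<^sup>2 * (v x t)\<^sup>2) + (chi' R x)\<^sup>2 * (vz x t)\<^sup>2) t"
  proof (rule W_mono[OF _ _ t])
    fix x
    define a d e where "a = chi R x * vzz x t" and "d = chi R x * v x t" and "e = chi' R x * vz x t"
    have "0 \<le> (\<eta> * a + d)\<^sup>2 / (2 * \<eta>) + (d + e)\<^sup>2" using eta by simp
    also have "\<dots> = \<eta> / 2 * a\<^sup>2 + (1 / (2 * \<eta>) + 1) * d\<^sup>2 + e\<^sup>2 + (d * a + 2 * d * e)"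
      using eta by (simp add: power2_eq_square field_simps)
    also have "d * a + 2 * d * e = v x t * P R x t"
      by (simp add: a_def d_def e_def P_def power2_eq_square algebra_simps)
    finally show "- 1 * (v x t * P R x t) \<le> \<eta> / 2 * ((chi R x)\<^sup>2 * (vzz x t)\<^sup>2) + (1 / (2 * \<eta>) + 1) * ((chi R x)\<^sup>2 * (v x t)\<^sup>2) + (chi' R x)\<^sup>2 * (vz x t)\<^sup>2"
      by (simp add: a_def d_def e_def power_mult_distrib)
  qed (intro c2 P_cont)+
  also have "\<dots> = \<eta> / 2 * WW R vzz t
     + (1 / (2 * \<eta>) + 1) * WW R v t + WE R t"
    by (subst W_add[OF _ _ t] | subst W_cmul | intro c2 refl)+
  finally show ?thesis .
qed

text \<open>Of the dissipation g0 |v_zz|^2, a quarter absorbs the drift, a half pays for (K +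
  \<Lambda>) |v_z|^2 by interpolation, and the last quarter is dropped. In this way any rate
  \<Lambda> is reached, at the expense of a multiple of |v|^2.\<close>

lemma parabolic_estimate_R:
  assumes R: "R > 0" and g0: "0 < g0" and L: "\<Lambda> > 0"
    and g: "\<And>x t. t \<in> {0..T} \<Longrightarrow> g0 \<le> \<gamma> x t" "\<And>x t. t \<in> {0..T} \<Longrightarrow> \<gamma> x t \<le> g1"
    and B: "\<And>t. t \<in> {0..T} \<Longrightarrow> U2 (\<lambda>x. m x t) B"
    and Q: "\<And>t. t \<in> {0..T} \<Longrightarrow> L2 (\<lambda>x. vz x t) Q" and t: "t \<in> {0..T}"
  defines "y \<equiv> \<lambda>t. WW R v t + WW R vz t"
  shows "y t \<le> exp (- \<Lambda> * t) * y 0 + integral {0..t} (\<lambda>q. exp (- \<Lambda> * (t - q)) *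
     (par_C \<Lambda> g0 g1 B * (WW R v q + 4 / R\<^sup>2 * Q) + par_K g0 g1 B * WW R r q))"
proof (rule gronwall[OF t])
      let ?M = "W R (\<lambda>x t. (chi R x * m x t * vz x t)\<^sup>2)" and ?R = "WW R r"
  let ?y' = "\<lambda>t. W R (\<lambda>x t. (chi R x)\<^sup>2 * (2 * v x t * vt x t)) t + W R (\<lambda>x t. - 2 * vt x t * P R x t) t"
  fix q assume q: "q \<in> {0..T}"
  show "(y has_real_derivative ?y' q) (at q within {0..T})"
    unfolding y_def by (intro DERIV_add energy0 energy1 R q)
  have g01: "g0 \<le> g1" using g[OF q, of 0] by simp
  have B0: "0 \<le> B" using B[OF q] by (simp add: U2_def)
  define A where "A = par_A g0 g1"
  have A: "A > 0" unfolding A_def by (rule par_A_pos[OF g0])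
  define d where "d = par_d g0 g1 B"
  have d: "0 < d" "d \<le> 1" using g0 A B0 by (auto simp: d_def par_d_def A_def[symmetric])
  have dA: "A * B * (4 * d) \<le> g0 / 4"
  proof -
    have "d \<le> g0 / (16 * A * (B + 1))" by (simp add: d_def par_d_def A_def)
    then have "d * (16 * A * (B + 1)) \<le> g0" using A B0 by (simp add: le_divide_eq)
    moreover have "0 \<le> A * d" using A d by simp
    ultimately show ?thesis by (simp add: algebra_simps)
  qed
  have nn: "0 \<le> WW R v q" "0 \<le> WW R vz q" "0 \<le> WW R vzz q" "0 \<le> WE R q" "0 \<le> ?R q"
    by (auto intro!: W_nonneg c2 q)
  define K where "K = par_K g0 g1 B"
  have K: "K = A * (1 + B * (2 / d + 4))" by (simp add: K_def par_K_def A_def d_def)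
  have K0: "K > 0" unfolding K using A B0 d by (intro mult_pos_pos add_pos_nonneg) auto
  have "?y' q = W R (\<lambda>x t. (chi R x)\<^sup>2 * (2 * v x t * vt x t) + - 2 * vt x t * P R x t) q"
    by (subst W_add[OF _ _ q]) (intro c2 P_cont refl)+
  also have "\<dots> \<le> W R (\<lambda>x t. - g0 * ((chi R x)\<^sup>2 * (vzz x t)\<^sup>2) + A * ((chi R x)\<^sup>2 * (v x t)\<^sup>2 + (chi' R x)\<^sup>2 * (vz x t)\<^sup>2
      + (chi R x * m x t * vz x t)\<^sup>2 + (chi R x)\<^sup>2 * (r x t)\<^sup>2)) q"
  proof (rule W_mono[OF _ _ q])
    fix x
    show "(chi R x)\<^sup>2 * (2 * v x q * vt x q) + - 2 * vt x q * P R x q \<le> - g0 * ((chi R x)\<^sup>2 * (vzz x q)\<^sup>2) + A * ((chi R x)\<^sup>2 * (v x q)\<^sup>2 + (chi' R x)\<^sup>2 * (vz x q)\<^sup>2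
      + (chi R x * m x q * vz x q)\<^sup>2 + (chi R x)\<^sup>2 * (r x q)\<^sup>2)"
      using energy_pointwise[OF g0 g(1)[OF q, of x] g(2)[OF q, of x], of "chi R x * vzz x q" "chi R x * m x q * vz x q"
          "chi R x * r x q" "chi R x * v x q" "chi' R x * vz x q"] eq[OF q, of x]
      by (simp add: A_def par_A_def P_def power_mult_distrib power2_eq_square algebra_simps)
  qed (intro c2 P_cont)+
  also have "\<dots> = - g0 * WW R vzz q + A * (WW R v q + WE R q + ?M q + ?R q)"
    by (subst W_add[OF _ _ q] | subst W_cmul | intro c2 refl)+
  also have "\<dots> \<le> - g0 * WW R vzz q + A * (WW R v q + WE R q + B * (2 / d * WW R vz q + 4 * d * (WE R q + WW R vzz q)) + ?R q)"
    using W_m[OF R q B[OF q] d] A by (intro add_left_mono mult_left_mono add_mono) auto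
  also have "\<dots> = - g0 * WW R vzz q + (A * B * (4 * d)) * WW R vzz q + A * WW R v q + A * (1 + B * (4 * d)) * WE R q + A * (B * (2 / d)) * WW R vz q + A * ?R q"
    by (simp add: algebra_simps)
  also have "\<dots> \<le> - g0 * WW R vzz q + (g0 / 4) * WW R vzz q + K * WW R v q + K * WE R q + K * WW R vz q + K * ?R q"
  proof (intro add_mono mult_right_mono dA nn order_refl)
    have "B * (4 * d) \<le> B * 4" using B0 d by (intro mult_left_mono) auto
    moreover have "0 \<le> B * (2 / d)" "0 \<le> B * 4" using B0 d by auto
    ultimately have 1: "1 \<le> 1 + B * (2 / d + 4)" "1 + B * (4 * d) \<le> 1 + B * (2 / d + 4)" "B * (2 / d) \<le> 1 + B * (2 / d + 4)"
      by (simp_all add: distrib_left)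
    show "A \<le> K" "A * (1 + B * (4 * d)) \<le> K" "A * (B * (2 / d)) \<le> K" "A \<le> K"
      unfolding K using mult_left_mono[OF 1(1), of A] mult_left_mono[OF 1(2), of A] mult_left_mono[OF 1(3), of A] A by auto
  qed
  finally have e1: "?y' q \<le> - (3 / 4 * g0) * WW R vzz q + K * (WW R v q + WE R q + ?R q) + K * WW R vz q"
    by (simp add: algebra_simps)
  \<comment> \<open>This \<eta> makes (K + \<Lambda>) * \<eta>/2 equal to g0/2, the share of the
    dissipation reserved for the interpolation.\<close>
  define \<eta> where "\<eta> = g0 / (K + \<Lambda>)"
  have eta: "\<eta> > 0" "(K + \<Lambda>) * (\<eta> / 2) = g0 / 2" "1 / (2 * \<eta>) = (K + \<Lambda>) / (2 * g0)" 
    using g0 K0 L by (auto simp: \<eta>_def divide_simps)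
  have "(K + \<Lambda>) * WW R vz q \<le> (K + \<Lambda>) * (\<eta> / 2 * WW R vzz q + (1 / (2 * \<eta>) + 1) * WW R v q + WE R q)"
    using W_interp[OF R q eta(1)] K0 L by (intro mult_left_mono) auto
  also have "\<dots> = ((K + \<Lambda>) * (\<eta> / 2)) * WW R vzz q + (K + \<Lambda>) * ((1 / (2 * \<eta>) + 1) * WW R v q + WE R q)"
    by (simp add: algebra_simps)
  also have "\<dots> = g0 / 2 * WW R vzz q + (K + \<Lambda>) * (((K + \<Lambda>) / (2 * g0) + 1) * WW R v q + WE R q)"
    unfolding eta(2,3) ..
  finally have e2: "K * WW R vz q \<le> - \<Lambda> * WW R vz q + g0 / 2 * WW R vzz q + (K + \<Lambda>) * (((K + \<Lambda>) / (2 * g0) + 1) * WW R v q + WE R q)"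
    by (simp add: algebra_simps)
  define C where "C = par_C \<Lambda> g0 g1 B"
  have C: "C = (K + \<Lambda>) * (2 + (K + \<Lambda>) / (2 * g0))" by (simp add: C_def par_C_def K_def)
  have C2: "2 * (K + \<Lambda>) \<le> C" "0 \<le> C" unfolding C using K0 L g0 by (auto simp: distrib_left)
  have "WE R q \<le> W R (\<lambda>x t. 4 / R\<^sup>2 * (vz x t)\<^sup>2) q"
    by (rule W_mono[OF _ _ q]; (intro c2)?) (intro mult_right_mono chi_bounds R, auto)
  also have "\<dots> \<le> 4 / R\<^sup>2 * Q"
    unfolding W_cmul by (intro mult_left_mono W_le_L2(2)[OF R cont(2) q Q[OF q]]) simp
  finally have E: "WE R q \<le> 4 / R\<^sup>2 * Q" .
  have "?y' q \<le> - \<Lambda> * WW R vz q - g0 / 4 * WW R vzz q + K * (WW R v q + WE R q + ?R q) + (K + \<Lambda>) * (((K + \<Lambda>) / (2 * g0) + 1) * WW R v q + WE R q)"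
    using e1 e2 by (simp add: algebra_simps)
  also have "\<dots> \<le> - \<Lambda> * WW R vz q + K * (WW R v q + WE R q + ?R q) + (K + \<Lambda>) * (((K + \<Lambda>) / (2 * g0) + 1) * WW R v q + WE R q)"
    using nn g0 by simp
  also have "\<dots> = - \<Lambda> * (WW R v q + WW R vz q) + (C * WW R v q + (2 * K + \<Lambda>) * WE R q + K * ?R q)"
    by (simp add: C algebra_simps)
  also have "\<dots> \<le> - \<Lambda> * (WW R v q + WW R vz q) + (C * WW R v q + C * (4 / R\<^sup>2 * Q) + K * ?R q)"
  proof (intro add_mono order_refl)
    have "(2 * K + \<Lambda>) * WE R q \<le> C * WE R q" using C2 L nn by (intro mult_right_mono) auto
    also have "\<dots> \<le> C * (4 / R\<^sup>2 * Q)" using C2 E by (intro mult_left_mono)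
    finally show "(2 * K + \<Lambda>) * WE R q \<le> C * (4 / R\<^sup>2 * Q)" .
  qed
  finally show "?y' q \<le> - \<Lambda> * y q + (par_C \<Lambda> g0 g1 B * (WW R v q + 4 / R\<^sup>2 * Q) + par_K g0 g1 B * ?R q)"
    by (simp add: y_def C_def K_def distrib_left)
next
  show "continuous_on {0..T} (\<lambda>q. par_C \<Lambda> g0 g1 B * (WW R v q + 4 / R\<^sup>2 * Q) + par_K g0 g1 B * WW R r q)"
    by (intro continuous_intros W_cont c2)
qed

lemma chi_lim: "(\<lambda>n. (chi (real (Suc n)) x)\<^sup>2 * indicator {- real (Suc n)..real (Suc n)} x) \<longlonglongrightarrow> 1"
proof -
  have "(\<lambda>n. (1 - x\<^sup>2 * (1 / real (Suc n))\<^sup>2)\<^sup>2) \<longlonglongrightarrow> (1 - x\<^sup>2 * 0\<^sup>2)\<^sup>2"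
    using LIMSEQ_inverse_real_of_nat by (intro tendsto_intros) (simp add: inverse_eq_divide)
  then have l: "(\<lambda>n. (chi (real (Suc n)) x)\<^sup>2) \<longlonglongrightarrow> 1" by (simp add: chi_def power_divide)
  obtain N where N: "\<bar>x\<bar> \<le> real N" using real_arch_simple by blast
  have "\<forall>\<^sub>F n in sequentially. (chi (real (Suc n)) x)\<^sup>2 = (chi (real (Suc n)) x)\<^sup>2 * indicator {- real (Suc n)..real (Suc n)} x"
    using eventually_ge_at_top[of N]
  proof eventually_elim
    case (elim n)
    then have "x \<in> {- real (Suc n)..real (Suc n)}" using N by auto
    then show ?case by simp
  qed
  then show ?thesis using l by (rule Lim_transform_eventually[rotated])
qed

text \<open>R runs through the positive integers: the weights tend to 1, Fatou's lemma treats the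
  left side, and the cut-off error, a multiple of Q / R^2, disappears. So \<open>Q\<close> is a
  qualitative bound that leaves no trace in the conclusion.\<close>

theorem parabolic_estimate:
  assumes g0: "0 < g0" and L: "\<Lambda> > 0"
    and g: "\<And>x t. t \<in> {0..T} \<Longrightarrow> g0 \<le> \<gamma> x t" "\<And>x t. t \<in> {0..T} \<Longrightarrow> \<gamma> x t \<le> g1"
    and B: "\<And>t. t \<in> {0..T} \<Longrightarrow> U2 (\<lambda>x. m x t) B"
    and Q: "\<And>t. t \<in> {0..T} \<Longrightarrow> L2 (\<lambda>x. vz x t) Q" and t: "t \<in> {0..T}"
    and N: "\<And>t. t \<in> {0..T} \<Longrightarrow> L2 (\<lambda>x. v x t) (N t)" and rho: "\<And>t. t \<in> {0..T} \<Longrightarrow> L2 (\<lambda>x. r x t) (\<rho> t)"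
    and A: "L2 (\<lambda>x. v x 0) A" "L2 (\<lambda>x. vz x 0) A"
  shows "(\<integral>\<^sup>+x. ennreal ((v x t)\<^sup>2 + (vz x t)\<^sup>2) \<partial>lborel)
     \<le> Duh \<Lambda> (2 * A) (\<lambda>q. par_C \<Lambda> g0 g1 B * N q + par_K g0 g1 B * \<rho> q) t"
proof -
  define C K where "C = par_C \<Lambda> g0 g1 B" and "K = par_K g0 g1 B"
  have T0: "0 \<in> {0..T}" using T by simp
  have B0: "0 \<le> B" using B[OF T0] by (simp add: U2_def)
  have A0: "par_A g0 g1 > 0" by (rule par_A_pos[OF g0])
  have "0 < par_d g0 g1 B" using g0 A0 B0 by (auto simp: par_d_def)
  then have K0: "K \<ge> 0" unfolding K_def par_K_def using A0 B0 by (intro mult_nonneg_nonneg add_nonneg_nonneg) auto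
  then have C0: "C \<ge> 0" unfolding C_def par_C_def K_def[symmetric] using L g0 by (intro mult_nonneg_nonneg add_nonneg_nonneg) auto
  have Q0: "0 \<le> Q" using Q[OF T0] by (simp add: L2_def)
  have tT: "{0..t} \<subseteq> {0..T}" "0 \<le> t" using t by auto
  let ?k = "\<lambda>n x. (chi (real (Suc n)) x)\<^sup>2 * indicator {- real (Suc n)..real (Suc n)} x"
  define I where "I n = (\<integral>\<^sup>+x. ennreal (?k n x * ((v x t)\<^sup>2 + (vz x t)\<^sup>2)) \<partial>lborel)" for n
  have [measurable]: "(\<lambda>x. v x t) \<in> borel_measurable borel" "(\<lambda>x. vz x t) \<in> borel_measurable borel"
    using N[OF t] Q[OF t] by (auto simp: L2_def)
  have [measurable]: "chi R \<in> borel_measurable borel" for R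
    by (intro borel_measurable_continuous_onI chi_cont)
  have In: "I n \<le> Duh \<Lambda> (2 * A) (\<lambda>q. C * N q + K * \<rho> q) t + ennreal (t * (C * (4 / (real (Suc n))\<^sup>2 * Q)))" for n
  proof -
    define R where "R = real (Suc n)"
    have R: "R > 0" by (simp add: R_def)
        let ?R = "WW R r"
    let ?e = "\<lambda>q. exp (- \<Lambda> * (t - q))"
    define c where "c = C * (4 / R\<^sup>2 * Q)"
    have c0: "0 \<le> c" using C0 Q0 by (simp add: c_def)
    have cG: "continuous_on {0..t} (\<lambda>q. ?e q * (C * WW R v q + K * ?R q))"
      by (intro continuous_intros continuous_on_subset[OF W_cont tT(1)] c2)
    have nn: "0 \<le> WW R v q" "0 \<le> ?R q" if "q \<in> {0..T}" for q using that by (auto intro!: W_nonneg c2)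
    have "I n = (\<integral>\<^sup>+x\<in>{-R..R}. ennreal ((chi R x)\<^sup>2 * (v x t)\<^sup>2 + (chi R x)\<^sup>2 * (vz x t)\<^sup>2) \<partial>lborel)"
      unfolding I_def R_def by (intro nn_integral_cong) (auto simp: indicator_def distrib_left)
    also have "\<dots> = ennreal (W R (\<lambda>x t. (chi R x)\<^sup>2 * (v x t)\<^sup>2 + (chi R x)\<^sup>2 * (vz x t)\<^sup>2) t)"
      by (rule W_nn[symmetric, OF _ t]) (auto intro!: c2)
    also have "W R (\<lambda>x t. (chi R x)\<^sup>2 * (v x t)\<^sup>2 + (chi R x)\<^sup>2 * (vz x t)\<^sup>2) t = WW R v t + WW R vz t"
      by (rule W_add[OF _ _ t]) (intro c2)+
    also have "ennreal (WW R v t + WW R vz t) \<le> ennreal (exp (- \<Lambda> * t) * (2 * A) + (integral {0..t} (\<lambda>q. ?e q * (C * WW R v q + K * ?R q)) + t * c))"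
    proof (rule ennreal_leI)
      have "WW R v t + WW R vz t \<le> exp (- \<Lambda> * t) * (WW R v 0 + WW R vz 0) + integral {0..t} (\<lambda>q. ?e q * (C * (WW R v q + 4 / R\<^sup>2 * Q) + K * ?R q))"
        using parabolic_estimate_R[OF R g0 L g B Q t] unfolding C_def K_def by blast
      also have "WW R v 0 + WW R vz 0 \<le> 2 * A"
        using W_le_L2(1)[OF R cont(1) T0 A(1)] W_le_L2(1)[OF R cont(2) T0 A(2)] by simp
      also have "integral {0..t} (\<lambda>q. ?e q * (C * (WW R v q + 4 / R\<^sup>2 * Q) + K * ?R q)) \<le> integral {0..t} (\<lambda>q. ?e q * (C * WW R v q + K * ?R q) + c)"
      proof (rule integral_le)
        fix q assume q: "q \<in> {0..t}"
        have "?e q \<le> 1" using q L by simp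
        then have "?e q * c \<le> 1 * c" using c0 by (intro mult_right_mono)
        then show "?e q * (C * (WW R v q + 4 / R\<^sup>2 * Q) + K * ?R q) \<le> ?e q * (C * WW R v q + K * ?R q) + c"
          by (simp add: c_def algebra_simps)
      qed (intro integrable_continuous_interval continuous_intros cG continuous_on_subset[OF W_cont tT(1)] c2)+
      also have "\<dots> = integral {0..t} (\<lambda>q. ?e q * (C * WW R v q + K * ?R q)) + t * c"
        using tT by (subst Henstock_Kurzweil_Integration.integral_add[OF integrable_continuous_interval[OF cG]]) auto
      finally show "WW R v t + WW R vz t \<le> exp (- \<Lambda> * t) * (2 * A) + (integral {0..t} (\<lambda>q. ?e q * (C * WW R v q + K * ?R q)) + t * c)"
        by simp
    qed
    also have "\<dots> = ennreal (exp (- \<Lambda> * t) * (2 * A)) + ennreal (integral {0..t} (\<lambda>q. ?e q * (C * WW R v q + K * ?R q))) + ennreal (t * c)"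
    proof -
      have "0 \<le> A" using A by (simp add: L2_def)
      moreover have "0 \<le> integral {0..t} (\<lambda>q. ?e q * (C * WW R v q + K * ?R q))"
        using nn tT C0 K0 by (intro integral_nonneg integrable_continuous_interval cG) auto
      ultimately show ?thesis using c0 tT by (simp add: add.assoc)
    qed
    also have "ennreal (integral {0..t} (\<lambda>q. ?e q * (C * WW R v q + K * ?R q))) = (\<integral>\<^sup>+q\<in>{0..t}. ennreal (?e q * (C * WW R v q + K * ?R q)) \<partial>lborel)"
      using nn tT C0 K0 by (intro nn_of_HK cG) auto
    also have "\<dots> \<le> (\<integral>\<^sup>+q\<in>{0..t}. ennreal (?e q * (C * N q + K * \<rho> q)) \<partial>lborel)"
    proof (intro nn_integral_mono)
      fix q
      show "ennreal (?e q * (C * WW R v q + K * ?R q)) * indicator {0..t} q \<le> ennreal (?e q * (C * N q + K * \<rho> q)) * indicator {0..t} q"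
      proof (cases "q \<in> {0..t}")
        case True
        then have q: "q \<in> {0..T}" using tT by auto
        have "C * WW R v q + K * ?R q \<le> C * N q + K * \<rho> q"
          using W_le_L2(1)[OF R cont(1) q N[OF q]] W_le_L2(1)[OF R cont(7) q rho[OF q]] C0 K0
          by (intro add_mono mult_left_mono) auto
        then show ?thesis by (intro mult_right_mono ennreal_leI mult_left_mono) auto
      qed simp
    qed
    finally show ?thesis by (simp add: Duh_def c_def R_def add_mono)
  qed
  have "(\<integral>\<^sup>+x. ennreal ((v x t)\<^sup>2 + (vz x t)\<^sup>2) \<partial>lborel)
     = (\<integral>\<^sup>+x. liminf (\<lambda>n. ennreal (?k n x * ((v x t)\<^sup>2 + (vz x t)\<^sup>2))) \<partial>lborel)"
  proof (intro nn_integral_cong)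
    fix x
    have "(\<lambda>n. ennreal (?k n x * ((v x t)\<^sup>2 + (vz x t)\<^sup>2)))
        \<longlonglongrightarrow> ennreal (1 * ((v x t)\<^sup>2 + (vz x t)\<^sup>2))"
      by (intro tendsto_ennrealI tendsto_mult chi_lim tendsto_const)
    from lim_imp_Liminf[OF _ this] show "ennreal ((v x t)\<^sup>2 + (vz x t)\<^sup>2)
       = liminf (\<lambda>n. ennreal (?k n x * ((v x t)\<^sup>2 + (vz x t)\<^sup>2)))"
      by simp
  qed
  also have "\<dots> \<le> liminf I"
    unfolding I_def[abs_def] by (rule nn_integral_liminf) measurable
  also have "\<dots> \<le> liminf (\<lambda>n. Duh \<Lambda> (2 * A) (\<lambda>q. C * N q + K * \<rho> q) t + ennreal (t * (C * (4 / (real (Suc n))\<^sup>2 * Q))))"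
    using In by (intro Liminf_mono) auto
  also have "\<dots> = Duh \<Lambda> (2 * A) (\<lambda>q. C * N q + K * \<rho> q) t + ennreal (t * (C * (4 * 0\<^sup>2 * Q)))"
  proof (rule lim_imp_Liminf)
    have "(\<lambda>n. 4 * (1 / real (Suc n))\<^sup>2) \<longlonglongrightarrow> 4 * 0\<^sup>2"
      using LIMSEQ_inverse_real_of_nat by (intro tendsto_intros) (simp add: inverse_eq_divide)
    then have "(\<lambda>n. 4 / (real (Suc n))\<^sup>2) \<longlonglongrightarrow> 4 * 0\<^sup>2" by (simp add: power_divide)
    then show "(\<lambda>n. Duh \<Lambda> (2 * A) (\<lambda>q. C * N q + K * \<rho> q) t + ennreal (t * (C * (4 / (real (Suc n))\<^sup>2 * Q))))
       \<longlonglongrightarrow> Duh \<Lambda> (2 * A) (\<lambda>q. C * N q + K * \<rho> q) t + ennreal (t * (C * (4 * 0\<^sup>2 * Q)))"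
      by (intro tendsto_add tendsto_const tendsto_ennrealI tendsto_mult)
  qed simp
  finally show ?thesis by (simp add: C_def K_def)
qed

end

section \<open>Composition with diffeomorphisms\<close>

text \<open>The Jacobian is expressed at the image point, as for an autonomous differential
  equation: the derivative of f(Y) is then (\<phi> f')(Y), again a composition with the same Y. The
  bounds 1/2 and 2 fit both the coordinate change and its inverse.\<close>

definition flow :: "(real \<Rightarrow> real) \<Rightarrow> (real \<Rightarrow> real) \<Rightarrow> bool" where
  "flow Y \<phi> \<longleftrightarrow> (\<forall>z. (Y has_real_derivative \<phi> (Y z)) (at z)) \<and> continuous_on UNIV \<phi> \<and> (\<forall>x. 1/2 \<le> \<phi> x \<and> \<phi> x \<le> 2)"

lemma flow_D:
  assumes "flow Y \<phi>"
  shows "(Y has_real_derivative \<phi> (Y z)) (at z)" "continuous_on S \<phi>" "1/2 \<le> \<phi> x" "\<phi> x \<le> 2" "continuous_on S Y"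
    "continuous_on S (\<lambda>z. \<phi> (Y z))"
proof -
  show 1: "(Y has_real_derivative \<phi> (Y z)) (at z)" for z using assms by (simp add: flow_def)
  show 2: "continuous_on S \<phi>" for S using assms by (auto simp: flow_def intro: continuous_on_subset)
  show "1/2 \<le> \<phi> x" "\<phi> x \<le> 2" using assms by (auto simp: flow_def)
  show 3: "continuous_on S Y" for S using 1 by (meson DERIV_isCont continuous_at_imp_continuous_on)
  show "continuous_on S (\<lambda>z. \<phi> (Y z))" by (rule continuous_on_compose2[OF 2 3]) auto
qed

lemma flow_mono: assumes "flow Y \<phi>" "a \<le> b" shows "Y a \<le> Y b"
proof (rule DERIV_nonneg_imp_nondecreasing[OF assms(2)])
  fix x
  have "0 \<le> \<phi> (Y x)" using flow_D(3)[OF assms(1), of "Y x"] by simp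
  then show "\<exists>y. (Y has_real_derivative y) (at x) \<and> 0 \<le> y" using flow_D(1)[OF assms(1)] by blast
qed

lemma prim_comp:
  assumes p: "prim f g" and Y: "flow Y \<phi>"
  shows "prim (\<lambda>z. f (Y z)) (\<lambda>z. \<phi> (Y z) * g (Y z))"
proof -
  have [measurable]: "g \<in> borel_measurable borel" using p by (rule prim_borel)
  have [measurable]: "Y \<in> borel_measurable borel" "(\<lambda>z. \<phi> (Y z)) \<in> borel_measurable borel"
    using flow_D[OF Y] by (auto intro: borel_measurable_continuous_onI)
  have m: "(\<lambda>z. \<phi> (Y z) * g (Y z)) \<in> borel_measurable borel" by measurable
  have "set_integrable lborel {a..b} (\<lambda>z. \<phi> (Y z) * g (Y z)) \<and>
      (LINT z:{a..b}|lborel. \<phi> (Y z) * g (Y z)) = f (Y b) - f (Y a)" if ab: "a \<le> b" for a b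
  proof -
    have nn: "0 \<le> \<phi> (Y z)" for z using flow_D(3)[OF Y, of "Y z"] by simp
    note sub = integral_substitution[OF prim_integrable[OF p] flow_D(1)[OF Y] flow_D(6)[OF Y] nn ab]
    show ?thesis using sub prim_eq[OF p flow_mono[OF Y ab]]
      by (simp add: mult.commute set_lebesgue_integral_def)
  qed
  then show ?thesis using m by (simp add: prim_def)
qed

lemma L2_comp:
  assumes f: "L2 f A" and Y: "flow Y \<phi>"
  shows "L2 (\<lambda>z. f (Y z)) (2 * A)"
proof -
  have [measurable]: "f \<in> borel_measurable borel" using f by (simp add: L2_def)
  have [measurable]: "Y \<in> borel_measurable borel" "(\<lambda>z. \<phi> (Y z)) \<in> borel_measurable borel"
    using flow_D[OF Y] by (auto intro: borel_measurable_continuous_onI)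
  have A: "0 \<le> A" using f by (simp add: L2_def)
  have nn: "0 \<le> \<phi> (Y z)" for z using flow_D(3)[OF Y, of "Y z"] by simp
  let ?I = "\<lambda>n::nat. \<integral>\<^sup>+z\<in>{- real n..real n}. ennreal ((f (Y z))\<^sup>2) \<partial>lborel"
  have I: "?I n \<le> ennreal (2 * A)" for n
  proof -
    have "?I n \<le> (\<integral>\<^sup>+z. 2 * (ennreal ((f (Y z))\<^sup>2) * ennreal (\<phi> (Y z)) * indicator {- real n..real n} z) \<partial>lborel)"
    proof (intro nn_integral_mono)
      fix z
      have "ennreal ((f (Y z))\<^sup>2) * 1 \<le> ennreal ((f (Y z))\<^sup>2) * ennreal (2 * \<phi> (Y z))"
        using flow_D(3)[OF Y, of "Y z"] by (intro mult_left_mono) auto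
      then have "ennreal ((f (Y z))\<^sup>2) \<le> 2 * (ennreal ((f (Y z))\<^sup>2) * ennreal (\<phi> (Y z)))"
        using nn[of z] by (simp add: ennreal_mult mult_ac)
      then show "ennreal ((f (Y z))\<^sup>2) * indicator {- real n..real n} z
         \<le> 2 * (ennreal ((f (Y z))\<^sup>2) * ennreal (\<phi> (Y z)) * indicator {- real n..real n} z)"
        by (auto simp: indicator_def)
    qed
    also have "\<dots> = 2 * (\<integral>\<^sup>+z\<in>{- real n..real n}. ennreal ((f (Y z))\<^sup>2) * ennreal (\<phi> (Y z)) \<partial>lborel)"
      by (rule nn_integral_cmult) measurable
    also have "(\<integral>\<^sup>+z\<in>{- real n..real n}. ennreal ((f (Y z))\<^sup>2) * ennreal (\<phi> (Y z)) \<partial>lborel)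
       = nsq_on {Y (- real n)..Y (real n)} f"
    proof -
      have "(\<integral>\<^sup>+x. ennreal ((f x)\<^sup>2 * indicator {Y (- real n)..Y (real n)} x) \<partial>lborel)
        = (\<integral>\<^sup>+z. ennreal ((f (Y z))\<^sup>2 * \<phi> (Y z) * indicator {- real n..real n} z) \<partial>lborel)"
        by (rule nn_integral_substitution) (auto intro: flow_D(1,6)[OF Y] nn simp: set_borel_measurable_def)
      moreover have "ennreal ((f x)\<^sup>2 * indicator S x) = ennreal ((f x)\<^sup>2) * indicator S x" for x S
        by (auto simp: indicator_def)
      moreover have "ennreal ((f (Y z))\<^sup>2 * \<phi> (Y z) * indicator S z) = ennreal ((f (Y z))\<^sup>2) * ennreal (\<phi> (Y z)) * indicator S z" for z S
        using nn[of z] by (auto simp: indicator_def ennreal_mult)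
      ultimately show ?thesis by simp
    qed
    also have "\<dots> \<le> nsq f"
      by (intro nn_integral_mono) (auto simp: indicator_def)
    also have "\<dots> \<le> ennreal A" using f by (simp add: L2_def)
    finally show ?thesis using A by (simp add: two_ennreal mult_left_mono)
  qed
  have "nsq (\<lambda>z. f (Y z)) = (\<integral>\<^sup>+z. liminf (\<lambda>n. ennreal ((f (Y z))\<^sup>2) * indicator {- real n..real n} z) \<partial>lborel)"
  proof (intro nn_integral_cong)
    fix z
    obtain N where N: "\<bar>z\<bar> \<le> real N" using real_arch_simple by blast
    have "\<forall>\<^sub>F n in sequentially. ennreal ((f (Y z))\<^sup>2) = ennreal ((f (Y z))\<^sup>2) * indicator {- real n..real n} z"
      using eventually_ge_at_top[of N]
    proof eventually_elim
      case (elim n)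
      then have "z \<in> {- real n..real n}" using N by auto
      then show ?case by simp
    qed
    then have "(\<lambda>n. ennreal ((f (Y z))\<^sup>2) * indicator {- real n..real n} z) \<longlonglongrightarrow> ennreal ((f (Y z))\<^sup>2)"
      by (rule Lim_transform_eventually[OF tendsto_const])
    from lim_imp_Liminf[OF _ this] show "ennreal ((f (Y z))\<^sup>2) = liminf (\<lambda>n. ennreal ((f (Y z))\<^sup>2) * indicator {- real n..real n} z)"
      by simp
  qed
  also have "\<dots> \<le> liminf ?I" by (rule nn_integral_liminf) measurable
  also have "\<dots> \<le> liminf (\<lambda>n. ennreal (2 * A))" using I by (intro Liminf_mono) auto
  also have "\<dots> = ennreal (2 * A)" by (simp add: Liminf_const)
  finally show ?thesis using A by (simp add: L2_def)
qed

text \<open>The derivative of f(Y) is (\<phi> g)(Y) with g = f', so the induction hypothesis is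
  applied to the product \<phi> g. The constant depends on Y only through the bound \<open>B\<close>
  of \<phi>.\<close>

lemma Hk_comp:
  assumes s: "0 < s"
  shows "k \<le> s \<Longrightarrow> \<exists>C>0. \<forall>Y \<phi> f A. flow Y \<phi> \<longrightarrow> Gk s \<phi> B \<longrightarrow> Hk k f A \<longrightarrow> Hk k (\<lambda>z. f (Y z)) (C * A)"
proof (induction k)
  case 0
  have "Hk 0 (\<lambda>z. f (Y z)) (2 * A)" if "flow Y \<phi>" "Hk 0 f A" for Y \<phi> f A
    using L2_comp that by simp
  then show ?case by (intro exI[of _ 2]) auto
next
  case (Suc k)
  then obtain C where C: "C > 0" "\<And>Y \<phi> f A. flow Y \<phi> \<Longrightarrow> Gk s \<phi> B \<Longrightarrow> Hk k f A \<Longrightarrow> Hk k (\<lambda>z. f (Y z)) (C * A)"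
    by auto
  define D where "D = max 2 (C * (4 ^ Suc k * B))"
  have *: "Hk (Suc k) (\<lambda>z. f (Y z)) (D * A)" if Y: "flow Y \<phi>" and G: "Gk s \<phi> B" and H: "Hk (Suc k) f A" for Y \<phi> f A
  proof -
    obtain g where g: "prim f g" "Hk k g A" using H by auto
    have A: "0 \<le> A" by (rule Hk_nonneg[OF H])
    have "Hk k (\<lambda>x. \<phi> x * g x) (4 ^ Suc k * B * A)"
      by (rule Hk_mult[OF G g(2)]) (use s Suc.prems in auto)
    then have "Hk k (\<lambda>z. \<phi> (Y z) * g (Y z)) (C * (4 ^ Suc k * B * A))"
      by (rule C(2)[OF Y G])
    moreover have "C * (4 ^ Suc k * B * A) \<le> D * A"
      using A mult_right_mono[of "C * (4 ^ Suc k * B)" D A] by (simp add: D_def mult.assoc)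
    ultimately have "Hk k (\<lambda>z. \<phi> (Y z) * g (Y z)) (D * A)" by (rule Hk_mono)
    moreover have "L2 (\<lambda>z. f (Y z)) (D * A)"
      by (rule L2_mono[OF L2_comp[OF Hk_L2[OF H] Y]]) (use A in \<open>auto simp: D_def intro: mult_right_mono\<close>)
    ultimately show ?thesis using prim_comp[OF g(1) Y] by (simp, blast)
  qed
  have "D > 0" by (simp add: D_def)
  then show ?case using * by blast
qed

section \<open>Uniformly local bounds for reciprocals and for the transported profile\<close>

lemma OG_bounded: "(\<And>i x. i \<in> I \<Longrightarrow> (f i x)\<^sup>2 \<le> B) \<Longrightarrow> (\<And>i. i \<in> I \<Longrightarrow> f i \<in> borel_measurable borel) \<Longrightarrow> OG 0 I f"
  by (rule OG_I[of _ _ _ B]) (auto intro: U2_bounded)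

lemma Gk_deriv:
  assumes H: "Gk (Suc k) f B" and d: "\<And>x. (f has_real_derivative f' x) (at x)"
    and c: "continuous_on UNIV f'"
  shows "Gk k f' B"
proof -
  obtain g where g: "prim f g" "Gk k g B" using H by auto
  have p: "prim f f'" using d c by (rule prim_deriv)
  show ?thesis
  proof (cases k)
    case 0
    have "(nsq_on {x..x+1} f') = nsq_on {x..x+1} g" for x
      by (rule nn_integral_cong_AE) (use prim_unique_AE[OF p g(1)] in eventually_elim, simp)
    then show ?thesis using g(2) 0 prim_borel[OF p] by (simp add: U2_def)
  next
    case (Suc k')
    then have "continuous_on UNIV g" using g(2) by (auto intro: prim_continuous_on)
    then have "(f has_real_derivative g x) (at x)" for x by (rule prim_DERIV[OF g(1)])
    then have "g = f'" using d DERIV_unique by blast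
    then show ?thesis using g by simp
  qed
qed

lemma OG_deriv:
  assumes "OG (Suc k) I f" "\<And>i x. i \<in> I \<Longrightarrow> (f i has_real_derivative f' i x) (at x)"
    "\<And>i. i \<in> I \<Longrightarrow> continuous_on UNIV (f' i)"
  shows "OG k I f'"
proof -
  obtain B where B: "\<And>i. i \<in> I \<Longrightarrow> Gk (Suc k) (f i) B" using assms(1) by (auto simp: OG_def simp del: Gk.simps)
  show ?thesis by (rule OG_I[OF Gk_deriv[OF B assms(2,3)]])
qed

lemma OG_inverse:
  assumes g: "OG k I g" and c: "c > 0" "\<And>i x. i \<in> I \<Longrightarrow> c \<le> g i x"
    and d: "\<And>i x. i \<in> I \<Longrightarrow> (g i has_real_derivative g' i x) (at x)"
    and c': "\<And>i. i \<in> I \<Longrightarrow> continuous_on UNIV (g' i)"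
  shows "OG k I (\<lambda>i x. inverse (g i x))"
  using g
proof (induction k)
  have bd: "(inverse (g i x))\<^sup>2 \<le> (inverse c)\<^sup>2" if "i \<in> I" for i x
    using c(2)[OF that, of x] c(1) by (intro power_mono le_imp_inverse_le) auto
  have nz: "g i x \<noteq> 0" if "i \<in> I" for i x using c(2)[OF that, of x] c(1) by auto
  have cg: "continuous_on UNIV (g i)" if "i \<in> I" for i
    using d[OF that] by (meson DERIV_isCont continuous_at_imp_continuous_on)
  have b: "(\<lambda>x. inverse (g i x)) \<in> borel_measurable borel" if "i \<in> I" for i
    using borel_measurable_continuous_onI[OF cg[OF that]] by measurable
  {
    case 0
    show ?case by (rule OG_bounded[OF bd b])
  next
    case (Suc k)
    have IH: "OG k I (\<lambda>i x. inverse (g i x))" using Suc.IH OG_lower[OF Suc.prems] by simp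
    have G': "OG k I g'" by (rule OG_deriv[OF Suc.prems d c'])
    let ?d = "\<lambda>i x. - ((inverse (g i x) * inverse (g i x)) * g' i x)"
    have "OG k I ?d"
    proof (cases k)
      \<comment> \<open>At this order g' is only in \<open>U2\<close> and \<open>OG_mult\<close> is
        not applicable. The reciprocals are bounded pointwise by the lower bound \<open>c\<close>,
        which is enough.\<close>
      case 0
      obtain B where B: "\<And>i. i \<in> I \<Longrightarrow> U2 (g' i) B" using G' 0 by (auto simp: OG_def)
      have "Gk 0 (\<lambda>x. (inverse (g i x) * inverse (g i x)) * g' i x) ((inverse c)\<^sup>2 * (inverse c)\<^sup>2 * B)" if i: "i \<in> I" for i
      proof -
        have "U2 (\<lambda>x. (inverse (g i x) * inverse (g i x)) * g' i x) ((inverse c)\<^sup>2 * (inverse c)\<^sup>2 * B)"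
        proof (rule U2_bounded_mult)
          show "(inverse (g i x) * inverse (g i x))\<^sup>2 \<le> (inverse c)\<^sup>2 * (inverse c)\<^sup>2" for x
            unfolding power_mult_distrib using bd[OF i, of x] by (intro mult_mono) auto
          show "U2 (g' i) B" using B[OF i] .
        qed (use b[OF i] in measurable)
        then show ?thesis by simp
      qed
      then show ?thesis unfolding 0 by (intro OG_minus OG_I)
    next
      case k: (Suc k')
      show ?thesis by (intro OG_minus OG_mult[OF OG_mult[OF IH IH] G', of k k]) (use k in auto)
    qed
    moreover have "prim (\<lambda>x. inverse (g i x)) (?d i)" if i: "i \<in> I" for i
    proof (rule prim_deriv)
      show "((\<lambda>x. inverse (g i x)) has_real_derivative ?d i x) (at x)" for x
        using DERIV_inverse_fun[OF d[OF i] nz[OF i], of x] by (simp add: mult.commute mult.left_commute)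
      show "continuous_on UNIV (?d i)" using nz[OF i] by (intro continuous_intros cg c' i) auto
    qed
    ultimately show ?case by (intro OG_prim[OF bd])
  }
qed

lemma smooth_periodic_bounded:
  assumes s: "smooth f" and P: "P > 0" "\<And>x. f (x + P) = f x"
  shows "\<exists>B. \<forall>x. \<bar>f x\<bar> \<le> B"
proof -
  obtain K where K: "\<And>x. x \<in> {0..P} \<Longrightarrow> \<bar>f x\<bar> \<le> K"
    using bounded_on_Icc[OF smooth_continuous_on[OF s]] by blast
  have n: "f (x + real n * P) = f x" for n x
  proof (induction n)
    case (Suc n)
    have "f (x + real (Suc n) * P) = f ((x + real n * P) + P)" by (simp add: algebra_simps)
    then show ?case using P(2) Suc by simp
  qed simp
  have i: "f (x + of_int k * P) = f x" for k x
  proof (cases "k \<ge> 0")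
    case True
    then show ?thesis using n[of x "nat k"] by simp
  next
    case False
    then show ?thesis using n[of "x + of_int k * P" "nat (- k)"] by (simp add: algebra_simps)
  qed
  have "\<bar>f x\<bar> \<le> K" for x
  proof -
    define k where "k = - \<lfloor>x / P\<rfloor>"
    have fr: "0 \<le> x / P - of_int \<lfloor>x / P\<rfloor>" "x / P - of_int \<lfloor>x / P\<rfloor> \<le> 1"
      by linarith+
    have e: "x + of_int k * P = (x / P - of_int \<lfloor>x / P\<rfloor>) * P" using P(1) by (simp add: k_def field_simps)
    have "0 \<le> (x / P - of_int \<lfloor>x / P\<rfloor>) * P" using fr P(1) by (intro mult_nonneg_nonneg) auto
    moreover have "(x / P - of_int \<lfloor>x / P\<rfloor>) * P \<le> 1 * P" using fr P(1) by (intro mult_right_mono) auto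
    ultimately have "x + of_int k * P \<in> {0..P}" unfolding e by simp
    then show ?thesis using K i by metis
  qed
  then show ?thesis by blast
qed

lemma deriv_periodic:
  assumes s: "smooth f" and P: "\<And>x. f (x + P) = f x" shows "deriv f (x + P) = deriv f x"
proof -
  have "((\<lambda>y. f (y + P)) has_real_derivative deriv f (x + P)) (at x)"
    using smooth_DERIV[OF s, of "x + P"] by (simp add: DERIV_shift)
  moreover have "(\<lambda>y. f (y + P)) = f" using P by auto
  ultimately show ?thesis using DERIV_unique[OF _ smooth_DERIV[OF s, of x]] by simp
qed

text \<open>The derivative of f(X) is f'(X) X_z, again a smooth periodic function of X times
  \<open>Xz\<close>. Since \<open>Xz\<close> has order s, the composition has order up to s +
  1.\<close>

lemma OG_profile:
  assumes P: "P > 0"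
    and X: "\<And>i z. i \<in> I \<Longrightarrow> (X i has_real_derivative Xz i z) (at z)" "\<And>i. i \<in> I \<Longrightarrow> continuous_on UNIV (Xz i)"
    and G: "OG s I Xz" and s: "s > 0"
  shows "k \<le> Suc s \<Longrightarrow> smooth f \<Longrightarrow> (\<And>x. f (x + P) = f x) \<Longrightarrow> OG k I (\<lambda>i z. f (X i z))"
proof (induction k arbitrary: f)
  have cX: "continuous_on UNIV (X i)" if "i \<in> I" for i
    using X(1)[OF that] by (meson DERIV_isCont continuous_at_imp_continuous_on)
  have cc: "continuous_on UNIV (\<lambda>z. f (X i z))" if "smooth f" "i \<in> I" for f i
    by (rule continuous_on_compose2[OF smooth_continuous_on[OF that(1)] cX[OF that(2)]]) auto
  have bd: "\<exists>B. \<forall>x. (f x)\<^sup>2 \<le> B" if f: "smooth f" "\<And>x. f (x + P) = f x" for f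
  proof -
    obtain B where B: "\<And>x. \<bar>f x\<bar> \<le> B" using smooth_periodic_bounded[OF f(1) P f(2)] by blast
    have "(f x)\<^sup>2 \<le> B\<^sup>2" for x using power_mono[OF B[of x], of 2] by simp
    then show ?thesis by blast
  qed
  {
    case 0
    obtain B where "\<And>x. (f x)\<^sup>2 \<le> B" using bd[OF 0(2,3)] by blast
    then show ?case by (intro OG_bounded[where B=B] borel_measurable_continuous_onI cc 0) auto
  next
    case (Suc k)
    obtain B where B: "\<And>x. (f x)\<^sup>2 \<le> B" using bd[OF Suc.prems(2,3)] by blast
    have f': "smooth (deriv f)" "\<And>x. deriv f (x + P) = deriv f x"
      using smooth_deriv[OF Suc.prems(2)] deriv_periodic[OF Suc.prems(2,3)] by auto
    have "OG k I (\<lambda>i z. deriv f (X i z))" using Suc.IH[OF _ f'] Suc.prems(1) by simp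
    then have "OG k I (\<lambda>i z. deriv f (X i z) * Xz i z)"
      by (rule OG_mult[OF _ G]) (use Suc.prems(1) s in auto)
    moreover have "prim (\<lambda>z. f (X i z)) (\<lambda>z. deriv f (X i z) * Xz i z)" if i: "i \<in> I" for i
      by (rule prim_deriv) (auto intro!: continuous_intros cc f' i X(2) DERIV_chain2[OF smooth_DERIV[OF Suc.prems(2)] X(1)[OF i]])
    ultimately show ?case by (intro OG_prim[where B=B]) (auto intro: B)
  }
qed

section \<open>Lagrangian coordinates\<close>

text \<open>Partial derivatives of which one is jointly continuous give total differentiability,
  hence joint continuity of f itself. The notion of solution supplies the continuity of derivatives
  only.\<close>

lemma cont2_partials:
  assumes c: "cont2 T ft"
    and dx: "\<And>x t. t \<in> {0..T} \<Longrightarrow> ((\<lambda>x. f x t) has_real_derivative fx x t) (at x)"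
    and dt: "\<And>x t. t \<in> {0..T} \<Longrightarrow> ((\<lambda>t. f x t) has_real_derivative ft x t) (at t within {0..T})"
  shows "cont2 T f"
proof -
  have D: "((\<lambda>(x, t). f x t) has_derivative (\<lambda>(tx, ty). fx x t * tx + blinfun_scaleR_left (ft x t) ty)) (at (x, t) within UNIV \<times> {0..T})"
    if t: "t \<in> {0..T}" for x t
  proof (rule has_derivative_partialsI[where fy="\<lambda>x t. blinfun_scaleR_left (ft x t)"])
    show "((\<lambda>x. f x t) has_derivative (\<lambda>tx. fx x t * tx)) (at x within UNIV)"
      using dx[OF t] by (simp add: has_field_derivative_def)
    show "((\<lambda>y. f x y) has_derivative blinfun_apply (blinfun_scaleR_left (ft x y))) (at y within {0..T})" if "y \<in> {0..T}" for x y
      using dt[OF that] by (simp add: has_field_derivative_def mult_commute_abs)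
    have "continuous_on (UNIV \<times> {0..T}) (\<lambda>p. blinfun_scaleR_left (ft (fst p) (snd p)))"
      using c unfolding cont2_def by (intro continuous_intros)
    then show "continuous (at (x, t) within UNIV \<times> {0..T}) (\<lambda>(x, y). blinfun_scaleR_left (ft x y))"
      using t by (simp add: continuous_on_eq_continuous_within split_beta')
  qed (use t in auto)
  then have "continuous_on (UNIV \<times> {0..T}) (\<lambda>(x, t). f x t)"
    unfolding continuous_on_eq_continuous_within using has_derivative_continuous[OF D] by auto
  then show ?thesis by (simp add: cont2_def split_beta')
qed

locale coords =
  fixes T c :: real and \<psi> pt px :: "real \<Rightarrow> real \<Rightarrow> real"
  assumes T: "T > 0" and cpt: "cont2 T pt" and cpx: "cont2 T px"
    and dpx: "\<And>x t. t \<in> {0..T} \<Longrightarrow> ((\<lambda>x. \<psi> x t) has_real_derivative px x t) (at x)"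
    and dpt: "\<And>x t. t \<in> {0..T} \<Longrightarrow> ((\<lambda>t. \<psi> x t) has_real_derivative pt x t) (at t within {0..T})"
    and bpx: "\<And>x t. t \<in> {0..T} \<Longrightarrow> \<bar>px x t\<bar> \<le> 1/2"
begin

definition Phi :: "real \<Rightarrow> real \<Rightarrow> real" where "Phi x t = x - \<psi> x t + c * t"

lemma Phi_dx: "t \<in> {0..T} \<Longrightarrow> ((\<lambda>x. Phi x t) has_real_derivative 1 - px x t) (at x)"
  unfolding Phi_def by (auto intro!: derivative_eq_intros dpx)

lemma Phi_dt: "t \<in> {0..T} \<Longrightarrow> ((\<lambda>t. Phi x t) has_real_derivative c - pt x t) (at t within {0..T})"
  unfolding Phi_def by (auto intro!: derivative_eq_intros dpt)

lemma J_bounds: "t \<in> {0..T} \<Longrightarrow> 1/2 \<le> 1 - px x t" "t \<in> {0..T} \<Longrightarrow> 1 - px x t \<le> 3/2"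
  using bpx[of t x] by auto

lemma Phi_expand: assumes t: "t \<in> {0..T}" and xy: "x \<le> y" shows "(y - x) / 2 \<le> Phi y t - Phi x t"
proof (cases "x = y")
  case False
  then obtain z where "Phi y t - Phi x t = (y - x) * (1 - px z t)"
    using MVT2[of x y "\<lambda>x. Phi x t" "\<lambda>x. 1 - px x t"] Phi_dx[OF t] xy by auto
  moreover have "(y - x) * (1/2) \<le> (y - x) * (1 - px z t)" using J_bounds[OF t, of z] xy by (intro mult_left_mono) auto
  ultimately show ?thesis by simp
qed simp

lemma Phi_abs: assumes t: "t \<in> {0..T}" shows "\<bar>y - x\<bar> \<le> 2 * \<bar>Phi y t - Phi x t\<bar>"
  using Phi_expand[OF t, of x y] Phi_expand[OF t, of y x] by (cases "x \<le> y") auto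

lemma Phi_ex: assumes t: "t \<in> {0..T}" shows "\<exists>!x. Phi x t = z"
proof -
  define k where "k = 2 * \<bar>z - Phi 0 t\<bar>"
  have k: "k \<ge> 0" by (simp add: k_def)
  have "Phi 0 t + k / 2 \<le> Phi k t" "Phi (- k) t \<le> Phi 0 t - k / 2"
    using Phi_expand[OF t, of 0 k] Phi_expand[OF t, of "-k" 0] k by auto
  then have "Phi (- k) t \<le> z" "z \<le> Phi k t" by (auto simp: k_def abs_real_def split: if_splits)
  moreover have "continuous_on {-k..k} (\<lambda>x. Phi x t)"
    using Phi_dx[OF t] by (meson DERIV_isCont continuous_at_imp_continuous_on)
  ultimately obtain x where "Phi x t = z" using IVT'[of "\<lambda>x. Phi x t" "-k" z k] k by auto
  moreover have "x = y" if "Phi x t = z" "Phi y t = z" for x y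
    using Phi_abs[OF t, of x y] that by simp
  ultimately show ?thesis by blast
qed

definition X :: "real \<Rightarrow> real \<Rightarrow> real" where "X z t = (THE x. Phi x t = z)"

lemma Phi_X: "t \<in> {0..T} \<Longrightarrow> Phi (X z t) t = z"
  unfolding X_def by (rule theI'[OF Phi_ex])

lemma X_Phi: "t \<in> {0..T} \<Longrightarrow> X (Phi x t) t = x"
  using Phi_X[of t "Phi x t"] Phi_ex[of t "Phi x t"] by auto

lemma Phi_cont: "cont2 T Phi"
proof -
  have "cont2 T \<psi>" by (rule cont2_partials[OF cpt dpx dpt])
  then show ?thesis unfolding Phi_def[abs_def]
    by (intro cont2_add cont2_diff cont2_x cont2_t continuous_intros)
qed

text \<open>\<open>Phi\<close> is expanding in x, uniformly in time. Hence X at (z', t') differs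
  from x = X z t by at most twice the defect |z' - Phi x t'|, which tends to 0 by continuity of
  \<open>Phi\<close> in time.\<close>

lemma X_cont: "cont2 T X"
  unfolding cont2_def continuous_on_def
proof (intro ballI)
  fix p :: "real \<times> real" assume p: "p \<in> UNIV \<times> {0..T}"
  define z t where "z = fst p" and "t = snd p"
  have t: "t \<in> {0..T}" using p by (auto simp: t_def)
  show "((\<lambda>q. X (fst q) (snd q)) \<longlongrightarrow> X (fst p) (snd p)) (at p within UNIV \<times> {0..T})"
  proof (rule LIM_zero_cancel)
    show "((\<lambda>q. X (fst q) (snd q) - X (fst p) (snd p)) \<longlongrightarrow> 0) (at p within UNIV \<times> {0..T})"
    proof (rule Lim_null_comparison)
      have L: "((\<lambda>q::real\<times>real. 2 * \<bar>fst q - Phi (X z t) (snd q)\<bar>) \<longlongrightarrow> 2 * \<bar>fst p - Phi (X z t) (snd p)\<bar>) (at p within UNIV \<times> {0..T})"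
      proof -
        have "continuous_on (UNIV \<times> {0..T}) (\<lambda>q::real\<times>real. Phi (X z t) (snd q))"
          using cont2_t[of T "Phi (X z t)"] cont2_slice_t[OF Phi_cont, of "{0..T}" "X z t"] by (simp add: cont2_def)
        then have "continuous_on (UNIV \<times> {0..T}) (\<lambda>q::real\<times>real. 2 * \<bar>fst q - Phi (X z t) (snd q)\<bar>)"
          by (intro continuous_intros)
        then show ?thesis using p unfolding continuous_on_def by blast
      qed
      have "2 * \<bar>fst p - Phi (X z t) (snd p)\<bar> = 0" using Phi_X[OF t, of z] by (simp add: z_def t_def)
      with L show "((\<lambda>q::real\<times>real. 2 * \<bar>fst q - Phi (X z t) (snd q)\<bar>) \<longlongrightarrow> 0) (at p within UNIV \<times> {0..T})"
        by (simp only:)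
      show "\<forall>\<^sub>F q in at p within UNIV \<times> {0..T}. norm (X (fst q) (snd q) - X (fst p) (snd p)) \<le> 2 * \<bar>fst q - Phi (X z t) (snd q)\<bar>"
        unfolding eventually_at_filter
      proof (intro always_eventually allI impI)
        fix q :: "real \<times> real" assume "q \<in> UNIV \<times> {0..T}"
        then have q: "snd q \<in> {0..T}" by auto
        show "norm (X (fst q) (snd q) - X (fst p) (snd p)) \<le> 2 * \<bar>fst q - Phi (X z t) (snd q)\<bar>"
          using Phi_abs[OF q, of "X (fst q) (snd q)" "X z t"] Phi_X[OF q, of "fst q"] by (simp add: z_def t_def)
      qed
    qed
  qed
qed

lemma X_dz: assumes t: "t \<in> {0..T}" shows "((\<lambda>z. X z t) has_real_derivative 1 / (1 - px (X z t) t)) (at z)"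
proof -
  have "((\<lambda>z. X z t) has_real_derivative inverse (1 - px (X z t) t)) (at z)"
  proof (rule DERIV_inverse_function[where f="\<lambda>x. Phi x t" and a="z - 1" and b="z + 1"])
    show "((\<lambda>x. Phi x t) has_real_derivative 1 - px (X z t) t) (at (X z t))" by (rule Phi_dx[OF t])
    show "1 - px (X z t) t \<noteq> 0" using J_bounds[OF t, of "X z t"] by auto
    show "isCont (\<lambda>z. X z t) z"
      using cont2_slice_x[OF X_cont t, of UNIV] by (simp add: continuous_on_eq_continuous_at)
  qed (use Phi_X[OF t] in auto)
  then show ?thesis by (simp add: inverse_eq_divide)
qed

text \<open>Implicit differentiation on the closed time interval. The mean value theorem in x at
  time s gives Phi (X z s) s - Phi x s = (1 - px \<xi> s) (X z s - x) with \<xi> between the two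
  points; dividing by s - t and letting \<xi> tend to x yields the derivative.\<close>

lemma X_dt:
  assumes t: "t \<in> {0..T}"
  shows "((\<lambda>t. X z t) has_real_derivative (pt (X z t) t - c) / (1 - px (X z t) t)) (at t within {0..T})"
proof -
  define x where "x = X z t"
  have "\<forall>s. \<exists>\<xi>. s \<in> {0..T} \<longrightarrow> \<bar>\<xi> - x\<bar> \<le> \<bar>X z s - x\<bar> \<and> Phi (X z s) s - Phi x s = (1 - px \<xi> s) * (X z s - x)"
  proof (intro allI)
    fix s
    show "\<exists>\<xi>. s \<in> {0..T} \<longrightarrow> \<bar>\<xi> - x\<bar> \<le> \<bar>X z s - x\<bar> \<and> Phi (X z s) s - Phi x s = (1 - px \<xi> s) * (X z s - x)"
    proof (cases "s \<in> {0..T}")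
      case s: True
      consider "X z s = x" | "x < X z s" | "X z s < x" by linarith
      then show ?thesis
      proof cases
        case 1 then show ?thesis by auto
      next
        case 2
        then obtain \<xi> where "x < \<xi>" "\<xi> < X z s" "Phi (X z s) s - Phi x s = (X z s - x) * (1 - px \<xi> s)"
          using MVT2[of x "X z s" "\<lambda>x. Phi x s" "\<lambda>x. 1 - px x s"] Phi_dx[OF s] by blast
        then show ?thesis by (intro exI[of _ \<xi>]) (auto simp: mult.commute)
      next
        case 3
        then obtain \<xi> where "X z s < \<xi>" "\<xi> < x" "Phi x s - Phi (X z s) s = (x - X z s) * (1 - px \<xi> s)"
          using MVT2[of "X z s" x "\<lambda>x. Phi x s" "\<lambda>x. 1 - px x s"] Phi_dx[OF s] by blast
        then show ?thesis by (intro exI[of _ \<xi>]) (auto simp: algebra_simps)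
      qed
    next
      case False then show ?thesis by blast
    qed
  qed
  then obtain \<xi> where \<xi>: "\<And>s. s \<in> {0..T} \<Longrightarrow> \<bar>\<xi> s - x\<bar> \<le> \<bar>X z s - x\<bar>"
    "\<And>s. s \<in> {0..T} \<Longrightarrow> Phi (X z s) s - Phi x s = (1 - px (\<xi> s) s) * (X z s - x)" by metis
  have Xl: "((\<lambda>s. X z s) \<longlongrightarrow> x) (at t within {0..T})"
    using cont2_slice_t[OF X_cont order_refl, of z] t by (auto simp: continuous_on_def x_def)
  have \<xi>l: "(\<xi> \<longlongrightarrow> x) (at t within {0..T})"
  proof (rule LIM_zero_cancel, rule Lim_null_comparison)
    show "((\<lambda>s. \<bar>X z s - x\<bar>) \<longlongrightarrow> 0) (at t within {0..T})"
      using tendsto_rabs[OF LIM_zero[OF Xl]] by simp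
    show "\<forall>\<^sub>F s in at t within {0..T}. norm (\<xi> s - x) \<le> \<bar>X z s - x\<bar>"
      unfolding eventually_at_filter by (intro always_eventually allI impI) (simp add: \<xi>(1))
  qed
  have "((\<lambda>s. px (\<xi> s) s) \<longlongrightarrow> px x t) (at t within {0..T})"
  proof -
    have "((\<lambda>s. (\<xi> s, s)) \<longlongrightarrow> (x, t)) (at t within {0..T})" by (intro tendsto_Pair \<xi>l tendsto_ident_at)
    from continuous_on_tendsto_compose[OF cpx[unfolded cont2_def] this] show ?thesis
      using t by (simp add: eventually_at_filter always_eventually)
  qed
  then have l1: "((\<lambda>s. 1 - px (\<xi> s) s) \<longlongrightarrow> 1 - px x t) (at t within {0..T})" by (intro tendsto_intros)
  have l2: "((\<lambda>s. (Phi x s - Phi x t) / (s - t)) \<longlongrightarrow> c - pt x t) (at t within {0..T})"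
    using Phi_dt[OF t, of x] by (simp add: has_field_derivative_iff)
  have "((\<lambda>s. - ((Phi x s - Phi x t) / (s - t)) / (1 - px (\<xi> s) s)) \<longlongrightarrow> - (c - pt x t) / (1 - px x t)) (at t within {0..T})"
    by (intro tendsto_intros l1 l2) (use J_bounds[OF t, of x] in auto)
  then have "((\<lambda>s. (X z s - X z t) / (s - t)) \<longlongrightarrow> - (c - pt x t) / (1 - px x t)) (at t within {0..T})"
  proof (rule Lim_transform_eventually)
    show "\<forall>\<^sub>F s in at t within {0..T}. - ((Phi x s - Phi x t) / (s - t)) / (1 - px (\<xi> s) s) = (X z s - X z t) / (s - t)"
      unfolding eventually_at_filter
    proof (intro always_eventually allI impI)
      fix s assume s: "s \<noteq> t" "s \<in> {0..T}"
      have J: "1 - px (\<xi> s) s \<noteq> 0" using J_bounds[OF s(2), of "\<xi> s"] by auto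
      have "(1 - px (\<xi> s) s) * (X z s - x) = - (Phi x s - Phi x t)"
        using \<xi>(2)[OF s(2)] Phi_X[OF s(2), of z] Phi_X[OF t, of z] by (simp add: x_def)
      then have "X z s - x = - (Phi x s - Phi x t) / (1 - px (\<xi> s) s)"
        using J by (simp add: eq_divide_eq mult.commute)
      then have "(X z s - X z t) / (s - t) = - (Phi x s - Phi x t) / (1 - px (\<xi> s) s) / (s - t)"
        by (simp only: x_def)
      then show "- ((Phi x s - Phi x t) / (s - t)) / (1 - px (\<xi> s) s) = (X z s - X z t) / (s - t)"
        by (simp only: minus_divide_left divide_divide_eq_left mult.commute)
    qed
  qed
  then show ?thesis by (simp add: has_field_derivative_iff x_def)
qed

lemma chain_t:
  assumes t: "t \<in> {0..T}" and fx: "\<And>x t. t \<in> {0..T} \<Longrightarrow> ((\<lambda>x. f x t) has_real_derivative fx x t) (at x)"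
    and ft: "\<And>x t. t \<in> {0..T} \<Longrightarrow> ((\<lambda>t. f x t) has_real_derivative ft x t) (at t within {0..T})"
    and c: "cont2 T ft"
  shows "((\<lambda>t. f (X z t) t) has_real_derivative
    fx (X z t) t * ((pt (X z t) t - c) / (1 - px (X z t) t)) + ft (X z t) t) (at t within {0..T})"
proof -
  have "((\<lambda>(x, t). f x t) has_derivative (\<lambda>(tx, ty). fx (X z t) t * tx + blinfun_scaleR_left (ft (X z t) t) ty)) (at (X z t, t) within UNIV \<times> {0..T})"
  proof (rule has_derivative_partialsI[where fy="\<lambda>x t. blinfun_scaleR_left (ft x t)"])
    show "((\<lambda>x. f x t) has_derivative (\<lambda>tx. fx (X z t) t * tx)) (at (X z t) within UNIV)"
      using fx[OF t] by (simp add: has_field_derivative_def)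
    show "((\<lambda>y. f x y) has_derivative blinfun_apply (blinfun_scaleR_left (ft x y))) (at y within {0..T})" if "y \<in> {0..T}" for x y
      using ft[OF that] by (simp add: has_field_derivative_def mult_commute_abs)
    have "continuous_on (UNIV \<times> {0..T}) (\<lambda>p. blinfun_scaleR_left (ft (fst p) (snd p)))"
      using c unfolding cont2_def by (intro continuous_intros)
    then show "continuous (at (X z t, t) within UNIV \<times> {0..T}) (\<lambda>(x, y). blinfun_scaleR_left (ft x y))"
      using t by (simp add: continuous_on_eq_continuous_within split_beta')
  qed (use t in auto)
  then have D: "((\<lambda>(x, t). f x t) has_derivative (\<lambda>(tx, ty). fx (X z t) t * tx + ft (X z t) t * ty)) (at (X z t, t) within (\<lambda>s. (X z s, s)) ` {0..T})"
    by (rule has_derivative_subset[THEN has_derivative_eq_rhs]) (auto simp: mult.commute)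
  define d a b where "d = (pt (X z t) t - c) / (1 - px (X z t) t)" and "a = fx (X z t) t" and "b = ft (X z t) t"
  have "((\<lambda>s. X z s) has_derivative (*) d) (at t within {0..T})"
    using X_dt[OF t, of z] unfolding has_field_derivative_def d_def .
  from diff_chain_within[OF has_derivative_Pair[OF this has_derivative_ident] D]
  have "((\<lambda>s. f (X z s) s) has_derivative (\<lambda>h. a * (d * h) + b * h)) (at t within {0..T})"
    by (simp add: o_def a_def[symmetric] b_def[symmetric])
  moreover have "(\<lambda>h. a * (d * h) + b * h) = (*) (a * d + b)" by (auto simp: algebra_simps)
  ultimately show ?thesis by (simp add: has_field_derivative_def a_def b_def d_def)
qed

end

section \<open>Algebraic structure of the system\<close>

text \<open>Values at a point of the profile (subscript \<open>b\<close>), of the specific volume's inverse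
  \<open>s = 1/\<tau>\<close> and of derivatives; \<open>c ub1\<close> is eliminated through the profile equation.\<close>

lemma u_equation_algebra:
  fixes st sb :: real
  assumes prof: "- c * ub1 + sb * sb1 * iF = (1 - tb * ub\<^sup>2) + \<nu> * (2 * sb * sb1 * ub1 + sb\<^sup>2 * ub2)"
    and ut: "ut = ub + u" and tt: "tt = tb + \<tau>"
  shows "\<nu> * (st\<^sup>2 * (u2 + ub2 * (1 + p)\<^sup>2 + ub1 * p1) + 2 * st * st1 * (ub1 * (1 + p) + u1)) - st * st1 * iF
      + (1 - tt * ut\<^sup>2) - ub1 * (- c + q) =
    \<nu> * st\<^sup>2 * u2 + (2 * \<nu> * (st * st1)) * u1 +
    (\<nu> * ((st - sb) * ((st + sb) * ((1 + p) * (1 + p)) * ub2) + p * ((2 + p) * (sb * sb) * ub2) + p1 * (st * st * ub1))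
     + 2 * \<nu> * (p * (st * st1 * ub1) + (st1 - sb1) * (st * ub1) + (st - sb) * (sb1 * ub1))
     - iF * ((st1 - sb1) * st + (st - sb) * sb1)
     - (\<tau> * (ut * ut) + u * (tb * (ut + ub))) - q * ub1)"
proof -
  have "c * ub1 = sb * sb1 * iF - (1 - tb * ub\<^sup>2) - \<nu> * (2 * sb * sb1 * ub1 + sb\<^sup>2 * ub2)"
    using prof by simp
  then show ?thesis unfolding ut tt by (simp add: power2_eq_square algebra_simps)
qed

text \<open>The pressure term iF * st * st1 is \<kappa> * st times \<nu> * st1 and so becomes
  damping of the effective velocity. \<open>prof1\<close> rewrites the viscous term of the profile,
  so that on the right every undamped term has a factor that vanishes with the perturbation. Here q
  stands for X_t + c, ph for the quotient replacing X_z - 1, and dqq for the quotient of q.\<close>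

lemma omega_equation_algebra:
  fixes st sb :: real
  assumes prof: "- c * ub1 + sb * sb1 * iF = (1 - tb * ub\<^sup>2) + \<nu> * (2 * sb * sb1 * ub1 + sb\<^sup>2 * ub2)"
    and prof1: "c * sb2 = 2 * sb * sb1 * ub1 + sb\<^sup>2 * ub2"
    and ut: "ut = ub + u" and tt: "tt = tb + \<tau>" and k: "\<kappa> * \<nu> = iF"
  shows "(- iF * (st * st1) + (1 - tt * ut\<^sup>2)) - (ub1 + \<nu> * sb2) * (- c + q) - \<nu> * (sb2 * (- c + q) * ph + sb1 * dqq)
    = - (\<kappa> * st) * (u + \<nu> * st1 - \<nu> * sb1 * (1 + ph)) +
     (\<kappa> * (u * st) - iF * ((st - sb) * sb1) - (\<tau> * (ut * ut) + u * (tb * (ut + ub)))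
      - q * (ub1 + \<nu> * sb2) - iF * (ph * (st * sb1)) - \<nu> * (ph * (sb2 * (q - c))) - \<nu> * (dqq * sb1))"
proof -
  have "c * ub1 = sb * sb1 * iF - (1 - tb * ub\<^sup>2) - \<nu> * (c * sb2)"
    using prof prof1 by simp
  then show ?thesis unfolding ut tt k[symmetric] by (simp add: power2_eq_square algebra_simps)
qed

section \<open>The profile equations in terms of 1/\<tau>\<close>

locale profile =
  fixes F \<nu> c per :: real and \<tau>b ub :: "real \<Rightarrow> real"
  assumes F: "F > 0" and nu: "\<nu> > 0" and per: "per > 0"
    and smooth_tau: "smooth \<tau>b" and smooth_u: "smooth ub"
    and per_tau: "\<And>x. \<tau>b (x + per) = \<tau>b x" and per_u: "\<And>x. ub (x + per) = ub x"
    and pos_tau: "\<And>x. \<tau>b x > 0"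
    and prof1: "\<And>x. - c * deriv \<tau>b x - deriv ub x = 0"
    and prof2: "\<And>x. - c * deriv ub x + deriv (\<lambda>y. inverse (2 * F\<^sup>2) * inverse ((\<tau>b y)\<^sup>2)) x =
         1 - \<tau>b x * (ub x)\<^sup>2 + \<nu> * deriv (\<lambda>y. inverse ((\<tau>b y)\<^sup>2) * deriv ub y) x"
begin

definition "iF = 1 / F\<^sup>2"
definition "\<kappa> = 1 / (F\<^sup>2 * \<nu>)"
definition "t1 = deriv \<tau>b"
definition "t2 = deriv t1"
definition "v1 = deriv ub"
definition "v2 = deriv v1"
definition "sb x = inverse (\<tau>b x)"
definition "sb1 x = - (sb x * sb x * t1 x)"
definition "sb2 x = 2 * (sb x * sb x * sb x * (t1 x * t1 x)) - sb x * sb x * t2 x"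

lemma kappa: "\<kappa> * \<nu> = iF" "\<kappa> > 0" using F nu by (auto simp: \<kappa>_def iF_def)

lemma smooths: "smooth \<tau>b" "smooth ub" "smooth t1" "smooth t2" "smooth v1" "smooth v2"
  by (simp_all add: t1_def t2_def v1_def v2_def smooth_tau smooth_u smooth_deriv)

lemma periodics: "\<tau>b (x + per) = \<tau>b x" "ub (x + per) = ub x" "t1 (x + per) = t1 x" "t2 (x + per) = t2 x"
  "v1 (x + per) = v1 x" "v2 (x + per) = v2 x"
proof -
  show t: "\<tau>b (x + per) = \<tau>b x" and u: "ub (x + per) = ub x" for x by (rule per_tau per_u)+
  show t1: "t1 (x + per) = t1 x" for x unfolding t1_def by (rule deriv_periodic[OF smooth_tau per_tau])
  show v1: "v1 (x + per) = v1 x" for x unfolding v1_def by (rule deriv_periodic[OF smooth_u per_u])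
  show "t2 (x + per) = t2 x" unfolding t2_def by (rule deriv_periodic[OF smooths(3) t1])
  show "v2 (x + per) = v2 x" unfolding v2_def by (rule deriv_periodic[OF smooths(5) v1])
qed

lemma derivs:
  "(\<tau>b has_real_derivative t1 x) (at x)" "(t1 has_real_derivative t2 x) (at x)"
  "(ub has_real_derivative v1 x) (at x)" "(v1 has_real_derivative v2 x) (at x)"
  using smooth_DERIV[OF smooths(1)] smooth_DERIV[OF smooths(3)] smooth_DERIV[OF smooths(2)] smooth_DERIV[OF smooths(5)]
  by (simp_all add: t1_def t2_def v1_def v2_def)

lemma tau_nz: "\<tau>b x \<noteq> 0" using pos_tau[of x] by simp

lemma sb_derivs: "(sb has_real_derivative sb1 x) (at x)" "(sb1 has_real_derivative sb2 x) (at x)"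
proof -
  show 1: "(sb has_real_derivative sb1 x) (at x)" for x
    unfolding sb_def[abs_def] sb1_def using tau_nz[of x]
    by (auto intro!: derivative_eq_intros derivs simp: sb_def field_simps power2_eq_square)
  show "(sb1 has_real_derivative sb2 x) (at x)"
    unfolding sb1_def[abs_def] sb2_def
    by (rule derivative_eq_intros 1 derivs refl)+ (simp add: sb1_def algebra_simps)
qed

lemma conts: "continuous_on S \<tau>b" "continuous_on S ub" "continuous_on S t1" "continuous_on S t2"
  "continuous_on S v1" "continuous_on S v2" "continuous_on S sb" "continuous_on S sb1" "continuous_on S sb2"
proof -
  show c: "continuous_on S \<tau>b" "continuous_on S ub" "continuous_on S t1" "continuous_on S t2"
    "continuous_on S v1" "continuous_on S v2"
    using smooths smooth_continuous_on by auto
  show s: "continuous_on S sb" unfolding sb_def[abs_def] by (intro continuous_intros c) (use tau_nz in auto)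
  show "continuous_on S sb1" "continuous_on S sb2" unfolding sb1_def[abs_def] sb2_def[abs_def]
    by (intro continuous_intros c s)+
qed

lemma prof_v: "v1 x = - c * t1 x" "v2 x = - c * t2 x"
proof -
  show 1: "v1 x = - c * t1 x" for x using prof1[of x] by (simp add: t1_def v1_def)
  have "(v1 has_real_derivative - c * t2 x) (at x)"
  proof -
    have "v1 = (\<lambda>x. - c * t1 x)" using 1 by auto
    then show ?thesis using DERIV_cmult[OF derivs(2), of "-c" x] by simp
  qed
  then show "v2 x = - c * t2 x" using derivs(4) DERIV_unique by blast
qed

lemma prof_u: "- c * v1 x + sb x * sb1 x * iF = (1 - \<tau>b x * (ub x)\<^sup>2) + \<nu> * (2 * sb x * sb1 x * v1 x + (sb x)\<^sup>2 * v2 x)"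
proof -
  have e: "inverse ((\<tau>b y)\<^sup>2) = (sb y)\<^sup>2" for y by (simp add: sb_def power_inverse)
  have "((\<lambda>y. inverse (2 * F\<^sup>2) * (sb y)\<^sup>2) has_real_derivative sb x * sb1 x * iF) (at x)"
    using F by (auto intro!: derivative_eq_intros sb_derivs simp: iF_def field_simps power2_eq_square)
  then have 1: "deriv (\<lambda>y. inverse (2 * F\<^sup>2) * inverse ((\<tau>b y)\<^sup>2)) x = sb x * sb1 x * iF"
    unfolding e by (rule DERIV_imp_deriv)
  have "((\<lambda>y. (sb y)\<^sup>2 * v1 y) has_real_derivative 2 * sb x * sb1 x * v1 x + (sb x)\<^sup>2 * v2 x) (at x)"
    by (auto intro!: derivative_eq_intros sb_derivs derivs)
  then have 2: "deriv (\<lambda>y. inverse ((\<tau>b y)\<^sup>2) * deriv ub y) x = 2 * sb x * sb1 x * v1 x + (sb x)\<^sup>2 * v2 x"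
    unfolding v1_def[symmetric] e by (rule DERIV_imp_deriv)
  show ?thesis using prof2[of x] unfolding 1 2 by (simp add: v1_def)
qed

text \<open>In terms of sb = 1/\<tau> the first profile equation reads c sb' = sb^2 ub'; this is its
  derivative. It lets the viscous term of the profile be absorbed by the effective velocity.\<close>

lemma prof_w: "c * sb2 x = 2 * sb x * sb1 x * v1 x + (sb x)\<^sup>2 * v2 x"
  unfolding prof_v sb2_def sb1_def by (simp add: power2_eq_square algebra_simps)

lemma tau_bounds: obtains lo hi where "0 < lo" "\<And>x. lo \<le> \<tau>b x" "\<And>x. \<tau>b x \<le> hi"
proof -
  obtain hi where hi: "\<And>x. \<bar>\<tau>b x\<bar> \<le> hi" using smooth_periodic_bounded[OF smooth_tau per per_tau] by blast
  obtain x0 where x0: "x0 \<in> {0..per}" "\<And>x. x \<in> {0..per} \<Longrightarrow> \<tau>b x0 \<le> \<tau>b x"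
    using continuous_attains_inf[of "{0..per}" \<tau>b] per smooth_continuous_on[OF smooth_tau] by auto
  have n: "\<tau>b (x + real n * per) = \<tau>b x" for n x
  proof (induction n)
    case (Suc n)
    have "\<tau>b (x + real (Suc n) * per) = \<tau>b ((x + real n * per) + per)" by (simp add: algebra_simps)
    then show ?case using per_tau Suc by simp
  qed simp
  have i: "\<tau>b (x + of_int k * per) = \<tau>b x" for k x
  proof (cases "k \<ge> 0")
    case True
    then show ?thesis using n[of x "nat k"] by simp
  next
    case False
    then show ?thesis using n[of "x + of_int k * per" "nat (- k)"] by (simp add: algebra_simps)
  qed
  have "\<tau>b x0 \<le> \<tau>b x" for x
  proof -
    define k where "k = - \<lfloor>x / per\<rfloor>"
    have fr: "0 \<le> x / per - of_int \<lfloor>x / per\<rfloor>" "x / per - of_int \<lfloor>x / per\<rfloor> \<le> 1"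
      by linarith+
    have e: "x + of_int k * per = (x / per - of_int \<lfloor>x / per\<rfloor>) * per" using per by (simp add: k_def field_simps)
    have "0 \<le> (x / per - of_int \<lfloor>x / per\<rfloor>) * per" using fr per by (intro mult_nonneg_nonneg) auto
    moreover have "(x / per - of_int \<lfloor>x / per\<rfloor>) * per \<le> 1 * per" using fr per by (intro mult_right_mono) auto
    ultimately have "x + of_int k * per \<in> {0..per}" unfolding e by simp
    then show ?thesis using x0(2) i by metis
  qed
  then show ?thesis using that[of "\<tau>b x0" hi] pos_tau hi by (meson abs_le_D1)
qed

end

text \<open>Bounds at fixed times: an index stands for one time slice of one solution,
  \<open>p\<close> for X_z - 1 and \<open>q\<close> for X_t + c. The weight 1 in
  \<open>bound\<close> makes all of them multipliers; finer weights appear in the individual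
  lemmas.\<close>

locale slices = profile F \<nu> c per \<tau>b ub
  for F \<nu> c per :: real and \<tau>b ub :: "real \<Rightarrow> real" +
  fixes I :: "'i set" and s :: nat and lo :: real
    and X p p1 q \<tau> \<tau>1 u u1 :: "'i \<Rightarrow> real \<Rightarrow> real" and h :: "'i \<Rightarrow> real"
  assumes s: "s > 0" and lo: "lo > 0"
    and dX: "\<And>i z. i \<in> I \<Longrightarrow> (X i has_real_derivative 1 + p i z) (at z)"
    and dp: "\<And>i z. i \<in> I \<Longrightarrow> (p i has_real_derivative p1 i z) (at z)"
    and d\<tau>: "\<And>i z. i \<in> I \<Longrightarrow> (\<tau> i has_real_derivative \<tau>1 i z) (at z)"
    and du: "\<And>i z. i \<in> I \<Longrightarrow> (u i has_real_derivative u1 i z) (at z)"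
    and cont1: "\<And>i. i \<in> I \<Longrightarrow> continuous_on UNIV (p1 i)" "\<And>i. i \<in> I \<Longrightarrow> continuous_on UNIV (\<tau>1 i)"
      "\<And>i. i \<in> I \<Longrightarrow> continuous_on UNIV (u1 i)"
    and h: "\<And>i. i \<in> I \<Longrightarrow> 0 < h i \<and> h i \<le> 1"
    and low: "\<And>i z. i \<in> I \<Longrightarrow> lo \<le> \<tau>b (X i z) + \<tau> i z" "\<And>x. lo \<le> \<tau>b x"
    and bound: "OH s I p (\<lambda>_. 1)" "OH s I q (\<lambda>_. 1)" "OH s I \<tau> (\<lambda>_. 1)" "OH s I u (\<lambda>_. 1)"
begin

text \<open>Suffix \<open>b\<close>: profile; suffix \<open>1\<close>, \<open>2\<close>: derivatives in \<open>z\<close>; \<open>tt\<close>, \<open>ut\<close>: the full specific volume and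
  velocity; \<open>st = 1/tt\<close>; \<open>sg\<close>: perturbation of \<open>1/\<tau>\<close>; \<open>om\<close>: perturbation of the effective velocity, up to
  the replacement of \<open>p = X\<^sub>z - 1\<close> by its difference quotient \<open>ph\<close>; \<open>R0\<close>, \<open>Sh\<close>: source terms.\<close>

definition "Xz i z = 1 + p i z"
definition "tt i z = \<tau>b (X i z) + \<tau> i z"
definition "tt1 i z = t1 (X i z) * Xz i z + \<tau>1 i z"
definition "ut i z = ub (X i z) + u i z"
definition "st i z = inverse (tt i z)"
definition "st1 i z = - (st i z * st i z * tt1 i z)"
definition "sg i z = st i z - sb (X i z)"
definition "sg1 i z = st1 i z - sb1 (X i z) * Xz i z"
definition "ph i z = dq (h i) (X i) z - 1"
definition "om i z = u i z + \<nu> * st1 i z - \<nu> * sb1 (X i z) * (1 + ph i z)"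

definition "R0 i z =
    \<nu> * ((st i z - sb (X i z)) * ((st i z + sb (X i z)) * ((1 + p i z) * (1 + p i z)) * v2 (X i z))
       + p i z * ((2 + p i z) * (sb (X i z) * sb (X i z)) * v2 (X i z)) + p1 i z * (st i z * st i z * v1 (X i z)))
     + 2 * \<nu> * (p i z * (st i z * st1 i z * v1 (X i z)) + (st1 i z - sb1 (X i z)) * (st i z * v1 (X i z))
       + (st i z - sb (X i z)) * (sb1 (X i z) * v1 (X i z)))
     - iF * ((st1 i z - sb1 (X i z)) * st i z + (st i z - sb (X i z)) * sb1 (X i z))
     - (\<tau> i z * (ut i z * ut i z) + u i z * (\<tau>b (X i z) * (ut i z + ub (X i z)))) - q i z * v1 (X i z)"

definition "Sh i z =
    \<kappa> * (u i z * st i z) - iF * ((st i z - sb (X i z)) * sb1 (X i z))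
      - (\<tau> i z * (ut i z * ut i z) + u i z * (\<tau>b (X i z) * (ut i z + ub (X i z))))
      - q i z * (v1 (X i z) + \<nu> * sb2 (X i z)) - iF * (ph i z * (st i z * sb1 (X i z)))
      - \<nu> * (ph i z * (sb2 (X i z) * (q i z - c))) - \<nu> * (dq (h i) (q i) z * sb1 (X i z))"

lemma cont0: assumes i: "i \<in> I"
  shows "continuous_on UNIV (X i)" "continuous_on UNIV (p i)" "continuous_on UNIV (\<tau> i)" "continuous_on UNIV (u i)"
  using dX[OF i] dp[OF i] d\<tau>[OF i] du[OF i] by (meson DERIV_isCont continuous_at_imp_continuous_on)+

lemma contX: "i \<in> I \<Longrightarrow> continuous_on UNIV f \<Longrightarrow> continuous_on UNIV (\<lambda>z. f (X i z))"
  by (rule continuous_on_compose2[OF _ cont0(1)]) auto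

lemma G_Xz: "OG s I Xz" unfolding Xz_def[abs_def]
  by (intro OG_add OG_const OH_imp_OG[OF bound(1), of 1]) simp

lemma G_small: "OG s I p" "OG s I q" "OG s I \<tau>" "OG s I u"
  by (rule OH_imp_OG[OF bound(1), of 1] OH_imp_OG[OF bound(2), of 1] OH_imp_OG[OF bound(3), of 1] OH_imp_OG[OF bound(4), of 1]; simp)+

lemma G_prof:
  assumes "smooth f" "\<And>x. f (x + per) = f x" shows "OG s I (\<lambda>i z. f (X i z))"
proof (rule OG_profile[OF per _ _ G_Xz s _ assms])
  show "(X i has_real_derivative Xz i z) (at z)" if "i \<in> I" for i z using dX[OF that] by (simp add: Xz_def)
  show "continuous_on UNIV (Xz i)" if "i \<in> I" for i
    unfolding Xz_def[abs_def] by (intro continuous_intros cont0 that)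
qed simp

lemma GG: "OG s I f \<Longrightarrow> OG s I g \<Longrightarrow> OG s I (\<lambda>i z. f i z * g i z)"
  by (rule OG_mult) (use s in auto)

lemma G_b: "OG s I (\<lambda>i z. \<tau>b (X i z))" "OG s I (\<lambda>i z. ub (X i z))" "OG s I (\<lambda>i z. t1 (X i z))"
  "OG s I (\<lambda>i z. t2 (X i z))" "OG s I (\<lambda>i z. v1 (X i z))" "OG s I (\<lambda>i z. v2 (X i z))"
  by (intro G_prof smooths periodics)+

lemma tt_deriv: "i \<in> I \<Longrightarrow> (tt i has_real_derivative tt1 i z) (at z)"
  unfolding tt_def[abs_def] tt1_def Xz_def
  by (intro DERIV_add DERIV_chain2[OF derivs(1) dX] d\<tau>)

lemma tt1_cont: "i \<in> I \<Longrightarrow> continuous_on UNIV (tt1 i)"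
  unfolding tt1_def[abs_def] Xz_def by (intro continuous_intros contX conts cont0 cont1)

lemma tt_low: "i \<in> I \<Longrightarrow> lo \<le> tt i z" unfolding tt_def by (rule low)

lemma tt_nz: "i \<in> I \<Longrightarrow> tt i z \<noteq> 0" using tt_low[of i z] lo by auto

lemma G_tt: "OG s I tt" unfolding tt_def[abs_def] by (intro OG_add G_b G_small)

lemma G_ut: "OG s I ut" unfolding ut_def[abs_def] by (intro OG_add G_b G_small)

lemma G_st: "OG s I st" unfolding st_def[abs_def]
  by (rule OG_inverse[OF G_tt lo tt_low tt_deriv tt1_cont])

lemma G_sb: "OG s I (\<lambda>i z. sb (X i z))" unfolding sb_def[abs_def]
proof (rule OG_inverse[OF G_b(1) lo low(2)])
  show "((\<lambda>z. \<tau>b (X i z)) has_real_derivative t1 (X i z) * (1 + p i z)) (at z)" if "i \<in> I" for i z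
    by (rule DERIV_chain2[OF derivs(1) dX[OF that]])
  show "continuous_on UNIV (\<lambda>z. t1 (X i z) * (1 + p i z))" if "i \<in> I" for i
    by (intro continuous_intros contX conts cont0 that)
qed

lemma G_sb1: "OG s I (\<lambda>i z. sb1 (X i z))" unfolding sb1_def[abs_def] by (intro OG_minus GG G_sb G_b)

lemma G_sb2: "OG s I (\<lambda>i z. sb2 (X i z))" unfolding sb2_def[abs_def] by (intro OG_diff OG_cmul GG G_sb G_b)

lemma G_tt1: "OG (s - 1) I tt1"
  by (rule OG_deriv[OF _ tt_deriv tt1_cont]) (use G_tt s in simp)

lemma GG1: "OG s I f \<Longrightarrow> OG (s - 1) I g \<Longrightarrow> OG (s - 1) I (\<lambda>i z. f i z * g i z)"
  by (rule OG_mult) (use s in auto)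

lemma G_st1: "OG (s - 1) I st1" unfolding st1_def[abs_def]
  by (intro OG_minus GG1 GG G_st G_tt1)

lemma st_deriv: "i \<in> I \<Longrightarrow> (st i has_real_derivative st1 i z) (at z)"
  unfolding st_def[abs_def] st1_def
  using DERIV_inverse_fun[OF tt_deriv tt_nz, of i z] by (simp add: st_def mult.commute mult.left_commute)

lemma st_cont: "i \<in> I \<Longrightarrow> continuous_on UNIV (st i)"
  using st_deriv by (meson DERIV_isCont continuous_at_imp_continuous_on)

lemma st1_cont: "i \<in> I \<Longrightarrow> continuous_on UNIV (st1 i)"
  unfolding st1_def[abs_def] by (intro continuous_intros st_cont tt1_cont)

lemma sg_deriv: "i \<in> I \<Longrightarrow> (sg i has_real_derivative sg1 i z) (at z)"
  unfolding sg_def[abs_def] sg1_def Xz_def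
  by (intro DERIV_diff st_deriv DERIV_chain2[OF sb_derivs(1) dX])

lemma sg1_cont: "i \<in> I \<Longrightarrow> continuous_on UNIV (sg1 i)"
  unfolding sg1_def[abs_def] Xz_def by (intro continuous_intros st1_cont contX conts cont0)

lemma st_tt: "i \<in> I \<Longrightarrow> st i z * tt i z = 1" using tt_nz[of i z] by (simp add: st_def)

lemma sb_tau: "sb x * \<tau>b x = 1" using tau_nz[of x] by (simp add: sb_def)

lemma sg_eq: assumes i: "i \<in> I" shows "sg i z = - (\<tau> i z * (st i z * sb (X i z)))"
proof -
  have "sg i z = st i z * (sb (X i z) * \<tau>b (X i z)) - sb (X i z) * (st i z * tt i z)"
    unfolding st_tt[OF i] sb_tau by (simp add: sg_def)
  then show ?thesis by (simp add: tt_def algebra_simps)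
qed

lemma tau_eq: assumes i: "i \<in> I" shows "\<tau> i z = - (sg i z * (tt i z * \<tau>b (X i z)))"
proof -
  have "sg i z * (tt i z * \<tau>b (X i z)) = (st i z * tt i z) * \<tau>b (X i z) - (sb (X i z) * \<tau>b (X i z)) * tt i z"
    by (simp add: sg_def algebra_simps)
  then show ?thesis unfolding st_tt[OF i] sb_tau by (simp add: tt_def)
qed

lemma HG: "OH k I f A \<Longrightarrow> OG s I g \<Longrightarrow> k \<le> s \<Longrightarrow> OH k I (\<lambda>i z. f i z * g i z) A"
  by (rule OH_mult'[of k I f A s g k]) (use s in auto)

lemma HG1: "OH s I f A \<Longrightarrow> OG (s - 1) I g \<Longrightarrow> OH (s - 1) I (\<lambda>i z. f i z * g i z) A"
  by (rule OH_mult'[of s I f A "s - 1" g "s - 1"]) (use s in auto)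

lemma H_sg: "OH k I \<tau> A \<Longrightarrow> k \<le> s \<Longrightarrow> OH k I sg A"
proof -
  assume "OH k I \<tau> A" "k \<le> s"
  then have "OH k I (\<lambda>i z. - (\<tau> i z * (st i z * sb (X i z)))) A" by (intro OH_minus HG GG G_st G_sb)
  then show ?thesis
    by (rule OH_cong[where f="\<lambda>i z. - (\<tau> i z * (st i z * sb (X i z)))", rotated]) (rule sg_eq[symmetric])
qed

lemma H_sg1: "OH (Suc k) I \<tau> A \<Longrightarrow> Suc k \<le> s \<Longrightarrow> OH k I sg1 A"
  by (rule OH_deriv[OF H_sg sg_deriv sg1_cont])

lemma H_a1:
  assumes "OH (Suc k) I \<tau> A" "Suc k \<le> s" "OH s I p A"
  shows "OH k I (\<lambda>i z. st1 i z - sb1 (X i z)) A"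
proof -
  have "OH k I (\<lambda>i z. sg1 i z + p i z * sb1 (X i z)) A"
    using assms by (intro OH_add H_sg1 HG G_sb1 OH_lower[OF assms(3)]) auto
  then show ?thesis by (rule OH_cong[rotated]) (simp add: sg1_def Xz_def algebra_simps)
qed

text \<open>Each summand is a perturbation quantity times a multiplier. The worst ones contain
  z-derivatives of \<tau> or p, hence the order s - 1. In the product of p with \<open>st1\<close>
  the multiplier has order s - 1 only, and p must be used at the full order s.\<close>

lemma H_R0:
  assumes "OH s I \<tau> A" "OH s I u A" "OH s I p A" "OH s I q A"
  shows "OH (s - 1) I R0 A"
proof -
  have le: "s - 1 \<le> s" by simp
  have ss: "Suc (s - 1) = s" using s by simp
  have l: "OH (s - 1) I \<tau> A" "OH (s - 1) I u A" "OH (s - 1) I p A" "OH (s - 1) I q A"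
    using assms by (auto intro: OH_lower)
  have sg: "OH (s - 1) I (\<lambda>i z. st i z - sb (X i z)) A"
    using H_sg[OF l(1) le] by (simp add: sg_def[abs_def])
  have a1: "OH (s - 1) I (\<lambda>i z. st1 i z - sb1 (X i z)) A"
    by (rule H_a1) (use assms ss in auto)
  have p1: "OH (s - 1) I p1 A"
    by (rule OH_deriv[OF _ dp cont1(1)]) (use assms ss in auto)
  have G1: "OG s I (\<lambda>i z. (st i z + sb (X i z)) * ((1 + p i z) * (1 + p i z)) * v2 (X i z))"
    by (intro GG OG_add OG_const G_st G_sb G_small G_b)
  have G2: "OG s I (\<lambda>i z. (2 + p i z) * (sb (X i z) * sb (X i z)) * v2 (X i z))"
    by (intro GG OG_add OG_const G_st G_sb G_small G_b)
  have G3: "OG s I (\<lambda>i z. st i z * st i z * v1 (X i z))" by (intro GG G_st G_b)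
  have G4: "OG (s - 1) I (\<lambda>i z. st i z * st1 i z * v1 (X i z))"
  proof -
    have "OG (s - 1) I (\<lambda>i z. (v1 (X i z) * st i z) * st1 i z)" by (intro GG1 GG G_st G_b G_st1)
    then show ?thesis by (simp add: mult_ac)
  qed
  have G5: "OG s I (\<lambda>i z. st i z * v1 (X i z))" "OG s I (\<lambda>i z. sb1 (X i z) * v1 (X i z))"
    "OG s I (\<lambda>i z. ut i z * ut i z)" "OG s I (\<lambda>i z. \<tau>b (X i z) * (ut i z + ub (X i z)))"
    by (intro GG OG_add G_st G_b G_sb1 G_ut)+
  show ?thesis unfolding R0_def[abs_def]
    by (intro OH_add OH_diff OH_cmul HG[OF sg G1 le] HG[OF l(3) G2 le] HG[OF p1 G3 le] HG1[OF assms(3) G4]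
        HG[OF a1 G5(1) le] HG[OF sg G5(2) le] HG[OF a1 G_st le] HG[OF sg G_sb1 le] HG[OF l(1) G5(3) le]
        HG[OF l(2) G5(4) le] HG[OF l(4) G_b(5) le])
qed

text \<open>\<open>ph\<close> is the difference quotient of X(z) - z, whose derivative is
  \<open>p\<close>; X itself is not in L^2.\<close>

lemma H_ph: assumes "OH s I p A" shows "OH s I ph A"
proof -
  have pr: "prim (\<lambda>z. X i z - z) (p i)" if i: "i \<in> I" for i
    by (rule prim_deriv) (use dX[OF i] cont0[OF i] in \<open>auto intro!: derivative_eq_intros\<close>)
  have e: "ph i = dq (h i) (\<lambda>z. X i z - z)" if i: "i \<in> I" for i
    using h[OF i] by (auto simp: ph_def dq_def fun_eq_iff field_simps)
  obtain C where C: "C > 0" "\<And>i. i \<in> I \<Longrightarrow> Hk s (p i) (C * A i)" using assms by (auto simp: OH_def)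
  have ss: "Suc (s - 1) = s" using s by simp
  have "Hk s (ph i) (C * A i)" if i: "i \<in> I" for i
  proof -
    have "L2 (ph i) (C * A i)" unfolding e[OF i] using L2_dq[OF pr[OF i] Hk_L2[OF C(2)[OF i]]] h[OF i] by simp
    moreover have "prim (ph i) (dq (h i) (p i))" unfolding e[OF i] by (rule prim_dq[OF pr[OF i]])
    moreover have "Hk (s - 1) (dq (h i) (p i)) (C * A i)"
      by (rule Hk_dq) (use C(2)[OF i] ss h[OF i] in auto)
    ultimately have "Hk (Suc (s - 1)) (ph i) (C * A i)" by (simp, blast)
    then show ?thesis using ss by simp
  qed
  then show ?thesis by (rule OH_I[OF C(1)])
qed

text \<open>In contrast to \<open>H_R0\<close>, the orders s - 1 of \<tau> and u suffice, since no
  derivative of them is left in the damped equation. Interpolation can therefore make their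
  contribution small relative to the top norm.\<close>

lemma H_Sh:
  assumes "OH (s - 1) I \<tau> A" "OH (s - 1) I u A" "OH s I p A" "OH s I q A"
  shows "OH (s - 1) I Sh A"
proof -
  have le: "s - 1 \<le> s" by simp
  have ss: "Suc (s - 1) = s" using s by simp
  have l: "OH (s - 1) I p A" "OH (s - 1) I q A" "OH (s - 1) I ph A"
    by (rule OH_lower[OF assms(3) le] OH_lower[OF assms(4) le] OH_lower[OF H_ph[OF assms(3)] le])+
  have sg: "OH (s - 1) I (\<lambda>i z. st i z - sb (X i z)) A"
    using H_sg[OF assms(1) le] by (simp add: sg_def[abs_def])
  have dqq: "OH (s - 1) I (\<lambda>i. dq (h i) (q i)) A"
    by (rule OH_dq) (use assms ss h in auto)
  have G: "OG s I (\<lambda>i z. ut i z * ut i z)" "OG s I (\<lambda>i z. \<tau>b (X i z) * (ut i z + ub (X i z)))"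
    "OG s I (\<lambda>i z. v1 (X i z) + \<nu> * sb2 (X i z))" "OG s I (\<lambda>i z. st i z * sb1 (X i z))"
    "OG s I (\<lambda>i z. sb2 (X i z) * (q i z - c))"
    by (intro GG OG_add OG_diff OG_cmul OG_const G_st G_b G_sb1 G_sb2 G_ut G_small)+
  show ?thesis unfolding Sh_def[abs_def]
    by (intro OH_add OH_diff OH_cmul HG[OF assms(2) G_st le] HG[OF sg G_sb1 le] HG[OF assms(1) G(1) le]
        HG[OF assms(2) G(2) le] HG[OF l(2) G(3) le] HG[OF l(3) G(4) le] HG[OF l(3) G(5) le] HG[OF dqq G_sb1 le])
qed

lemma om_eq: "om i z = u i z + \<nu> * (sg1 i z + (p i z - ph i z) * sb1 (X i z))"
  by (simp add: om_def sg1_def Xz_def algebra_simps)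

lemma H_om:
  assumes "OH (Suc k) I \<tau> A" "OH (Suc k) I u A" "OH s I p A" "Suc k \<le> s"
  shows "OH k I om A"
proof -
  have le: "k \<le> s" "k \<le> Suc k" using assms by auto
  show ?thesis unfolding om_eq[abs_def]
    by (intro OH_add OH_cmul OH_lower[OF assms(2) le(2)] H_sg1[OF assms(1,4)] HG[OF _ G_sb1 le(1)]
        OH_diff OH_lower[OF assms(3) le(1)] OH_lower[OF H_ph[OF assms(3)] le(1)])
qed

text \<open>Subtracting u from the effective velocity leaves the derivative of the perturbation of
  1/\<tau>. With the L^2 bound this gives its norm of order s, and \<open>tau_eq\<close> returns to
  \<tau> without loss.\<close>

lemma H_recover:
  assumes "OH 0 I \<tau> A" "OH (s - 1) I u A" "OH (s - 1) I (\<lambda>i z. u i z + \<nu> * sg1 i z) A"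
  shows "OH s I \<tau> A"
proof -
  have ss: "Suc (s - 1) = s" using s by simp
  have "OH (s - 1) I (\<lambda>i z. (1/\<nu>) * ((u i z + \<nu> * sg1 i z) - u i z)) A"
    by (intro OH_cmul OH_diff assms)
  then have sg1: "OH (s - 1) I sg1 A" by (rule OH_cong[rotated]) (use nu in simp)
  have "OH (Suc (s - 1)) I sg A"
    by (rule OH_prim[OF H_sg[OF assms(1)] sg1]) (auto intro: prim_deriv sg_deriv sg1_cont)
  then have "OH s I sg A" using ss by simp
  then have "OH s I (\<lambda>i z. - (sg i z * (tt i z * \<tau>b (X i z)))) A"
    by (intro OH_minus HG GG G_tt G_b) auto
  then show ?thesis
    by (rule OH_cong[where f="\<lambda>i z. - (sg i z * (tt i z * \<tau>b (X i z)))", rotated]) (rule tau_eq[symmetric])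
qed

lemma u_equation:
  "\<nu> * ((st i z)\<^sup>2 * (u2 + v2 (X i z) * (1 + p i z)\<^sup>2 + v1 (X i z) * p1 i z)
      + 2 * st i z * st1 i z * (v1 (X i z) * (1 + p i z) + u1 i z)) - st i z * st1 i z * iF
      + (1 - tt i z * (ut i z)\<^sup>2) - v1 (X i z) * (- c + q i z) =
    \<nu> * (st i z)\<^sup>2 * u2 + (2 * \<nu> * (st i z * st1 i z)) * u1 i z + R0 i z"
  unfolding R0_def by (rule u_equation_algebra[OF prof_u ut_def tt_def])

lemma omega_equation:
  "(- iF * (st i z * st1 i z) + (1 - tt i z * (ut i z)\<^sup>2)) - (v1 (X i z) + \<nu> * sb2 (X i z)) * (- c + q i z)
     - \<nu> * (sb2 (X i z) * (- c + q i z) * ph i z + sb1 (X i z) * dq (h i) (q i) z)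
    = - (\<kappa> * st i z) * om i z + Sh i z"
  unfolding Sh_def om_def by (rule omega_equation_algebra[OF prof_u prof_w ut_def tt_def kappa(1)])

end

section \<open>The system in Lagrangian coordinates\<close>

lemma OH_subset: "OH k I f A \<Longrightarrow> J \<subseteq> I \<Longrightarrow> OH k J f A" by (auto simp: OH_def)

lemma time_integral_deriv:
  fixes f g :: "real \<Rightarrow> real"
  assumes "\<And>t. t \<in> {0..T} \<Longrightarrow> (f has_real_derivative g t) (at t within {0..T})" "t \<in> {0..T}"
  shows "(g has_integral (f t - f 0)) {0..t}"
proof (rule fundamental_theorem_of_calculus)
  show "0 \<le> t" using assms(2) by simp
  fix q assume "q \<in> {0..t}"
  then have "q \<in> {0..T}" "{0..t} \<subseteq> {0..T}" using assms(2) by auto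
  then show "(f has_vector_derivative g q) (at q within {0..t})"
    using has_vector_derivative_within_subset[of f "g q" q "{0..T}" "{0..t}"] assms(1)[of q]
    by (simp add: has_real_derivative_iff_has_vector_derivative)
qed

text \<open>Integrating g in time and differentiating under the integral sign gives fz(z,r) =
  fz(z,0) + the integral of gz(z,.) over [0,r]. So the time derivative of fz is a consequence and
  need not be given.\<close>

lemma schwarz:
  fixes f fz g gz :: "real \<Rightarrow> real \<Rightarrow> real"
  assumes fz: "\<And>z t. t \<in> {0..T} \<Longrightarrow> ((\<lambda>z. f z t) has_real_derivative fz z t) (at z)"
    and ft: "\<And>z t. t \<in> {0..T} \<Longrightarrow> ((\<lambda>t. f z t) has_real_derivative g z t) (at t within {0..T})"
    and gz: "\<And>z t. t \<in> {0..T} \<Longrightarrow> ((\<lambda>z. g z t) has_real_derivative gz z t) (at z)"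
    and c: "cont2 T g" "cont2 T gz" and t: "t \<in> {0..T}"
  shows "((\<lambda>t. fz z t) has_real_derivative gz z t) (at t within {0..T})"
proof -
  have T0: "0 \<in> {0..T}" using t by auto
  have e: "fz z r = fz z 0 + integral {0..r} (\<lambda>q. gz z q)" if r: "r \<in> {0..T}" for r
  proof -
    have sub: "{0..r} \<subseteq> {0..T}" using r by auto
    have "((\<lambda>z. integral (cbox 0 r) ((\<lambda>z q. g z q) z)) has_field_derivative integral (cbox 0 r) ((\<lambda>z q. gz z q) z)) (at z within UNIV)"
    proof (rule leibniz_rule_field_derivative)
      show "((\<lambda>z. g z q) has_field_derivative gz z q) (at z within UNIV)" if "z \<in> UNIV" "q \<in> cbox 0 r" for z q
        using gz[of q z] that sub by auto
      show "g z integrable_on cbox 0 r" for z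
        by (simp, intro integrable_continuous_interval cont2_slice_t[OF c(1) sub])
      have "continuous_on (UNIV \<times> cbox 0 r) (\<lambda>p. gz (fst p) (snd p))"
        using c(2) sub unfolding cont2_def by (auto intro: continuous_on_subset)
      then show "continuous_on (UNIV \<times> cbox 0 r) (\<lambda>(x, t). gz x t)" by (simp add: split_beta')
    qed auto
    moreover have "(\<lambda>z. integral (cbox 0 r) (g z)) = (\<lambda>z. f z r - f z 0)"
      using time_integral_deriv[OF ft r] by (auto dest: integral_unique)
    ultimately have "((\<lambda>z. f z r - f z 0) has_real_derivative integral {0..r} (gz z)) (at z)" by simp
    moreover have "((\<lambda>z. f z r - f z 0) has_real_derivative fz z r - fz z 0) (at z)"
      by (intro DERIV_diff fz r T0)
    ultimately show ?thesis using DERIV_unique by fastforce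
  qed
  have "((\<lambda>r. integral {0..r} (gz z)) has_real_derivative gz z t) (at t within {0..T})"
    using integral_has_vector_derivative[OF cont2_slice_t[OF c(2) order_refl] t]
    by (simp add: has_real_derivative_iff_has_vector_derivative)
  then have "((\<lambda>r. fz z 0 + integral {0..r} (gz z)) has_real_derivative gz z t) (at t within {0..T})"
    by (auto intro!: derivative_eq_intros)
  then show ?thesis
    by (rule has_field_derivative_transform_within[OF _ zero_less_one t]) (rule e[symmetric])
qed

text \<open>A whole set \<open>S\<close> of solutions is fixed, each with its own time interval, so
  that the constants hidden in \<open>OH\<close> and \<open>OG\<close> are uniform over all of them.
  \<open>M\<close>, \<open>L\<close> and \<open>Ps\<close> stand for the squared H^s norm of V, its
  squared L^2 norm and the squared H^s norm of (psi_t, psi_x). \<open>E1\<close> and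
  \<open>E2\<close> are the system with all derivatives carried out.\<close>

locale dyn = profile F \<nu> c per \<tau>b ub
  for F \<nu> c per :: real and \<tau>b ub :: "real \<Rightarrow> real" +
  fixes S :: "'d set" and s :: nat and lo :: real and T :: "'d \<Rightarrow> real"
    and \<psi> pt px pxx \<tau> \<tau>x \<tau>t u ux uxx u_t :: "'d \<Rightarrow> real \<Rightarrow> real \<Rightarrow> real"
    and M L Ps :: "'d \<Rightarrow> real \<Rightarrow> real"
  assumes s: "s > 0" and lo: "lo > 0" and low_b: "\<And>x. lo \<le> \<tau>b x"
    and T: "\<And>d. d \<in> S \<Longrightarrow> T d > 0"
    and cont: "\<And>d. d \<in> S \<Longrightarrow> cont2 (T d) (pt d)" "\<And>d. d \<in> S \<Longrightarrow> cont2 (T d) (px d)" "\<And>d. d \<in> S \<Longrightarrow> cont2 (T d) (pxx d)"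
      "\<And>d. d \<in> S \<Longrightarrow> cont2 (T d) (\<tau> d)" "\<And>d. d \<in> S \<Longrightarrow> cont2 (T d) (\<tau>x d)" "\<And>d. d \<in> S \<Longrightarrow> cont2 (T d) (\<tau>t d)"
      "\<And>d. d \<in> S \<Longrightarrow> cont2 (T d) (u d)" "\<And>d. d \<in> S \<Longrightarrow> cont2 (T d) (ux d)" "\<And>d. d \<in> S \<Longrightarrow> cont2 (T d) (uxx d)"
      "\<And>d. d \<in> S \<Longrightarrow> cont2 (T d) (u_t d)"
    and dpx: "\<And>d x t. d \<in> S \<Longrightarrow> t \<in> {0..T d} \<Longrightarrow> ((\<lambda>x. \<psi> d x t) has_real_derivative px d x t) (at x)"
    and dpxx: "\<And>d x t. d \<in> S \<Longrightarrow> t \<in> {0..T d} \<Longrightarrow> ((\<lambda>x. px d x t) has_real_derivative pxx d x t) (at x)"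
    and dpt: "\<And>d x t. d \<in> S \<Longrightarrow> t \<in> {0..T d} \<Longrightarrow> ((\<lambda>t. \<psi> d x t) has_real_derivative pt d x t) (at t within {0..T d})"
    and d\<tau>x: "\<And>d x t. d \<in> S \<Longrightarrow> t \<in> {0..T d} \<Longrightarrow> ((\<lambda>x. \<tau> d x t) has_real_derivative \<tau>x d x t) (at x)"
    and d\<tau>t: "\<And>d x t. d \<in> S \<Longrightarrow> t \<in> {0..T d} \<Longrightarrow> ((\<lambda>t. \<tau> d x t) has_real_derivative \<tau>t d x t) (at t within {0..T d})"
    and dux: "\<And>d x t. d \<in> S \<Longrightarrow> t \<in> {0..T d} \<Longrightarrow> ((\<lambda>x. u d x t) has_real_derivative ux d x t) (at x)"
    and duxx: "\<And>d x t. d \<in> S \<Longrightarrow> t \<in> {0..T d} \<Longrightarrow> ((\<lambda>x. ux d x t) has_real_derivative uxx d x t) (at x)"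
    and dut: "\<And>d x t. d \<in> S \<Longrightarrow> t \<in> {0..T d} \<Longrightarrow> ((\<lambda>t. u d x t) has_real_derivative u_t d x t) (at t within {0..T d})"
    and bpx: "\<And>d x t. d \<in> S \<Longrightarrow> t \<in> {0..T d} \<Longrightarrow> \<bar>px d x t\<bar> \<le> 1/2"
    and low: "\<And>d x t. d \<in> S \<Longrightarrow> t \<in> {0..T d} \<Longrightarrow> lo \<le> \<tau>b x + \<tau> d x t"
    and E1: "\<And>d x t. d \<in> S \<Longrightarrow> t \<in> {0..T d} \<Longrightarrow>
      (1 - px d x t) * \<tau>t d x t = c * \<tau>x d x t + ux d x t - pt d x t * (t1 x + \<tau>x d x t)"
    and E2: "\<And>d x t. d \<in> S \<Longrightarrow> t \<in> {0..T d} \<Longrightarrow>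
      (1 - px d x t) * u_t d x t = (c - pt d x t) * (v1 x + ux d x t) + (1 - px d x t) * (1 - (\<tau>b x + \<tau> d x t) * (ub x + u d x t)\<^sup>2)
      + \<nu> * ((inverse (\<tau>b x + \<tau> d x t))\<^sup>2 * ((v2 x + uxx d x t) * inverse (1 - px d x t) + (v1 x + ux d x t) * pxx d x t * (inverse (1 - px d x t))\<^sup>2)
        - 2 * (inverse (\<tau>b x + \<tau> d x t))^3 * (t1 x + \<tau>x d x t) * (v1 x + ux d x t) * inverse (1 - px d x t))
      + iF * (inverse (\<tau>b x + \<tau> d x t))^3 * (t1 x + \<tau>x d x t)"
    and H: "\<And>d t. d \<in> S \<Longrightarrow> t \<in> {0..T d} \<Longrightarrow> Hk s (\<lambda>x. \<tau> d x t) (M d t)" "\<And>d t. d \<in> S \<Longrightarrow> t \<in> {0..T d} \<Longrightarrow> Hk s (\<lambda>x. u d x t) (M d t)"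
      "\<And>d t. d \<in> S \<Longrightarrow> t \<in> {0..T d} \<Longrightarrow> Hk s (\<lambda>x. px d x t) (Ps d t)" "\<And>d t. d \<in> S \<Longrightarrow> t \<in> {0..T d} \<Longrightarrow> Hk s (\<lambda>x. pt d x t) (Ps d t)"
      "\<And>d t. d \<in> S \<Longrightarrow> t \<in> {0..T d} \<Longrightarrow> L2 (\<lambda>x. \<tau> d x t) (L d t)" "\<And>d t. d \<in> S \<Longrightarrow> t \<in> {0..T d} \<Longrightarrow> L2 (\<lambda>x. u d x t) (L d t)"
    and small: "\<And>d t. d \<in> S \<Longrightarrow> t \<in> {0..T d} \<Longrightarrow> M d t \<le> 1" "\<And>d t. d \<in> S \<Longrightarrow> t \<in> {0..T d} \<Longrightarrow> Ps d t \<le> 1"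
begin

lemma coords: "d \<in> S \<Longrightarrow> coords (T d) (\<psi> d) (pt d) (px d)"
  by unfold_locales (use T cont dpx dpt bpx in auto)

text \<open>An index consists of a solution, a time, a step width and an auxiliary bound.\<close>

definition I :: "('d \<times> real \<times> real \<times> real) set" where
  "I = {(d,t,h,a). d \<in> S \<and> t \<in> {0..T d} \<and> 0 < h \<and> h \<le> 1}"

definition X where "X d z t = coords.X c (\<psi> d) z t"
definition j where "j d x t = inverse (1 - px d x t)"

definition Xi :: "'d \<times> real \<times> real \<times> real \<Rightarrow> real \<Rightarrow> real" where
  "Xi = (\<lambda>(d,t,h,a) z. X d z t)"
text \<open>This is X_z - 1, since j px = j - 1; likewise \<open>qi\<close> is X_t + c. In this form
  both are multipliers times H^s functions.\<close>

definition pi :: "'d \<times> real \<times> real \<times> real \<Rightarrow> real \<Rightarrow> real" where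
  "pi = (\<lambda>(d,t,h,a) z. j d (X d z t) t * px d (X d z t) t)"
definition qi :: "'d \<times> real \<times> real \<times> real \<Rightarrow> real \<Rightarrow> real" where
  "qi = (\<lambda>(d,t,h,a) z. j d (X d z t) t * (pt d (X d z t) t - c * px d (X d z t) t))"
definition p1i :: "'d \<times> real \<times> real \<times> real \<Rightarrow> real \<Rightarrow> real" where
  "p1i = (\<lambda>(d,t,h,a) z. pxx d (X d z t) t * j d (X d z t) t ^ 3)"
definition ti :: "'d \<times> real \<times> real \<times> real \<Rightarrow> real \<Rightarrow> real" where
  "ti = (\<lambda>(d,t,h,a) z. \<tau> d (X d z t) t)"
definition t1i :: "'d \<times> real \<times> real \<times> real \<Rightarrow> real \<Rightarrow> real" where
  "t1i = (\<lambda>(d,t,h,a) z. \<tau>x d (X d z t) t * j d (X d z t) t)"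
definition ui :: "'d \<times> real \<times> real \<times> real \<Rightarrow> real \<Rightarrow> real" where
  "ui = (\<lambda>(d,t,h,a) z. u d (X d z t) t)"
definition u1i :: "'d \<times> real \<times> real \<times> real \<Rightarrow> real \<Rightarrow> real" where
  "u1i = (\<lambda>(d,t,h,a) z. ux d (X d z t) t * j d (X d z t) t)"
definition u2i :: "'d \<times> real \<times> real \<times> real \<Rightarrow> real \<Rightarrow> real" where
  "u2i = (\<lambda>(d,t,h,a) z. (uxx d (X d z t) t * j d (X d z t) t + ux d (X d z t) t * pxx d (X d z t) t * (j d (X d z t) t)\<^sup>2) * j d (X d z t) t)"
definition hi :: "'d \<times> real \<times> real \<times> real \<Rightarrow> real" where
  "hi = (\<lambda>(d,t,h,a). h)"

lemmas idefs = Xi_def pi_def qi_def p1i_def ti_def t1i_def ui_def u1i_def u2i_def hi_def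

lemma j_eq: "d \<in> S \<Longrightarrow> t \<in> {0..T d} \<Longrightarrow> (1 - px d x t) * j d x t = 1" "d \<in> S \<Longrightarrow> t \<in> {0..T d} \<Longrightarrow> j d x t * px d x t = j d x t - 1"
  "d \<in> S \<Longrightarrow> t \<in> {0..T d} \<Longrightarrow> 2/3 \<le> j d x t" "d \<in> S \<Longrightarrow> t \<in> {0..T d} \<Longrightarrow> j d x t \<le> 2"
proof -
  assume a: "d \<in> S" "t \<in> {0..T d}"
  have b: "1/2 \<le> 1 - px d x t" "1 - px d x t \<le> 3/2" using bpx[OF a, of x] by auto
  show 1: "(1 - px d x t) * j d x t = 1" using b by (simp add: j_def)
  then show "j d x t * px d x t = j d x t - 1" by (simp add: algebra_simps)
  show "2/3 \<le> j d x t" using le_imp_inverse_le[OF b(2)] b by (simp add: j_def)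
  show "j d x t \<le> 2" using le_imp_inverse_le[OF b(1)] b by (simp add: j_def)
qed

lemma X_dz: "d \<in> S \<Longrightarrow> t \<in> {0..T d} \<Longrightarrow> ((\<lambda>z. X d z t) has_real_derivative j d (X d z t) t) (at z)"
  using coords.X_dz[OF coords, of d t c z] by (simp add: X_def[abs_def] j_def inverse_eq_divide)

lemma X_dt: "d \<in> S \<Longrightarrow> t \<in> {0..T d} \<Longrightarrow>
   ((\<lambda>t. X d z t) has_real_derivative - c + j d (X d z t) t * (pt d (X d z t) t - c * px d (X d z t) t)) (at t within {0..T d})"
proof -
  assume a: "d \<in> S" "t \<in> {0..T d}"
  have "(pt d (X d z t) t - c) / (1 - px d (X d z t) t) = j d (X d z t) t * (pt d (X d z t) t - c)"
    by (simp add: j_def divide_inverse mult.commute)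
  also have "\<dots> = - c + j d (X d z t) t * (pt d (X d z t) t - c * px d (X d z t) t)"
  proof -
    have "c * (j d (X d z t) t * px d (X d z t) t) = c * (j d (X d z t) t - 1)" using j_eq(2)[OF a] by simp
    then show ?thesis by (simp add: algebra_simps)
  qed
  finally show ?thesis using coords.X_dt[OF coords[OF a(1)] a(2), of c z] by (simp add: X_def[abs_def])
qed

lemma X_cont: "d \<in> S \<Longrightarrow> cont2 (T d) (X d)"
  using coords.X_cont[OF coords, of d c] by (simp add: X_def[abs_def])

lemma zchain:
  assumes "d \<in> S" "t \<in> {0..T d}" "\<And>x. ((\<lambda>x. f x t) has_real_derivative fx x t) (at x)"
  shows "((\<lambda>z. f (X d z t) t) has_real_derivative fx (X d z t) t * j d (X d z t) t) (at z)"
  by (rule DERIV_chain2[OF assms(3) X_dz[OF assms(1,2)]])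

lemma tchain:
  assumes "d \<in> S" "t \<in> {0..T d}" "\<And>x t. t \<in> {0..T d} \<Longrightarrow> ((\<lambda>x. f x t) has_real_derivative fx x t) (at x)"
    "\<And>x t. t \<in> {0..T d} \<Longrightarrow> ((\<lambda>t. f x t) has_real_derivative ft x t) (at t within {0..T d})" "cont2 (T d) ft"
  shows "((\<lambda>t. f (X d z t) t) has_real_derivative
    fx (X d z t) t * (- c + j d (X d z t) t * (pt d (X d z t) t - c * px d (X d z t) t)) + ft (X d z t) t) (at t within {0..T d})"
proof -
  have e: "(pt d (X d z t) t - c) / (1 - px d (X d z t) t) = - c + j d (X d z t) t * (pt d (X d z t) t - c * px d (X d z t) t)"
  proof -
    have "c * (j d (X d z t) t * px d (X d z t) t) = c * (j d (X d z t) t - 1)" using j_eq(2)[OF assms(1,2)] by simp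
    moreover have "(pt d (X d z t) t - c) / (1 - px d (X d z t) t) = j d (X d z t) t * (pt d (X d z t) t - c)"
      by (simp add: j_def divide_inverse mult.commute)
    ultimately show ?thesis by (simp add: algebra_simps)
  qed
  show ?thesis using coords.chain_t[OF coords[OF assms(1)] assms(2) assms(3,4,5), of c z]
    unfolding X_def[symmetric] e .
qed

lemma j_cont: assumes d: "d \<in> S" shows "cont2 (T d) (j d)"
proof -
  have "1 - px d x t \<noteq> 0" if "t \<in> {0..T d}" for x t using bpx[OF d that, of x] by auto
  then show ?thesis unfolding j_def[abs_def] by (intro cont2_inverse cont2_diff cont2_const cont d)
qed

lemma j_dx: assumes a: "d \<in> S" "t \<in> {0..T d}" shows "((\<lambda>x. j d x t) has_real_derivative pxx d x t * (j d x t)\<^sup>2) (at x)"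
proof -
  have "1 - px d x t \<noteq> 0" using bpx[OF a, of x] by auto
  then show ?thesis unfolding j_def
    by (auto intro!: derivative_eq_intros dpxx a simp: power2_eq_square)
qed

lemma Z_cont:
  assumes "d \<in> S" "cont2 (T d) f" shows "cont2 (T d) (\<lambda>z t. f (X d z t) t)"
  by (rule cont2_comp[OF assms(2) X_cont[OF assms(1)]])

lemma Z_cont1: "d \<in> S \<Longrightarrow> continuous_on UNIV f \<Longrightarrow> cont2 (T d) (\<lambda>z t. f (X d z t))"
  by (rule cont2_comp1[OF _ X_cont])

lemma i_conts: assumes "d \<in> S"
  shows "cont2 (T d) (\<lambda>z t. pi (d,t,h,a) z)" "cont2 (T d) (\<lambda>z t. qi (d,t,h,a) z)" "cont2 (T d) (\<lambda>z t. p1i (d,t,h,a) z)"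
    "cont2 (T d) (\<lambda>z t. ti (d,t,h,a) z)" "cont2 (T d) (\<lambda>z t. t1i (d,t,h,a) z)" "cont2 (T d) (\<lambda>z t. ui (d,t,h,a) z)"
    "cont2 (T d) (\<lambda>z t. u1i (d,t,h,a) z)" "cont2 (T d) (\<lambda>z t. u2i (d,t,h,a) z)" "cont2 (T d) (\<lambda>z t. Xi (d,t,h,a) z)"
  unfolding idefs prod.case
  by (intro cont2_mult cont2_add cont2_diff cont2_power cont2_const Z_cont j_cont cont X_cont assms)+

lemma i_derivs: assumes "(d,t,h,a) \<in> I"
  shows "(Xi (d,t,h,a) has_real_derivative 1 + pi (d,t,h,a) z) (at z)"
    "(pi (d,t,h,a) has_real_derivative p1i (d,t,h,a) z) (at z)"
    "(ti (d,t,h,a) has_real_derivative t1i (d,t,h,a) z) (at z)"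
    "(ui (d,t,h,a) has_real_derivative u1i (d,t,h,a) z) (at z)"
    "(u1i (d,t,h,a) has_real_derivative u2i (d,t,h,a) z) (at z)"
proof -
  have a: "d \<in> S" "t \<in> {0..T d}" using assms by (auto simp: I_def)
  show "(Xi (d,t,h,a) has_real_derivative 1 + pi (d,t,h,a) z) (at z)"
    using X_dz[OF a, of z] by (simp add: idefs j_eq(2)[OF a])
  have "((\<lambda>x. j d x t - 1) has_real_derivative pxx d x t * (j d x t)\<^sup>2) (at x)" for x
    using j_dx[OF a, of x] by (auto intro!: derivative_eq_intros)
  from zchain[where f="\<lambda>x t. j d x t - 1" and fx="\<lambda>x t. pxx d x t * (j d x t)\<^sup>2", OF a this, of z] show "(pi (d,t,h,a) has_real_derivative p1i (d,t,h,a) z) (at z)"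
    by (simp add: idefs j_eq(2)[OF a] power2_eq_square power3_eq_cube mult.assoc)
  show "(ti (d,t,h,a) has_real_derivative t1i (d,t,h,a) z) (at z)"
    unfolding idefs prod.case by (rule zchain[where f="\<tau> d" and fx="\<tau>x d", OF a d\<tau>x[OF a]])
  show "(ui (d,t,h,a) has_real_derivative u1i (d,t,h,a) z) (at z)"
    unfolding idefs prod.case by (rule zchain[where f="u d" and fx="ux d", OF a dux[OF a]])
  have "((\<lambda>x. ux d x t * j d x t) has_real_derivative uxx d x t * j d x t + ux d x t * pxx d x t * (j d x t)\<^sup>2) (at x)" for x
    by (auto intro!: derivative_eq_intros duxx j_dx a)
  from zchain[where f="\<lambda>x t. ux d x t * j d x t" and fx="\<lambda>x t. uxx d x t * j d x t + ux d x t * pxx d x t * (j d x t)\<^sup>2", OF a this, of z]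
  show "(u1i (d,t,h,a) has_real_derivative u2i (d,t,h,a) z) (at z)"
    unfolding idefs prod.case .
qed

definition wM :: "'d \<times> real \<times> real \<times> real \<Rightarrow> real" where "wM = (\<lambda>(d,t,h,a). M d t)"
definition wL :: "'d \<times> real \<times> real \<times> real \<Rightarrow> real" where "wL = (\<lambda>(d,t,h,a). L d t)"
definition wP :: "'d \<times> real \<times> real \<times> real \<Rightarrow> real" where "wP = (\<lambda>(d,t,h,a). Ps d t)"

lemma nonneg: assumes "d \<in> S" "t \<in> {0..T d}" shows "0 \<le> M d t" "0 \<le> L d t" "0 \<le> Ps d t"
  using Hk_nonneg[OF H(1)[OF assms]] Hk_nonneg[OF H(3)[OF assms]] H(5)[OF assms] by (auto simp: L2_def)

lemma flow_X: "d \<in> S \<Longrightarrow> t \<in> {0..T d} \<Longrightarrow> flow (\<lambda>z. X d z t) (\<lambda>x. j d x t)"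
  unfolding flow_def
proof (intro conjI allI)
  assume a: "d \<in> S" "t \<in> {0..T d}"
  show "((\<lambda>z. X d z t) has_real_derivative j d (X d z t) t) (at z)" for z by (rule X_dz[OF a])
  show "continuous_on UNIV (\<lambda>x. j d x t)" by (rule cont2_slice_x[OF j_cont[OF a(1)] a(2)])
  show "1/2 \<le> j d x t" "j d x t \<le> 2" for x using j_eq(3,4)[OF a, of x] by auto
qed

lemma x_bounds:
  "OH s I (\<lambda>(d,t,h,a) x. px d x t) wP" "OH s I (\<lambda>(d,t,h,a) x. pt d x t) wP"
  "OG s I (\<lambda>(d,t,h,a) x. j d x t)"
proof -
  show p: "OH s I (\<lambda>(d,t,h,a) x. px d x t) wP" "OH s I (\<lambda>(d,t,h,a) x. pt d x t) wP"
    using H by (auto simp: wP_def I_def intro!: OH_1)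
  have G: "OG s I (\<lambda>(d,t,h,a) x. px d x t)"
    by (rule OH_imp_OG[OF p(1), of 1]) (use small(2) in \<open>auto simp: wP_def I_def\<close>)
  have "OG s I (\<lambda>i x. inverse ((\<lambda>i x. 1 - (case i of (d,t,h,a) \<Rightarrow> \<lambda>x. px d x t) x) i x))"
  proof (rule OG_inverse[where g'="\<lambda>(d,t,h,a) x. - pxx d x t" and c="1/2"])
    show "OG s I (\<lambda>i x. 1 - (case i of (d,t,h,a) \<Rightarrow> \<lambda>x. px d x t) x)"
      by (rule OG_diff[OF OG_const G])
    fix i x assume i: "i \<in> I"
    obtain d t h a where e: "i = (d,t,h,a)" by (cases i)
    have a: "d \<in> S" "t \<in> {0..T d}" using i e by (auto simp: I_def)
    show "1/2 \<le> 1 - (case i of (d,t,h,a) \<Rightarrow> \<lambda>x. px d x t) x" using bpx[OF a, of x] by (auto simp: e)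
    show "((\<lambda>x. 1 - (case i of (d,t,h,a) \<Rightarrow> \<lambda>x. px d x t) x) has_real_derivative (case i of (d,t,h,a) \<Rightarrow> \<lambda>x. - pxx d x t) x) (at x)"
      unfolding e prod.case by (auto intro!: derivative_eq_intros dpxx a)
  next
    fix i assume i: "i \<in> I"
    obtain d t h a where e: "i = (d,t,h,a)" by (cases i)
    have a: "d \<in> S" "t \<in> {0..T d}" using i e by (auto simp: I_def)
    show "continuous_on UNIV ((\<lambda>(d,t,h,a) x. - pxx d x t) i)"
      unfolding e prod.case by (intro continuous_intros cont2_slice_x[OF cont(3)] a)
  qed simp
  then show "OG s I (\<lambda>(d,t,h,a) x. j d x t)"
    by (rule OG_cong[rotated]) (auto simp: j_def split: prod.split)
qed

text \<open>The Jacobians of all maps X(., t) have a common bound in \<open>Gk s\<close>, so one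
  constant of \<open>Hk_comp\<close> serves the whole family.\<close>

lemma to_z:
  assumes "OH k I f A" "k \<le> s"
  shows "OH k I (\<lambda>i z. f i (Xi i z)) A"
proof -
  obtain B where B: "\<And>i. i \<in> I \<Longrightarrow> Gk s ((\<lambda>(d,t,h,a) x. j d x t) i) B" using x_bounds(3) unfolding OG_def by blast
  obtain C where C: "C > 0" "\<And>Y \<phi> f A. flow Y \<phi> \<Longrightarrow> Gk s \<phi> B \<Longrightarrow> Hk k f A \<Longrightarrow> Hk k (\<lambda>z. f (Y z)) (C * A)"
    using Hk_comp[OF s assms(2), of B] by blast
  obtain D where D: "D > 0" "\<And>i. i \<in> I \<Longrightarrow> Hk k (f i) (D * A i)" using assms(1) by (auto simp: OH_def)
  show ?thesis
  proof (rule OH_I[of "C * D"])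
    fix i assume i: "i \<in> I"
    obtain d t h a where e: "i = (d,t,h,a)" by (cases i)
    have a: "d \<in> S" "t \<in> {0..T d}" using i e by (auto simp: I_def)
    show "Hk k (\<lambda>z. f i (Xi i z)) (C * D * A i)"
      using C(2)[OF flow_X[OF a] _ D(2)[OF i]] B[OF i] by (simp add: e Xi_def mult.assoc)
  qed (use C D in simp)
qed

lemma z_bounds: "OH s I ti wM" "OH s I ui wM" "OH s I pi wP" "OH s I qi wP" "OH 0 I ti wL" "OH 0 I ui wL"
proof -
  have "OH s I (\<lambda>(d,t,h,a) x. \<tau> d x t) wM" "OH s I (\<lambda>(d,t,h,a) x. u d x t) wM"
    "OH 0 I (\<lambda>(d,t,h,a) x. \<tau> d x t) wL" "OH 0 I (\<lambda>(d,t,h,a) x. u d x t) wL"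
    using H by (auto simp: wM_def wL_def I_def intro!: OH_1)
  note this[THEN to_z]
  then show "OH s I ti wM" "OH s I ui wM" "OH 0 I ti wL" "OH 0 I ui wL"
    by (auto simp: idefs split_def)
  have "OH s I (\<lambda>i x. (case i of (d,t,h,a) \<Rightarrow> \<lambda>x. j d x t) x * (case i of (d,t,h,a) \<Rightarrow> \<lambda>x. px d x t) x) wP"
    by (rule OH_mult[OF x_bounds(3,1)]) (use s in auto)
  from to_z[OF this] show "OH s I pi wP" by (auto simp: idefs split_def)
  have "OH s I (\<lambda>i x. (case i of (d,t,h,a) \<Rightarrow> \<lambda>x. j d x t) x *
     ((case i of (d,t,h,a) \<Rightarrow> \<lambda>x. pt d x t) x - c * (case i of (d,t,h,a) \<Rightarrow> \<lambda>x. px d x t) x)) wP"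
    by (rule OH_mult[OF x_bounds(3) OH_diff[OF x_bounds(2) OH_cmul[OF x_bounds(1)]]]) (use s in auto)
  from to_z[OF this] show "OH s I qi wP" by (auto simp: idefs split_def)
qed

end

sublocale dyn \<subseteq> slices F \<nu> c per \<tau>b ub I s lo Xi pi p1i qi ti t1i ui u1i hi
proof
  fix i assume i: "i \<in> I"
  obtain d t h a where e: "i = (d,t,h,a)" by (cases i)
  have a: "d \<in> S" "t \<in> {0..T d}" using i e by (auto simp: I_def)
  show "(Xi i has_real_derivative 1 + pi i z) (at z)" "(pi i has_real_derivative p1i i z) (at z)"
    "(ti i has_real_derivative t1i i z) (at z)" "(ui i has_real_derivative u1i i z) (at z)" for z
    using i_derivs i unfolding e by auto
  show "continuous_on UNIV (p1i i)" "continuous_on UNIV (t1i i)" "continuous_on UNIV (u1i i)"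
    using cont2_slice_x[OF i_conts(3)[OF a(1)] a(2)] cont2_slice_x[OF i_conts(5)[OF a(1)] a(2)] cont2_slice_x[OF i_conts(7)[OF a(1)] a(2)]
    unfolding e by auto
  show "0 < hi i \<and> hi i \<le> 1" using i by (auto simp: e hi_def I_def)
  show "lo \<le> \<tau>b (Xi i z) + ti i z" for z using low[OF a, of "X d z t"] by (simp add: e idefs)
next
  have w: "wM i \<le> 1 * 1" "wP i \<le> 1 * 1" if "i \<in> I" for i
    using that small by (auto simp: wM_def wP_def I_def)
  show "OH s I pi (\<lambda>_. 1)" "OH s I qi (\<lambda>_. 1)" "OH s I ti (\<lambda>_. 1)" "OH s I ui (\<lambda>_. 1)"
    by (rule OH_weight[OF z_bounds(3) zero_less_one w(2)] OH_weight[OF z_bounds(4) zero_less_one w(2)]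
        OH_weight[OF z_bounds(1) zero_less_one w(1)] OH_weight[OF z_bounds(2) zero_less_one w(1)]; assumption)+
qed (use s lo low_b in auto)

section \<open>Time derivatives in Lagrangian coordinates\<close>

lemma dqs_deriv:
  assumes "\<And>z. ((\<lambda>t. f z t) has_real_derivative g z) (at t within U)"
  shows "((\<lambda>t. dqs hs (\<lambda>z. f z t) z) has_real_derivative dqs hs g z) (at t within U)"
proof (induction hs arbitrary: z)
  case (Cons h hs)
  show ?case
  proof (cases "h = 0")
    case False
    then show ?thesis unfolding dqs.simps dq_def
      by (auto intro!: derivative_eq_intros Cons.IH)
  qed (simp add: dq_def)
qed (use assms in simp)

lemma dqs_deriv_z:
  assumes "\<And>z. (f has_real_derivative g z) (at z)"
  shows "(dqs hs f has_real_derivative dqs hs g z) (at z)"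
proof (induction hs arbitrary: z)
  case (Cons h hs)
  have "((\<lambda>z. dqs hs f (z + h)) has_real_derivative dqs hs g (z + h)) (at z)"
    using Cons.IH[of "z + h"] by (simp add: DERIV_shift)
  then show ?case unfolding dqs.simps dq_def[abs_def]
    by (cases "h = 0") (auto intro!: derivative_eq_intros Cons.IH)
qed (use assms in simp)

context dyn
begin

lemma I_mem: "d \<in> S \<Longrightarrow> t \<in> {0..T d} \<Longrightarrow> 0 < h \<Longrightarrow> h \<le> 1 \<Longrightarrow> (d,t,h,a) \<in> I"
  by (simp add: I_def)

lemma prof_conts: assumes "d \<in> S" "continuous_on UNIV f"
  shows "cont2 (T d) (\<lambda>z t. f (Xi (d,t,h,a) z))"
  unfolding idefs prod.case by (rule Z_cont1[OF assms])

lemma conts2: assumes d: "d \<in> S" and h: "0 < h" "h \<le> 1"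
  shows "cont2 (T d) (\<lambda>z t. Xz (d,t,h,a) z)" "cont2 (T d) (\<lambda>z t. tt (d,t,h,a) z)"
    "cont2 (T d) (\<lambda>z t. tt1 (d,t,h,a) z)" "cont2 (T d) (\<lambda>z t. ut (d,t,h,a) z)"
    "cont2 (T d) (\<lambda>z t. st (d,t,h,a) z)" "cont2 (T d) (\<lambda>z t. st1 (d,t,h,a) z)"
    "cont2 (T d) (\<lambda>z t. ph (d,t,h,a) z)" "cont2 (T d) (\<lambda>z t. om (d,t,h,a) z)"
    "cont2 (T d) (\<lambda>z t. R0 (d,t,h,a) z)" "cont2 (T d) (\<lambda>z t. Sh (d,t,h,a) z)"
proof -
  note c = cont2_mult cont2_add cont2_diff cont2_minus cont2_power cont2_const i_conts[OF d] prof_conts[OF d] conts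
  show Xz: "cont2 (T d) (\<lambda>z t. Xz (d,t,h,a) z)" unfolding Xz_def by (intro c)
  show tt: "cont2 (T d) (\<lambda>z t. tt (d,t,h,a) z)" unfolding tt_def by (intro c)
  show tt1: "cont2 (T d) (\<lambda>z t. tt1 (d,t,h,a) z)" unfolding tt1_def by (intro c Xz)
  show ut: "cont2 (T d) (\<lambda>z t. ut (d,t,h,a) z)" unfolding ut_def by (intro c)
  show st: "cont2 (T d) (\<lambda>z t. st (d,t,h,a) z)" unfolding st_def
    by (intro cont2_inverse tt tt_nz I_mem d h)
  show st1: "cont2 (T d) (\<lambda>z t. st1 (d,t,h,a) z)" unfolding st1_def by (intro c tt1 st)
  show ph: "cont2 (T d) (\<lambda>z t. ph (d,t,h,a) z)" unfolding ph_def unfolding hi_def prod.case by (intro c cont2_dq)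
  show "cont2 (T d) (\<lambda>z t. om (d,t,h,a) z)" unfolding om_def by (intro c st1 ph)
  show "cont2 (T d) (\<lambda>z t. R0 (d,t,h,a) z)" unfolding R0_def by (intro c st st1 ut)
  show "cont2 (T d) (\<lambda>z t. Sh (d,t,h,a) z)" unfolding Sh_def unfolding hi_def prod.case by (intro c st ut ph[unfolded hi_def] cont2_dq)
qed

definition ut1 where "ut1 i z = v1 (Xi i z) * (1 + pi i z) + u1i i z"
definition ut2 where "ut2 i z = u2i i z + v2 (Xi i z) * (1 + pi i z)\<^sup>2 + v1 (Xi i z) * p1i i z"

text \<open>The transport terms cancel: X_t = J (Q - c) multiplies the x-derivative of \<tau>, while
  the equation multiplied by J contains J (c - Q) times the same derivative. The remaining profile
  terms are sorted by \<open>pi\<close> and \<open>qi\<close> through the profile equation.\<close>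

lemma ti_dt: assumes a: "d \<in> S" "t \<in> {0..T d}"
  shows "((\<lambda>t. ti (d,t,h,b) z) has_real_derivative
    u1i (d,t,h,b) z + v1 (Xi (d,t,h,b) z) * pi (d,t,h,b) z - t1 (Xi (d,t,h,b) z) * qi (d,t,h,b) z) (at t within {0..T d})"
proof -
  define x where "x = X d z t"
  define J P Q A B D where "J = j d x t" and "P = px d x t" and "Q = pt d x t" and "A = \<tau>x d x t" and "B = \<tau>t d x t" and "D = ux d x t"
  have jp: "J * P = J - 1" using j_eq(2)[OF a, of x] by (simp add: J_def P_def)
  have "(1 - P) * B = c * A + D - Q * (t1 x + A)"
    using E1[OF a, of x] by (simp add: P_def Q_def A_def B_def D_def)
  moreover have "J * ((1 - P) * B) = B"
  proof -
    have "J * ((1 - P) * B) = (J - J * P) * B" by (simp add: algebra_simps)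
    then show ?thesis unfolding jp by simp
  qed
  ultimately have B: "B = J * (c * A + D - Q * (t1 x + A))" by metis
  have "A * (- c + J * (Q - c * P)) + B = A * (- c - c * (J * P)) + J * (c * A + D - Q * t1 x)"
    unfolding B by (simp add: algebra_simps)
  also have "\<dots> = D * J + v1 x * (J * P) - t1 x * (J * (Q - c * P))"
  proof -
    have "A * (- c - c * (J * P)) = - (c * A * J)" unfolding jp by (simp add: algebra_simps)
    then show ?thesis unfolding prof_v by (simp add: algebra_simps)
  qed
  finally show ?thesis
    using tchain[where f="\<tau> d" and fx="\<tau>x d" and ft="\<tau>t d" and z=z, OF a d\<tau>x[OF a(1)] d\<tau>t[OF a(1)] cont(6)[OF a(1)]]
    by (simp add: idefs x_def J_def P_def Q_def A_def B_def D_def)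
qed

lemma Xi_dt: assumes a: "d \<in> S" "t \<in> {0..T d}"
  shows "((\<lambda>t. Xi (d,t,h,b) z) has_real_derivative - c + qi (d,t,h,b) z) (at t within {0..T d})"
  using X_dt[OF a, of z] by (simp add: idefs)

lemma prof_dt: assumes a: "d \<in> S" "t \<in> {0..T d}" and f: "\<And>x. (f has_real_derivative f' x) (at x)"
  shows "((\<lambda>t. f (Xi (d,t,h,b) z)) has_real_derivative f' (Xi (d,t,h,b) z) * (- c + qi (d,t,h,b) z)) (at t within {0..T d})"
  by (rule DERIV_chain2[OF f Xi_dt[OF a]])

text \<open>The transport part of u_t is J (c - Q) (v1 + D), and the path contributes J (Q - c) D.
  Only the v1 part survives; it is minus the time derivative of the transported profile.\<close>

lemma ui_dt: fixes b :: real assumes a: "d \<in> S" "t \<in> {0..T d}" and h: "0 < h" "h \<le> 1"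
  defines "i \<equiv> (d,t,h,b)"
  shows "((\<lambda>t. ui (d,t,h,b) z) has_real_derivative
    \<nu> * ((st i z)\<^sup>2 * ut2 i z + 2 * st i z * st1 i z * ut1 i z) - st i z * st1 i z * iF
      + (1 - tt i z * (ut i z)\<^sup>2) - v1 (Xi i z) * (- c + qi i z)) (at t within {0..T d})"
proof -
  define x where "x = X d z t"
  define J P Q A B D E R Y where "J = j d x t" and "P = px d x t" and "Q = pt d x t" and "A = t1 x + \<tau>x d x t"
    and "B = u_t d x t" and "D = ux d x t" and "E = uxx d x t" and "R = pxx d x t" and "Y = inverse (\<tau>b x + \<tau> d x t)"
  have jp: "J * P = J - 1" using j_eq(2)[OF a, of x] by (simp add: J_def P_def)
  have J: "inverse (1 - P) = J" by (simp add: J_def P_def j_def)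
  define H where "H = 1 - (\<tau>b x + \<tau> d x t) * (ub x + u d x t)\<^sup>2"
  have eq: "(1 - P) * B = (c - Q) * (v1 x + D) + (1 - P) * H
      + \<nu> * (Y\<^sup>2 * ((v2 x + E) * J + (v1 x + D) * R * J\<^sup>2) - 2 * Y^3 * A * (v1 x + D) * J) + iF * Y^3 * A"
    using E2[OF a, of x] unfolding J[symmetric] by (simp add: P_def Q_def A_def B_def D_def E_def R_def Y_def H_def)
  have J1: "J * (1 - P) = 1" using jp by (simp add: right_diff_distrib)
  then have "B = J * ((1 - P) * B)" by (simp add: mult.assoc[symmetric])
  also have "\<dots> = J * (c - Q) * (v1 x + D) + (J * (1 - P)) * H
      + J * (\<nu> * (Y\<^sup>2 * ((v2 x + E) * J + (v1 x + D) * R * J\<^sup>2) - 2 * Y^3 * A * (v1 x + D) * J) + iF * Y^3 * A)"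
    unfolding eq by (simp only: distrib_left mult.assoc)
  also note J1
  finally have B: "B = J * (c - Q) * (v1 x + D) + H
      + J * (\<nu> * (Y\<^sup>2 * ((v2 x + E) * J + (v1 x + D) * R * J\<^sup>2) - 2 * Y^3 * A * (v1 x + D) * J) + iF * Y^3 * A)"
    by simp
  have q: "- c + J * (Q - c * P) = J * (Q - c)"
  proof -
    have "- c + J * (Q - c * P) = - c + J * Q - c * (J * P)" by (simp add: algebra_simps)
    then show ?thesis unfolding jp by (simp add: algebra_simps)
  qed
  have st: "st i z = Y" unfolding i_def st_def tt_def unfolding idefs by (simp add: Y_def x_def)
  have p: "1 + pi i z = J" using jp by (simp add: i_def idefs J_def P_def x_def)
  have tt1: "tt1 i z = A * J" by (simp add: tt1_def Xz_def p) (simp add: i_def idefs A_def J_def x_def algebra_simps)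
  have st1: "st1 i z = - (Y * Y * (A * J))" by (simp add: st1_def st tt1)
  have ut1: "ut1 i z = (v1 x + D) * J" by (simp add: ut1_def p) (simp add: i_def idefs D_def J_def x_def algebra_simps)
  have ut2: "ut2 i z = ((v2 x + E) * J + (v1 x + D) * R * J\<^sup>2) * J"
    by (simp add: ut2_def p) (simp add: i_def idefs D_def E_def R_def J_def x_def algebra_simps power2_eq_square power3_eq_cube)
  have HH: "1 - tt i z * (ut i z)\<^sup>2 = H" unfolding i_def tt_def ut_def unfolding idefs by (simp add: H_def x_def)
  have qq: "- c + qi i z = J * (Q - c)" using q by (simp add: i_def idefs J_def P_def Q_def x_def)
  have xx: "Xi i z = x" by (simp add: i_def idefs x_def)
  have "D * (J * (Q - c)) + B = \<nu> * ((st i z)\<^sup>2 * ut2 i z + 2 * st i z * st1 i z * ut1 i z) - st i z * st1 i z * iF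
      + (1 - tt i z * (ut i z)\<^sup>2) - v1 (Xi i z) * (- c + qi i z)"
    unfolding B st st1 ut1 ut2 HH qq xx
    by (simp add: algebra_simps power2_eq_square power3_eq_cube)
  moreover have "((\<lambda>t. ui (d,t,h,b) z) has_real_derivative D * (- c + J * (Q - c * P)) + B) (at t within {0..T d})"
    using tchain[where f="u d" and fx="ux d" and ft="u_t d" and z=z, OF a dux[OF a(1)] dut[OF a(1)] cont(10)[OF a(1)]]
    by (simp add: idefs x_def J_def P_def Q_def B_def D_def)
  ultimately show ?thesis unfolding q by simp
qed

lemma ui_dt': fixes b :: real assumes a: "d \<in> S" "t \<in> {0..T d}" and h: "0 < h" "h \<le> 1"
  defines "i \<equiv> (d,t,h,b)"
  shows "((\<lambda>t. ui (d,t,h,b) z) has_real_derivative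
    \<nu> * (st i z)\<^sup>2 * u2i i z + (2 * \<nu> * (st i z * st1 i z)) * u1i i z + R0 i z) (at t within {0..T d})"
  using ui_dt[OF a h, of b z] u_equation[of i z "u2i i z"]
  by (simp add: i_def ut1_def ut2_def)

lemma tt_dt: assumes a: "d \<in> S" "t \<in> {0..T d}"
  shows "((\<lambda>t. tt (d,t,h,b) z) has_real_derivative ut1 (d,t,h,b) z) (at t within {0..T d})"
proof -
  have "((\<lambda>t. tt (d,t,h,b) z) has_real_derivative t1 (Xi (d,t,h,b) z) * (- c + qi (d,t,h,b) z)
     + (u1i (d,t,h,b) z + v1 (Xi (d,t,h,b) z) * pi (d,t,h,b) z - t1 (Xi (d,t,h,b) z) * qi (d,t,h,b) z)) (at t within {0..T d})"
    unfolding tt_def by (intro DERIV_add prof_dt[OF a derivs(1)] ti_dt a)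
  then show ?thesis by (simp add: ut1_def prof_v algebra_simps)
qed

lemma st_dt: assumes a: "d \<in> S" "t \<in> {0..T d}" and h: "0 < h" "h \<le> 1"
  shows "((\<lambda>t. st (d,t,h,b) z) has_real_derivative - ((st (d,t,h,b) z)\<^sup>2 * ut1 (d,t,h,b) z)) (at t within {0..T d})"
proof -
  have "tt (d,t,h,b) z \<noteq> 0" by (intro tt_nz I_mem a h)
  then show ?thesis unfolding st_def
    by (auto intro!: derivative_eq_intros tt_dt a simp: power2_eq_square)
qed

lemma ut1_dz: assumes "(d,t,h,b) \<in> I"
  shows "(ut1 (d,t,h,b) has_real_derivative ut2 (d,t,h,b) z) (at z)"
proof -
  note D = i_derivs[OF assms]
  show ?thesis unfolding ut1_def[abs_def] ut2_def
    by (rule derivative_eq_intros DERIV_chain2[OF derivs(4) D(1)] D refl)+ (simp add: power2_eq_square algebra_simps)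
qed

text \<open>\<open>st1\<close> contains x-derivatives of \<tau> and psi for which no time
  derivatives are given. \<open>schwarz\<close> obtains its time derivative from the z-derivative of
  \<open>st_dt\<close>, where second derivatives of u and psi suffice.\<close>

lemma st1_dt: assumes a: "d \<in> S" "t \<in> {0..T d}" and h: "0 < h" "h \<le> 1"
  shows "((\<lambda>t. st1 (d,t,h,b) z) has_real_derivative
    - (2 * st (d,t,h,b) z * st1 (d,t,h,b) z * ut1 (d,t,h,b) z + (st (d,t,h,b) z)\<^sup>2 * ut2 (d,t,h,b) z)) (at t within {0..T d})"
proof -
  let ?i = "\<lambda>t. (d,t,h,b)"
  let ?g = "\<lambda>z t. - ((st (?i t) z)\<^sup>2 * ut1 (?i t) z)"
  let ?gz = "\<lambda>z t. - (2 * st (?i t) z * st1 (?i t) z * ut1 (?i t) z + (st (?i t) z)\<^sup>2 * ut2 (?i t) z)"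
  note c = cont2_mult cont2_add cont2_diff cont2_minus cont2_power cont2_const i_conts[OF a(1)] prof_conts[OF a(1)] conts conts2[OF a(1) h]
  show ?thesis
  proof (rule schwarz[where f="\<lambda>z t. st (?i t) z" and fz="\<lambda>z t. st1 (?i t) z" and g="?g" and gz="?gz"])
    fix z t assume t: "t \<in> {0..T d}"
    show "((\<lambda>z. st (?i t) z) has_real_derivative st1 (?i t) z) (at z)" by (intro st_deriv I_mem a t h)
    show "((\<lambda>t. st (?i t) z) has_real_derivative ?g z t) (at t within {0..T d})" by (intro st_dt a t h)
    show "((\<lambda>z. ?g z t) has_real_derivative ?gz z t) (at z)"
      by (rule derivative_eq_intros st_deriv ut1_dz I_mem a t h refl)+ (simp add: power2_eq_square algebra_simps)
  next
    show "cont2 (T d) ?g" unfolding ut1_def by (intro c)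
    show "cont2 (T d) ?gz" unfolding ut1_def ut2_def by (intro c)
  qed (rule a)
qed

text \<open>The viscous terms cancel: \<open>om\<close> obeys an ordinary differential equation along particle paths.\<close>

lemma om_dt: fixes b :: real assumes a: "d \<in> S" "t \<in> {0..T d}" and h: "0 < h" "h \<le> 1"
  defines "i \<equiv> (d,t,h,b)"
  shows "((\<lambda>t. om (d,t,h,b) z) has_real_derivative - (\<kappa> * st i z) * om i z + Sh i z) (at t within {0..T d})"
proof -
  have ph: "((\<lambda>t. ph (d,t,h,b) z) has_real_derivative dq (hi i) (qi i) z) (at t within {0..T d})"
  proof -
    have "((\<lambda>t. dqs [h] (\<lambda>z. Xi (d,t,h,b) z) z - 1) has_real_derivative dqs [h] (\<lambda>z. - c + qi (d,t,h,b) z) z - 0) (at t within {0..T d})"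
      by (intro DERIV_diff dqs_deriv Xi_dt a DERIV_const)
    then show ?thesis unfolding i_def ph_def unfolding hi_def prod.case by (simp add: dq_def)
  qed
  have "((\<lambda>t. om (d,t,h,b) z) has_real_derivative
      (\<nu> * ((st i z)\<^sup>2 * ut2 i z + 2 * st i z * st1 i z * ut1 i z) - st i z * st1 i z * iF
      + (1 - tt i z * (ut i z)\<^sup>2) - v1 (Xi i z) * (- c + qi i z))
      + \<nu> * - (2 * st i z * st1 i z * ut1 i z + (st i z)\<^sup>2 * ut2 i z)
      - \<nu> * (sb2 (Xi i z) * (- c + qi i z) * (1 + ph i z) + sb1 (Xi i z) * dq (hi i) (qi i) z)) (at t within {0..T d})"
    unfolding om_def i_def
    by (rule derivative_eq_intros ui_dt[OF a h] st1_dt[OF a h] prof_dt[OF a sb_derivs(2)] ph[unfolded i_def] refl)+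
      (simp add: algebra_simps)
  moreover have "(\<nu> * ((st i z)\<^sup>2 * ut2 i z + 2 * st i z * st1 i z * ut1 i z) - st i z * st1 i z * iF
      + (1 - tt i z * (ut i z)\<^sup>2) - v1 (Xi i z) * (- c + qi i z))
      + \<nu> * - (2 * st i z * st1 i z * ut1 i z + (st i z)\<^sup>2 * ut2 i z)
      - \<nu> * (sb2 (Xi i z) * (- c + qi i z) * (1 + ph i z) + sb1 (Xi i z) * dq (hi i) (qi i) z)
    = (- iF * (st i z * st1 i z) + (1 - tt i z * (ut i z)\<^sup>2)) - (v1 (Xi i z) + \<nu> * sb2 (Xi i z)) * (- c + qi i z)
     - \<nu> * (sb2 (Xi i z) * (- c + qi i z) * ph i z + sb1 (Xi i z) * dq (hi i) (qi i) z)"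
    by (simp add: algebra_simps)
  ultimately show ?thesis unfolding omega_equation by simp
qed

end

section \<open>Estimates of the specific volume and the velocity\<close>

lemma Duh_mono:
  assumes "A \<le> B" "\<And>q. q \<in> {0..t} \<Longrightarrow> f q \<le> g q"
  shows "Duh \<Lambda> A f t \<le> Duh \<Lambda> B g t"
  unfolding Duh_def
proof (intro add_mono ennreal_leI mult_left_mono assms(1) nn_integral_mono)
  fix q
  show "ennreal (exp (- \<Lambda> * (t - q)) * f q) * indicator {0..t} q \<le> ennreal (exp (- \<Lambda> * (t - q)) * g q) * indicator {0..t} q"
    using assms(2)[of q] by (cases "q \<in> {0..t}") (auto intro!: ennreal_leI mult_left_mono)
qed simp

lemma comm_bound_uniform:
  "\<exists>C>0. \<forall>k hs f g A B. k < n \<longrightarrow> length hs = Suc k \<longrightarrow> set hs \<subseteq> {0<..1} \<longrightarrow> Hk k f A \<longrightarrow> Gk (Suc (Suc k)) g B \<longrightarrow>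
     L2 (\<lambda>x. dqs hs (\<lambda>y. g y * f y) x - g x * dqs hs f x) (C * B * A)"
proof -
  have "\<forall>k. \<exists>C. C > 0 \<and> (\<forall>hs f g A B. length hs = Suc k \<longrightarrow> set hs \<subseteq> {0<..1} \<longrightarrow> Hk k f A \<longrightarrow> Gk (Suc (Suc k)) g B \<longrightarrow>
     L2 (\<lambda>x. dqs hs (\<lambda>y. g y * f y) x - g x * dqs hs f x) (C * B * A))"
    using comm_bound by blast
  then obtain c where c: "\<And>k. c k > 0" "\<And>k hs f g A B. length hs = Suc k \<Longrightarrow> set hs \<subseteq> {0<..1} \<Longrightarrow> Hk k f A \<Longrightarrow> Gk (Suc (Suc k)) g B \<Longrightarrow>
     L2 (\<lambda>x. dqs hs (\<lambda>y. g y * f y) x - g x * dqs hs f x) (c k * B * A)" by metis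
  define C where "C = 1 + (\<Sum>k<n. c k)"
  have C0: "C > 0" using sum_nonneg[of "{..<n}" c] less_imp_le[OF c(1)] by (simp add: C_def add_pos_nonneg)
  have "L2 (\<lambda>x. dqs hs (\<lambda>y. g y * f y) x - g x * dqs hs f x) (C * B * A)"
    if h: "k < n" "length hs = Suc k" "set hs \<subseteq> {0<..1}" "Hk k f A" "Gk (Suc (Suc k)) g B" for k hs f g A B
  proof (rule L2_mono[OF c(2)[OF h(2-5)]])
    have "c k \<le> (\<Sum>k<n. c k)" using h(1) less_imp_le[OF c(1)] by (intro member_le_sum) auto
    then have "c k \<le> C" by (simp add: C_def)
    then show "c k * B * A \<le> C * B * A"
      by (intro mult_right_mono Hk_nonneg[OF h(4)] Gk_nonneg[OF h(5)])
  qed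
  then show ?thesis using C0 by blast
qed

context dyn
begin

text \<open>Restricting the index set allows the fixed-time lemmas to be used with other weights,
  valid only for the indices of the subset.\<close>

lemma slices_subset:
  assumes J: "J \<subseteq> I"
  shows "slices F \<nu> c per \<tau>b ub J s lo Xi pi p1i qi ti t1i ui u1i hi"
proof unfold_locales
  fix i assume "i \<in> J"
  then have i: "i \<in> I" using J by auto
  show "(Xi i has_real_derivative 1 + pi i z) (at z)" for z by (rule dX[OF i])
  show "(pi i has_real_derivative p1i i z) (at z)" for z by (rule dp[OF i])
  show "(ti i has_real_derivative t1i i z) (at z)" for z by (rule d\<tau>[OF i])
  show "(ui i has_real_derivative u1i i z) (at z)" for z by (rule du[OF i])
  show "continuous_on UNIV (p1i i)" "continuous_on UNIV (t1i i)" "continuous_on UNIV (u1i i)" by (rule cont1[OF i])+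
  show "0 < hi i \<and> hi i \<le> 1" by (rule h[OF i])
  show "lo \<le> \<tau>b (Xi i z) + ti i z" for z using tt_low[OF i, of z] by (simp add: tt_def)
next
  show "OH s J pi (\<lambda>_. 1)" "OH s J qi (\<lambda>_. 1)" "OH s J ti (\<lambda>_. 1)" "OH s J ui (\<lambda>_. 1)"
    by (intro OH_subset[OF bound(1) J] OH_subset[OF bound(2) J] OH_subset[OF bound(3) J] OH_subset[OF bound(4) J])+
qed (use s lo low_b in auto)

lemma indep: "Xi (d,t,h,a) = Xi (d,t,h',b)" "pi (d,t,h,a) = pi (d,t,h',b)" "p1i (d,t,h,a) = p1i (d,t,h',b)"
  "qi (d,t,h,a) = qi (d,t,h',b)" "ti (d,t,h,a) = ti (d,t,h',b)" "t1i (d,t,h,a) = t1i (d,t,h',b)"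
  "ui (d,t,h,a) = ui (d,t,h',b)" "u1i (d,t,h,a) = u1i (d,t,h',b)" "u2i (d,t,h,a) = u2i (d,t,h',b)"
  "hi (d,t,h,a) = hi (d,t,h,b)"
  by (simp_all add: idefs)

lemma indep2: "st (d,t,h,a) = st (d,t,h',b)" "st1 (d,t,h,a) = st1 (d,t,h',b)" "sg1 (d,t,h,a) = sg1 (d,t,h',b)"
proof -
  note i = indep(1-9)[of d t h a h' b]
  show 1: "st (d,t,h,a) = st (d,t,h',b)" by (rule ext) (simp only: st_def tt_def i)
  show 2: "st1 (d,t,h,a) = st1 (d,t,h',b)" by (rule ext) (simp only: st1_def tt1_def Xz_def 1 i)
  show "sg1 (d,t,h,a) = sg1 (d,t,h',b)" by (rule ext) (simp only: sg1_def Xz_def 2 i)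
qed

lemma indep3: "om (d,t,h,a) = om (d,t,h,b)" "Sh (d,t,h,a) = Sh (d,t,h,b)"
proof -
  note i = indep(1-9)[of d t h a h b] indep(10)[of d t h a b] indep2[of d t h a h b]
  have p: "ph (d,t,h,a) = ph (d,t,h,b)" by (rule ext) (simp only: ph_def i)
  show "om (d,t,h,a) = om (d,t,h,b)" by (rule ext) (simp only: om_def i p)
  show "Sh (d,t,h,a) = Sh (d,t,h,b)" by (rule ext) (simp only: Sh_def ut_def i p)
qed

lemma u1_bound: "OH (s - 1) I u1i wM"
  by (rule OH_deriv[OF _ du cont1(3)]) (use z_bounds(2) s in auto)

lemma weights: "i \<in> I \<Longrightarrow> 0 \<le> wM i" "i \<in> I \<Longrightarrow> 0 \<le> wL i" "i \<in> I \<Longrightarrow> 0 \<le> wP i"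
  using nonneg by (auto simp: wM_def wL_def wP_def I_def)

lemma OH_wM: "OH k I f wM \<Longrightarrow> OH k I f (\<lambda>i. wM i + wP i)"
  by (rule OH_weight[of k I f wM 1]) (use weights in auto)

lemma OH_wP: "OH k I f wP \<Longrightarrow> OH k I f (\<lambda>i. wM i + wP i)"
  by (rule OH_weight[of k I f wP 1]) (use weights in auto)

abbreviation "wi i z \<equiv> ui i z + \<nu> * sg1 i z"
abbreviation "tau_le d t A \<equiv> nsq (ti (d,t,1,0)) \<le> A"
abbreviation "u_le d t A \<equiv> (\<forall>hs. length hs < s \<longrightarrow> set hs \<subseteq> {0<..1} \<longrightarrow>
  (\<integral>\<^sup>+z. ennreal ((dqs hs (ui (d,t,1,0)) z)\<^sup>2 + (dqs hs (u1i (d,t,1,0)) z)\<^sup>2) \<partial>lborel) \<le> A)"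
abbreviation "w_le d t A \<equiv> (\<forall>hs. length hs < s \<longrightarrow> set hs \<subseteq> {0<..1} \<longrightarrow>
  (nsq (dqs hs (wi (d,t,1,0)))) \<le> A)"

text \<open>There is no damping in this equation; the term -\<Lambda> \<tau> is added and
  subtracted. The compensating source \<Lambda> \<tau> costs only L, and the remaining source, which
  contains u_z and so the top norm if s = 1, gets the factor 1/\<Lambda> from
  \<open>damped_ode\<close>.\<close>

lemma est_tau:
  "\<exists>K>0. \<forall>\<Lambda>>0. \<exists>C>0. \<forall>d\<in>S. \<forall>t\<in>{0..T d}. tau_le d t (Duh \<Lambda> (K * M d 0) (\<lambda>r. K / \<Lambda> * M d r + C * (L d r + Ps d r)) t)"
proof -
  let ?f = "\<lambda>i z. u1i i z + pi i z * v1 (Xi i z) - qi i z * t1 (Xi i z)"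
  have "OH 0 I ?f (\<lambda>i. wM i + wP i)"
    by (intro OH_diff OH_add OH_wM[OF OH_lower[OF u1_bound]] HG[OF OH_wP[OF OH_lower[OF z_bounds(3)]] G_b(5)]
        HG[OF OH_wP[OF OH_lower[OF z_bounds(4)]] G_b(3)]) auto
  then obtain D where D: "D > 0" "\<And>i. i \<in> I \<Longrightarrow> Hk 0 (?f i) (D * (wM i + wP i))" by (auto simp: OH_def)
  obtain C1 where C1: "C1 > 0" "\<And>i. i \<in> I \<Longrightarrow> Hk 0 (ti i) (C1 * wL i)" using z_bounds(5) by (auto simp: OH_def)
  obtain C2 where C2: "C2 > 0" "\<And>i. i \<in> I \<Longrightarrow> Hk 0 (ti i) (C2 * wM i)" using OH_lower[OF z_bounds(1), of 0] by (auto simp: OH_def)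
  define K where "K = 2 * D + C2"
  have K: "K > 0" using D C2 by (simp add: K_def)
  have main: "nsq (ti (d,t,1,0))
     \<le> Duh \<Lambda> (K * M d 0) (\<lambda>r. K / \<Lambda> * M d r + (2 * \<Lambda> * C1 + 2 * D / \<Lambda>) * (L d r + Ps d r)) t"
    if \<Lambda>: "\<Lambda> > 0" and d: "d \<in> S" and t: "t \<in> {0..T d}" for \<Lambda> d t
  proof -
    note c = cont2_mult cont2_add cont2_diff cont2_minus cont2_power cont2_const i_conts[OF d] prof_conts[OF d] conts
    have T0: "0 \<in> {0..T d}" using T[OF d] by simp
    have I: "(d,q,1,0) \<in> I" if "q \<in> {0..T d}" for q using d that by (intro I_mem) auto
    have "nsq (ti (d,t,1,0))
      \<le> Duh \<Lambda> (C2 * M d 0) (\<lambda>q. (2 * (\<Lambda>\<^sup>2 * (C1 * L d q) + D * (M d q + Ps d q))) / \<Lambda>) t"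
    proof (rule damped_ode[OF \<Lambda> t, where a="\<lambda>z q. \<Lambda>" and S="\<lambda>z q. \<Lambda> * ti (d,q,1,0) z + ?f (d,q,1,0) z" and r="\<lambda>z q. ti (d,q,1,0) z" and ?r0.0="ti (d,0,1,0)"])
      fix z q assume q: "q \<in> {0..T d}"
      show "((\<lambda>q. ti (d,q,1,0) z) has_real_derivative - \<Lambda> * ti (d,q,1,0) z + (\<Lambda> * ti (d,q,1,0) z + ?f (d,q,1,0) z)) (at q within {0..T d})"
        using ti_dt[OF d q, of 1 0 z] by (simp add: mult.commute)
    next
      show "cont2 (T d) (\<lambda>z q. \<Lambda> * ti (d,q,1,0) z + ?f (d,q,1,0) z)" by (intro c)
      show "ti (d,0,1,0) \<in> borel_measurable borel" by (rule Hk_borel[OF C1(2)[OF I[OF T0]]])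
      show "L2 (ti (d,0,1,0)) (C2 * M d 0)" using C2(2)[OF I[OF T0]] by (simp add: wM_def)
      fix q assume q: "q \<in> {0..T d}"
      have "L2 (ti (d,q,1,0)) (C1 * L d q)" using C1(2)[OF I[OF q]] by (simp add: wL_def)
      moreover have "L2 (?f (d,q,1,0)) (D * (M d q + Ps d q))" using D(2)[OF I[OF q]] by (simp add: wM_def wP_def)
      ultimately show "L2 (\<lambda>z. \<Lambda> * ti (d,q,1,0) z + ?f (d,q,1,0) z) (2 * (\<Lambda>\<^sup>2 * (C1 * L d q) + D * (M d q + Ps d q)))"
        by (intro L2_add L2_cmul)
    qed auto
    also have "\<dots> \<le> Duh \<Lambda> (K * M d 0) (\<lambda>r. K / \<Lambda> * M d r + (2 * \<Lambda> * C1 + 2 * D / \<Lambda>) * (L d r + Ps d r)) t"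
    proof (rule Duh_mono)
      show "C2 * M d 0 \<le> K * M d 0" using nonneg(1)[OF d T0] D by (intro mult_right_mono) (auto simp: K_def)
      fix q assume "q \<in> {0..t}"
      then have q: "q \<in> {0..T d}" using t by auto
      have n: "0 \<le> M d q" "0 \<le> L d q" "0 \<le> Ps d q" using nonneg[OF d q] by auto
      have "(2 * (\<Lambda>\<^sup>2 * (C1 * L d q) + D * (M d q + Ps d q))) / \<Lambda> = 2 * \<Lambda> * C1 * L d q + 2 * D / \<Lambda> * M d q + 2 * D / \<Lambda> * Ps d q"
        using \<Lambda> by (simp add: field_simps power2_eq_square)
      also have "\<dots> \<le> 2 * \<Lambda> * C1 * (L d q + Ps d q) + K / \<Lambda> * M d q + 2 * D / \<Lambda> * (L d q + Ps d q)"
        using n \<Lambda> C1 D C2 by (intro add_mono mult_mono mult_left_mono divide_right_mono) (auto simp: K_def)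
      finally show "(2 * (\<Lambda>\<^sup>2 * (C1 * L d q) + D * (M d q + Ps d q))) / \<Lambda> \<le> K / \<Lambda> * M d q + (2 * \<Lambda> * C1 + 2 * D / \<Lambda>) * (L d q + Ps d q)"
        by (simp add: algebra_simps)
    qed
    finally show ?thesis .
  qed
  have "\<exists>C>0. \<forall>d\<in>S. \<forall>t\<in>{0..T d}. tau_le d t (Duh \<Lambda> (K * M d 0) (\<lambda>r. K / \<Lambda> * M d r + C * (L d r + Ps d r)) t)" if "\<Lambda> > 0" for \<Lambda>
    using main[OF that] that C1 D by (intro exI[of _ "2 * \<Lambda> * C1 + 2 * D / \<Lambda>"]) (auto intro!: add_pos_pos)
  then show ?thesis using K by blast
qed

lemma tt_up: "\<exists>up>0. \<forall>i\<in>I. \<forall>z. tt i z \<le> up"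
proof -
  obtain B where B: "B > 0" "\<And>i. i \<in> I \<Longrightarrow> Gk s (tt i) B" using G_tt by (auto simp: OG_def)
  obtain s' where s': "s = Suc s'" using s by (cases s) auto
  have "tt i z \<le> sqrt B" if i: "i \<in> I" for i z
  proof -
    have "(tt i z)\<^sup>2 \<le> B" using B(2)[OF i] s' by simp
    then show ?thesis using real_le_rsqrt by blast
  qed
  then show ?thesis using B(1) by (intro exI[of _ "sqrt B"]) auto
qed

text \<open>For hs = [] the drift term is left out and treated as drift: if s = 1,
  \<open>st1\<close> is only uniformly locally and \<open>u1i\<close> only globally in L^2, so their
  product is no admissible source. For nonempty hs, \<open>length hs < s\<close> forces s \<ge> 2,
  and the drift term can join the source.\<close>

definition rem where
  "rem hs i z = (if hs = [] then R0 i z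
     else dqs hs (\<lambda>z. 2 * \<nu> * (st i z * st1 i z) * u1i i z + R0 i z) z
       + (dqs hs (\<lambda>z. \<nu> * (st i z * st i z) * u2i i z) z - \<nu> * (st i z * st i z) * dqs hs (u2i i) z))"

text \<open>u_zz has only s - 2 orders, but the commutator with its coefficient saves one
  derivative, so up to s - 1 quotients are admissible.\<close>

lemma rem_bound: "\<exists>C>0. \<forall>i\<in>I. \<forall>hs. length hs < s \<longrightarrow> set hs \<subseteq> {0<..1} \<longrightarrow> L2 (rem hs i) (C * (wM i + wP i))"
proof -
  let ?w = "\<lambda>i. wM i + wP i"
  have R: "OH (s - 1) I R0 ?w"
    by (intro H_R0 OH_wM OH_wP z_bounds)
  then obtain C0 where C0: "C0 > 0" "\<And>i. i \<in> I \<Longrightarrow> Hk (s - 1) (R0 i) (C0 * ?w i)" by (auto simp: OH_def)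
  have "\<exists>C>0. \<forall>i\<in>I. \<forall>hs. length hs < s \<longrightarrow> hs \<noteq> [] \<longrightarrow> set hs \<subseteq> {0<..1} \<longrightarrow> L2 (rem hs i) (C * ?w i)"
  proof (cases "s = 1")
    case True
    then show ?thesis by (intro exI[of _ 1]) auto
  next
    case False
    then have s2: "Suc (Suc (s - 2)) = s" "Suc (s - 2) = s - 1" "0 < s - 1" using s by auto
    have "OH (s - 1) I (\<lambda>i z. (2 * \<nu> * (st i z * st1 i z)) * u1i i z) ?w"
      by (rule OH_mult[OF OG_cmul[OF GG1[OF G_st G_st1]] OH_wM[OF u1_bound]]) (use s2 in auto)
    from OH_add[OF this R] obtain C1 where C1: "C1 > 0"
      "\<And>i. i \<in> I \<Longrightarrow> Hk (s - 1) (\<lambda>z. (2 * \<nu> * (st i z * st1 i z)) * u1i i z + R0 i z) (C1 * ?w i)"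
      by (auto simp: OH_def)
    have "OH (s - 2) I u2i wM"
    proof (rule OH_deriv[of _ _ u1i])
      show "OH (Suc (s - 2)) I u1i wM" using u1_bound s2 by simp
      show "(u1i i has_real_derivative u2i i z) (at z)" if "i \<in> I" for i z
        using that i_derivs(5) by (cases i) auto
      show "continuous_on UNIV (u2i i)" if "i \<in> I" for i
      proof -
        obtain d t h a where e: "i = (d,t,h,a)" by (cases i)
        then show ?thesis using that cont2_slice_x[OF i_conts(8), of d t UNIV h a] by (auto simp: I_def)
      qed
    qed
    from OH_wM[OF this] obtain C2 where C2: "C2 > 0" "\<And>i. i \<in> I \<Longrightarrow> Hk (s - 2) (u2i i) (C2 * ?w i)"
      by (auto simp: OH_def)
    have "OG s I (\<lambda>i z. \<nu> * (st i z * st i z))" by (intro OG_cmul GG G_st)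
    then obtain B where B: "B > 0" "\<And>i. i \<in> I \<Longrightarrow> Gk s (\<lambda>z. \<nu> * (st i z * st i z)) B" by (auto simp: OG_def)
    obtain D where D: "D > 0" "\<And>k hs f g A B. k < s \<Longrightarrow> length hs = Suc k \<Longrightarrow> set hs \<subseteq> {0<..1} \<Longrightarrow> Hk k f A \<Longrightarrow> Gk (Suc (Suc k)) g B \<Longrightarrow>
       L2 (\<lambda>x. dqs hs (\<lambda>y. g y * f y) x - g x * dqs hs f x) (D * B * A)"
      using comm_bound_uniform[of s] by blast
    have *: "L2 (rem hs i) (2 * (C1 + D * B * C2) * ?w i)"
      if i: "i \<in> I" and hs: "length hs < s" "hs \<noteq> []" "set hs \<subseteq> {0<..1}" for i hs
    proof -
      obtain k where k: "length hs = Suc k" using hs(2) by (cases hs) auto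
      have pos: "set hs \<subseteq> {0<..}" using hs(3) by auto
      have 1: "L2 (dqs hs (\<lambda>z. (2 * \<nu> * (st i z * st1 i z)) * u1i i z + R0 i z)) (C1 * ?w i)"
        by (rule L2_dqs[OF Hk_lower[OF C1(2)[OF i]] pos]) (use hs in simp)
      have 2: "L2 (\<lambda>z. dqs hs (\<lambda>z. \<nu> * (st i z * st i z) * u2i i z) z - \<nu> * (st i z * st i z) * dqs hs (u2i i) z) (D * B * (C2 * ?w i))"
        by (rule D(2)[of k]) (use k hs s2 in \<open>auto intro!: Hk_lower[OF C2(2)[OF i]] Gk_lower[OF B(2)[OF i]] simp del: Gk.simps\<close>)
      show ?thesis using L2_add[OF 1 2] hs(2) by (simp add: rem_def[abs_def] algebra_simps)
    qed
    then show ?thesis using C1 D B C2 by (intro exI[of _ "2 * (C1 + D * B * C2)"]) (auto intro!: add_pos_pos mult_pos_pos)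
  qed
  then obtain C where C: "C > 0" "\<And>i hs. i \<in> I \<Longrightarrow> length hs < s \<Longrightarrow> hs \<noteq> [] \<Longrightarrow> set hs \<subseteq> {0<..1} \<Longrightarrow> L2 (rem hs i) (C * ?w i)"
    by blast
  have "L2 (rem hs i) ((C + C0) * ?w i)" if i: "i \<in> I" and hs: "length hs < s" "set hs \<subseteq> {0<..1}" for i hs
  proof -
    have w: "0 \<le> ?w i" using weights[OF i] by simp
    have m: "C * ?w i \<le> (C + C0) * ?w i" "C0 * ?w i \<le> (C + C0) * ?w i"
      using w C(1) C0(1) by (auto intro!: mult_right_mono)
    show ?thesis
    proof (cases "hs = []")
      case True
      then have "rem hs i = R0 i" by (auto simp: rem_def)
      then show ?thesis using L2_mono[OF Hk_L2[OF C0(2)[OF i]] m(2)] by simp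
    next
      case False
      then show ?thesis using L2_mono[OF C(2)[OF i hs(1) _ hs(2)] m(1)] by simp
    qed
  qed
  then show ?thesis using C(1) C0(1) by (intro exI[of _ "C + C0"]) auto
qed

lemma interp_i:
  assumes f: "OH s I f wM" "OH 0 I f wL" and \<eta>: "\<eta> > 0"
  shows "\<exists>C>0. \<forall>i\<in>I. Hk (s - 1) (f i) (\<eta> * wM i + C * wL i)"
proof -
  obtain C1 where C1: "C1 > 0" "\<And>i. i \<in> I \<Longrightarrow> Hk s (f i) (C1 * wM i)" using f(1) by (auto simp: OH_def)
  obtain C2 where C2: "C2 > 0" "\<And>i. i \<in> I \<Longrightarrow> L2 (f i) (C2 * wL i)" using f(2) by (auto simp: OH_def)
  obtain C where C: "C > 0" "\<And>f M L. Hk (Suc (s - 1)) f M \<Longrightarrow> L2 f L \<Longrightarrow> Hk (s - 1) f (\<eta> / C1 * M + C * L)"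
    using interp[of "\<eta> / C1" "s - 1"] \<eta> C1 by (auto simp del: Hk.simps)
  have "Hk (s - 1) (f i) (\<eta> * wM i + C * C2 * wL i)" if i: "i \<in> I" for i
    using C(2)[OF _ C2(2)[OF i], of "C1 * wM i"] C1(2)[OF i] C1(1) s by (simp del: Hk.simps add: mult.assoc)
  then show ?thesis using C C2 by (intro exI[of _ "C * C2"]) auto
qed

text \<open>The rate \<Lambda> is free, and \<open>K\<close> must not depend on it. In
  \<open>parabolic_estimate\<close> the coefficient depending on \<Lambda> multiplies only the norm
  of dqs hs u, which has order at most s - 1 and is interpolated between M and L so as to cancel
  that coefficient. The source keeps the factor \<open>par_K\<close>.\<close>

lemma est_u:
  "\<exists>K>0. \<forall>\<Lambda>>0. \<exists>C>0. \<forall>d\<in>S. \<forall>t\<in>{0..T d}. u_le d t (Duh \<Lambda> (K * M d 0) (\<lambda>r. K * M d r + C * (L d r + Ps d r)) t)"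
proof -
  obtain up where up: "up > 0" "\<And>i z. i \<in> I \<Longrightarrow> tt i z \<le> up" using tt_up by blast
  have stb: "inverse up \<le> st i z" "st i z \<le> inverse lo" if "i \<in> I" for i z
    using up(2)[OF that, of z] tt_low[OF that, of z] lo by (auto simp: st_def intro!: le_imp_inverse_le)
  define g0 g1 where "g0 = \<nu> * (inverse up * inverse up)" and "g1 = \<nu> * (inverse lo * inverse lo)"
  have g0: "g0 > 0" using nu up by (simp add: g0_def)
  have gb: "g0 \<le> \<nu> * (st i z * st i z)" "\<nu> * (st i z * st i z) \<le> g1" if "i \<in> I" for i z
  proof -
    have "0 < inverse up" "0 < inverse lo" using up lo by auto
    moreover have "0 \<le> st i z" using stb(1)[OF that, of z] \<open>0 < inverse up\<close> by linarith
    ultimately show "g0 \<le> \<nu> * (st i z * st i z)" "\<nu> * (st i z * st i z) \<le> g1"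
      using stb[OF that, of z] nu unfolding g0_def g1_def by (auto intro!: mult_left_mono mult_mono)
  qed
  have "OG 0 I (\<lambda>i z. 2 * \<nu> * (st i z * st1 i z))" by (rule OG_lower[OF OG_cmul[OF GG1[OF G_st G_st1]]]) simp
  then obtain B where B: "B > 0" "\<And>i. i \<in> I \<Longrightarrow> U2 (\<lambda>z. 2 * \<nu> * (st i z * st1 i z)) B" by (auto simp: OG_def)
  obtain C0 where C0: "C0 > 0" "\<And>i hs. i \<in> I \<Longrightarrow> length hs < s \<Longrightarrow> set hs \<subseteq> {0<..1} \<Longrightarrow> L2 (rem hs i) (C0 * (wM i + wP i))"
    using rem_bound by blast
  obtain C1 where C1: "C1 > 0" "\<And>i. i \<in> I \<Longrightarrow> Hk s (ui i) (C1 * wM i)" using z_bounds(2) by (auto simp: OH_def)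
  obtain C2 where C2: "C2 > 0" "\<And>i. i \<in> I \<Longrightarrow> Hk (s - 1) (u1i i) (C2 * wM i)" using u1_bound by (auto simp: OH_def)
  define A0 where "A0 = C1 + C2"
  define Kp where "Kp = \<bar>par_K g0 g1 B\<bar>"
  define K where "K = 2 * A0 + Kp * C0 + 1"
  have K: "K > 0" using C0 C1 C2 by (simp add: K_def A0_def Kp_def add_pos_nonneg add_nonneg_pos)
  have main: "\<exists>C>0. \<forall>d\<in>S. \<forall>t\<in>{0..T d}. u_le d t (Duh \<Lambda> (K * M d 0) (\<lambda>r. K * M d r + C * (L d r + Ps d r)) t)" if \<Lambda>: "\<Lambda> > 0" for \<Lambda>
  proof -
    define Cp where "Cp = \<bar>par_C \<Lambda> g0 g1 B\<bar> + 1"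
    have Cp: "Cp > 0" by (simp add: Cp_def)
    \<comment> \<open>The factor 1/Cp compensates the \<Lambda>-dependent coefficient: Cp * (1/Cp) *
      M = M.\<close>
    obtain C3 where C3: "C3 > 0" "\<And>i. i \<in> I \<Longrightarrow> Hk (s - 1) (ui i) (1 / Cp * wM i + C3 * wL i)"
      using interp_i[OF z_bounds(2,6), of "1 / Cp"] Cp by auto
    define C where "C = Cp * C3 + Kp * C0"
    have C: "C > 0" using Cp C3 C0 by (simp add: C_def Kp_def add_pos_nonneg)
    have "(\<integral>\<^sup>+z. ennreal ((dqs hs (ui (d,t,1,0)) z)\<^sup>2 + (dqs hs (u1i (d,t,1,0)) z)\<^sup>2) \<partial>lborel)
     \<le> Duh \<Lambda> (K * M d 0) (\<lambda>r. K * M d r + C * (L d r + Ps d r)) t"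
      if d: "d \<in> S" and t: "t \<in> {0..T d}" and hs: "length hs < s" "set hs \<subseteq> {0<..1}" for d t hs
    proof -
      have T0: "0 \<in> {0..T d}" using T[OF d] by simp
      have I: "(d,q,1,0) \<in> I" if "q \<in> {0..T d}" for q using d that by (intro I_mem) auto
      have pos: "set hs \<subseteq> {0<..}" using hs(2) by auto
      note c = cont2_mult cont2_add cont2_diff cont2_minus cont2_power cont2_const i_conts[OF d] prof_conts[OF d] conts
        conts2[OF d zero_less_one order_refl]
      let ?i = "\<lambda>q. (d, q, 1 :: real, 0 :: real)"
      let ?g = "\<lambda>z q. \<nu> * (st (?i q) z * st (?i q) z)"
      let ?F = "\<lambda>q z. ?g z q * u2i (?i q) z + (2 * \<nu> * (st (?i q) z * st1 (?i q) z) * u1i (?i q) z + R0 (?i q) z)"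
      let ?m = "\<lambda>z q. if hs = [] then 2 * \<nu> * (st (?i q) z * st1 (?i q) z) else 0"
      have P: "parabolic (T d) (\<lambda>z q. dqs hs (ui (?i q)) z) (\<lambda>z q. dqs hs (u1i (?i q)) z) (\<lambda>z q. dqs hs (u2i (?i q)) z)
        (\<lambda>z q. dqs hs (?F q) z)
        ?g ?m (\<lambda>z q. rem hs (?i q) z)"
      proof
        show "T d > 0" by (rule T[OF d])
        show "cont2 (T d) (\<lambda>z q. dqs hs (ui (?i q)) z)" "cont2 (T d) (\<lambda>z q. dqs hs (u1i (?i q)) z)"
          "cont2 (T d) (\<lambda>z q. dqs hs (u2i (?i q)) z)" by (intro cont2_dqs c)+
        show "cont2 (T d) (\<lambda>z q. dqs hs (?F q) z)"
          by (intro cont2_dqs c)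
        show "cont2 (T d) ?g" by (intro c)
        show "cont2 (T d) ?m" by (cases "hs = []") (auto intro!: c)
        show "cont2 (T d) (\<lambda>z q. rem hs (?i q) z)"
          by (cases "hs = []") (auto simp: rem_def intro!: c cont2_dqs)
        fix z q assume q: "q \<in> {0..T d}"
        show "(dqs hs (ui (?i q)) has_real_derivative dqs hs (u1i (?i q)) z) (at z)"
          by (intro dqs_deriv_z i_derivs I q)
        show "(dqs hs (u1i (?i q)) has_real_derivative dqs hs (u2i (?i q)) z) (at z)"
          by (intro dqs_deriv_z i_derivs I q)
        show "((\<lambda>q. dqs hs (ui (?i q)) z) has_real_derivative dqs hs (?F q) z) (at q within {0..T d})"
        proof (rule dqs_deriv)
          fix z
          show "((\<lambda>q. ui (?i q) z) has_real_derivative ?F q z) (at q within {0..T d})"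
            using ui_dt'[OF d q zero_less_one order_refl, of 0 z] by (simp add: power2_eq_square add.assoc)
        qed
        show "dqs hs (?F q) z =
          ?g z q * dqs hs (u2i (?i q)) z + ?m z q * dqs hs (u1i (?i q)) z + rem hs (?i q) z"
          by (cases "hs = []") (simp_all add: rem_def dqs_add)
      qed
      have "(\<integral>\<^sup>+z. ennreal ((dqs hs (ui (?i t)) z)\<^sup>2 + (dqs hs (u1i (?i t)) z)\<^sup>2) \<partial>lborel)
        \<le> Duh \<Lambda> (2 * (A0 * M d 0)) (\<lambda>q. par_C \<Lambda> g0 g1 B * (1 / Cp * M d q + C3 * L d q) + par_K g0 g1 B * (C0 * (M d q + Ps d q))) t"
      proof (rule parabolic.parabolic_estimate[OF P g0 \<Lambda> _ _ _ _ t])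
        have le: "length hs \<le> s - 1" "length hs \<le> s" using hs by auto
        have A: "L2 (dqs hs (ui (?i q))) (A0 * M d q)" "L2 (dqs hs (u1i (?i q))) (A0 * M d q)" if q: "q \<in> {0..T d}" for q
        proof -
          have m: "C1 * M d q \<le> A0 * M d q" "C2 * M d q \<le> A0 * M d q"
            using nonneg(1)[OF d q] C1 C2 by (auto simp: A0_def intro!: mult_right_mono)
          have "Hk (length hs) (ui (?i q)) (C1 * M d q)" "Hk (length hs) (u1i (?i q)) (C2 * M d q)"
            using Hk_lower[OF C1(2)[OF I[OF q]] le(2)] Hk_lower[OF C2(2)[OF I[OF q]] le(1)] by (simp_all add: wM_def)
          from L2_mono[OF L2_dqs[OF this(1) pos] m(1)] L2_mono[OF L2_dqs[OF this(2) pos] m(2)]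
          show "L2 (dqs hs (ui (?i q))) (A0 * M d q)" "L2 (dqs hs (u1i (?i q))) (A0 * M d q)" .
        qed
        show "L2 (dqs hs (ui (?i 0))) (A0 * M d 0)" "L2 (dqs hs (u1i (?i 0))) (A0 * M d 0)" using A[OF T0] .
        fix q assume q: "q \<in> {0..T d}"
        show "g0 \<le> ?g z q" "?g z q \<le> g1" for z
          using gb[OF I[OF q]] by auto
        show "U2 (\<lambda>z. ?m z q) B"
          using B(2)[OF I[OF q]] U2_bounded[of "\<lambda>_. 0" B] B(1) by (cases "hs = []") auto
        \<comment> \<open>The bound M \<le> 1 makes this independent of time, as required of the
          qualitative bound \<open>Q\<close>.\<close>
        show "L2 (dqs hs (u1i (?i q))) A0"
        proof (rule L2_mono[OF A(2)[OF q]])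
          have "A0 * M d q \<le> A0 * 1" using small(1)[OF d q] C1 C2 by (intro mult_left_mono) (auto simp: A0_def)
          then show "A0 * M d q \<le> A0" by simp
        qed
        show "L2 (dqs hs (ui (?i q))) (1 / Cp * M d q + C3 * L d q)"
          using L2_dqs[OF Hk_lower[OF C3(2)[OF I[OF q]] le(1)] pos] by (simp add: wM_def wL_def)
        show "L2 (rem hs (?i q)) (C0 * (M d q + Ps d q))"
          using C0(2)[OF I[OF q] hs] by (simp add: wM_def wP_def)
      qed
      also have "\<dots> \<le> Duh \<Lambda> (K * M d 0) (\<lambda>r. K * M d r + C * (L d r + Ps d r)) t"
      proof (rule Duh_mono)
        have KA: "2 * A0 \<le> K" "1 + Kp * C0 \<le> K" using C0 C1 C2 by (auto simp: K_def Kp_def A0_def)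
        show "2 * (A0 * M d 0) \<le> K * M d 0" using mult_right_mono[OF KA(1) nonneg(1)[OF d T0]] by (simp add: mult.assoc)
        fix q assume "q \<in> {0..t}"
        then have q: "q \<in> {0..T d}" using t by auto
        have n: "0 \<le> M d q" "0 \<le> L d q" "0 \<le> Ps d q" using nonneg[OF d q] by auto
        have "par_C \<Lambda> g0 g1 B * (1 / Cp * M d q + C3 * L d q) \<le> Cp * (1 / Cp * M d q + C3 * L d q)"
          using n Cp C3 by (intro mult_right_mono add_nonneg_nonneg) (auto simp: Cp_def)
        also have "\<dots> = M d q + Cp * C3 * L d q" using Cp by (simp add: distrib_left)
        finally have 1: "par_C \<Lambda> g0 g1 B * (1 / Cp * M d q + C3 * L d q) \<le> M d q + Cp * C3 * L d q" .
        have 2: "par_K g0 g1 B * (C0 * (M d q + Ps d q)) \<le> Kp * (C0 * (M d q + Ps d q))"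
          using n C0 by (intro mult_right_mono) (auto simp: Kp_def)
        have "par_C \<Lambda> g0 g1 B * (1 / Cp * M d q + C3 * L d q) + par_K g0 g1 B * (C0 * (M d q + Ps d q))
          \<le> (1 + Kp * C0) * M d q + (Cp * C3 * L d q + Kp * C0 * Ps d q)"
          using 1 2 by (simp add: algebra_simps)
        also have "\<dots> \<le> K * M d q + (C * L d q + C * Ps d q)"
        proof (intro add_mono mult_right_mono KA n)
          have "0 \<le> Kp * C0" "0 \<le> Cp * C3" using C0 Cp C3 by (auto simp: Kp_def)
          then show "Cp * C3 \<le> C" "Kp * C0 \<le> C" by (auto simp: C_def)
        qed
        finally show "par_C \<Lambda> g0 g1 B * (1 / Cp * M d q + C3 * L d q) + par_K g0 g1 B * (C0 * (M d q + Ps d q)) \<le> K * M d q + C * (L d q + Ps d q)"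
          by (simp add: distrib_left)
      qed
      finally show ?thesis .
    qed
    then show ?thesis using C by blast
  qed
  then show ?thesis using K by blast
qed

end

section \<open>The damped quantity and the energy argument\<close>

lemma nn_fatou_eps:
  assumes F: "\<And>n. F n \<in> borel_measurable borel" "\<And>n. (nsq (F n)) \<le> B + ennreal (e n)"
    and lim: "\<And>x. (\<lambda>n. F n x) \<longlonglongrightarrow> f x" and e: "e \<longlonglongrightarrow> 0"
  shows "nsq f \<le> B"
proof -
  note [measurable] = F(1)
  have "liminf (\<lambda>n. ennreal ((F n x)\<^sup>2)) = ennreal ((f x)\<^sup>2)" for x
    by (intro lim_imp_Liminf tendsto_intros lim) simp
  then have "nsq f = (\<integral>\<^sup>+x. liminf (\<lambda>n. ennreal ((F n x)\<^sup>2)) \<partial>lborel)" by simp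
  also have "\<dots> \<le> liminf (\<lambda>n. \<integral>\<^sup>+x. ennreal ((F n x)\<^sup>2) \<partial>lborel)"
    by (rule nn_integral_liminf) measurable
  also have "\<dots> \<le> liminf (\<lambda>n. B + ennreal (e n))"
    by (intro Liminf_mono always_eventually allI F)
  also have "\<dots> = B + ennreal 0" by (intro lim_imp_Liminf tendsto_intros e) auto
  finally show ?thesis by simp
qed

lemma Duh_init: assumes "0 \<le> A" "0 \<le> B" "0 \<le> \<Lambda>" "0 \<le> t" shows "Duh \<Lambda> (A + B) g t \<le> Duh \<Lambda> A g t + ennreal B"
proof -
  have "exp (- \<Lambda> * t) * B \<le> 1 * B" using assms by (intro mult_right_mono) auto
  then have "ennreal (exp (- \<Lambda> * t) * (A + B)) \<le> ennreal (exp (- \<Lambda> * t) * A) + ennreal B"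
    using assms by (simp add: distrib_left ennreal_plus[symmetric] del: ennreal_plus)
  then show ?thesis unfolding Duh_def by (simp add: add.assoc add.left_commute add_mono add_right_mono)
qed

context dyn
begin

text \<open>The commutator of the quotients with the damping coefficient \<kappa> st counts as
  source, so that dqs hs om obeys a damped equation of the same form as om.\<close>

definition src where
  "src hs i z = dqs hs (Sh i) z - \<kappa> * (dqs hs (\<lambda>z. st i z * om i z) z - st i z * dqs hs (om i) z)"

text \<open>The fourth component of an index is used as the common bound, so that the constant
  does not depend on the way in which the lower-order norms are estimated.\<close>

lemma src_bound:
  "\<exists>C>0. \<forall>d t h a hs. (d,t,h,a) \<in> I \<longrightarrow> Hk (s - 1) (ti (d,t,h,a)) a \<longrightarrow> Hk (s - 1) (ui (d,t,h,a)) a \<longrightarrow>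
     Hk s (pi (d,t,h,a)) a \<longrightarrow> Hk s (qi (d,t,h,a)) a \<longrightarrow> length hs < s \<longrightarrow> set hs \<subseteq> {0<..1} \<longrightarrow> L2 (src hs (d,t,h,a)) (C * a)"
proof -
  define w :: "'d \<times> real \<times> real \<times> real \<Rightarrow> real" where "w = (\<lambda>(d,t,h,a). a)"
  define J where "J = {i \<in> I. Hk (s - 1) (ti i) (w i) \<and> Hk (s - 1) (ui i) (w i) \<and> Hk s (pi i) (w i) \<and> Hk s (qi i) (w i)}"
  have JI: "J \<subseteq> I" by (auto simp: J_def)
  note J = slices_subset[OF JI]
  have w: "OH (s - 1) J ti w" "OH (s - 1) J ui w" "OH s J pi w" "OH s J qi w"
    by (rule OH_1; simp add: J_def del: Hk.simps)+
  obtain C0 where C0: "C0 > 0" "\<And>i. i \<in> J \<Longrightarrow> Hk (s - 1) (Sh i) (C0 * w i)"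
    using slices.H_Sh[OF J w] by (auto simp: OH_def)
  obtain B where B: "B > 0" "\<And>i. i \<in> I \<Longrightarrow> Gk s (st i) B" using G_st by (auto simp: OG_def)
  obtain D where D: "D > 0" "\<And>k hs f g A B. k < s \<Longrightarrow> length hs = Suc k \<Longrightarrow> set hs \<subseteq> {0<..1} \<Longrightarrow> Hk k f A \<Longrightarrow> Gk (Suc (Suc k)) g B \<Longrightarrow>
       L2 (\<lambda>x. dqs hs (\<lambda>y. g y * f y) x - g x * dqs hs f x) (D * B * A)"
    using comm_bound_uniform[of s] by blast
  \<comment> \<open>A commutator with k + 1 < s quotients needs om at order k \<le> s - 2, which
    costs \<tau> and u at order at most s - 1. For s = 1 there is no commutator.\<close>
  have "\<exists>C>0. \<forall>i\<in>J. \<forall>k. Suc k < s \<longrightarrow> Hk k (om i) (C * w i)"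
  proof (cases "s = 1")
    case True then show ?thesis by (intro exI[of _ 1]) auto
  next
    case False
    then have s2: "Suc (s - 2) = s - 1" using s by auto
    have "OH (s - 2) J om w"
      by (rule slices.H_om[OF J]) (use w s2 in auto)
    then obtain C where "C > 0" "\<And>i. i \<in> J \<Longrightarrow> Hk (s - 2) (om i) (C * w i)" by (auto simp: OH_def)
    moreover have "k \<le> s - 2" if "Suc k < s" for k using that by auto
    ultimately show ?thesis by (intro exI[of _ C]) (blast intro: Hk_lower)
  qed
  then obtain C1 where C1: "C1 > 0" "\<And>i k. i \<in> J \<Longrightarrow> Suc k < s \<Longrightarrow> Hk k (om i) (C1 * w i)" by blast
  have *: "L2 (src hs i) (2 * (C0 + \<kappa>\<^sup>2 * (D * B * C1)) * w i)" if i: "i \<in> J" and hs: "length hs < s" "set hs \<subseteq> {0<..1}" for i hs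
  proof -
    have pos: "set hs \<subseteq> {0<..}" using hs by auto
    have 1: "L2 (dqs hs (Sh i)) (C0 * w i)"
      by (rule L2_dqs[OF Hk_lower[OF C0(2)[OF i]] pos]) (use hs in simp)
    have w0: "0 \<le> w i" using Hk_nonneg[OF C0(2)[OF i]] C0(1) by (simp add: zero_le_mult_iff)
    have 2: "L2 (\<lambda>z. dqs hs (\<lambda>z. st i z * om i z) z - st i z * dqs hs (om i) z) (D * B * (C1 * w i))"
    proof (cases "hs = []")
      case True
      then show ?thesis using w0 B C1 D by (simp add: L2_def)
    next
      case False
      then obtain k where k: "length hs = Suc k" by (cases hs) auto
      show ?thesis
        by (rule D(2)[of k]) (use k hs i JI in \<open>auto intro!: C1(2) Gk_lower[OF B(2)] simp del: Gk.simps\<close>)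
    qed
    show ?thesis unfolding src_def[abs_def] using L2_diff[OF 1 L2_cmul[OF 2]] by (simp add: algebra_simps)
  qed
  have "2 * (C0 + \<kappa>\<^sup>2 * (D * B * C1)) > 0" using C0 B C1 D by (auto intro!: add_pos_nonneg)
  moreover have "(d,t,h,a) \<in> J" if "(d,t,h,a) \<in> I" "Hk (s - 1) (ti (d,t,h,a)) a" "Hk (s - 1) (ui (d,t,h,a)) a"
     "Hk s (pi (d,t,h,a)) a" "Hk s (qi (d,t,h,a)) a" for d t h a
    using that by (simp add: J_def w_def)
  moreover have "w (d,t,h,a) = a" for d t h a by (simp add: w_def)
  ultimately show ?thesis using * by metis
qed

text \<open>\<open>om\<close> differs from the true effective velocity by a multiple of p - ph, of
  size h in L^2 by \<open>L2_dq_diff\<close>. The quotients of this error are estimated crudely: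
  \<open>e\<close> depends on hs, but \<open>K\<close> does not, and h tends to 0 with hs
  fixed.\<close>

lemma om_init:
  "\<exists>K>0. \<forall>hs. length hs < s \<longrightarrow> set hs \<subseteq> {0<..1} \<longrightarrow> (\<exists>e\<ge>0. \<forall>i\<in>I.
     L2 (dqs hs (om i)) (K * wM i + e * (hi i)\<^sup>2))"
proof -
  have ss: "Suc (s - 1) = s" using s by simp
  have "OH (s - 1) I wi wM"
    by (intro OH_add OH_cmul OH_lower[OF z_bounds(2)] H_sg1) (use z_bounds(1) ss in auto)
  then obtain K where K: "K > 0" "\<And>i. i \<in> I \<Longrightarrow> Hk (s - 1) (wi i) (K * wM i)" by (auto simp: OH_def)
  have "OH (s - 1) I p1i wP" by (rule OH_deriv[OF _ dp cont1(1)]) (use z_bounds(3) ss in auto)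
  from OH_lower[OF this le0] obtain D where D: "D > 0" "\<And>i. i \<in> I \<Longrightarrow> L2 (p1i i) (D * wP i)" by (auto simp: OH_def)
  have e: "L2 (\<lambda>z. pi i z - ph i z) (D * (hi i)\<^sup>2)" if i: "i \<in> I" for i
  proof -
    have h0: "hi i > 0" using h[OF i] by simp
    have "prim (\<lambda>z. Xi i z - z) (pi i)"
      by (rule prim_deriv) (use dX[OF i] cont0[OF i] in \<open>auto intro!: derivative_eq_intros\<close>)
    moreover have "prim (pi i) (p1i i)" by (rule prim_deriv[OF dp[OF i] cont1(1)[OF i]])
    ultimately have "L2 (\<lambda>x. dq (hi i) (\<lambda>z. Xi i z - z) x - pi i x) ((hi i)\<^sup>2 * (D * wP i))"
      by (rule L2_dq_diff[OF _ _ D(2)[OF i] h0])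
    from L2_cmul[OF this, of "-1"] have "L2 (\<lambda>z. pi i z - ph i z) ((hi i)\<^sup>2 * (D * wP i))"
      using h0 by (simp add: ph_def dq_def field_simps)
    moreover have "wP i \<le> 1" using i small(2) by (auto simp: wP_def I_def)
    then have "(hi i)\<^sup>2 * (D * wP i) \<le> (hi i)\<^sup>2 * (D * 1)" using D by (intro mult_left_mono) auto
    ultimately show ?thesis using L2_mono by (simp add: mult.commute)
  qed
  have "OH 0 I (\<lambda>i z. pi i z - ph i z) (\<lambda>i. (hi i)\<^sup>2)" by (rule OH_I[OF D(1)]) (simp add: e)
  from OH_cmul[OF HG[OF this G_sb1], of \<nu>] obtain E where E: "E > 0" "\<And>i. i \<in> I \<Longrightarrow> L2 (\<lambda>z. \<nu> * ((pi i z - ph i z) * sb1 (Xi i z))) (E * (hi i)\<^sup>2)"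
    by (auto simp: OH_def)
  have oe: "om i = (\<lambda>z. (ui i z + \<nu> * sg1 i z) + \<nu> * ((pi i z - ph i z) * sb1 (Xi i z)))" for i
    by (rule ext) (simp add: om_eq distrib_left)
  have "\<exists>e\<ge>0. \<forall>i\<in>I. L2 (dqs hs (om i)) (2 * K * wM i + e * (hi i)\<^sup>2)" if hs: "length hs < s" "set hs \<subseteq> {0<..1}" for hs
  proof -
    have pos: "set hs \<subseteq> {0<..}" using hs by auto
    obtain c where c: "c \<ge> 0" "\<And>f A. L2 f A \<Longrightarrow> L2 (dqs hs f) (c * A)"
      using L2_dqs_plain[OF _ pos, of "\<lambda>_. 0" 0] by (auto simp: L2_def)
    have "L2 (dqs hs (om i)) (2 * K * wM i + (2 * c * E) * (hi i)\<^sup>2)" if i: "i \<in> I" for i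
    proof -
      have "L2 (dqs hs (wi i)) (K * wM i)"
        by (rule L2_dqs[OF Hk_lower[OF K(2)[OF i]] pos]) (use hs in simp)
      from L2_add[OF this c(2)[OF E(2)[OF i]]] show ?thesis unfolding oe dqs_add by (simp add: algebra_simps)
    qed
    then show ?thesis using c E by (intro exI[of _ "2 * c * E"]) auto
  qed
  then show ?thesis using K by (intro exI[of _ "2 * K"]) auto
qed

lemma om_limit:
  assumes d: "d \<in> S" "t \<in> {0..T d}"
  shows "(\<lambda>n. dqs hs (om (d, t, 1 / real (Suc n), 0)) z) \<longlonglongrightarrow> dqs hs (wi (d,t,1,0)) z"
proof (induction hs arbitrary: z)
  case Nil
  have I: "(d,t,1,0) \<in> I" using d by (intro I_mem) auto
  have "(\<lambda>n. dq (1 / real (Suc n)) (Xi (d,t,1,0)) z) \<longlonglongrightarrow> 1 + pi (d,t,1,0) z"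
  proof -
    have "((\<lambda>h. (Xi (d,t,1,0) (z + h) - Xi (d,t,1,0) z) / h) \<longlongrightarrow> 1 + pi (d,t,1,0) z) (at 0)"
      using dX[OF I, of z] by (simp add: DERIV_def)
    moreover have "filterlim (\<lambda>n. 1 / real (Suc n)) (at 0) sequentially"
      by (rule filterlim_atI) (use LIMSEQ_inverse_real_of_nat in \<open>auto simp: inverse_eq_divide\<close>)
    ultimately show ?thesis unfolding dq_def by (rule filterlim_compose)
  qed
  moreover have "dq (1 / real (Suc n)) (Xi (d,t,1,0)) z = ph (d, t, 1 / real (Suc n), 0) z + 1" for n
    unfolding ph_def unfolding indep(1)[of d t "1 / real (Suc n)" 0 1 0] hi_def by simp
  ultimately have "(\<lambda>n. ph (d, t, 1 / real (Suc n), 0) z + 1 - 1) \<longlonglongrightarrow> 1 + pi (d,t,1,0) z - 1" by (intro tendsto_diff) auto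
  then have p: "(\<lambda>n. ph (d, t, 1 / real (Suc n), 0) z) \<longlonglongrightarrow> pi (d,t,1,0) z" by simp
  have "om (d, t, 1 / real (Suc n), 0) z = ui (d,t,1,0) z + \<nu> * (sg1 (d,t,1,0) z + (pi (d,t,1,0) z - ph (d, t, 1 / real (Suc n), 0) z) * sb1 (Xi (d,t,1,0) z))" for n
    unfolding om_eq by (simp only: indep(1,2,7)[of d t "1 / real (Suc n)" 0 1 0] indep2[of d t "1 / real (Suc n)" 0 1 0])
  moreover have "(\<lambda>n. ui (d,t,1,0) z + \<nu> * (sg1 (d,t,1,0) z + (pi (d,t,1,0) z - ph (d, t, 1 / real (Suc n), 0) z) * sb1 (Xi (d,t,1,0) z)))
    \<longlonglongrightarrow> ui (d,t,1,0) z + \<nu> * (sg1 (d,t,1,0) z + (pi (d,t,1,0) z - pi (d,t,1,0) z) * sb1 (Xi (d,t,1,0) z))"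
    by (intro tendsto_intros p)
  ultimately show ?case by simp
next
  case (Cons h hs)
  then show ?case by (cases "h = 0") (auto simp: dq_def intro!: tendsto_intros)
qed

text \<open>The rate is a lower bound of the damping coefficient \<kappa> st, so it is dictated by
  the equation. In exchange the factor \<eta> of M is arbitrary, since \<open>src_bound\<close> asks
  for \<tau> and u at order s - 1 only. The step in \<open>ph\<close> is sent to 0 at the end, for
  each fixed hs.\<close>

lemma est_om:
  "\<exists>\<theta>0>0. \<exists>K>0. \<forall>\<eta>>0. \<exists>C>0. \<forall>d\<in>S. \<forall>t\<in>{0..T d}. w_le d t (Duh \<theta>0 (K * M d 0) (\<lambda>r. \<eta> * M d r + C * (L d r + Ps d r)) t)"
proof -
  obtain up where up: "up > 0" "\<And>i z. i \<in> I \<Longrightarrow> tt i z \<le> up" using tt_up by blast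
  have stb: "inverse up \<le> st i z" if "i \<in> I" for i z
    using up(2)[OF that, of z] tt_low[OF that, of z] lo by (auto simp: st_def intro!: le_imp_inverse_le)
  define a0 where "a0 = \<kappa> * inverse up"
  have a0: "a0 > 0" using up kappa by (simp add: a0_def)
  obtain CS where CS: "CS > 0" "\<And>d t h a hs. (d,t,h,a) \<in> I \<Longrightarrow> Hk (s - 1) (ti (d,t,h,a)) a \<Longrightarrow> Hk (s - 1) (ui (d,t,h,a)) a \<Longrightarrow>
     Hk s (pi (d,t,h,a)) a \<Longrightarrow> Hk s (qi (d,t,h,a)) a \<Longrightarrow> length hs < s \<Longrightarrow> set hs \<subseteq> {0<..1} \<Longrightarrow> L2 (src hs (d,t,h,a)) (CS * a)"
    using src_bound by blast
  obtain K where K: "K > 0" "\<And>hs. length hs < s \<Longrightarrow> set hs \<subseteq> {0<..1} \<Longrightarrow> \<exists>e\<ge>0. \<forall>i\<in>I. L2 (dqs hs (om i)) (K * wM i + e * (hi i)\<^sup>2)"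
    using om_init by blast
  obtain Cp where Cp: "Cp > 0" "\<And>i. i \<in> I \<Longrightarrow> Hk s (pi i) (Cp * wP i)" using z_bounds(3) by (auto simp: OH_def)
  obtain Cq where Cq: "Cq > 0" "\<And>i. i \<in> I \<Longrightarrow> Hk s (qi i) (Cq * wP i)" using z_bounds(4) by (auto simp: OH_def)
  have main: "\<exists>C>0. \<forall>d\<in>S. \<forall>t\<in>{0..T d}. w_le d t (Duh a0 (K * M d 0) (\<lambda>r. \<eta> * M d r + C * (L d r + Ps d r)) t)" if \<eta>: "\<eta> > 0" for \<eta>
  proof -
    \<comment> \<open>Undoes the constant \<open>CS\<close> of the source and the factor 1/a0 of
      \<open>damped_ode\<close>.\<close>
    define \<eta>' where "\<eta>' = \<eta> * a0 / CS"
    have \<eta>': "\<eta>' > 0" using \<eta> a0 CS by (simp add: \<eta>'_def)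
    obtain Ct where Ct: "Ct > 0" "\<And>i. i \<in> I \<Longrightarrow> Hk (s - 1) (ti i) (\<eta>' * wM i + Ct * wL i)"
      using interp_i[OF z_bounds(1,5) \<eta>'] by auto
    obtain Cu where Cu: "Cu > 0" "\<And>i. i \<in> I \<Longrightarrow> Hk (s - 1) (ui i) (\<eta>' * wM i + Cu * wL i)"
      using interp_i[OF z_bounds(2,6) \<eta>'] by auto
    define D where "D = Ct + Cu + Cp + Cq"
    have D: "D > 0" using Ct Cu Cp Cq by (simp add: D_def)
    define a where "a d q = \<eta>' * M d q + D * (L d q + Ps d q)" for d q
    define C where "C = CS * D / a0"
    have C: "C > 0" using CS D a0 by (simp add: C_def)
    have Ca: "CS * a d q / a0 = \<eta> * M d q + C * (L d q + Ps d q)" for d q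
      using CS a0 by (simp add: a_def C_def \<eta>'_def field_simps)
    have "nsq (dqs hs (wi (d,t,1,0)))
       \<le> Duh a0 (K * M d 0) (\<lambda>r. \<eta> * M d r + C * (L d r + Ps d r)) t"
      if d: "d \<in> S" and t: "t \<in> {0..T d}" and hs: "length hs < s" "set hs \<subseteq> {0<..1}" for d t hs
    proof -
      have T0: "0 \<in> {0..T d}" using T[OF d] by simp
      obtain e where e: "e \<ge> 0" "\<And>i. i \<in> I \<Longrightarrow> L2 (dqs hs (om i)) (K * wM i + e * (hi i)\<^sup>2)" using K(2)[OF hs] by blast
      have S: "L2 (src hs (d,q,h,0)) (CS * a d q)" if q: "q \<in> {0..T d}" and h: "0 < h" "h \<le> 1" for q h
      proof -
        \<comment> \<open>The bound a d q is carried as fourth component only to apply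
          \<open>src_bound\<close>; \<open>src\<close> itself does not depend on that component,
          which is reset to 0 afterwards.\<close>
        define i where "i = (d, q, h, a d q)"
        have i: "i \<in> I" using d q h by (simp add: i_def I_def)
        have w: "wM i = M d q" "wL i = L d q" "wP i = Ps d q" by (simp_all add: i_def wM_def wL_def wP_def)
        have n: "0 \<le> M d q" "0 \<le> L d q" "0 \<le> Ps d q" using nonneg[OF d q] by auto
        have "\<eta>' * wM i + Ct * wL i \<le> a d q" "\<eta>' * wM i + Cu * wL i \<le> a d q"
          "Cp * wP i \<le> a d q" "Cq * wP i \<le> a d q"
          using n Ct Cu Cp Cq \<eta>' by (auto simp: w a_def D_def distrib_right distrib_left)
        then have "L2 (src hs i) (CS * a d q)" unfolding i_def
          by (intro CS(2) hs i[unfolded i_def] Hk_mono[OF Ct(2)[OF i], unfolded i_def] Hk_mono[OF Cu(2)[OF i], unfolded i_def]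
            Hk_mono[OF Cp(2)[OF i], unfolded i_def] Hk_mono[OF Cq(2)[OF i], unfolded i_def]) (auto simp: i_def)
        moreover have "src hs i = src hs (d,q,h,0)"
          unfolding src_def[abs_def] i_def by (simp only: indep3[of d q h "a d q" 0] indep2[of d q h "a d q" h 0])
        ultimately show ?thesis by simp
      qed
      have *: "nsq (dqs hs (om (d,t,h,0)))
         \<le> Duh a0 (K * M d 0) (\<lambda>r. \<eta> * M d r + C * (L d r + Ps d r)) t + ennreal (e * h\<^sup>2)" if h: "0 < h" "h \<le> 1" for h
      proof -
        have I: "(d,q,h,0) \<in> I" if "q \<in> {0..T d}" for q using d that h by (intro I_mem) auto
        note c = cont2_mult cont2_add cont2_diff cont2_minus cont2_const cont2_dqs conts2[OF d h]
        have A: "L2 (dqs hs (om (d,0,h,0))) (K * M d 0 + e * h\<^sup>2)"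
          using e(2)[OF I[OF T0]] by (simp add: wM_def hi_def)
        have "nsq (dqs hs (om (d,t,h,0))) \<le> Duh a0 (K * M d 0 + e * h\<^sup>2) (\<lambda>q. CS * a d q / a0) t"
        proof (rule damped_ode[OF a0 t, where a="\<lambda>z q. \<kappa> * st (d,q,h,0) z" and S="\<lambda>z q. src hs (d,q,h,0) z"
              and r="\<lambda>z q. dqs hs (om (d,q,h,0)) z" and ?r0.0="dqs hs (om (d,0,h,0))"])
          fix z q assume q: "q \<in> {0..T d}"
          have "((\<lambda>q. dqs hs (om (d,q,h,0)) z) has_real_derivative
             dqs hs (\<lambda>z. - (\<kappa> * st (d,q,h,0) z) * om (d,q,h,0) z + Sh (d,q,h,0) z) z) (at q within {0..T d})"
            by (rule dqs_deriv) (rule om_dt[OF d q h])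
          moreover have "(\<lambda>z. - (\<kappa> * st (d,q,h,0) z) * om (d,q,h,0) z + Sh (d,q,h,0) z)
            = (\<lambda>z. (- \<kappa>) * (st (d,q,h,0) z * om (d,q,h,0) z) + Sh (d,q,h,0) z)" by (simp add: mult.assoc)
          ultimately show "((\<lambda>q. dqs hs (om (d,q,h,0)) z) has_real_derivative
             - (\<kappa> * st (d,q,h,0) z) * dqs hs (om (d,q,h,0)) z + src hs (d,q,h,0) z) (at q within {0..T d})"
            by (simp only: dqs_add dqs_cmul src_def) (simp add: algebra_simps)
          show "a0 \<le> \<kappa> * st (d,q,h,0) z" unfolding a0_def using stb[OF I[OF q]] kappa(2) by (intro mult_left_mono) auto
        next
          show "cont2 (T d) (\<lambda>z q. src hs (d,q,h,0) z)" unfolding src_def by (intro c)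
          show "dqs hs (om (d,0,h,0)) \<in> borel_measurable borel" using A by (simp add: L2_def)
        qed (use A S h in auto)
        also have "\<dots> \<le> Duh a0 (K * M d 0) (\<lambda>q. CS * a d q / a0) t + ennreal (e * h\<^sup>2)"
          using a0 e K t nonneg(1)[OF d T0] by (intro Duh_init) auto
        finally show ?thesis unfolding Ca .
      qed
      show ?thesis
      proof (rule nn_fatou_eps[where F="\<lambda>n. dqs hs (om (d, t, 1 / real (Suc n), 0))" and e="\<lambda>n. e * (1 / real (Suc n))\<^sup>2"])
        fix n
        have h: "0 < 1 / real (Suc n)" "1 / real (Suc n) \<le> 1" by auto
        show "dqs hs (om (d, t, 1 / real (Suc n), 0)) \<in> borel_measurable borel"
          using e(2)[OF I_mem[OF d t h, of 0]] by (simp add: L2_def)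
        show "nsq (dqs hs (om (d, t, 1 / real (Suc n), 0)))
         \<le> Duh a0 (K * M d 0) (\<lambda>r. \<eta> * M d r + C * (L d r + Ps d r)) t + ennreal (e * (1 / real (Suc n))\<^sup>2)" by (rule *[OF h])
      next
        have "(\<lambda>n. e * (1 / real (Suc n))\<^sup>2) \<longlonglongrightarrow> e * 0\<^sup>2"
          using LIMSEQ_inverse_real_of_nat by (intro tendsto_intros) (simp add: inverse_eq_divide)
        then show "(\<lambda>n. e * (1 / real (Suc n))\<^sup>2) \<longlonglongrightarrow> 0" by simp
      qed (rule om_limit[OF d t])
    qed
    then show ?thesis using C by blast
  qed
  then show ?thesis using a0 K by blast
qed

end

section \<open>Closing the estimates by the ratio argument\<close>

lemma weighted_HK:
  fixes f G :: "real \<Rightarrow> real"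
  assumes t: "t \<in> {0..T}" and G: "(\<lambda>r. indicator {0..T} r * G r) \<in> borel_measurable borel"
    and b: "\<And>r. r \<in> {0..T} \<Longrightarrow> 0 \<le> G r \<and> G r \<le> b"
    and f: "continuous_on {0..t} f" "\<And>r. r \<in> {0..t} \<Longrightarrow> 0 \<le> f r"
  shows "(\<lambda>r. f r * G r) integrable_on {0..t}"
    "ennreal (integral {0..t} (\<lambda>r. f r * G r)) = (\<integral>\<^sup>+r\<in>{0..t}. ennreal (f r * G r) \<partial>lborel)"
proof -
  have fi: "set_integrable lborel {0..t} f" by (rule borel_integrable_atLeastAtMost'[OF f(1)])
  have s: "set_integrable lborel {0..t} (\<lambda>r. f r * G r)" unfolding set_integrable_def
  proof (rule Bochner_Integration.integrable_bound)
    show "integrable lborel (\<lambda>r. b * (indicator {0..t} r *\<^sub>R f r))"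
      using fi unfolding set_integrable_def by (rule integrable_mult_right)
    have "(\<lambda>r. indicator {0..t} r *\<^sub>R f r) \<in> borel_measurable borel"
      using borel_measurable_integrable[OF fi[unfolded set_integrable_def]] by simp
    from borel_measurable_times[OF this G]
    have "(\<lambda>r. (indicator {0..t} r *\<^sub>R f r) * (indicator {0..T} r * G r)) \<in> borel_measurable borel" .
    moreover have "(\<lambda>r. (indicator {0..t} r *\<^sub>R f r) * (indicator {0..T} r * G r)) = (\<lambda>r. indicator {0..t} r *\<^sub>R (f r * G r))"
      using t by (auto simp: fun_eq_iff indicator_def)
    ultimately show "(\<lambda>r. indicator {0..t} r *\<^sub>R (f r * G r)) \<in> borel_measurable lborel" by simp
    show "AE r in lborel. norm (indicator {0..t} r *\<^sub>R (f r * G r)) \<le> norm (b * (indicator {0..t} r *\<^sub>R f r))"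
    proof (rule AE_I2)
      fix r
      show "norm (indicator {0..t} r *\<^sub>R (f r * G r)) \<le> norm (b * (indicator {0..t} r *\<^sub>R f r))"
      proof (cases "r \<in> {0..t}")
        case True
        then have "0 \<le> G r" "G r \<le> b" "0 \<le> f r" using b[of r] f(2) t by auto
        then have "f r * G r \<le> b * f r" by (subst mult.commute) (intro mult_right_mono)
        then show ?thesis using True \<open>0 \<le> G r\<close> \<open>G r \<le> b\<close> \<open>0 \<le> f r\<close> by (simp add: abs_mult)
      qed simp
    qed
  qed
  show "(\<lambda>r. f r * G r) integrable_on {0..t}" using set_borel_integral_eq_integral(1)[OF s] .
  have nn: "0 \<le> indicator {0..t} r *\<^sub>R (f r * G r)" for r
    using b[of r] f(2)[of r] t by (cases "r \<in> {0..t}") auto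
  have "(\<integral>\<^sup>+r\<in>{0..t}. ennreal (f r * G r) \<partial>lborel) = (\<integral>\<^sup>+r. ennreal (indicator {0..t} r *\<^sub>R (f r * G r)) \<partial>lborel)"
    by (intro nn_integral_cong) (auto simp: indicator_def)
  also have "\<dots> = ennreal (LINT r|lborel. indicator {0..t} r *\<^sub>R (f r * G r))"
    using s nn unfolding set_integrable_def by (intro nn_integral_eq_integral) auto
  also have "\<dots> = ennreal (integral {0..t} (\<lambda>r. f r * G r))"
    using set_borel_integral_eq_integral(2)[OF s] by (simp add: set_lebesgue_integral_def)
  finally show "ennreal (integral {0..t} (\<lambda>r. f r * G r)) = (\<integral>\<^sup>+r\<in>{0..t}. ennreal (f r * G r) \<partial>lborel)" ..
qed

lemma exp_kernel_integral:
  fixes \<mu> t :: real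
  assumes \<mu>: "\<mu> > 0" and t: "0 \<le> t"
  shows "integral {0..t} (\<lambda>r. exp (- \<mu> * (t - r))) \<le> 1 / \<mu>"
proof -
  have "((\<lambda>r. exp (- \<mu> * (t - r))) has_integral exp (- \<mu> * (t - t)) / \<mu> - exp (- \<mu> * (t - 0)) / \<mu>) {0..t}"
  proof (rule fundamental_theorem_of_calculus[OF t])
    fix r
    have "((\<lambda>r. exp (- \<mu> * (t - r)) / \<mu>) has_real_derivative exp (- \<mu> * (t - r))) (at r within {0..t})"
      using \<mu> by (auto intro!: derivative_eq_intros)
    then show "((\<lambda>r. exp (- \<mu> * (t - r)) / \<mu>) has_vector_derivative exp (- \<mu> * (t - r))) (at r within {0..t})"
      by (simp add: has_real_derivative_iff_has_vector_derivative)
  qed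
  then show ?thesis using \<mu> by (simp add: integral_unique)
qed

text \<open>If M grows backwards in time at most like exp(\<theta>(t - r)) E, then integrating it
  against the kernel of rate \<Lambda> > \<theta> leaves the kernel of rate \<Lambda> - \<theta>, of
  mass at most 1/(\<Lambda> - \<theta>). This is the source of smallness for every term in
  M.\<close>

lemma Duh_bound:
  fixes G M :: "real \<Rightarrow> real"
  assumes t: "t \<in> {0..T}" and G: "(\<lambda>r. indicator {0..T} r * G r) \<in> borel_measurable borel"
    and b: "\<And>r. r \<in> {0..T} \<Longrightarrow> 0 \<le> G r \<and> G r \<le> b"
    and \<theta>: "0 < \<theta>" "\<theta> < \<Lambda>"
    and E: "exp (- \<theta> * t) * M0 + integral {0..t} (\<lambda>r. exp (- \<theta> * (t - r)) * G r) \<le> E" and M0: "0 \<le> M0"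
    and M: "\<And>r. r \<in> {0..t} \<Longrightarrow> M r \<le> k * (exp (\<theta> * (t - r)) * E)"
    and nn: "0 \<le> a" "0 \<le> k" "0 \<le> C" "0 \<le> K"
  shows "Duh \<Lambda> (K * M0) (\<lambda>r. a * M r + C * G r) t \<le> ennreal ((K + a * k / (\<Lambda> - \<theta>) + C) * E)"
proof -
  have t0: "0 \<le> t" using t by auto
  let ?e = "\<lambda>r. exp (- \<theta> * (t - r))" and ?m = "\<lambda>r. exp (- (\<Lambda> - \<theta>) * (t - r))"
  define J where "J = integral {0..t} (\<lambda>r. ?e r * G r)"
  note H = weighted_HK[OF t G b, of ?e]
  have J: "ennreal J = (\<integral>\<^sup>+r\<in>{0..t}. ennreal (?e r * G r) \<partial>lborel)"
    unfolding J_def by (rule H(2)) (auto intro!: continuous_intros)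
  have J0: "0 \<le> J" unfolding J_def
    by (rule integral_nonneg[OF H(1)]) (use b t in \<open>auto intro!: continuous_intros\<close>)
  have i0: "0 \<le> exp (- \<theta> * t) * M0" using M0 by simp
  have E0: "0 \<le> E" "J \<le> E" "exp (- \<theta> * t) * M0 \<le> E" using E J0 i0 unfolding J_def[symmetric] by linarith+
  have 1: "ennreal (exp (- \<Lambda> * t) * (K * M0)) \<le> ennreal (K * E)"
  proof (rule ennreal_leI)
    have "\<theta> * t \<le> \<Lambda> * t" using \<theta> t0 by (intro mult_right_mono) auto
    then have "exp (- \<Lambda> * t) * M0 \<le> exp (- \<theta> * t) * M0" using M0 by (intro mult_right_mono) auto
    then have "K * (exp (- \<Lambda> * t) * M0) \<le> K * E" using E0(3) nn by (intro mult_left_mono) auto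
    then show "exp (- \<Lambda> * t) * (K * M0) \<le> K * E" by (simp add: ac_simps)
  qed
  have pt: "exp (- \<Lambda> * (t - r)) * (a * M r + C * G r) \<le> (a * k * E) * ?m r + C * (?e r * G r)" if r: "r \<in> {0..t}" for r
  proof -
    have g: "0 \<le> G r" using b[of r] r t by auto
    have "exp (- \<Lambda> * (t - r)) * (a * M r) \<le> exp (- \<Lambda> * (t - r)) * (a * (k * (exp (\<theta> * (t - r)) * E)))"
      using M[OF r] nn by (intro mult_left_mono) auto
    also have "\<dots> = (a * k * E) * (exp (- \<Lambda> * (t - r)) * exp (\<theta> * (t - r)))" by (simp add: ac_simps)
    also have "\<dots> = (a * k * E) * ?m r" by (simp add: exp_add[symmetric] algebra_simps)
    finally have 1: "exp (- \<Lambda> * (t - r)) * (a * M r) \<le> (a * k * E) * ?m r" .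
    have "\<theta> * (t - r) \<le> \<Lambda> * (t - r)" using \<theta> r by (intro mult_right_mono) auto
    then have "exp (- \<Lambda> * (t - r)) * (C * G r) \<le> ?e r * (C * G r)" using g nn by (intro mult_right_mono) auto
    with 1 show ?thesis by (simp add: algebra_simps)
  qed
  have "(\<integral>\<^sup>+r\<in>{0..t}. ennreal (exp (- \<Lambda> * (t - r)) * (a * M r + C * G r)) \<partial>lborel)
     \<le> (\<integral>\<^sup>+r. ennreal (a * k * E) * (ennreal (?m r) * indicator {0..t} r) + ennreal C * (ennreal (?e r * G r) * indicator {0..t} r) \<partial>lborel)"
  proof (rule nn_integral_mono)
    fix r
    show "ennreal (exp (- \<Lambda> * (t - r)) * (a * M r + C * G r)) * indicator {0..t} r
      \<le> ennreal (a * k * E) * (ennreal (?m r) * indicator {0..t} r) + ennreal C * (ennreal (?e r * G r) * indicator {0..t} r)"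
    proof (cases "r \<in> {0..t}")
      case True
      then have g: "0 \<le> G r" using b[of r] t by auto
      have "ennreal (exp (- \<Lambda> * (t - r)) * (a * M r + C * G r)) \<le> ennreal ((a * k * E) * ?m r + C * (?e r * G r))"
        by (rule ennreal_leI[OF pt[OF True]])
      also have "\<dots> = ennreal (a * k * E) * ennreal (?m r) + ennreal C * ennreal (?e r * G r)"
        using nn E0 g by (subst ennreal_plus) (auto simp: ennreal_mult)
      finally show ?thesis using True by simp
    qed simp
  qed
  also have "\<dots> = ennreal (a * k * E) * (\<integral>\<^sup>+r\<in>{0..t}. ennreal (?m r) \<partial>lborel)
     + ennreal C * (\<integral>\<^sup>+r\<in>{0..t}. ennreal (?e r * G r) \<partial>lborel)"
  proof -
    have "(\<lambda>r. ennreal (?e r * G r) * indicator {0..t} r) = (\<lambda>r. ennreal (?e r * (indicator {0..T} r * G r)) * indicator {0..t} r)"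
      using t by (auto simp: fun_eq_iff indicator_def)
    moreover have "(\<lambda>r. ennreal (?e r * (indicator {0..T} r * G r)) * indicator {0..t} r) \<in> borel_measurable borel"
      using G by measurable
    ultimately have [measurable]: "(\<lambda>r. ennreal (?e r * G r) * indicator {0..t} r) \<in> borel_measurable borel" by simp
    define f g where "f r = ennreal (?m r) * indicator {0..t} r" and "g r = ennreal (?e r * G r) * indicator {0..t} r" for r
    have [measurable]: "f \<in> borel_measurable borel" "g \<in> borel_measurable borel" unfolding f_def g_def by measurable
    show ?thesis unfolding f_def[symmetric] g_def[symmetric] by (simp add: nn_integral_add nn_integral_cmult)
  qed
  also have "\<dots> = ennreal (a * k * E) * ennreal (integral {0..t} ?m) + ennreal C * ennreal J"
    unfolding J by (subst nn_of_HK) (auto intro!: continuous_intros)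
  also have "\<dots> \<le> ennreal (a * k * E) * ennreal (1 / (\<Lambda> - \<theta>)) + ennreal C * ennreal E"
    using exp_kernel_integral[of "\<Lambda> - \<theta>" t] \<theta> t0 E0 by (intro add_mono mult_left_mono ennreal_leI) auto
  also have "\<dots> = ennreal (a * k / (\<Lambda> - \<theta>) * E + C * E)"
    using nn E0 \<theta> by (subst ennreal_plus) (auto simp: ennreal_mult[symmetric])
  finally have 2: "(\<integral>\<^sup>+r\<in>{0..t}. ennreal (exp (- \<Lambda> * (t - r)) * (a * M r + C * G r)) \<partial>lborel)
    \<le> ennreal (a * k / (\<Lambda> - \<theta>) * E + C * E)" .
  have "Duh \<Lambda> (K * M0) (\<lambda>r. a * M r + C * G r) t \<le> ennreal (K * E) + ennreal (a * k / (\<Lambda> - \<theta>) * E + C * E)"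
    unfolding Duh_def by (intro add_mono 1 2)
  also have "\<dots> = ennreal ((K + a * k / (\<Lambda> - \<theta>) + C) * E)"
    using nn E0 \<theta> by (subst ennreal_plus[symmetric]) (auto simp: distrib_right)
  finally show ?thesis .
qed

context dyn
begin

text \<open>\<open>H_recover\<close> on the subfamily where the fourth component is a common bound,
  so that the constant is the same for every such bound.\<close>

lemma recover:
  "\<exists>C>0. \<forall>d t h a. (d,t,h,a) \<in> I \<longrightarrow> L2 (ti (d,t,h,a)) a \<longrightarrow> Hk (s - 1) (ui (d,t,h,a)) a \<longrightarrow>
     Hk (s - 1) (wi (d,t,h,a)) a \<longrightarrow> Hk s (ti (d,t,h,a)) (C * a)"
proof -
  define w :: "'d \<times> real \<times> real \<times> real \<Rightarrow> real" where "w = (\<lambda>(d,t,h,a). a)"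
  define J where "J = {i \<in> I. Hk 0 (ti i) (w i) \<and> Hk (s - 1) (ui i) (w i) \<and> Hk (s - 1) (wi i) (w i)}"
  have JI: "J \<subseteq> I" by (auto simp: J_def)
  note J = slices_subset[OF JI]
  have w: "OH 0 J ti w" "OH (s - 1) J ui w" "OH (s - 1) J wi w"
    by (rule OH_1; simp add: J_def del: Hk.simps)+
  obtain C where C: "C > 0" "\<And>i. i \<in> J \<Longrightarrow> Hk s (ti i) (C * w i)"
    using slices.H_recover[OF J w] by (auto simp: OH_def)
  have "Hk s (ti (d,t,h,a)) (C * a)" if "(d,t,h,a) \<in> I" "L2 (ti (d,t,h,a)) a" "Hk (s - 1) (ui (d,t,h,a)) a"
     "Hk (s - 1) (wi (d,t,h,a)) a" for d t h a
    using C(2)[of "(d,t,h,a)"] that by (simp add: J_def w_def del: Hk.simps(2))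
  then show ?thesis using C(1) by blast
qed

text \<open>The inverse map \<open>Phi\<close> is itself a flow, with Jacobian 1 - px evaluated at
  X. Its bound of order s in z comes from \<open>to_z\<close>, and \<open>Hk_comp\<close> then
  applies in the reverse direction.\<close>

lemma from_z:
  "\<exists>C>0. \<forall>d\<in>S. \<forall>t\<in>{0..T d}. \<forall>f A. Hk s (\<lambda>z. f (X d z t)) A \<longrightarrow> Hk s f (C * A)"
proof -
  have "OH s I (\<lambda>(d,t,h,a) x. px d x t) (\<lambda>i. 1)"
    by (rule OH_weight[OF x_bounds(1), of 1]) (use small(2) in \<open>auto simp: wP_def I_def\<close>)
  from to_z[OF this order_refl] have "OG s I (\<lambda>i z. (\<lambda>(d,t,h,a) x. px d x t) i (Xi i z))"
    by (rule OH_imp_OG[of _ _ _ _ 1]) auto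
  from OG_diff[OF OG_const[of s I 1] this] obtain B where B: "\<And>i. i \<in> I \<Longrightarrow> Gk s (\<lambda>z. 1 - (\<lambda>(d,t,h,a) x. px d x t) i (Xi i z)) B"
    unfolding OG_def by blast
  obtain C where C: "C > 0" "\<And>Y \<phi> f A. flow Y \<phi> \<Longrightarrow> Gk s \<phi> B \<Longrightarrow> Hk s f A \<Longrightarrow> Hk s (\<lambda>z. f (Y z)) (C * A)"
    using Hk_comp[OF s order_refl, of B] by blast
  have "Hk s f (C * A)" if d: "d \<in> S" and t: "t \<in> {0..T d}" and H: "Hk s (\<lambda>z. f (X d z t)) A" for d t f A
  proof -
    note co = coords[OF d]
    define Y where "Y x = coords.Phi c (\<psi> d) x t" for x
    have XY: "X d (Y x) t = x" for x using coords.X_Phi[OF co t, of c x] by (simp add: X_def Y_def)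
    have b: "1/2 \<le> 1 - px d x t" "1 - px d x t \<le> 2" for x using bpx[OF d t, of x] by auto
    have "flow Y (\<lambda>z. 1 - px d (X d z t) t)" unfolding flow_def
    proof (intro conjI allI b)
      show "(Y has_real_derivative 1 - px d (X d (Y x) t) t) (at x)" for x
        using coords.Phi_dx[OF co t, of c x] unfolding XY by (simp add: Y_def[abs_def])
      show "continuous_on UNIV (\<lambda>z. 1 - px d (X d z t) t)"
        by (intro continuous_intros cont2_slice_x[OF Z_cont[OF d cont(2)[OF d]] t])
    qed
    moreover have "Gk s (\<lambda>z. 1 - px d (X d z t) t) B"
      using B[OF I_mem[OF d t zero_less_one order_refl, of 0]] by (simp add: Xi_def del: Gk.simps)
    ultimately have "Hk s (\<lambda>x. f (X d (Y x) t)) (C * A)" using C(2) H by (auto simp del: Hk.simps Gk.simps)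
    then show ?thesis unfolding XY .
  qed
  then show ?thesis using C by blast
qed

lemma Hk_all:
  "\<exists>C>0. \<forall>d\<in>S. \<forall>t\<in>{0..T d}. \<forall>A\<ge>0.
     tau_le d t (ennreal A) \<longrightarrow> u_le d t (ennreal A) \<longrightarrow> w_le d t (ennreal A) \<longrightarrow>
     Hk s (\<lambda>x. \<tau> d x t) (C * A) \<and> Hk s (\<lambda>x. u d x t) (C * A)"
proof -
  obtain C1 where C1: "C1 > 0" "\<And>d t h a. (d,t,h,a) \<in> I \<Longrightarrow> L2 (ti (d,t,h,a)) a \<Longrightarrow> Hk (s - 1) (ui (d,t,h,a)) a \<Longrightarrow>
     Hk (s - 1) (\<lambda>z. ui (d,t,h,a) z + \<nu> * sg1 (d,t,h,a) z) a \<Longrightarrow> Hk s (ti (d,t,h,a)) (C1 * a)" using recover by blast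
  obtain C2 where C2: "C2 > 0" "\<And>d t f A. d \<in> S \<Longrightarrow> t \<in> {0..T d} \<Longrightarrow> Hk s (\<lambda>z. f (X d z t)) A \<Longrightarrow> Hk s f (C2 * A)"
    using from_z by blast
  have ss: "Suc (s - 1) = s" using s by simp
  obtain D where D: "D > 0" "\<And>i. i \<in> I \<Longrightarrow> Hk s (ui i) (D * wM i)" using z_bounds(2) by (auto simp: OH_def)
  have "OH (s - 1) I wi wM"
    by (intro OH_add OH_cmul OH_lower[OF z_bounds(2)] H_sg1) (use z_bounds(1) ss in auto)
  then obtain K where K: "K > 0" "\<And>i. i \<in> I \<Longrightarrow> Hk (s - 1) (wi i) (K * wM i)" by (auto simp: OH_def)
  define C where "C = C2 * (C1 + 1)"
  have C: "C > 0" using C1 C2 by (simp add: C_def)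
  have "Hk s (\<lambda>x. \<tau> d x t) (C * A) \<and> Hk s (\<lambda>x. u d x t) (C * A)"
    if d: "d \<in> S" and t: "t \<in> {0..T d}" and A: "A \<ge> 0"
      and a1: "tau_le d t (ennreal A)"
      and a2: "u_le d t (ennreal A)"
      and a3: "w_le d t (ennreal A)" for d t A
  proof -
    define i where "i = (d, t, 1 :: real, 0 :: real)"
    \<comment> \<open>The same time slice as \<open>i\<close>, with the common bound A as fourth
      component as needed for \<open>recover\<close>.\<close>
    define k where "k = (d, t, 1 :: real, A)"
    have i: "i \<in> I" and k: "k \<in> I" using d t by (auto simp: i_def k_def I_def)
    have uf: "set hs \<subseteq> {0<..1}" if "set hs \<subseteq> unit_fractions" for hs using that unit_fractions_bounds by auto
    have m: "ti i \<in> borel_measurable borel" "ui i \<in> borel_measurable borel" "u1i i \<in> borel_measurable borel"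
      using d\<tau>[OF i] du[OF i] cont1(3)[OF i] by (auto intro!: borel_measurable_continuous_onI DERIV_continuous_on)
    have u: "L2 (dqs hs (ui i)) A" "L2 (dqs hs (u1i i)) A" if hs: "length hs < s" "set hs \<subseteq> unit_fractions" for hs
    proof -
      note b = dqs_borel[OF m(2), of hs] dqs_borel[OF m(3), of hs]
      have le: "(\<integral>\<^sup>+z. ennreal ((dqs hs (ui i) z)\<^sup>2 + (dqs hs (u1i i) z)\<^sup>2) \<partial>lborel) \<le> ennreal A"
        using a2[rule_format, OF hs(1) uf[OF hs(2)]] by (simp add: i_def)
      have "nsq (dqs hs (ui i)) \<le> ennreal A" "nsq (dqs hs (u1i i)) \<le> ennreal A"
        by (rule order_trans[OF nn_integral_mono le], rule ennreal_leI, simp)+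
      then show "L2 (dqs hs (ui i)) A" "L2 (dqs hs (u1i i)) A" using b A by (auto simp: L2_def)
    qed
    have Hu: "Hk s (ui i) A"
    proof (rule Hk_of_dqs[OF D(2)[OF i]])
      fix hs :: "real list" assume hs: "length hs \<le> s" "set hs \<subseteq> unit_fractions"
      show "L2 (dqs hs (ui i)) A"
      proof (cases "length hs < s")
        \<comment> \<open>Here hs has length s. One quotient is traded for the derivative, leaving s
          - 1 quotients of u_z, which the energy estimate controls.\<close>
        case False
        then obtain h gs where e: "hs = h # gs" using hs s by (cases hs) auto
        have "prim (dqs gs (ui i)) (dqs gs (u1i i))"
          by (rule prim_dqs) (rule prim_deriv[OF du[OF i] cont1(3)[OF i]])
        moreover have "L2 (dqs gs (u1i i)) A" using u(2)[of gs] hs e by auto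
        ultimately show ?thesis unfolding e dqs.simps using hs(2) unit_fractions_bounds[of h] e by (intro L2_dq) auto
      qed (use u hs in auto)
    qed
    have Hw: "Hk (s - 1) (wi i) A"
    proof (rule Hk_of_dqs[OF K(2)[OF i]])
      fix hs :: "real list" assume hs: "length hs \<le> s - 1" "set hs \<subseteq> unit_fractions"
      have "length hs < s" using hs s by auto
      then have "nsq (dqs hs (wi i)) \<le> ennreal A"
        using a3[rule_format, OF _ uf[OF hs(2)]] by (simp add: i_def)
      moreover have "wi i \<in> borel_measurable borel" by (rule Hk_borel[OF K(2)[OF i]])
      ultimately show "L2 (dqs hs (wi i)) A" using A by (simp add: L2_def dqs_borel)
    qed
    have e: "ti k = ti i" "ui k = ui i" "sg1 k = sg1 i"
      unfolding i_def k_def by (rule indep indep2)+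
    have "L2 (ti i) A" using a1 m A by (simp add: L2_def i_def)
    then have Ht: "Hk s (ti i) (C1 * A)"
      using C1(2)[OF k[unfolded k_def]] Hw Hk_lower[OF Hu, of "s - 1"] unfolding k_def[symmetric] e by simp
    have *: "A * C1 \<le> A * (C1 + 1)" "A \<le> A * (C1 + 1)" using C1 A by (auto intro: mult_left_mono simp: distrib_left)
    have 1: "Hk s (\<lambda>z. \<tau> d (X d z t) t) (A * (C1 + 1))" "Hk s (\<lambda>z. u d (X d z t) t) (A * (C1 + 1))"
      using Hk_mono[OF Ht] Hk_mono[OF Hu] * by (auto simp: i_def idefs mult.commute simp del: Hk.simps)
    show ?thesis using C2(2)[where f="\<lambda>x. \<tau> d x t", OF d t 1(1)] C2(2)[where f="\<lambda>x. u d x t", OF d t 1(2)]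
      by (simp add: C_def ac_simps del: Hk.simps)
  qed
  then show ?thesis using C by blast
qed

text \<open>exp(\<theta> t) Q(t) is nondecreasing, so M(r) \<le> R E(r) at earlier times r is at
  most R exp(\<theta>(q - r)) E(q), exactly the form that \<open>Duh_bound\<close> needs. The
  resulting inequality for R is linear with slope 1/2, and R is finite a priori.\<close>

theorem energy:
  assumes G: "\<And>d. d \<in> S \<Longrightarrow> (\<lambda>r. indicator {0..T d} r * (L d r + Ps d r)) \<in> borel_measurable borel"
    and L1: "\<And>d t. d \<in> S \<Longrightarrow> t \<in> {0..T d} \<Longrightarrow> L d t \<le> 1"
    and cM: "cM > 0" "\<And>d t A. d \<in> S \<Longrightarrow> t \<in> {0..T d} \<Longrightarrow> Hk s (\<lambda>x. \<tau> d x t) A \<Longrightarrow> Hk s (\<lambda>x. u d x t) A \<Longrightarrow> M d t \<le> cM * A"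
  shows "\<exists>\<theta>>0. \<exists>C>0. \<forall>d\<in>S. \<forall>t\<in>{0..T d}.
    M d t \<le> C * (exp (- \<theta> * t) * M d 0 + integral {0..t} (\<lambda>r. exp (- \<theta> * (t - r)) * (L d r + Ps d r)))"
proof -
  let ?G = "\<lambda>d r. L d r + Ps d r"
  obtain K1 where K1: "K1 > 0" "\<And>\<Lambda>. \<Lambda> > 0 \<Longrightarrow> \<exists>C>0. \<forall>d\<in>S. \<forall>t\<in>{0..T d}. tau_le d t (Duh \<Lambda> (K1 * M d 0) (\<lambda>r. K1 / \<Lambda> * M d r + C * ?G d r) t)" using est_tau by blast
  obtain K2 where K2: "K2 > 0" "\<And>\<Lambda>. \<Lambda> > 0 \<Longrightarrow> \<exists>C>0. \<forall>d\<in>S. \<forall>t\<in>{0..T d}. u_le d t (Duh \<Lambda> (K2 * M d 0) (\<lambda>r. K2 * M d r + C * ?G d r) t)" using est_u by blast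
  obtain \<theta>0 K3 where K3: "\<theta>0 > 0" "K3 > 0" "\<And>\<eta>. \<eta> > 0 \<Longrightarrow> \<exists>C>0. \<forall>d\<in>S. \<forall>t\<in>{0..T d}. w_le d t (Duh \<theta>0 (K3 * M d 0) (\<lambda>r. \<eta> * M d r + C * ?G d r) t)" using est_om by blast
  obtain C0 where C0: "C0 > 0" "\<And>d t A. d \<in> S \<Longrightarrow> t \<in> {0..T d} \<Longrightarrow> A \<ge> 0 \<Longrightarrow>
     tau_le d t (ennreal A) \<Longrightarrow> u_le d t (ennreal A) \<Longrightarrow> w_le d t (ennreal A) \<Longrightarrow>
     Hk s (\<lambda>x. \<tau> d x t) (C0 * A) \<and> Hk s (\<lambda>x. u d x t) (C0 * A)"
    using Hk_all by blast
  \<comment> \<open>Each of the three estimates may contribute \<zeta> * R * E; after the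
    conversions with the constants C0 and cM this becomes R/2 times E.\<close>
  define \<zeta> where "\<zeta> = 1 / (2 * (cM * C0))"
  have \<zeta>: "\<zeta> > 0" "cM * C0 * \<zeta> = 1/2" using cM C0 by (auto simp: \<zeta>_def)
  define \<theta> where "\<theta> = \<theta>0 / 2"
  \<comment> \<open>The gap \<Lambda> - \<theta> exceeds K1/\<zeta> and K2/\<zeta>, so the kernel
    mass reduces both factors below \<zeta>; \<Lambda> \<ge> 1 gives K1/\<Lambda> \<le> K1.\<close>
  define \<Lambda> where "\<Lambda> = \<theta> + 1 + (K1 + K2) / \<zeta>"
  have \<theta>: "\<theta> > 0" "\<theta> < \<theta>0" using K3 by (auto simp: \<theta>_def)
  have kz: "K1 / \<zeta> > 0" "K2 / \<zeta> > 0" using K1 K2 \<zeta> by auto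
  have \<Lambda>: "\<theta> < \<Lambda>" "1 \<le> \<Lambda>" "K1 / \<zeta> \<le> \<Lambda> - \<theta>" "K2 / \<zeta> \<le> \<Lambda> - \<theta>" using kz \<theta> by (auto simp: \<Lambda>_def add_divide_distrib)
  \<comment> \<open>The rate \<theta>0 of the damped quantity is fixed, so here the factor of M is
    adapted to the gap \<theta>0 - \<theta> instead.\<close>
  define \<eta> where "\<eta> = \<zeta> * (\<theta>0 - \<theta>)"
  have \<eta>: "\<eta> > 0" using \<zeta> \<theta> by (simp add: \<eta>_def)
  obtain D1 where D1: "D1 > 0" "\<And>d t. d \<in> S \<Longrightarrow> t \<in> {0..T d} \<Longrightarrow> tau_le d t (Duh \<Lambda> (K1 * M d 0) (\<lambda>r. K1 / \<Lambda> * M d r + D1 * ?G d r) t)" using K1(2)[of \<Lambda>] \<Lambda> by auto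
  obtain D2 where D2: "D2 > 0" "\<And>d t. d \<in> S \<Longrightarrow> t \<in> {0..T d} \<Longrightarrow> u_le d t (Duh \<Lambda> (K2 * M d 0) (\<lambda>r. K2 * M d r + D2 * ?G d r) t)" using K2(2)[of \<Lambda>] \<Lambda> by auto
  obtain D3 where D3: "D3 > 0" "\<And>d t. d \<in> S \<Longrightarrow> t \<in> {0..T d} \<Longrightarrow> w_le d t (Duh \<theta>0 (K3 * M d 0) (\<lambda>r. \<eta> * M d r + D3 * ?G d r) t)" using K3(3)[OF \<eta>] by auto
  define A0 where "A0 = K1 + K2 + K3 + D1 + D2 + D3"
  have A0: "A0 > 0" using K1 K2 K3 D1 D2 D3 by (simp add: A0_def)
  define C where "C = 2 * (cM * C0 * A0)"
  have C: "C > 0" using cM C0 A0 by (simp add: C_def)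
  have "M d t \<le> C * (exp (- \<theta> * t) * M d 0 + integral {0..t} (\<lambda>r. exp (- \<theta> * (t - r)) * ?G d r))"
    if d: "d \<in> S" and t: "t \<in> {0..T d}" for d t
  proof -
    define Q where "Q t = exp (- \<theta> * t) * M d 0 + integral {0..t} (\<lambda>r. exp (- \<theta> * (t - r)) * ?G d r)" for t
    have T0: "0 \<in> {0..T d}" using T[OF d] by simp
    have M0: "0 \<le> M d 0" by (rule nonneg(1)[OF d T0])
    have b: "0 \<le> ?G d r \<and> ?G d r \<le> 2" if "r \<in> {0..T d}" for r
      using nonneg[OF d that] L1[OF d that] small(2)[OF d that] by simp
    note gi = weighted_HK(1)[OF _ G[OF d] b]
    have Qe: "Q t = exp (- \<theta> * t) * (M d 0 + integral {0..t} (\<lambda>r. exp (\<theta> * r) * ?G d r))" for t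
    proof -
      have e: "exp (- \<theta> * (t - r)) = exp (- \<theta> * t) * exp (\<theta> * r)" for r by (simp add: exp_add[symmetric] algebra_simps)
      show ?thesis unfolding Q_def e mult.assoc integral_mult_right by (rule distrib_left[symmetric])
    qed
    have gr: "exp (\<theta> * r) * Q r \<le> exp (\<theta> * q) * Q q" "0 \<le> Q r" if q: "q \<in> {0..T d}" and r: "r \<in> {0..q}" for q r
    proof -
      have rT: "r \<in> {0..T d}" using q r by auto
      have i: "(\<lambda>r. exp (\<theta> * r) * ?G d r) integrable_on {0..q}" "(\<lambda>r. exp (\<theta> * r) * ?G d r) integrable_on {0..r}"
        by (intro gi q rT continuous_intros; simp)+
      have nn: "0 \<le> exp (\<theta> * x) * ?G d x" if "x \<in> {0..q}" for x using b[of x] that q by auto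
      have "integral {0..r} (\<lambda>r. exp (\<theta> * r) * ?G d r) \<le> integral {0..q} (\<lambda>r. exp (\<theta> * r) * ?G d r)"
        using i nn r by (intro integral_subset_le) auto
      moreover have "exp (\<theta> * t) * Q t = M d 0 + integral {0..t} (\<lambda>r. exp (\<theta> * r) * ?G d r)" for t
        unfolding Qe mult.assoc[symmetric] exp_add[symmetric] by simp
      ultimately show "exp (\<theta> * r) * Q r \<le> exp (\<theta> * q) * Q q" by simp
      have "0 \<le> integral {0..r} (\<lambda>r. exp (\<theta> * r) * ?G d r)" using i nn r by (intro integral_nonneg) auto
      then show "0 \<le> Q r" unfolding Qe using M0 by simp
    qed
    have step: "M d t \<le> C * (Q t + \<epsilon> * exp (- \<theta> * t))" if \<epsilon>: "\<epsilon> > 0" for \<epsilon>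
    proof -
      \<comment> \<open>The added term makes E positive, so that with M \<le> 1 the ratio M/E is
        bounded on the time interval. Its decay at rate \<theta> preserves the monotonicity of
        exp(\<theta> t) E; it is removed in the end by letting \<epsilon> tend to 0.\<close>
      define E where "E t = Q t + \<epsilon> * exp (- \<theta> * t)" for t
      have E0: "E r > 0" if "r \<in> {0..T d}" for r using gr(2)[OF that, of r] that \<epsilon> by (auto simp: E_def intro: add_nonneg_pos)
      have Egr: "E r \<le> exp (\<theta> * (q - r)) * E q" if q: "q \<in> {0..T d}" and r: "r \<in> {0..q}" for q r
      proof -
        have "exp (\<theta> * r) * E r = exp (\<theta> * r) * Q r + \<epsilon>" for r by (simp add: E_def distrib_left mult.left_commute exp_minus field_simps)
        then have "exp (\<theta> * r) * E r \<le> exp (\<theta> * q) * E q" using gr(1)[OF q r] by simp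
        then have "exp (- \<theta> * r) * (exp (\<theta> * r) * E r) \<le> exp (- \<theta> * r) * (exp (\<theta> * q) * E q)" by (intro mult_left_mono) auto
        moreover have "exp (- \<theta> * r) * exp (\<theta> * r) = 1" "exp (- \<theta> * r) * exp (\<theta> * q) = exp (\<theta> * (q - r))"
          by (simp_all add: exp_add[symmetric] algebra_simps)
        ultimately show ?thesis unfolding mult.assoc[symmetric] by (simp only: mult_1_left)
      qed
      define R where "R = (SUP r\<in>{0..T d}. M d r / E r)"
      have "M d r / E r \<le> exp (\<theta> * T d) / \<epsilon>" if r: "r \<in> {0..T d}" for r
      proof -
        have "\<theta> * r \<le> \<theta> * T d" using r \<theta> by (intro mult_left_mono) auto
        then have "exp (- \<theta> * T d) \<le> exp (- \<theta> * r)" by simp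
        then have "\<epsilon> * exp (- \<theta> * T d) \<le> \<epsilon> * exp (- \<theta> * r)" using \<epsilon> by (intro mult_left_mono) auto
        also have "\<dots> \<le> E r" using gr(2)[OF r, of r] r by (simp add: E_def)
        finally have "M d r / E r \<le> 1 / (\<epsilon> * exp (- \<theta> * T d))"
          using small(1)[OF d r] nonneg(1)[OF d r] \<epsilon> E0[OF r] by (intro frac_le) auto
        then show ?thesis by (simp add: exp_minus field_simps)
      qed
      then have bdd: "bdd_above ((\<lambda>r. M d r / E r) ` {0..T d})" by (intro bdd_aboveI2)
      have R: "M d r / E r \<le> R" if "r \<in> {0..T d}" for r unfolding R_def by (rule cSUP_upper[OF that bdd])
      have R0: "0 \<le> R" using R[OF T0] M0 E0[OF T0] by (meson divide_nonneg_pos order_trans)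
      have MR: "M d r \<le> R * E r" if "r \<in> {0..T d}" for r using R[OF that] E0[OF that] by (simp add: pos_divide_le_eq)
      have "M d q / E q \<le> cM * C0 * A0 + R / 2" if q: "q \<in> {0..T d}" for q
      proof -
        define A where "A = (A0 + \<zeta> * R) * E q"
        have A: "0 \<le> A" using A0 \<zeta> R0 E0[OF q] by (simp add: A_def)
        have Me: "M d r \<le> R * (exp (\<theta> * (q - r)) * E q)" if r: "r \<in> {0..q}" for r
          using MR[of r] mult_left_mono[OF Egr[OF q r] R0] r q by auto
        have EE: "exp (- \<theta> * q) * M d 0 + integral {0..q} (\<lambda>r. exp (- \<theta> * (q - r)) * ?G d r) \<le> E q"
          using \<epsilon> by (simp add: E_def Q_def)
        \<comment> \<open>The common treatment of the three estimates: the kernel mass 1/(\<Lambda>'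
          - \<theta>) turns the factor a of M into at most \<zeta>, while K and D are collected in
          A0.\<close>
        have *: "X \<le> ennreal A" if X: "X \<le> Duh \<Lambda>' (K * M d 0) (\<lambda>r. a * M d r + D * ?G d r) q" and
          k: "0 \<le> a" "0 \<le> D" "0 \<le> K" "K + D \<le> A0" "\<theta> < \<Lambda>'" "a / \<zeta> \<le> \<Lambda>' - \<theta>" for X \<Lambda>' K a D
        proof -
          have "a \<le> \<zeta> * (\<Lambda>' - \<theta>)" using k \<zeta> by (simp add: pos_divide_le_eq mult.commute)
          then have "a / (\<Lambda>' - \<theta>) \<le> \<zeta>" using k by (simp add: pos_divide_le_eq)
          from mult_right_mono[OF this R0] have "a * R / (\<Lambda>' - \<theta>) \<le> \<zeta> * R" by simp
          then have "(K + a * R / (\<Lambda>' - \<theta>) + D) * E q \<le> A" unfolding A_def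
            using k E0[OF q] by (intro mult_right_mono) auto
          then show ?thesis
            using X Duh_bound[OF q G[OF d] b \<theta>(1) k(5) EE M0 Me k(1) R0 k(2,3)] order_trans[OF _ ennreal_leI] by (meson order_trans)
        qed
        have "(K1 / \<Lambda>) / \<zeta> \<le> \<Lambda> - \<theta>"
        proof -
          have "K1 / \<Lambda> \<le> K1 / 1" using \<Lambda> K1 by (intro divide_left_mono) auto
          then have "(K1 / \<Lambda>) / \<zeta> \<le> K1 / \<zeta>" using \<zeta> by (intro divide_right_mono) auto
          then show ?thesis using \<Lambda> by linarith
        qed
        moreover have "\<eta> / \<zeta> \<le> \<theta>0 - \<theta>" using \<zeta> by (simp add: \<eta>_def)
        moreover have "0 \<le> K1 / \<Lambda>" using K1 \<Lambda> by simp
        ultimately have "Hk s (\<lambda>x. \<tau> d x q) (C0 * A) \<and> Hk s (\<lambda>x. u d x q) (C0 * A)"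
          using K1(1) K2(1) K3(2) D1(1) D2(1) D3(1) \<eta> \<theta> \<Lambda>
          by (intro C0(2)[OF d q A] allI impI *[OF D1(2)[OF d q]] *[OF D2(2)[OF d q, rule_format]] *[OF D3(2)[OF d q, rule_format]]) (auto simp: A0_def)
        then have "M d q \<le> cM * (C0 * A)" using cM(2)[OF d q] by blast
        also have "\<dots> = (cM * C0 * A0 + (cM * C0 * \<zeta>) * R) * E q" by (simp add: A_def algebra_simps)
        finally show ?thesis unfolding \<zeta>(2) using E0[OF q] by (simp add: pos_divide_le_eq)
      qed
      then have "R \<le> cM * C0 * A0 + R / 2" unfolding R_def using T0 by (intro cSUP_least) auto
      then have "R \<le> C" by (simp add: C_def)
      then have "R * E t \<le> C * E t" using E0[OF t] by (intro mult_right_mono) auto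
      then show ?thesis using MR[OF t] by (simp add: E_def)
    qed
    have "M d t \<le> C * Q t"
    proof (rule field_le_epsilon)
      fix e :: real assume e: "e > 0"
      define \<epsilon> where "\<epsilon> = e / (C * exp (- \<theta> * t))"
      have "C * (Q t + \<epsilon> * exp (- \<theta> * t)) = C * Q t + e" using C by (simp add: \<epsilon>_def distrib_left)
      then show "M d t \<le> C * Q t + e" using step[of \<epsilon>] e C by (simp add: \<epsilon>_def)
    qed
    then show ?thesis by (simp add: Q_def)
  qed
  then show ?thesis using \<theta> C by blast
qed

end

section \<open>Norms of pairs and their measurability in time\<close>

lemma sum_Basis_Pair:
  fixes h :: "'a::euclidean_space \<times> 'b::euclidean_space \<Rightarrow> real"
  shows "(\<Sum>b\<in>Basis. h b) = (\<Sum>i\<in>Basis. h (i, 0)) + (\<Sum>i\<in>Basis. h (0, i))"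
proof -
  have "(\<Sum>b\<in>Basis. h b) = sum h ((\<lambda>u. (u, 0)) ` Basis) + sum h ((\<lambda>u. (0, u)) ` Basis)"
    unfolding Basis_prod_def by (rule sum.union_disjoint) (auto simp: nonzero_Basis)
  then show ?thesis by (simp add: sum.reindex inj_on_def)
qed

lemma Hs_norm_Pair:
  fixes f :: "real \<Rightarrow> 'a::euclidean_space" and g :: "real \<Rightarrow> 'b::euclidean_space"
  assumes "in_Hs s (\<lambda>x. (f x, g x))"
  shows "in_Hs s f" "in_Hs s g" "(Hs_norm s (\<lambda>x. (f x, g x)))\<^sup>2 = (Hs_norm s f)\<^sup>2 + (Hs_norm s g)\<^sup>2"
proof -
  show f: "in_Hs s f" and g: "in_Hs s g"
    using in_Hs_linear[OF bounded_linear_fst assms] in_Hs_linear[OF bounded_linear_snd assms] by simp_all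
  show "(Hs_norm s (\<lambda>x. (f x, g x)))\<^sup>2 = (Hs_norm s f)\<^sup>2 + (Hs_norm s g)\<^sup>2"
    unfolding Hs_norm_components[OF assms] Hs_norm_components[OF f] Hs_norm_components[OF g] by (simp add: sum_Basis_Pair)
qed

lemma L2_norm_Pair:
  fixes f :: "real \<Rightarrow> 'a::euclidean_space" and g :: "real \<Rightarrow> 'b::euclidean_space"
  assumes "in_Hs s (\<lambda>x. (f x, g x))"
  shows "(L2_norm (\<lambda>x. (f x, g x)))\<^sup>2 = (L2_norm f)\<^sup>2 + (L2_norm g)\<^sup>2"
proof -
  have "in_L2 (\<lambda>x. (f x, g x))" "in_L2 f" "in_L2 g" using assms Hs_norm_Pair[OF assms] by (auto simp: in_Hs_def)
  then show ?thesis by (simp add: L2_norm_components sum_Basis_Pair)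
qed

lemma Hs_norm_0:
  assumes "in_Hs s (f :: real \<Rightarrow> real)" "continuous_on UNIV f"
  shows "(Hs_norm 0 f)\<^sup>2 = (L2_norm f)\<^sup>2"
proof -
  obtain d where d: "d 0 = f" "\<And>j. j \<le> s \<Longrightarrow> L2_norm (d j) = L2_norm (weak_deriv j f)"
    by (rule Hs_chain[OF assms]) blast
  then show ?thesis using d(2)[of 0] by (simp add: Hs_norm_sq)
qed

lemma L2_dqs_top:
  assumes "\<And>j. j < k \<Longrightarrow> prim (d j) (d (Suc j))" "L2 (d k) A" "set hs \<subseteq> {0<..}"
  shows "j + length hs = k \<Longrightarrow> L2 (dqs hs (d j)) A"
  using assms(3)
proof (induction hs arbitrary: j)
  case (Cons h hs)
  then have "prim (dqs hs (d j)) (dqs hs (d (Suc j)))" "L2 (dqs hs (d (Suc j))) A" by (auto intro!: prim_dqs assms(1))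
  then show ?case using Cons.prems by (auto intro: L2_dq)
qed (use assms(2) in simp)

text \<open>Sobolev norms depend measurably on time since they are suprema of countably many
  norms of difference quotients.\<close>

lemma Hs_norm_measurable:
  assumes c: "cont2 T f" and H: "\<And>t. t \<in> {0..T} \<Longrightarrow> in_Hs s (\<lambda>x. f x t)"
  shows "(\<lambda>t. indicator {0..T} t * (Hs_norm s (\<lambda>x. f x t))\<^sup>2) \<in> borel_measurable borel"
proof -
  define U where "U k = {hs. length hs = k \<and> set hs \<subseteq> unit_fractions}" for k
  define I where "I hs t = nsq (\<lambda>x. indicator {0..T} t * dqs hs (\<lambda>x. f x t) x)" for hs t
  have cU: "countable (U k)" for k
  proof -
    have "U k \<subseteq> lists unit_fractions" by (auto simp: U_def)
    moreover have "countable (lists unit_fractions)" unfolding unit_fractions_def by (intro countable_lists) simp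
    ultimately show ?thesis using countable_subset by blast
  qed
  have mI: "I hs \<in> borel_measurable borel" for hs
  proof -
    have [measurable]: "(\<lambda>p. indicator {0..T} (snd p) * dqs hs (\<lambda>x. f x (snd p)) (fst p)) \<in> borel_measurable (borel \<Otimes>\<^sub>M borel)"
      by (rule cont2_measurable[OF cont2_dqs[OF c]])
    have "(\<lambda>p. (snd p, fst p)) \<in> measurable (borel \<Otimes>\<^sub>M borel) (borel \<Otimes>\<^sub>M (borel :: real measure))" by measurable
    from measurable_compose[OF this, of "\<lambda>p. indicator {0..T} (snd p) * dqs hs (\<lambda>x. f x (snd p)) (fst p)"]
    have [measurable]: "(\<lambda>p. indicator {0..T} (fst p) * dqs hs (\<lambda>x. f x (fst p)) (snd p)) \<in> borel_measurable (borel \<Otimes>\<^sub>M borel)" by simp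
    have "(\<lambda>(t, x). ennreal ((indicator {0..T} t * dqs hs (\<lambda>x. f x t) x)\<^sup>2)) \<in> borel_measurable (borel \<Otimes>\<^sub>M lborel)"
      unfolding split_beta' by measurable
    then show ?thesis unfolding I_def by (rule lborel.borel_measurable_nn_integral)
  qed
  have eq: "(L2_norm (weak_deriv k (\<lambda>x. f x t)))\<^sup>2 = enn2real (SUP hs\<in>U k. I hs t)" if t: "t \<in> {0..T}" and k: "k \<le> s" for k t
  proof -
    obtain d where d: "d 0 = (\<lambda>x. f x t)" "\<And>j. j < s \<Longrightarrow> prim (d j) (d (Suc j))"
      "\<And>j. j \<le> s \<Longrightarrow> in_L2 (d j)" "\<And>j. j \<le> s \<Longrightarrow> L2_norm (d j) = L2_norm (weak_deriv j (\<lambda>x. f x t))"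
      by (rule Hs_chain[OF H[OF t] cont2_slice_x[OF c t]]) blast
    define A where "A = (L2_norm (d k))\<^sup>2"
    have dk: "L2 (d k) A" using L2_norm_le_iff[OF d(3)[OF k]] by (simp add: A_def)
    have p: "\<And>j. j < k \<Longrightarrow> prim (d j) (d (Suc j))" using d(2) k by simp
    have I: "I hs t = nsq (dqs hs (d 0))" for hs using t by (simp add: I_def d(1))
    have le: "(SUP hs\<in>U k. I hs t) \<le> ennreal A"
    proof (rule SUP_least)
      fix hs assume "hs \<in> U k"
      then have "L2 (dqs hs (d 0)) A" using L2_dqs_top[OF p dk unit_fractions_subset, of hs 0] by (simp add: U_def)
      then show "I hs t \<le> ennreal A" unfolding I by (simp add: L2_def)
    qed
    then have fin: "ennreal (enn2real (SUP hs\<in>U k. I hs t)) = (SUP hs\<in>U k. I hs t)"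
      by (intro ennreal_enn2real) (auto simp: order_le_less_trans)
    have "L2 (d k) (enn2real (SUP hs\<in>U k. I hs t))"
    proof (rule L2_top_of_dqs[where d=d])
      show "\<And>j. j < k \<Longrightarrow> prim (d j) (d (Suc j))" by (rule p)
      show "d k \<in> borel_measurable borel" using dk by (simp add: L2_def)
      fix hs assume hs: "length hs = k" "set hs \<subseteq> unit_fractions"
      have "I hs t \<le> (SUP hs\<in>U k. I hs t)" by (rule SUP_upper) (use hs in \<open>simp add: U_def\<close>)
      moreover have "L2 (dqs hs (d 0)) A" using L2_dqs_top[OF p dk unit_fractions_subset[OF hs(2)], of 0] hs by simp
      ultimately show "L2 (dqs hs (d 0)) (enn2real (SUP hs\<in>U k. I hs t))" unfolding L2_def fin I[symmetric] by simp
    qed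
    then have "A \<le> enn2real (SUP hs\<in>U k. I hs t)" using L2_norm_le_iff[OF d(3)[OF k]] by (simp add: A_def)
    moreover have "enn2real (SUP hs\<in>U k. I hs t) \<le> A" by (rule enn2real_leI[OF _ le]) (simp add: A_def)
    ultimately show ?thesis unfolding d(4)[OF k, symmetric] A_def by simp
  qed
  have "(\<lambda>t. indicator {0..T} t * (Hs_norm s (\<lambda>x. f x t))\<^sup>2) = (\<lambda>t. indicator {0..T} t * (\<Sum>k\<le>s. enn2real (SUP hs\<in>U k. I hs t)))"
  proof
    fix t
    show "indicator {0..T} t * (Hs_norm s (\<lambda>x. f x t))\<^sup>2 = indicator {0..T} t * (\<Sum>k\<le>s. enn2real (SUP hs\<in>U k. I hs t))"
      by (cases "t \<in> {0..T}") (auto simp: Hs_norm_sq eq)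
  qed
  moreover have "(\<lambda>t. SUP hs\<in>U k. I hs t) \<in> borel_measurable borel" for k by (intro borel_measurable_SUP cU mI)
  ultimately show ?thesis by simp
qed

section \<open>The nonlinear system with its derivatives carried out\<close>

context profile
begin

text \<open>The linear terms hidden in \<alpha> cancel the subtracted Taylor terms of f and g, and
  p/(1-p) = J - 1 adds the Jacobian. All five fluxes thus combine to the full flux with factor J
  minus the flux of the profile, and the derivative of the latter is given by the profile
  equation.\<close>

lemma perturbation_flux:
  fixes V :: "real \<Rightarrow> real \<times> real" and p :: "real \<Rightarrow> real"
  assumes dV: "\<And>x. ((\<lambda>x. fst (V x)) has_real_derivative \<tau>x x) (at x)" "\<And>x. ((\<lambda>x. snd (V x)) has_real_derivative ux x) (at x)"
    and dd: "\<And>x. (ux has_real_derivative uxx x) (at x)" "\<And>x. (p has_real_derivative p' x) (at x)"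
    and pos: "\<And>x. 0 < \<tau>b x + fst (V x)" and p: "\<And>x. p x < 1"
    and U: "\<And>x. U x = (\<tau>b x, ub x)"
  defines "Y \<equiv> \<lambda>x. inverse (\<tau>b x + fst (V x))" and "J \<equiv> \<lambda>x. inverse (1 - p x)"
  shows "deriv (\<lambda>y. sv_alpha F \<nu> U y * fst (V y)) x + \<nu> * deriv (\<lambda>y. inverse ((\<tau>b y)\<^sup>2) * deriv (\<lambda>y. snd (V y)) y) x
     + deriv (\<lambda>y. p y / (1 - p y) * sv_g \<nu> (\<tau>b y + fst (V y)) * deriv (\<lambda>z. ub z + snd (V z)) y) x
     + deriv (\<lambda>y. (sv_g \<nu> (\<tau>b y + fst (V y)) - sv_g \<nu> (\<tau>b y)) * deriv (\<lambda>y. snd (V y)) y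
         + (sv_g \<nu> (\<tau>b y + fst (V y)) - sv_g \<nu> (\<tau>b y) - deriv (sv_g \<nu>) (\<tau>b y) * fst (V y)) * deriv ub y) x
     - deriv (\<lambda>y. sv_f F (\<tau>b y + fst (V y)) - sv_f F (\<tau>b y) - deriv (sv_f F) (\<tau>b y) * fst (V y)) x
    = \<nu> * ((Y x)\<^sup>2 * ((v2 x + uxx x) * J x + (v1 x + ux x) * p' x * (J x)\<^sup>2) - 2 * Y x ^ 3 * (t1 x + \<tau>x x) * (v1 x + ux x) * J x)
      + iF * Y x ^ 3 * (t1 x + \<tau>x x) + c * v1 x + (1 - \<tau>b x * (ub x)\<^sup>2)"
proof -
  define \<tau> where "\<tau> = (\<lambda>y. fst (V y))"
  have d\<tau>: "(\<tau> has_real_derivative \<tau>x x) (at x)" for x using dV(1) by (simp add: \<tau>_def)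
  have dY: "(Y has_real_derivative - (Y x * Y x * (t1 x + \<tau>x x))) (at x)" for x
    unfolding Y_def
    by (rule DERIV_cong[OF DERIV_inverse'[OF DERIV_add[OF derivs(1) dV(1)]]]) (use pos[of x] in auto)
  have p1: "1 - p x \<noteq> 0" for x using p[of x] by simp
  have dJ: "(J has_real_derivative p' x * (J x)\<^sup>2) (at x)" for x
    unfolding J_def using p1[of x] by (auto intro!: derivative_eq_intros dd simp: field_simps power2_eq_square)
  have e: "deriv (\<lambda>y. snd (V y)) = ux" "deriv (\<lambda>z. ub z + snd (V z)) = (\<lambda>y. v1 y + ux y)" "deriv ub = v1" "deriv (\<lambda>y. snd (U y)) = v1"
    by (rule deriv_eqI, auto intro!: derivative_eq_intros derivs dV simp: U v1_def)+
  have iF: "inverse (2 * F\<^sup>2) = iF / 2" "inverse (F\<^sup>2) = iF" using F by (auto simp: iF_def field_simps)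
  have g: "sv_g \<nu> (\<tau>b y) = \<nu> * (sb y)\<^sup>2" "sv_g \<nu> (\<tau>b y + fst (V y)) = \<nu> * (Y y)\<^sup>2" for y
    by (simp_all add: sv_g_def sb_def Y_def power_inverse)
  have f: "sv_f F (\<tau>b y) = iF / 2 * (sb y)\<^sup>2" "sv_f F (\<tau>b y + fst (V y)) = iF / 2 * (Y y)\<^sup>2" for y
    by (simp_all add: sv_f_def sb_def Y_def power_inverse iF)
  have i2: "((\<lambda>w. inverse (w\<^sup>2)) has_real_derivative - (2 * sb y ^ 3)) (at (\<tau>b y))" for y
    using tau_nz[of y] by (auto intro!: derivative_eq_intros simp: sb_def field_simps power2_eq_square power3_eq_cube)
  have g': "deriv (sv_g \<nu>) (\<tau>b y) = - (2 * \<nu> * sb y ^ 3)" for y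
    using DERIV_imp_deriv[OF DERIV_cmult[OF i2[of y], of \<nu>]] by (simp add: sv_g_def[abs_def])
  have f': "deriv (sv_f F) (\<tau>b y) = - (iF * sb y ^ 3)" for y
    using DERIV_imp_deriv[OF DERIV_cmult[OF i2[of y], of "iF / 2"]] by (simp add: sv_f_def[abs_def] iF)
  have al: "sv_alpha F \<nu> U y = sb y ^ 3 * (iF - 2 * \<nu> * v1 y)" for y
    unfolding sv_alpha_def e iF by (simp add: U sb_def power_inverse)
  have b2: "inverse ((\<tau>b y)\<^sup>2) = (sb y)\<^sup>2" for y by (simp add: sb_def power_inverse)
  have pj: "p y / (1 - p y) = J y - 1" for y using p1[of y] by (simp add: J_def field_simps)
  let ?f1 = "\<lambda>y. sb y ^ 3 * (iF - 2 * \<nu> * v1 y) * \<tau> y" and ?f2 = "\<lambda>y. (sb y)\<^sup>2 * ux y"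
  let ?f3 = "\<lambda>y. (J y - 1) * (\<nu> * (Y y)\<^sup>2) * (v1 y + ux y)"
  let ?f4 = "\<lambda>y. (\<nu> * (Y y)\<^sup>2 - \<nu> * (sb y)\<^sup>2) * ux y + (\<nu> * (Y y)\<^sup>2 - \<nu> * (sb y)\<^sup>2 - - (2 * \<nu> * sb y ^ 3) * \<tau> y) * v1 y"
  let ?f5 = "\<lambda>y. iF / 2 * (Y y)\<^sup>2 - iF / 2 * (sb y)\<^sup>2 - - (iF * sb y ^ 3) * \<tau> y"
  let ?g = "\<lambda>y. \<nu> * (Y y)\<^sup>2 * (v1 y + ux y) * J y - iF / 2 * (Y y)\<^sup>2 - (\<nu> * (sb y)\<^sup>2 * v1 y - iF / 2 * (sb y)\<^sup>2)"
  note di = derivs(4) sb_derivs(1) dY dJ d\<tau> dd(1)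
  have D: "(f has_real_derivative deriv f x) (at x)" if "\<exists>D. (f has_real_derivative D) (at x)" for f :: "real \<Rightarrow> real"
    using that DERIV_imp_deriv by auto
  have "(?f1 has_real_derivative deriv ?f1 x) (at x)" "(?f2 has_real_derivative deriv ?f2 x) (at x)" "(?f3 has_real_derivative deriv ?f3 x) (at x)"
    "(?f4 has_real_derivative deriv ?f4 x) (at x)" "(?f5 has_real_derivative deriv ?f5 x) (at x)"
    by (rule D, rule exI, (rule derivative_intros di)+)+
  then have 1: "((\<lambda>y. ?f1 y + \<nu> * ?f2 y + ?f3 y + ?f4 y - ?f5 y) has_real_derivative
     deriv ?f1 x + \<nu> * deriv ?f2 x + deriv ?f3 x + deriv ?f4 x - deriv ?f5 x) (at x)"
    by (intro DERIV_add DERIV_diff DERIV_cmult)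
  \<comment> \<open>The collapse of the five fluxes to one difference takes place before
    differentiation, so that only \<open>?g\<close> has to be differentiated explicitly.\<close>
  have 2: "(\<lambda>y. ?f1 y + \<nu> * ?f2 y + ?f3 y + ?f4 y - ?f5 y) = ?g" by (rule ext) (simp add: field_simps)
  have 3: "(?g has_real_derivative \<nu> * ((Y x)\<^sup>2 * ((v2 x + uxx x) * J x + (v1 x + ux x) * p' x * (J x)\<^sup>2)
     - 2 * Y x ^ 3 * (t1 x + \<tau>x x) * (v1 x + ux x) * J x) + iF * Y x ^ 3 * (t1 x + \<tau>x x)
     - (\<nu> * (2 * sb x * sb1 x * v1 x + (sb x)\<^sup>2 * v2 x) - iF * sb x * sb1 x)) (at x)"
    by (rule derivative_eq_intros di refl)+ (simp add: algebra_simps power2_eq_square power3_eq_cube)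
  have E: "deriv ?f1 x + \<nu> * deriv ?f2 x + deriv ?f3 x + deriv ?f4 x - deriv ?f5 x
    = \<nu> * ((Y x)\<^sup>2 * ((v2 x + uxx x) * J x + (v1 x + ux x) * p' x * (J x)\<^sup>2)
     - 2 * Y x ^ 3 * (t1 x + \<tau>x x) * (v1 x + ux x) * J x) + iF * Y x ^ 3 * (t1 x + \<tau>x x)
     - (\<nu> * (2 * sb x * sb1 x * v1 x + (sb x)\<^sup>2 * v2 x) - iF * sb x * sb1 x)"
    by (rule DERIV_unique[OF 1[unfolded 2] 3])
  have pu: "- (\<nu> * (2 * sb x * sb1 x * v1 x + (sb x)\<^sup>2 * v2 x) - iF * sb x * sb1 x) = c * v1 x + (1 - \<tau>b x * (ub x)\<^sup>2)"
    using prof_u[of x] by (simp add: algebra_simps)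
  have sub: "W - Z = W + r + q" if "- Z = r + q" for W Z r q :: real using that by simp
  show ?thesis unfolding e g f g' f' al b2 pj by (rule trans[OF E[unfolded \<tau>_def] sub[OF pu]])
qed

end

lemma has_Dx_D: "has_Dx T w \<Longrightarrow> t \<in> {0..T} \<Longrightarrow> ((\<lambda>y. w y t) has_vector_derivative Dx w x t) (at x)"
  unfolding has_Dx_def Dx_def using vector_derivative_works by blast

lemma has_Dt_D: "has_Dt T w \<Longrightarrow> t \<in> {0..T} \<Longrightarrow> ((\<lambda>r. w x r) has_vector_derivative Dt T w x t) (at t within {0..T})"
  unfolding has_Dt_def Dt_def using vector_derivative_works by blast

lemma has_Dx_cont: "has_Dx T w \<Longrightarrow> continuous_on (UNIV \<times> {0..T}) (\<lambda>p. Dx w (fst p) (snd p))"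
  by (simp add: has_Dx_def split_beta')

lemma has_Dt_cont: "has_Dt T w \<Longrightarrow> continuous_on (UNIV \<times> {0..T}) (\<lambda>p. Dt T w (fst p) (snd p))"
  by (simp add: has_Dt_def split_beta')

lemma phase_shift_algebra:
  fixes p w q v ux :: real
  assumes "(1 - p) * w - (c * ux + d1 + d2 - a - b) = - (q * (v + ux)) - p * h + d3 + d4 - d5 + (h - h0 - (- a - b))"
    and "d1 + d2 + d3 + d4 - d5 = R1 + R2 + c * v + h0"
  shows "(1 - p) * w = (c - q) * (v + ux) + (1 - p) * h + R1 + R2"
proof -
  have "(1 - p) * w = c * ux - q * (v + ux) + (h - p * h) - h0 + (d1 + d2 + d3 + d4 - d5)" using assms(1) by simp
  then show ?thesis unfolding assms(2) by (simp add: algebra_simps)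
qed

section \<open>A single small solution: regularity, norms and equations\<close>

locale perturbation = profile F \<nu> c per \<tau>b ub
  for F \<nu> c per :: real and \<tau>b ub :: "real \<Rightarrow> real" +
  fixes U :: "real \<Rightarrow> real \<times> real" and s :: nat and lo \<epsilon> T :: real
    and V :: "real \<Rightarrow> real \<Rightarrow> real \<times> real" and \<psi> :: "real \<Rightarrow> real \<Rightarrow> real"
  assumes U: "\<And>x. U x = (\<tau>b x, ub x)" and s: "s > 0" and lo: "lo > 0" "\<And>x. 2 * lo \<le> \<tau>b x"
    and \<epsilon>: "\<epsilon> > 0" "2 * \<epsilon> \<le> lo" "4 * \<epsilon> \<le> 1" and T: "T > 0"
    and sol: "sv_perturbation_solution F \<nu> c U T V \<psi>"
    and sob: "\<And>t. t \<in> {0..T} \<Longrightarrow> in_Hs s (\<lambda>x. (V x t, Dt T \<psi> x t, Dx \<psi> x t))"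
      "\<And>t. t \<in> {0..T} \<Longrightarrow> Hs_norm s (\<lambda>x. (V x t, Dt T \<psi> x t, Dx \<psi> x t)) \<le> \<epsilon>"
begin

lemma sols: "has_Dt T V" "has_Dx T V" "has_Dx T (Dx (\<lambda>x t. snd (V x t)))" "has_Dt T \<psi>" "has_Dx T \<psi>" "has_Dx T (Dx \<psi>)"
  "t \<in> {0..T} \<Longrightarrow> sv_perturbation_eq F \<nu> c U T V \<psi> x t"
  using sol by (auto simp: sv_perturbation_solution_def)

lemma solution_derivs:
  assumes t: "t \<in> {0..T}"
  shows "((\<lambda>x. fst (V x t)) has_real_derivative fst (Dx V x t)) (at x)"
    "((\<lambda>x. snd (V x t)) has_real_derivative snd (Dx V x t)) (at x)"
    "((\<lambda>r. fst (V x r)) has_real_derivative fst (Dt T V x t)) (at t within {0..T})"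
    "((\<lambda>r. snd (V x r)) has_real_derivative snd (Dt T V x t)) (at t within {0..T})"
    "((\<lambda>x. \<psi> x t) has_real_derivative Dx \<psi> x t) (at x)"
    "((\<lambda>x. Dx \<psi> x t) has_real_derivative Dx (Dx \<psi>) x t) (at x)"
    "((\<lambda>r. \<psi> x r) has_real_derivative Dt T \<psi> x t) (at t within {0..T})"
    "((\<lambda>x. snd (Dx V x t)) has_real_derivative Dx (Dx (\<lambda>x t. snd (V x t))) x t) (at x)"
proof -
  note r = has_real_derivative_iff_has_vector_derivative
  note fs = bounded_linear.has_vector_derivative[OF bounded_linear_fst] bounded_linear.has_vector_derivative[OF bounded_linear_snd]
  show 1: "((\<lambda>x. fst (V x t)) has_real_derivative fst (Dx V x t)) (at x)"
    "((\<lambda>x. snd (V x t)) has_real_derivative snd (Dx V x t)) (at x)" for x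
    unfolding r by (intro fs has_Dx_D[OF sols(2) t])+
  show "((\<lambda>r. fst (V x r)) has_real_derivative fst (Dt T V x t)) (at t within {0..T})"
    "((\<lambda>r. snd (V x r)) has_real_derivative snd (Dt T V x t)) (at t within {0..T})"
    unfolding r by (intro fs has_Dt_D[OF sols(1) t])+
  show "((\<lambda>x. \<psi> x t) has_real_derivative Dx \<psi> x t) (at x)"
    "((\<lambda>x. Dx \<psi> x t) has_real_derivative Dx (Dx \<psi>) x t) (at x)"
    "((\<lambda>r. \<psi> x r) has_real_derivative Dt T \<psi> x t) (at t within {0..T})"
    unfolding r by (rule has_Dx_D[OF sols(5) t] has_Dx_D[OF sols(6) t] has_Dt_D[OF sols(4) t])+
  have "Dx (\<lambda>x t. snd (V x t)) y t = snd (Dx V y t)" for y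
    unfolding Dx_def[of "\<lambda>x t. snd (V x t)"] by (rule vector_derivative_at) (use 1(2) in \<open>simp add: r\<close>)
  then show "((\<lambda>x. snd (Dx V x t)) has_real_derivative Dx (Dx (\<lambda>x t. snd (V x t))) x t) (at x)"
    using has_Dx_D[OF sols(3) t, of x] by (simp add: r)
qed

lemma solution_conts:
  "cont2 T (Dt T \<psi>)" "cont2 T (Dx \<psi>)" "cont2 T (Dx (Dx \<psi>))"
  "cont2 T (\<lambda>x t. fst (V x t))" "cont2 T (\<lambda>x t. fst (Dx V x t))" "cont2 T (\<lambda>x t. fst (Dt T V x t))"
  "cont2 T (\<lambda>x t. snd (V x t))" "cont2 T (\<lambda>x t. snd (Dx V x t))" "cont2 T (Dx (Dx (\<lambda>x t. snd (V x t))))"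
  "cont2 T (\<lambda>x t. snd (Dt T V x t))"
proof -
  show "cont2 T (Dt T \<psi>)" "cont2 T (Dx \<psi>)" "cont2 T (Dx (Dx \<psi>))" "cont2 T (Dx (Dx (\<lambda>x t. snd (V x t))))"
    "cont2 T (\<lambda>x t. fst (Dx V x t))" "cont2 T (\<lambda>x t. snd (Dx V x t))"
    unfolding cont2_def using has_Dx_cont[OF sols(2)]
    by (auto intro!: has_Dt_cont has_Dx_cont sols continuous_intros)
  show 1: "cont2 T (\<lambda>x t. fst (Dt T V x t))" "cont2 T (\<lambda>x t. snd (Dt T V x t))"
    unfolding cont2_def using has_Dt_cont[OF sols(1)] by (auto intro!: continuous_intros)
  \<comment> \<open>Continuity of V itself is not part of the notion of solution; it follows from
    its partial derivatives.\<close>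
  show "cont2 T (\<lambda>x t. fst (V x t))" by (rule cont2_partials[OF 1(1) solution_derivs(1,3)])
  show "cont2 T (\<lambda>x t. snd (V x t))" by (rule cont2_partials[OF 1(2) solution_derivs(2,4)])
qed

definition "Hs_V t = (Hs_norm s (\<lambda>x. V x t))\<^sup>2"
definition "L2_V t = (L2_norm (\<lambda>x. V x t))\<^sup>2"
definition "Hs_psi t = (Hs_norm s (\<lambda>x. (Dt T \<psi> x t, Dx \<psi> x t)))\<^sup>2"

lemma norms:
  assumes t: "t \<in> {0..T}"
  shows "in_Hs s (\<lambda>x. fst (V x t))" "in_Hs s (\<lambda>x. snd (V x t))" "in_Hs s (\<lambda>x. Dt T \<psi> x t)" "in_Hs s (\<lambda>x. Dx \<psi> x t)"
    "Hs_V t = (Hs_norm s (\<lambda>x. fst (V x t)))\<^sup>2 + (Hs_norm s (\<lambda>x. snd (V x t)))\<^sup>2"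
    "Hs_psi t = (Hs_norm s (\<lambda>x. Dt T \<psi> x t))\<^sup>2 + (Hs_norm s (\<lambda>x. Dx \<psi> x t))\<^sup>2"
    "L2_V t = (Hs_norm 0 (\<lambda>x. fst (V x t)))\<^sup>2 + (Hs_norm 0 (\<lambda>x. snd (V x t)))\<^sup>2"
    "L2_V t = (L2_norm (\<lambda>x. fst (V x t)))\<^sup>2 + (L2_norm (\<lambda>x. snd (V x t)))\<^sup>2"
    "Hs_V t + Hs_psi t \<le> \<epsilon>\<^sup>2"
proof -
  note P = Hs_norm_Pair[OF sob(1)[OF t]]
  have V: "in_Hs s (\<lambda>x. (fst (V x t), snd (V x t)))" using P(1) by simp
  note V' = Hs_norm_Pair[OF V]
  note Q = Hs_norm_Pair[OF P(2)]
  show fs: "in_Hs s (\<lambda>x. fst (V x t))" "in_Hs s (\<lambda>x. snd (V x t))" "in_Hs s (\<lambda>x. Dt T \<psi> x t)" "in_Hs s (\<lambda>x. Dx \<psi> x t)"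
    by (rule V' Q)+
  show "Hs_V t = (Hs_norm s (\<lambda>x. fst (V x t)))\<^sup>2 + (Hs_norm s (\<lambda>x. snd (V x t)))\<^sup>2" using V'(3) by (simp add: Hs_V_def)
  show "Hs_psi t = (Hs_norm s (\<lambda>x. Dt T \<psi> x t))\<^sup>2 + (Hs_norm s (\<lambda>x. Dx \<psi> x t))\<^sup>2" unfolding Hs_psi_def by (rule Q(3))
  show L: "L2_V t = (L2_norm (\<lambda>x. fst (V x t)))\<^sup>2 + (L2_norm (\<lambda>x. snd (V x t)))\<^sup>2" using L2_norm_Pair[OF V] by (simp add: L2_V_def)
  show "L2_V t = (Hs_norm 0 (\<lambda>x. fst (V x t)))\<^sup>2 + (Hs_norm 0 (\<lambda>x. snd (V x t)))\<^sup>2" unfolding L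
    by (simp add: Hs_norm_0[OF fs(1) cont2_slice_x[OF solution_conts(4) t]] Hs_norm_0[OF fs(2) cont2_slice_x[OF solution_conts(7) t]])
  have "0 \<le> Hs_norm s (\<lambda>x. (V x t, Dt T \<psi> x t, Dx \<psi> x t))" by (simp add: Hs_norm_def sum_nonneg)
  then have "(Hs_norm s (\<lambda>x. (V x t, Dt T \<psi> x t, Dx \<psi> x t)))\<^sup>2 \<le> \<epsilon>\<^sup>2" using sob(2)[OF t] by (intro power_mono)
  then show "Hs_V t + Hs_psi t \<le> \<epsilon>\<^sup>2" unfolding P(3) Hs_V_def Hs_psi_def .
qed

lemma bounds:
  assumes t: "t \<in> {0..T}"
  shows "Hk s (\<lambda>x. fst (V x t)) (Hs_V t)" (is ?H1) "Hk s (\<lambda>x. snd (V x t)) (Hs_V t)" (is ?H2)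
    "Hk s (\<lambda>x. Dx \<psi> x t) (Hs_psi t)" (is ?H3) "Hk s (\<lambda>x. Dt T \<psi> x t) (Hs_psi t)" (is ?H4)
    "L2 (\<lambda>x. fst (V x t)) (L2_V t)" "L2 (\<lambda>x. snd (V x t)) (L2_V t)"
    "Hs_V t \<le> 1" "Hs_psi t \<le> 1" "L2_V t \<le> 1" "\<bar>Dx \<psi> x t\<bar> \<le> 1/2" "lo \<le> \<tau>b x + fst (V x t)"
    "Hk s (\<lambda>x. fst (V x t)) A \<Longrightarrow> Hk s (\<lambda>x. snd (V x t)) A \<Longrightarrow> Hs_V t \<le> 2 * (real s + 1) * A"
proof -
  note n = norms[OF t]
  note sl = cont2_slice_x[OF solution_conts(4) t] cont2_slice_x[OF solution_conts(7) t]
    cont2_slice_x[OF solution_conts(1) t] cont2_slice_x[OF solution_conts(2) t]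
  show H: ?H1 ?H2 ?H3 ?H4
    by (rule Hk_mono[OF Hk_of_Hs[OF n(1) sl(1)]] Hk_mono[OF Hk_of_Hs[OF n(2) sl(2)]]
      Hk_mono[OF Hk_of_Hs[OF n(4) sl(4)]] Hk_mono[OF Hk_of_Hs[OF n(3) sl(3)]], simp add: n(5,6))+
  have i: "in_L2 (\<lambda>x. fst (V x t))" "in_L2 (\<lambda>x. snd (V x t))" using n(1,2) by (auto simp: in_Hs_def)
  show "L2 (\<lambda>x. fst (V x t)) (L2_V t)" "L2 (\<lambda>x. snd (V x t)) (L2_V t)"
    unfolding L2_norm_le_iff[OF i(1)] L2_norm_le_iff[OF i(2)] n(8) by auto
  have nn: "0 \<le> Hs_V t" "0 \<le> Hs_psi t" by (auto simp: Hs_V_def Hs_psi_def)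
  have "\<epsilon>\<^sup>2 \<le> 1" using \<epsilon> by (simp add: power_le_one)
  then show "Hs_V t \<le> 1" "Hs_psi t \<le> 1" using n(9) nn by auto
  have "(L2_norm (\<lambda>x. fst (V x t)))\<^sup>2 \<le> (Hs_norm s (\<lambda>x. fst (V x t)))\<^sup>2" "(L2_norm (\<lambda>x. snd (V x t)))\<^sup>2 \<le> (Hs_norm s (\<lambda>x. snd (V x t)))\<^sup>2"
    using Hk_L2[OF Hk_of_Hs[OF n(1) sl(1)]] Hk_L2[OF Hk_of_Hs[OF n(2) sl(2)]] L2_norm_le_iff[OF i(1)] L2_norm_le_iff[OF i(2)] by auto
  then show "L2_V t \<le> 1" using n(9) nn n(5) \<open>\<epsilon>\<^sup>2 \<le> 1\<close> unfolding n(8) by auto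
  obtain k where k: "s = Suc k" using s by (cases s) auto
  \<comment> \<open>The Sobolev inequality gives the sup bound 2 \<epsilon>. The conditions 4
    \<epsilon> \<le> 1 and 2 \<epsilon> \<le> lo then yield |psi_x| \<le> 1/2 and keep the full
    specific volume above lo, because the profile is at least 2 lo.\<close>
  have ab: "\<bar>f x\<bar> \<le> 2 * \<epsilon>" if "Hk s f B" "B \<le> \<epsilon>\<^sup>2" for f B and x :: real
  proof -
    have "(f x)\<^sup>2 \<le> 4 * B" using Hk_sup that(1) unfolding k by blast
    then have "(f x)\<^sup>2 \<le> (2 * \<epsilon>)\<^sup>2" using that(2) by (simp add: power_mult_distrib)
    then show ?thesis using \<epsilon> abs_le_square_iff[of "f x" "2 * \<epsilon>"] by simp
  qed
  have "\<bar>Dx \<psi> x t\<bar> \<le> 2 * \<epsilon>" using ab[OF H(3)] n(9) nn by simp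
  then show "\<bar>Dx \<psi> x t\<bar> \<le> 1/2" using \<epsilon>(3) by linarith
  have "\<bar>fst (V x t)\<bar> \<le> 2 * \<epsilon>" using ab[OF H(1)] n(9) nn by simp
  then show "lo \<le> \<tau>b x + fst (V x t)" using \<epsilon>(2) lo(2)[of x] by linarith
  show "Hs_V t \<le> 2 * (real s + 1) * A" if "Hk s (\<lambda>x. fst (V x t)) A" "Hk s (\<lambda>x. snd (V x t)) A"
    using Hs_norm_le[OF n(1) sl(1) that(1)] Hs_norm_le[OF n(2) sl(2) that(2)] unfolding n(5) by (simp add: algebra_simps)
qed

lemma equations:
  assumes t: "t \<in> {0..T}"
  shows "(1 - Dx \<psi> x t) * fst (Dt T V x t) = c * fst (Dx V x t) + snd (Dx V x t) - Dt T \<psi> x t * (t1 x + fst (Dx V x t))" (is ?E1)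
    and "(1 - Dx \<psi> x t) * snd (Dt T V x t) = (c - Dt T \<psi> x t) * (v1 x + snd (Dx V x t))
      + (1 - Dx \<psi> x t) * (1 - (\<tau>b x + fst (V x t)) * (ub x + snd (V x t))\<^sup>2)
      + \<nu> * ((inverse (\<tau>b x + fst (V x t)))\<^sup>2 * ((v2 x + Dx (Dx (\<lambda>x t. snd (V x t))) x t) * inverse (1 - Dx \<psi> x t)
          + (v1 x + snd (Dx V x t)) * Dx (Dx \<psi>) x t * (inverse (1 - Dx \<psi> x t))\<^sup>2)
        - 2 * (inverse (\<tau>b x + fst (V x t)))^3 * (t1 x + fst (Dx V x t)) * (v1 x + snd (Dx V x t)) * inverse (1 - Dx \<psi> x t))
      + iF * (inverse (\<tau>b x + fst (V x t)))^3 * (t1 x + fst (Dx V x t))" (is ?E2)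
proof -
  note D = solution_derivs[OF t]
  have d: "deriv (\<lambda>y. fst (V y t)) x = fst (Dx V x t)" "deriv (\<lambda>y. snd (V y t)) x = snd (Dx V x t)"
    by (rule DERIV_imp_deriv D)+
  have "((\<lambda>y. (\<tau>b y + fst (V y t), ub y + snd (V y t))) has_vector_derivative (t1 x + fst (Dx V x t), v1 x + snd (Dx V x t))) (at x)"
    by (intro has_vector_derivative_Pair has_vector_derivative_add)
      (auto simp: has_real_derivative_iff_has_vector_derivative[symmetric] derivs D)
  moreover have "(\<lambda>y. U y + V y t) = (\<lambda>y. (\<tau>b y + fst (V y t), ub y + snd (V y t)))"
    by (auto simp: U fun_eq_iff prod_eq_iff)
  ultimately have DU: "Dx (\<lambda>y r. U y + V y r) x t = (t1 x + fst (Dx V x t), v1 x + snd (Dx V x t))"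
    unfolding Dx_def[of "\<lambda>y r. U y + V y r"] by (simp only: vector_derivative_at)
  have fsU: "fst (U y) = \<tau>b y" "snd (U y) = ub y" for y by (simp_all add: U)
  note eq = sols(7)[OF t, of x, unfolded sv_perturbation_eq_def Let_def DU]
  note L = sv_L_def[of F \<nu> c U "\<lambda>y. V y t" x, unfolded Let_def]
  show ?E1
    using arg_cong[OF eq, of fst] by (simp add: L d)
  have pos: "0 < \<tau>b x + fst (V x t)" for x using bounds(11)[OF t, of x] lo by linarith
  have p: "Dx \<psi> x t < 1" for x using bounds(10)[OF t, of x] by linarith
  note flux = perturbation_flux[where V="\<lambda>x. V x t" and p="\<lambda>x. Dx \<psi> x t" and U=U, OF D(1,2,8,6) pos p U]
  have h: "sv_h (U x + V x t) = 1 - (\<tau>b x + fst (V x t)) * (ub x + snd (V x t))\<^sup>2" "sv_h (U x) = 1 - \<tau>b x * (ub x)\<^sup>2"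
    "sv_dh (U x) (V x t) = - ((ub x)\<^sup>2 * fst (V x t)) - 2 * ub x * \<tau>b x * snd (V x t)"
    by (simp_all add: sv_h_def sv_dh_def U split_beta)
  show ?E2
    by (rule phase_shift_algebra[OF _ flux])
      (use arg_cong[OF eq, of snd] in \<open>simp only: L d h fsU snd_add snd_diff snd_uminus snd_scaleR snd_conv real_scaleR_def mult_minus_left diff_conv_add_uminus\<close>)
qed

text \<open>The final integral is a gauge integral, with value 0 for non-integrable functions, so
  the norms on the right must be shown measurable. The L^2 norm is treated as the Sobolev norm of
  order 0.\<close>

lemma norm_measurable: "(\<lambda>r. indicator {0..T} r * (L2_V r + Hs_psi r)) \<in> borel_measurable borel"
proof -
  let ?f = "\<lambda>r. indicator {0..T} r * (Hs_norm 0 (\<lambda>x. fst (V x r)))\<^sup>2 + indicator {0..T} r * (Hs_norm 0 (\<lambda>x. snd (V x r)))\<^sup>2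
     + (indicator {0..T} r * (Hs_norm s (\<lambda>x. Dt T \<psi> x r))\<^sup>2 + indicator {0..T} r * (Hs_norm s (\<lambda>x. Dx \<psi> x r))\<^sup>2)"
  have "?f \<in> borel_measurable borel"
    by (intro borel_measurable_add Hs_norm_measurable solution_conts in_Hs_lower[OF norms(1)] in_Hs_lower[OF norms(2)] norms(3,4)) auto
  moreover have "?f r = indicator {0..T} r * (L2_V r + Hs_psi r)" for r
    by (cases "r \<in> {0..T}") (simp_all add: norms(6,7))
  ultimately show ?thesis by simp
qed

end

section \<open>Constants uniform over all small solutions\<close>

context profile
begin

abbreviation energy_bound where
  "energy_bound s \<theta> C T V \<psi> \<equiv> (\<forall>t\<in>{0..T}.
          (Hs_norm s (\<lambda>x. V x t))\<^sup>2
            \<le> C * exp (- \<theta> * t) * (Hs_norm s (\<lambda>x. V x 0))\<^sup>2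
              + C * integral {0..t} (\<lambda>t'. exp (- \<theta> * (t - t')) *
                  ((L2_norm (\<lambda>x. V x t'))\<^sup>2
                   + (Hs_norm s (\<lambda>x. (Dt T \<psi> x t', Dx \<psi> x t')))\<^sup>2)))"

lemma perturbation_energy:
  assumes U: "\<And>x. U x = (\<tau>b x, ub x)" and s: "s > 0" and lo: "lo > 0" "\<And>x. 2 * lo \<le> \<tau>b x"
    and \<epsilon>: "\<epsilon> > 0" "2 * \<epsilon> \<le> lo" "4 * \<epsilon> \<le> 1"
  shows "\<exists>\<theta>>0. \<exists>C>0. \<forall>T V \<psi>. perturbation F \<nu> c per \<tau>b ub U s lo \<epsilon> T V \<psi> \<longrightarrow> energy_bound s \<theta> C T V \<psi>"
proof -
  \<comment> \<open>All admissible triples at once: the constants of \<open>energy\<close> depend on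
    the set \<open>S\<close>, not on its elements, and so neither on T nor on the solution.\<close>
  define S where "S = {(T, V, \<psi>). perturbation F \<nu> c per \<tau>b ub U s lo \<epsilon> T V \<psi>}"
  define M L Ps where "M d t = perturbation.Hs_V s (fst (snd d)) t"
    and "L d t = perturbation.L2_V (fst (snd d)) t" and "Ps d t = perturbation.Hs_psi s (fst d) (snd (snd d)) t"
    for d :: "real \<times> (real \<Rightarrow> real \<Rightarrow> real \<times> real) \<times> (real \<Rightarrow> real \<Rightarrow> real)" and t :: real
  have P: "perturbation F \<nu> c per \<tau>b ub U s lo \<epsilon> (fst d) (fst (snd d)) (snd (snd d))" if "d \<in> S" for d
    using that by (auto simp: S_def)
  have lo': "lo \<le> \<tau>b x" for x using lo(1) lo(2)[of x] by linarith
  interpret dyn F \<nu> c per \<tau>b ub S s lo fst "\<lambda>d. snd (snd d)" "\<lambda>d. Dt (fst d) (snd (snd d))" "\<lambda>d. Dx (snd (snd d))" "\<lambda>d. Dx (Dx (snd (snd d)))"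
    "\<lambda>d x t. fst (fst (snd d) x t)" "\<lambda>d x t. fst (Dx (fst (snd d)) x t)" "\<lambda>d x t. fst (Dt (fst d) (fst (snd d)) x t)"
    "\<lambda>d x t. snd (fst (snd d) x t)" "\<lambda>d x t. snd (Dx (fst (snd d)) x t)" "\<lambda>d. Dx (Dx (\<lambda>x t. snd (fst (snd d) x t)))"
    "\<lambda>d x t. snd (Dt (fst d) (fst (snd d)) x t)" M L Ps
  proof (intro dyn.intro dyn_axioms.intro profile_axioms s lo(1) lo')
  qed (unfold M_def L_def Ps_def, (rule perturbation.T[OF P] perturbation.solution_conts[OF P] perturbation.solution_derivs[OF P]
        perturbation.bounds(1-8,10,11)[OF P] perturbation.equations[OF P]; assumption)+)
  have "\<exists>\<theta>>0. \<exists>C>0. \<forall>d\<in>S. \<forall>t\<in>{0..fst d}.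
    M d t \<le> C * (exp (- \<theta> * t) * M d 0 + integral {0..t} (\<lambda>r. exp (- \<theta> * (t - r)) * (L d r + Ps d r)))"
  proof (rule energy[of "2 * (real s + 1)"])
    show "(\<lambda>r. indicator {0..fst d} r * (L d r + Ps d r)) \<in> borel_measurable borel" if "d \<in> S" for d
      unfolding L_def Ps_def by (rule perturbation.norm_measurable[OF P[OF that]])
    show "L d t \<le> 1" if "d \<in> S" "t \<in> {0..fst d}" for d t
      unfolding L_def by (rule perturbation.bounds(9)[OF P[OF that(1)] that(2)])
    show "M d t \<le> 2 * (real s + 1) * A" if "d \<in> S" "t \<in> {0..fst d}" "Hk s (\<lambda>x. fst (fst (snd d) x t)) A" "Hk s (\<lambda>x. snd (fst (snd d) x t)) A" for d t A
      unfolding M_def by (rule perturbation.bounds(12)[OF P[OF that(1)] that(2-4)])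
  qed simp
  then obtain \<theta> C where C: "\<theta> > 0" "C > 0" "\<And>d t. d \<in> S \<Longrightarrow> t \<in> {0..fst d} \<Longrightarrow>
    M d t \<le> C * (exp (- \<theta> * t) * M d 0 + integral {0..t} (\<lambda>r. exp (- \<theta> * (t - r)) * (L d r + Ps d r)))" by blast
  show ?thesis
  proof (rule exI[of _ \<theta>], rule conjI[OF C(1)], rule exI[of _ C], rule conjI[OF C(2)], intro allI impI)
    fix T V \<psi> assume p: "perturbation F \<nu> c per \<tau>b ub U s lo \<epsilon> T V \<psi>"
    then have "(T, V, \<psi>) \<in> S" by (simp add: S_def)
    from C(3)[OF this] show "energy_bound s \<theta> C T V \<psi>"
      by (simp add: M_def L_def Ps_def perturbation.Hs_V_def[OF p] perturbation.L2_V_def[OF p] perturbation.Hs_psi_def[OF p] distrib_left mult.assoc)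
  qed
qed

end

theorem proposition4p2:
  fixes F \<nu> c :: real and U :: "real \<Rightarrow> real \<times> real" and s :: nat
  assumes "F > 0" and "\<nu> > 0"
    and "sv_profile F \<nu> c U"
    and "s > 0"
  shows "\<exists>\<theta> C \<epsilon> :: real. \<theta> > 0 \<and> C > 0 \<and> \<epsilon> > 0 \<and>
    (\<forall>T V \<psi>. T > 0 \<longrightarrow> sv_perturbation_solution F \<nu> c U T V \<psi> \<longrightarrow>
       (\<forall>t\<in>{0..T}. in_Hs s (\<lambda>x. (V x t, Dt T \<psi> x t, Dx \<psi> x t)) \<and>
                    Hs_norm s (\<lambda>x. (V x t, Dt T \<psi> x t, Dx \<psi> x t)) \<le> \<epsilon>) \<longrightarrow>
       (\<forall>t\<in>{0..T}.
          (Hs_norm s (\<lambda>x. V x t))\<^sup>2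
            \<le> C * exp (- \<theta> * t) * (Hs_norm s (\<lambda>x. V x 0))\<^sup>2
              + C * integral {0..t} (\<lambda>t'. exp (- \<theta> * (t - t')) *
                  ((L2_norm (\<lambda>x. V x t'))\<^sup>2
                   + (Hs_norm s (\<lambda>x. (Dt T \<psi> x t', Dx \<psi> x t')))\<^sup>2))))"
proof -
  define \<tau>b ub where "\<tau>b = (\<lambda>x. fst (U x))" and "ub = (\<lambda>x. snd (U x))"
  have U: "U x = (\<tau>b x, ub x)" for x by (simp add: \<tau>b_def ub_def)
  note p = assms(3)[unfolded sv_profile_def Let_def \<tau>b_def[symmetric] ub_def[symmetric]]
  then obtain per where per: "per > 0" "\<And>x. U (x + per) = U x" by blast
  interpret profile F \<nu> c per \<tau>b ub
  proof
    show "\<tau>b (x + per) = \<tau>b x" "ub (x + per) = ub x" for x using per(2)[of x] by (simp_all add: \<tau>b_def ub_def)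
  qed (use assms(1,2) per(1) p in \<open>auto simp: \<tau>b_def\<close>)
  obtain lo0 hi where lo0: "0 < lo0" "\<And>x. lo0 \<le> \<tau>b x" "\<And>x. \<tau>b x \<le> hi" using tau_bounds by blast
  \<comment> \<open>Half of the minimal specific volume of the profile is reserved for the
    perturbation. Pointwise it is at most 2 \<epsilon>, so \<epsilon> \<le> lo/2 suffices, and
    \<epsilon> \<le> 1/4 gives |psi_x| \<le> 1/2.\<close>
  define lo \<epsilon> where "lo = lo0 / 2" and "\<epsilon> = min (lo / 2) (1 / 4)"
  have lo: "lo > 0" "\<And>x. 2 * lo \<le> \<tau>b x" using lo0 by (auto simp: lo_def)
  have \<epsilon>: "\<epsilon> > 0" "2 * \<epsilon> \<le> lo" "4 * \<epsilon> \<le> 1" using lo by (auto simp: \<epsilon>_def min_def)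
  obtain \<theta> C where C: "\<theta> > 0" "C > 0" "\<And>T V \<psi>. perturbation F \<nu> c per \<tau>b ub U s lo \<epsilon> T V \<psi> \<Longrightarrow> energy_bound s \<theta> C T V \<psi>"
    using perturbation_energy[OF U assms(4) lo \<epsilon>] by blast
  have P: "perturbation F \<nu> c per \<tau>b ub U s lo \<epsilon> T V \<psi>"
    if "T > 0" "sv_perturbation_solution F \<nu> c U T V \<psi>"
      "\<forall>t\<in>{0..T}. in_Hs s (\<lambda>x. (V x t, Dt T \<psi> x t, Dx \<psi> x t)) \<and> Hs_norm s (\<lambda>x. (V x t, Dt T \<psi> x t, Dx \<psi> x t)) \<le> \<epsilon>" for T V \<psi>
    using that by (intro perturbation.intro perturbation_axioms.intro profile_axioms U assms(4) lo \<epsilon>) auto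
  show ?thesis
    by (rule exI[of _ \<theta>], rule exI[of _ C], rule exI[of _ \<epsilon>], intro conjI C(1,2) \<epsilon>(1) allI impI)
      (rule C(3), rule P; assumption)
qed

end
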